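(* Let $p\ge1$, $q\ge0$ be integers and $\mathcal{B}\in M_{q,p}(\mathbb{K})$. Let $V_0$ be the group $(\mathbb{K}[[x_1,\dots,x_p,y_1,\dots,y_q]]_+,+)$. The group $\mathbf{G}_{\mathcal{B}}$ acts by automorphisms on $V_0$ by: $$\forall F\in\mathbf{G}_{\mathcal{B}},\ \forall P\in V_0,\quad F\hookrightarrow P=P\left(F,y\Big(\frac{F}{x}\Big)^{\mathcal{B}}\right).$$ For all $r\geq0$, the group $V_0^r\rtimes\mathbf{G}_{\mathcal{B}}$ is isomorphic to the character group of an $\mathbb{N}^{p+q}$-graded Hopf algebra $\mathcal{H}_{\mathcal{B},r}$, whose graded dual is the enveloping algebra of the fundamental deg1 pre-Lie algebra with basis $(f_i(\alpha))_{i\in[p+r],\alpha\in\mathbb{N}^{p+q}\setminus\{0\}}$ and product $$f_j(\beta)*f_i(\alpha)=(A^{(i,j)}\cdot\alpha+b^{(i,j)})f_i(\alpha+\beta),$$ with structure coefficients, for all $i,j\in[p+r]$: $A^{(i,j)}=A_j$ if $1\le j\leq p$, $A^{(i,j)}=0$ if $p+1\le j\le p+r$, and $b^{(i,j)}=0$, where $A_j\in\mathbb{K}^{p+q}$ is the $j$-th column of $A=\begin{pmatrix}I_p\\\mathcal{B}\end{pmatrix}$.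
   Context: $\mathbb{K}$ is a field of characteristic zero. $\mathbb{K}[[x_1,\dots,x_p,y_1,\dots,y_q]]_+$ is the set of formal series without constant term. For $i\in[p]=\{1,\dots,p\}$, $\mathbf{G}_i=\{x_i(1+F)\mid F\in\mathbb{K}[[x_1,\dots,x_p,y_1,\dots,y_q]]_+\}$. For $F_i=x_i(1+h)\in\mathbf{G}_i$ and $c\in\mathbb{K}$, $(F_i/x_i)^c=(1+h)^c=\sum_{n\ge0}\binom{c}{n}h^n$. For $F=(F_1,\dots,F_p)\in\mathbf{G}_1\times\dots\times\mathbf{G}_p$ and a series (or tuple of series) $P$, $P\left(F,y(F/x)^{\mathcal{B}}\right)$ denotes the result of substituting in $P$: $x_i\mapsto F_i$ for $i\in[p]$ and $y_m\mapsto y_m\prod_{i=1}^p(F_i/x_i)^{\mathcal{B}_{m,i}}$ for $m\in[q]$. $\mathbf{G}_{\mathcal{B}}$ is the group $\mathbf{G}_1\times\dots\times\mathbf{G}_p$ with product $F\bullet G=G\left(F,y(F/x)^{\mathcal{B}}\right)$. The semidirect product $V_0^r\rtimes\mathbf{G}_{\mathcal{B}}$ has product $(P_1,\dots,P_r,F)\bullet(Q_1,\dots,Q_r,G)=(P_1+F\hookrightarrow Q_1,\dots,P_r+F\hookrightarrow Q_r,F\bullet G)$. A (left) pre-Lie algebra is a vector space with a bilinear product $*$ such that $(x*y)*z-x*(y*z)=(y*x)*z-y*(x*z)$; $[x,y]=x*y-y*x$ is then a Lie bracket, and the enveloping algebra of a pre-Lie algebra is the enveloping algebra of this Lie algebra.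 A deg1 pre-Lie algebra with structure coefficients $A^{(i,j)}\in\mathbb{K}^N$, $b^{(i,j)}\in\mathbb{K}$ ($i,j\in[M]$) is a pre-Lie algebra with a basis $(f_i(\alpha))_{i\in[M],\alpha\in\mathbb{N}^N\setminus\{0\}}$ and product as displayed in the claim ($\cdot$ is the usual inner product). It is fundamental if there are a partition $[M]=I_0\sqcup\dots\sqcup I_k$ with $I_1,\dots,I_k\ne\emptyset$, vectors $A_1,\dots,A_k$, scalars $b_1,\dots,b_k$ and $b^{(i)}_m$ ($i\in I_0$, $m\in[k]$) such that $A^{(i,j)}=A_m$ if $j\in I_m$, $m\geq1$, and $0$ if $j\in I_0$; $b^{(i,j)}=\delta_{l,m}b_m$ if $j\in I_m$, $i\in I_l$, $l,m\ge1$; $b^{(i,j)}=0$ if $j\in I_0$; $b^{(i,j)}=b^{(i)}_m$ if $j\in I_m$, $m\ge1$, $i\in I_0$. The group of characters of a commutative Hopf algebra is the set of algebra morphisms to $\mathbb{K}$ with the convolution product. *)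

theory Defs
  imports
    "HOL-Algebra.Module"
    "HOL-Algebra.QuotRing"
    "HOL-Algebra.Bij"
    "HOL-Algebra.Product_Groups"
    "HOL-Library.Poly_Mapping"
    "HOL-Library.Disjoint_Sets"
    HOL.Hull
begin

section \<open>Linear algebra over a field\<close>

definition scalars :: "'k::field ring" where
  "scalars = \<lparr>carrier = UNIV, mult = (*), one = 1, zero = 0, add = (+)\<rparr>"

abbreviation kspace :: "('k::field, 'a, 'm) module_scheme \<Rightarrow> bool" where
  "kspace M \<equiv> Module.module scalars M"

definition lin_map ::
    "('k, 'a, 'm) module_scheme \<Rightarrow> ('k, 'b, 'n) module_scheme \<Rightarrow> ('a \<Rightarrow> 'b) \<Rightarrow> bool" where
  "lin_map M N f \<longleftrightarrow> f \<in> carrier M \<rightarrow> carrier N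
     \<and> (\<forall>x\<in>carrier M. \<forall>y\<in>carrier M. f (x \<oplus>\<^bsub>M\<^esub> y) = f x \<oplus>\<^bsub>N\<^esub> f y)
     \<and> (\<forall>c. \<forall>x\<in>carrier M. f (c \<odot>\<^bsub>M\<^esub> x) = c \<odot>\<^bsub>N\<^esub> f x)"

definition linear_form :: "('k::field, 'a, 'm) module_scheme \<Rightarrow> ('a \<Rightarrow> 'k) \<Rightarrow> bool" where
  "linear_form M f \<longleftrightarrow>
     (\<forall>x\<in>carrier M. \<forall>y\<in>carrier M. f (x \<oplus>\<^bsub>M\<^esub> y) = f x + f y)
     \<and> (\<forall>c. \<forall>x\<in>carrier M. f (c \<odot>\<^bsub>M\<^esub> x) = c * f x)"

definition bilinear_form ::
    "('k::field, 'a, 'm) module_scheme \<Rightarrow> ('k, 'b, 'n) module_scheme \<Rightarrow> ('a \<Rightarrow> 'b \<Rightarrow> 'k) \<Rightarrow> bool" where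
  "bilinear_form M N \<beta> \<longleftrightarrow> (\<forall>y\<in>carrier N. linear_form M (\<lambda>x. \<beta> x y))
     \<and> (\<forall>x\<in>carrier M. linear_form N (\<beta> x))"

definition lin_span :: "('k::field, 'a, 'm) module_scheme \<Rightarrow> 'a set \<Rightarrow> 'a set" where
  "lin_span M S = (\<lambda>W. submodule W scalars M) hull S"

definition is_basis :: "('k::field, 'a, 'm) module_scheme \<Rightarrow> 'j set \<Rightarrow> ('j \<Rightarrow> 'a) \<Rightarrow> bool" where
  "is_basis M J f \<longleftrightarrow> f \<in> J \<rightarrow> carrier M
     \<and> (\<forall>x\<in>carrier M. \<exists>!c :: 'j \<Rightarrow>\<^sub>0 'k. Poly_Mapping.keys c \<subseteq> J
           \<and> x = (\<Oplus>\<^bsub>M\<^esub>j\<in>Poly_Mapping.keys c. Poly_Mapping.lookup c j \<odot>\<^bsub>M\<^esub> f j))"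

definition assoc_algebra :: "('k::field, 'a, 'm) module_scheme \<Rightarrow> bool" where
  "assoc_algebra M \<longleftrightarrow> kspace M \<and> ring M
     \<and> (\<forall>c. \<forall>x\<in>carrier M. \<forall>y\<in>carrier M.
           (c \<odot>\<^bsub>M\<^esub> x) \<otimes>\<^bsub>M\<^esub> y = c \<odot>\<^bsub>M\<^esub> (x \<otimes>\<^bsub>M\<^esub> y) \<and> x \<otimes>\<^bsub>M\<^esub> (c \<odot>\<^bsub>M\<^esub> y) = c \<odot>\<^bsub>M\<^esub> (x \<otimes>\<^bsub>M\<^esub> y))"

text \<open>
  Tensor products. Over a field, the tensor product of \<open>M\<close> and \<open>N\<close> embeds in the dual of the
  space of bilinear forms on \<open>M \<times> N\<close>, the pure tensor of \<open>a\<close> and \<open>b\<close> being the evaluation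
  \<open>\<beta> \<mapsto> \<beta> a b\<close>; the tensor product is modelled by its image, the set of finite sums
  of pure tensors. In particular \<open>T \<beta>\<close> is the value at the tensor \<open>T\<close> of the linear form induced
  by the bilinear form \<open>\<beta>\<close>. Tensors are set to 0 on functions that are not bilinear, so that
  equality of tensors is equality in HOL.
\<close>

type_synonym ('k, 'a, 'b) tensor = "('a \<Rightarrow> 'b \<Rightarrow> 'k) \<Rightarrow> 'k"

definition pure_tensor :: "('k::field, 'a, 'm) module_scheme \<Rightarrow> ('k, 'b, 'n) module_scheme
    \<Rightarrow> 'a \<Rightarrow> 'b \<Rightarrow> ('k, 'a, 'b) tensor" where
  "pure_tensor M N a b = (\<lambda>\<beta>. if bilinear_form M N \<beta> then \<beta> a b else 0)"

definition tensor_sum :: "('k::field, 'a, 'm) module_scheme \<Rightarrow> ('k, 'b, 'n) module_scheme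
    \<Rightarrow> ('a \<times> 'b) list \<Rightarrow> ('k, 'a, 'b) tensor" where
  "tensor_sum M N L = (\<lambda>\<beta>. \<Sum>(a, b)\<leftarrow>L. pure_tensor M N a b \<beta>)"

text \<open>
  The fields \<open>mult\<close> and \<open>one\<close> are meaningful when \<open>M\<close> and \<open>N\<close> are algebras. The formula for
  \<open>mult\<close> is the bilinear extension of \<open>(a \<otimes> b)(a' \<otimes> b') = aa' \<otimes> bb'\<close>.
\<close>

definition tensor_product :: "('k::field, 'a, 'm) module_scheme \<Rightarrow> ('k, 'b, 'n) module_scheme
    \<Rightarrow> ('k, ('k, 'a, 'b) tensor) module" where
  "tensor_product M N =
     \<lparr>carrier = {tensor_sum M N L | L. set L \<subseteq> carrier M \<times> carrier N},
      mult = (\<lambda>S T \<beta>. if bilinear_form M N \<beta>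
                then S (\<lambda>a b. T (\<lambda>a' b'. \<beta> (a \<otimes>\<^bsub>M\<^esub> a') (b \<otimes>\<^bsub>N\<^esub> b'))) else 0),
      one = pure_tensor M N \<one>\<^bsub>M\<^esub> \<one>\<^bsub>N\<^esub>,
      zero = (\<lambda>\<beta>. 0),
      add = (\<lambda>S T \<beta>. S \<beta> + T \<beta>),
      smult = (\<lambda>c T \<beta>. c * T \<beta>)\<rparr>"

text \<open>
  The linear map from the tensor product of \<open>M\<close> and \<open>N\<close> to \<open>P\<close> induced by a bilinear map
  \<open>f\<close> from \<open>M \<times> N\<close> to \<open>P\<close>.
\<close>

definition tensor_lift :: "('k::field, 'a, 'm) module_scheme \<Rightarrow> ('k, 'b, 'n) module_scheme
    \<Rightarrow> ('k, 'c, 'l) module_scheme \<Rightarrow> ('a \<Rightarrow> 'b \<Rightarrow> 'c) \<Rightarrow> ('k, 'a, 'b) tensor \<Rightarrow> 'c" where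
  "tensor_lift M N P f T = (THE v. \<exists>L. set L \<subseteq> carrier M \<times> carrier N \<and> T = tensor_sum M N L
     \<and> v = foldr (\<lambda>(a, b) w. f a b \<oplus>\<^bsub>P\<^esub> w) L \<zero>\<^bsub>P\<^esub>)"


section \<open>Hopf algebras\<close>

record ('k, 'a) hopf = "('k, 'a) module" +
  comult :: "'a \<Rightarrow> ('k, 'a, 'a) tensor"
  counit :: "'a \<Rightarrow> 'k"
  antipode :: "'a \<Rightarrow> 'a"

definition hopf_algebra :: "('k::field, 'a, 'm) hopf_scheme \<Rightarrow> bool" where
  "hopf_algebra H \<longleftrightarrow>
     assoc_algebra H
     \<and> comult H \<in> ring_hom H (tensor_product H H)
     \<and> lin_map H (tensor_product H H) (comult H)
     \<and> counit H \<in> ring_hom H scalars \<and> linear_form H (counit H)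
     \<and> lin_map H H (antipode H)
     \<and> (let HHH = tensor_product H (tensor_product H H) in
          \<forall>x\<in>carrier H.
            tensor_lift H H HHH
              (\<lambda>a b. tensor_lift H H HHH
                 (\<lambda>a1 a2. pure_tensor H (tensor_product H H) a1 (pure_tensor H H a2 b))
                 (comult H a)) (comult H x)
            = tensor_lift H H HHH
                (\<lambda>a b. pure_tensor H (tensor_product H H) a (comult H b)) (comult H x))
     \<and> (\<forall>x\<in>carrier H.
            tensor_lift H H H (\<lambda>a b. counit H a \<odot>\<^bsub>H\<^esub> b) (comult H x) = x
          \<and> tensor_lift H H H (\<lambda>a b. counit H b \<odot>\<^bsub>H\<^esub> a) (comult H x) = x
          \<and> tensor_lift H H H (\<lambda>a b. antipode H a \<otimes>\<^bsub>H\<^esub> b) (comult H x) = counit H x \<odot>\<^bsub>H\<^esub> \<one>\<^bsub>H\<^esub>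
          \<and> tensor_lift H H H (\<lambda>a b. a \<otimes>\<^bsub>H\<^esub> antipode H b) (comult H x) = counit H x \<odot>\<^bsub>H\<^esub> \<one>\<^bsub>H\<^esub>)"

definition hopf_iso ::
    "('k::field, 'a, 'm) hopf_scheme \<Rightarrow> ('k, 'b, 'n) hopf_scheme \<Rightarrow> ('a \<Rightarrow> 'b) set" where
  "hopf_iso H H' = {\<phi> \<in> ring_iso H H'. lin_map H H' \<phi>
     \<and> (\<forall>x\<in>carrier H.
           tensor_lift H H (tensor_product H' H') (\<lambda>a b. pure_tensor H' H' (\<phi> a) (\<phi> b)) (comult H x)
             = comult H' (\<phi> x)
           \<and> counit H' (\<phi> x) = counit H x
           \<and> antipode H' (\<phi> x) = \<phi> (antipode H x))}"

text \<open>Characters with the convolution product.\<close>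

definition character_group :: "('k::field, 'a, 'm) hopf_scheme \<Rightarrow> ('a \<Rightarrow> 'k) monoid" where
  "character_group H =
     \<lparr>carrier = {\<chi> \<in> extensional (carrier H). \<chi> \<in> ring_hom H scalars \<and> linear_form H \<chi>},
      mult = (\<lambda>\<chi> \<psi>. \<lambda>x\<in>carrier H. comult H x (\<lambda>a b. \<chi> a * \<psi> b)),
      one = (\<lambda>x\<in>carrier H. counit H x)\<rparr>"

text \<open>\<open>\<nat>\<^sup>n\<close>, as the set of exponents of monomials in the variables \<open>1, \<dots>, n\<close>.\<close>

type_synonym expo = "nat \<Rightarrow>\<^sub>0 nat"

definition expos :: "nat \<Rightarrow> expo set" where
  "expos n = {\<alpha>. Poly_Mapping.keys \<alpha> \<subseteq> {1..n}}"

text \<open>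
  Gradings by \<open>\<nat>\<^sup>n\<close>. The homogeneous components are required to be finite-dimensional,
  as is needed for the graded dual to be a Hopf algebra.
\<close>

definition graded_hopf_algebra ::
    "nat \<Rightarrow> ('k::field, 'a, 'm) hopf_scheme \<Rightarrow> (expo \<Rightarrow> 'a set) \<Rightarrow> bool" where
  "graded_hopf_algebra n H Hc \<longleftrightarrow>
     hopf_algebra H
     \<and> (\<forall>\<alpha>\<in>expos n. submodule (Hc \<alpha>) scalars H
           \<and> (\<exists>S. finite S \<and> S \<subseteq> carrier H \<and> Hc \<alpha> = lin_span H S))
     \<and> (\<forall>x\<in>carrier H. \<exists>!c. c \<in> (\<Pi>\<^sub>E \<alpha>\<in>expos n. Hc \<alpha>)
           \<and> finite {\<alpha>\<in>expos n. c \<alpha> \<noteq> \<zero>\<^bsub>H\<^esub>}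
           \<and> x = (\<Oplus>\<^bsub>H\<^esub>\<alpha>\<in>{\<alpha>\<in>expos n. c \<alpha> \<noteq> \<zero>\<^bsub>H\<^esub>}. c \<alpha>))
     \<and> \<one>\<^bsub>H\<^esub> \<in> Hc 0
     \<and> (\<forall>\<alpha>\<in>expos n. \<forall>\<beta>\<in>expos n. \<forall>x\<in>Hc \<alpha>. \<forall>y\<in>Hc \<beta>. x \<otimes>\<^bsub>H\<^esub> y \<in> Hc (\<alpha> + \<beta>))
     \<and> (\<forall>\<gamma>\<in>expos n. \<forall>x\<in>Hc \<gamma>. comult H x \<in> lin_span (tensor_product H H)
           {pure_tensor H H a b | a b \<alpha> \<beta>. \<alpha> \<in> expos n \<and> \<beta> \<in> expos n \<and> \<alpha> + \<beta> = \<gamma> \<and> a \<in> Hc \<alpha> \<and> b \<in> Hc \<beta>})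
     \<and> (\<forall>\<alpha>\<in>expos n - {0}. \<forall>x\<in>Hc \<alpha>. counit H x = 0)
     \<and> (\<forall>\<alpha>\<in>expos n. \<forall>x\<in>Hc \<alpha>. antipode H x \<in> Hc \<alpha>)"

text \<open>
  The graded dual: linear forms vanishing on all but finitely many homogeneous components,
  with the transposed structure.
\<close>

definition graded_dual_algebra ::
    "nat \<Rightarrow> ('k::field, 'a, 'm) hopf_scheme \<Rightarrow> (expo \<Rightarrow> 'a set) \<Rightarrow> ('k, 'a \<Rightarrow> 'k) module" where
  "graded_dual_algebra n H Hc =
     \<lparr>carrier = {f \<in> extensional (carrier H). linear_form H f
                   \<and> finite {\<alpha>\<in>expos n. \<exists>x\<in>Hc \<alpha>. f x \<noteq> 0}},
      mult = (\<lambda>f g. \<lambda>x\<in>carrier H. comult H x (\<lambda>a b. f a * g b)),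
      one = (\<lambda>x\<in>carrier H. counit H x),
      zero = (\<lambda>x\<in>carrier H. 0),
      add = (\<lambda>f g. \<lambda>x\<in>carrier H. f x + g x),
      smult = (\<lambda>c f. \<lambda>x\<in>carrier H. c * f x)\<rparr>"

definition graded_dual ::
    "nat \<Rightarrow> ('k::field, 'a, 'm) hopf_scheme \<Rightarrow> (expo \<Rightarrow> 'a set) \<Rightarrow> ('k, 'a \<Rightarrow> 'k) hopf" where
  "graded_dual n H Hc = (let D = graded_dual_algebra n H Hc in module.extend D
     \<lparr>comult = (\<lambda>f. THE T. T \<in> carrier (tensor_product D D)
         \<and> (\<forall>x\<in>carrier H. \<forall>y\<in>carrier H. T (\<lambda>g h. g x * h y) = f (x \<otimes>\<^bsub>H\<^esub> y))),
      counit = (\<lambda>f. f \<one>\<^bsub>H\<^esub>),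
      antipode = (\<lambda>f. \<lambda>x\<in>carrier H. f (antipode H x))\<rparr>)"

definition graded_dual_component ::
    "nat \<Rightarrow> ('k::field, 'a, 'm) hopf_scheme \<Rightarrow> (expo \<Rightarrow> 'a set) \<Rightarrow> expo \<Rightarrow> ('a \<Rightarrow> 'k) set" where
  "graded_dual_component n H Hc \<alpha> =
     {f \<in> carrier (graded_dual n H Hc). \<forall>\<beta>\<in>expos n - {\<alpha>}. \<forall>x\<in>Hc \<beta>. f x = 0}"


section \<open>Pre-Lie algebras and enveloping algebras\<close>

text \<open>
  Pre-Lie and Lie algebras are represented by \<open>module\<close> records whose \<open>mult\<close> field is the
  pre-Lie product, respectively the bracket; the field \<open>one\<close> is not used.
\<close>

definition pre_lie_algebra :: "('k::field, 'a, 'm) module_scheme \<Rightarrow> bool" where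
  "pre_lie_algebra L \<longleftrightarrow> kspace L
     \<and> (\<forall>x\<in>carrier L. lin_map L L (\<lambda>y. x \<otimes>\<^bsub>L\<^esub> y) \<and> lin_map L L (\<lambda>y. y \<otimes>\<^bsub>L\<^esub> x))
     \<and> (\<forall>x\<in>carrier L. \<forall>y\<in>carrier L. \<forall>z\<in>carrier L.
           ((x \<otimes>\<^bsub>L\<^esub> y) \<otimes>\<^bsub>L\<^esub> z) \<ominus>\<^bsub>L\<^esub> (x \<otimes>\<^bsub>L\<^esub> (y \<otimes>\<^bsub>L\<^esub> z))
           = ((y \<otimes>\<^bsub>L\<^esub> x) \<otimes>\<^bsub>L\<^esub> z) \<ominus>\<^bsub>L\<^esub> (y \<otimes>\<^bsub>L\<^esub> (x \<otimes>\<^bsub>L\<^esub> z)))"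

definition lie_of_pre_lie :: "('k::field, 'a) module \<Rightarrow> ('k, 'a) module" where
  "lie_of_pre_lie L = L\<lparr>mult := (\<lambda>x y. (x \<otimes>\<^bsub>L\<^esub> y) \<ominus>\<^bsub>L\<^esub> (y \<otimes>\<^bsub>L\<^esub> x))\<rparr>"

text \<open>The free associative unital algebra on a set of letters, with words as a basis.\<close>

definition free_algebra :: "'x set \<Rightarrow> ('k::field, 'x list \<Rightarrow> 'k) module" where
  "free_algebra X =
     \<lparr>carrier = {f. finite {w. f w \<noteq> 0} \<and> {w. f w \<noteq> 0} \<subseteq> lists X},
      mult = (\<lambda>f g w. \<Sum>i\<le>length w. f (take i w) * g (drop i w)),
      one = (\<lambda>w. of_bool (w = [])),
      zero = (\<lambda>w. 0),
      add = (\<lambda>f g w. f w + g w),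
      smult = (\<lambda>c f w. c * f w)\<rparr>"

definition word :: "'x list \<Rightarrow> 'x list \<Rightarrow> 'k::field" where
  "word w = (\<lambda>v. of_bool (v = w))"

definition quotient_algebra ::
    "('k::field, 'a, 'm) module_scheme \<Rightarrow> 'a set \<Rightarrow> ('k, 'a set) module" where
  "quotient_algebra A I = ring.extend (A Quot I)
     \<lparr>smult = (\<lambda>c X. \<Union>x\<in>X. I +>\<^bsub>A\<^esub> (c \<odot>\<^bsub>A\<^esub> x))\<rparr>"

text \<open>
  The enveloping algebra of a Lie algebra \<open>L\<close>. The first two families of relations turn the
  free algebra on the set \<open>carrier L\<close> into the tensor algebra of the vector space \<open>L\<close>.
\<close>

definition enveloping_ideal :: "('k::field, 'a, 'm) module_scheme \<Rightarrow> ('a list \<Rightarrow> 'k) set" where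
  "enveloping_ideal L =
     Idl\<^bsub>free_algebra (carrier L)\<^esub>
       ({(\<lambda>w. word [x \<oplus>\<^bsub>L\<^esub> y] w - word [x] w - word [y] w) | x y. x \<in> carrier L \<and> y \<in> carrier L}
      \<union> {(\<lambda>w. word [c \<odot>\<^bsub>L\<^esub> x] w - c * word [x] w) | c x. x \<in> carrier L}
      \<union> {(\<lambda>w. word [x, y] w - word [y, x] w - word [x \<otimes>\<^bsub>L\<^esub> y] w)
          | x y. x \<in> carrier L \<and> y \<in> carrier L})"

definition enveloping_algebra ::
    "('k::field, 'a, 'm) module_scheme \<Rightarrow> ('k, ('a list \<Rightarrow> 'k) set) module" where
  "enveloping_algebra L = quotient_algebra (free_algebra (carrier L)) (enveloping_ideal L)"

text \<open>The class of the product of a list of elements of \<open>L\<close>.\<close>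

definition env_word :: "('k::field, 'a, 'm) module_scheme \<Rightarrow> 'a list \<Rightarrow> ('a list \<Rightarrow> 'k) set" where
  "env_word L w = enveloping_ideal L +>\<^bsub>free_algebra (carrier L)\<^esub> word w"

text \<open>
  The usual Hopf algebra structure of the enveloping algebra, for which the elements of \<open>L\<close> are
  primitive; as \<open>L\<close> generates the algebra, this condition determines the coproduct, hence
  also the counit and the antipode.
\<close>

definition enveloping_hopf_algebra ::
    "('k::field, 'a, 'm) module_scheme \<Rightarrow> ('k, ('a list \<Rightarrow> 'k) set) hopf \<Rightarrow> bool" where
  "enveloping_hopf_algebra L U \<longleftrightarrow> hopf_algebra U \<and> module.truncate U = enveloping_algebra L
     \<and> (\<forall>x\<in>carrier L. comult U (env_word L [x]) =
           pure_tensor U U (env_word L [x]) \<one>\<^bsub>U\<^esub> \<oplus>\<^bsub>tensor_product U U\<^esub> pure_tensor U U \<one>\<^bsub>U\<^esub> (env_word L [x]))"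

text \<open>The grading of the enveloping algebra induced by a grading \<open>Lc\<close> of \<open>L\<close>.\<close>

definition enveloping_component ::
    "nat \<Rightarrow> ('k::field, 'a, 'm) module_scheme \<Rightarrow> (expo \<Rightarrow> 'a set) \<Rightarrow> expo \<Rightarrow> ('a list \<Rightarrow> 'k) set set" where
  "enveloping_component n L Lc \<gamma> = lin_span (enveloping_algebra L)
     {env_word L w | w \<alpha>s. set \<alpha>s \<subseteq> expos n \<and> list_all2 (\<lambda>x \<alpha>. x \<in> Lc \<alpha>) w \<alpha>s \<and> sum_list \<alpha>s = \<gamma>}"


section \<open>Deg1 pre-Lie algebras\<close>

text \<open>\<open>A i j l\<close> is the \<open>l\<close>-th coordinate of \<open>A\<^sup>(\<^sup>i\<^sup>,\<^sup>j\<^sup>)\<close>; all indices start at 1.\<close>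

definition deg1_pre_lie_algebra :: "nat \<Rightarrow> nat \<Rightarrow> (nat \<Rightarrow> nat \<Rightarrow> nat \<Rightarrow> 'k) \<Rightarrow> (nat \<Rightarrow> nat \<Rightarrow> 'k)
    \<Rightarrow> ('k::field, 'a, 'm) module_scheme \<Rightarrow> (nat \<Rightarrow> expo \<Rightarrow> 'a) \<Rightarrow> bool" where
  "deg1_pre_lie_algebra N M A b L f \<longleftrightarrow> pre_lie_algebra L
     \<and> is_basis L ({1..M} \<times> (expos N - {0})) (\<lambda>(i, \<alpha>). f i \<alpha>)
     \<and> (\<forall>i\<in>{1..M}. \<forall>j\<in>{1..M}. \<forall>\<alpha>\<in>expos N - {0}. \<forall>\<beta>\<in>expos N - {0}.
           f j \<beta> \<otimes>\<^bsub>L\<^esub> f i \<alpha> =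
           ((\<Sum>l=1..N. A i j l * of_nat (Poly_Mapping.lookup \<alpha> l)) + b i j) \<odot>\<^bsub>L\<^esub> f i (\<alpha> + \<beta>))"

definition fundamental_coefficients ::
    "nat \<Rightarrow> nat \<Rightarrow> (nat \<Rightarrow> nat \<Rightarrow> nat \<Rightarrow> 'k::field) \<Rightarrow> (nat \<Rightarrow> nat \<Rightarrow> 'k) \<Rightarrow> bool" where
  "fundamental_coefficients N M A b \<longleftrightarrow>
     (\<exists>(k :: nat) (I :: nat \<Rightarrow> nat set) (A' :: nat \<Rightarrow> nat \<Rightarrow> 'k) (b' :: nat \<Rightarrow> 'k) (b'' :: nat \<Rightarrow> nat \<Rightarrow> 'k).
        {1..M} = (\<Union>m\<in>{0..k}. I m) \<and> disjoint_family_on I {0..k} \<and> (\<forall>m\<in>{1..k}. I m \<noteq> {})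
        \<and> (\<forall>i\<in>{1..M}.
             (\<forall>j\<in>I 0. (\<forall>l\<in>{1..N}. A i j l = 0) \<and> b i j = 0)
             \<and> (\<forall>m\<in>{1..k}. \<forall>j\<in>I m. \<forall>l\<in>{1..N}. A i j l = A' m l))
        \<and> (\<forall>l\<in>{1..k}. \<forall>m\<in>{1..k}. \<forall>i\<in>I l. \<forall>j\<in>I m. b i j = (if l = m then b' m else 0))
        \<and> (\<forall>m\<in>{1..k}. \<forall>i\<in>I 0. \<forall>j\<in>I m. b i j = b'' i m))"

text \<open>
  The vector space with basis \<open>f\<^sub>i(\<alpha>) = single (i, \<alpha>) 1\<close> and the bilinear product prescribed
  on this basis by the structure coefficients.
\<close>

type_synonym 'k deg1 = "(nat \<times> expo) \<Rightarrow>\<^sub>0 'k"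

definition deg1_basis :: "nat \<Rightarrow> expo \<Rightarrow> 'k::field deg1" where
  "deg1_basis i \<alpha> = Poly_Mapping.single (i, \<alpha>) 1"

definition deg1_algebra :: "nat \<Rightarrow> nat \<Rightarrow> (nat \<Rightarrow> nat \<Rightarrow> nat \<Rightarrow> 'k) \<Rightarrow> (nat \<Rightarrow> nat \<Rightarrow> 'k)
    \<Rightarrow> ('k::field, 'k deg1) module" where
  "deg1_algebra N M A b =
     \<lparr>carrier = {x. Poly_Mapping.keys x \<subseteq> {1..M} \<times> (expos N - {0})},
      mult = (\<lambda>x y. \<Sum>(j, \<beta>)\<in>Poly_Mapping.keys x. \<Sum>(i, \<alpha>)\<in>Poly_Mapping.keys y.
        Poly_Mapping.single (i, \<alpha> + \<beta>)
          (Poly_Mapping.lookup x (j, \<beta>) * Poly_Mapping.lookup y (i, \<alpha>)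
           * ((\<Sum>l=1..N. A i j l * of_nat (Poly_Mapping.lookup \<alpha> l)) + b i j))),
      one = undefined,
      zero = 0,
      add = (+),
      smult = (\<lambda>c. Poly_Mapping.map ((*) c))\<rparr>"

definition deg1_component ::
    "nat \<Rightarrow> ('k::field, 'k deg1, 'm) module_scheme \<Rightarrow> expo \<Rightarrow> 'k deg1 set" where
  "deg1_component M L \<alpha> = (if \<alpha> = 0 then {\<zero>\<^bsub>L\<^esub>} else lin_span L {deg1_basis i \<alpha> | i. i \<in> {1..M}})"


section \<open>Formal power series in several variables\<close>

text \<open>
  Series in the variables \<open>1, \<dots>, n\<close> are given by their coefficients. With \<open>n = p + q\<close>,
  variable \<open>i \<le> p\<close> is \<open>x\<^sub>i\<close> and variable \<open>p + m\<close> is \<open>y\<^sub>m\<close>.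
\<close>

type_synonym 'k mps = "expo \<Rightarrow> 'k"

definition total_degree :: "expo \<Rightarrow> nat" where
  "total_degree \<alpha> = (\<Sum>i\<in>Poly_Mapping.keys \<alpha>. Poly_Mapping.lookup \<alpha> i)"

definition series_ring :: "nat \<Rightarrow> ('k::field mps) ring" where
  "series_ring n =
     \<lparr>carrier = {F. \<forall>\<alpha>. \<alpha> \<notin> expos n \<longrightarrow> F \<alpha> = 0},
      mult = (\<lambda>F G \<gamma>. \<Sum>(\<alpha>, \<beta>)\<in>{(\<alpha>, \<beta>). \<alpha> + \<beta> = \<gamma>}. F \<alpha> * G \<beta>),
      one = (\<lambda>\<alpha>. of_bool (\<alpha> = 0)),
      zero = (\<lambda>\<alpha>. 0),
      add = (\<lambda>F G \<alpha>. F \<alpha> + G \<alpha>)\<rparr>"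

definition series_var :: "nat \<Rightarrow> 'k::field mps" where
  "series_var i = (\<lambda>\<alpha>. of_bool (\<alpha> = Poly_Mapping.single i 1))"

definition V0 :: "nat \<Rightarrow> 'k::field mps monoid" where
  "V0 n = \<lparr>carrier = {F \<in> carrier (series_ring n). F 0 = 0},
           mult = add (series_ring n), one = \<zero>\<^bsub>series_ring n\<^esub>\<rparr>"

text \<open>
  Substitution of \<open>g i\<close>, without constant term, for the variable \<open>i\<close>. The monomial of exponent
  \<open>\<alpha>\<close> contributes to the coefficient of exponent \<open>\<gamma>\<close> only if its total degree is at most that
  of \<open>\<gamma>\<close>, whence the truncation to a finite sum.
\<close>

definition series_subst :: "nat \<Rightarrow> (nat \<Rightarrow> 'k::field mps) \<Rightarrow> 'k mps \<Rightarrow> 'k mps" where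
  "series_subst n g P = (\<lambda>\<gamma>. \<Sum>\<alpha>\<in>{\<alpha>\<in>expos n. total_degree \<alpha> \<le> total_degree \<gamma>}.
     P \<alpha> * (\<Otimes>\<^bsub>series_ring n\<^esub>i\<in>{1..n}. g i [^]\<^bsub>series_ring n\<^esub> Poly_Mapping.lookup \<alpha> i) \<gamma>)"

text \<open>
  \<open>series_powr n u c\<close> is \<open>u\<^sup>c = (\<Sum>k. (c gchoose k) h\<^sup>k)\<close> for \<open>u = 1 + h\<close>, where \<open>h\<close> has
  no constant term; \<open>h\<^sup>k\<close> has no coefficient of total degree less than \<open>k\<close>.
\<close>

definition series_powr :: "nat \<Rightarrow> 'k::field_char_0 mps \<Rightarrow> 'k \<Rightarrow> 'k mps" where
  "series_powr n u c = (\<lambda>\<gamma>. \<Sum>k\<le>total_degree \<gamma>.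
     (c gchoose k) * ((u \<ominus>\<^bsub>series_ring n\<^esub> \<one>\<^bsub>series_ring n\<^esub>) [^]\<^bsub>series_ring n\<^esub> k) \<gamma>)"

text \<open>\<open>div_var i F\<close> is \<open>F / x\<^sub>i\<close> for a series \<open>F\<close> divisible by \<open>x\<^sub>i\<close>.\<close>

definition div_var :: "nat \<Rightarrow> 'k::field mps \<Rightarrow> 'k mps" where
  "div_var i F = (\<lambda>\<alpha>. F (\<alpha> + Poly_Mapping.single i 1))"


section \<open>The groups\<close>

text \<open>\<open>B m i\<close>, for \<open>1 \<le> m \<le> q\<close> and \<open>1 \<le> i \<le> p\<close>, are the entries of a matrix of size \<open>q \<times> p\<close>.\<close>

definition G_set :: "nat \<Rightarrow> nat \<Rightarrow> 'k::field mps set" where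
  "G_set n i = {series_var i \<otimes>\<^bsub>series_ring n\<^esub> (\<one>\<^bsub>series_ring n\<^esub> \<oplus>\<^bsub>series_ring n\<^esub> F) | F. F \<in> carrier (V0 n)}"

text \<open>The substitution \<open>x\<^sub>i \<mapsto> F\<^sub>i\<close>, \<open>y\<^sub>m \<mapsto> y\<^sub>m (\<Prod>i. (F\<^sub>i / x\<^sub>i) powr B m i)\<close>.\<close>

definition G_subst :: "nat \<Rightarrow> nat \<Rightarrow> (nat \<Rightarrow> nat \<Rightarrow> 'k::field_char_0)
    \<Rightarrow> (nat \<Rightarrow> 'k mps) \<Rightarrow> 'k mps \<Rightarrow> 'k mps" where
  "G_subst p q B F = series_subst (p + q)
     (\<lambda>l. if l \<le> p then F l
          else series_var l \<otimes>\<^bsub>series_ring (p + q)\<^esub>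
            (\<Otimes>\<^bsub>series_ring (p + q)\<^esub>i\<in>{1..p}. series_powr (p + q) (div_var i (F i)) (B (l - p) i)))"

definition G_group :: "nat \<Rightarrow> nat \<Rightarrow> (nat \<Rightarrow> nat \<Rightarrow> 'k::field_char_0) \<Rightarrow> (nat \<Rightarrow> 'k mps) monoid" where
  "G_group p q B =
     \<lparr>carrier = (\<Pi>\<^sub>E i\<in>{1..p}. G_set (p + q) i),
      mult = (\<lambda>F G. \<lambda>i\<in>{1..p}. G_subst p q B F (G i)),
      one = (\<lambda>i\<in>{1..p}. series_var i)\<rparr>"

definition semidirect_group :: "nat \<Rightarrow> nat \<Rightarrow> nat \<Rightarrow> (nat \<Rightarrow> nat \<Rightarrow> 'k::field_char_0)
    \<Rightarrow> ((nat \<Rightarrow> 'k mps) \<times> (nat \<Rightarrow> 'k mps)) monoid" where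
  "semidirect_group p q r B = (let V = product_group {1..r} (\<lambda>_. V0 (p + q)) in
     \<lparr>carrier = carrier V \<times> carrier (G_group p q B),
      mult = (\<lambda>(P, F) (Q, G). (P \<otimes>\<^bsub>V\<^esub> (\<lambda>j\<in>{1..r}. G_subst p q B F (Q j)), F \<otimes>\<^bsub>G_group p q B\<^esub> G)),
      one = (\<one>\<^bsub>V\<^esub>, \<one>\<^bsub>G_group p q B\<^esub>)\<rparr>)"

text \<open>
  \<open>A\<^sup>(\<^sup>i\<^sup>,\<^sup>j\<^sup>)\<close> is the \<open>j\<close>-th column of the identity matrix of size \<open>p\<close> stacked on \<open>B\<close> if
  \<open>j \<le> p\<close>, and 0 otherwise.
\<close>

definition coeff_A :: "nat \<Rightarrow> (nat \<Rightarrow> nat \<Rightarrow> 'k::field) \<Rightarrow> nat \<Rightarrow> nat \<Rightarrow> nat \<Rightarrow> 'k" where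
  "coeff_A p B i j l =
     (if j \<le> p then (if l \<le> p then of_bool (l = j) else B (l - p) j) else 0)"

end

theory Submission
  imports Defs
begin

text \<open>
  Write \<open>u\<^sub>F(\<alpha>)\<close> for the product over \<open>j\<close> of the powers of \<open>F\<^sub>j / x\<^sub>j\<close> with exponents
  \<open>A\<^sub>j \<cdot> \<alpha>\<close>. The substitution attached to \<open>F\<close> multiplies the monomial of exponent \<open>\<alpha>\<close> by
  \<open>u\<^sub>F(\<alpha>)\<close>, and \<open>u\<close> is multiplicative in \<open>\<alpha>\<close>, which gives the group law and the action.
  The coefficients of the series \<open>F\<^sub>i / x\<^sub>i - 1\<close> and \<open>P\<^sub>j\<close> are global coordinates on the
  semidirect product, and the coordinates of a product and of an inverse are weighted homogeneous
  polynomials in those of the factors. Hence the polynomial functions form a graded Hopf algebra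
  whose characters are the evaluations at the elements of the group; all identities in it are
  checked on such evaluations.

  The derivatives at the identity with respect to the coordinates are primitive elements of the
  graded dual, and their brackets, read off from the bilinear part of the coproduct, are those of
  the deg1 pre-Lie algebra. This pairs the enveloping algebra with the Hopf algebra. The pairing of
  ordered products of derivatives with monomials in the coordinates is triangular with positive
  integers on the diagonal. As the field has characteristic zero and ordered products span the
  enveloping algebra, the pairing is perfect and identifies the enveloping algebra with the graded
  dual.
\<close>

section \<open>Linear and bilinear forms\<close>

text \<open>Tensors are accessible only through bilinear forms, and \<open>tensor_lift\<close> and
  the coproducts are definite descriptions. Equality is therefore tested by
  \<open>separating\<close> families of linear forms, whose products separate tensor products. On
  the polynomial functions the family is evaluation at group elements; on the enveloping algebra it
  is pairing with functions, which turns each Hopf axiom into a transposed one.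

  Two features carry the argument. The substitution attached to the left factor acts linearly on the
  coefficients of the right factor, so the right legs in the coproduct of a coordinate have degree
  at most one, and the bracket is read off from the linear part of the left legs. And the
  Poincare-Birkhoff-Witt theorem is a by-product: spanning comes from exchanging letters modulo
  shorter words, independence from the pairing, where each derivative extends to an invariant vector
  field that is a partial derivative up to coefficients vanishing at the identity.

  Beyond the diagonal entries, characteristic zero serves to define powers with exponents in the
  field and to separate polynomials by their values at points with natural coordinates.\<close>

lemma cring_scalars: "cring (scalars :: 'k::field ring)"
proof (rule cringI)
  show "abelian_group (scalars :: 'k ring)"
    by (rule abelian_groupI) (auto simp: scalars_def ac_simps intro: exI[of _ "- x" for x])
  show "Group.comm_monoid (scalars :: 'k ring)"
    by (rule comm_monoidI) (auto simp: scalars_def ac_simps)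
qed (auto simp: scalars_def algebra_simps)

lemma scalars_simps [simp]:
  "carrier scalars = UNIV" "mult scalars = (*)" "one scalars = 1"
  "zero scalars = 0" "add scalars = (+)"
  by (auto simp: scalars_def)

text \<open>Additive inverses are produced by the scalar -1, so a vector space can be recognized
  without naming its inverse operation.\<close>

lemma kspaceI:
  fixes M :: "('k::field, 'a, 'm) module_scheme" (structure)
  assumes "\<And>x y. x \<in> carrier M \<Longrightarrow> y \<in> carrier M \<Longrightarrow> x \<oplus> y \<in> carrier M"
    and "\<zero> \<in> carrier M"
    and "\<And>c x. x \<in> carrier M \<Longrightarrow> c \<odot> x \<in> carrier M"
    and "\<And>x y z. x \<in> carrier M \<Longrightarrow> y \<in> carrier M \<Longrightarrow> z \<in> carrier M \<Longrightarrow> (x \<oplus> y) \<oplus> z = x \<oplus> (y \<oplus> z)"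
    and "\<And>x y. x \<in> carrier M \<Longrightarrow> y \<in> carrier M \<Longrightarrow> x \<oplus> y = y \<oplus> x"
    and "\<And>x. x \<in> carrier M \<Longrightarrow> \<zero> \<oplus> x = x"
    and "\<And>x. x \<in> carrier M \<Longrightarrow> (- 1) \<odot> x \<oplus> x = \<zero>"
    and "\<And>c d x. x \<in> carrier M \<Longrightarrow> (c + d) \<odot> x = c \<odot> x \<oplus> d \<odot> x"
    and "\<And>c x y. x \<in> carrier M \<Longrightarrow> y \<in> carrier M \<Longrightarrow> c \<odot> (x \<oplus> y) = c \<odot> x \<oplus> c \<odot> y"
    and "\<And>c d x. x \<in> carrier M \<Longrightarrow> (c * d) \<odot> x = c \<odot> (d \<odot> x)"
    and "\<And>x. x \<in> carrier M \<Longrightarrow> 1 \<odot> x = x"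
  shows "kspace M"
proof (rule moduleI)
  show "abelian_group M"
  proof (rule abelian_groupI)
    fix x assume x: "x \<in> carrier M"
    show "\<exists>y\<in>carrier M. y \<oplus> x = \<zero>"
      using assms(3)[OF x, of "- 1"] assms(7)[OF x] by blast
  qed (use assms(1,2,4-6) in blast)+
qed (simp_all add: assms cring_scalars)

lemma kspace_closed:
  fixes M (structure)
  assumes "kspace M"
  shows "x \<in> carrier M \<Longrightarrow> c \<odot> x \<in> carrier M"
    and "x \<in> carrier M \<Longrightarrow> y \<in> carrier M \<Longrightarrow> x \<oplus> y \<in> carrier M"
    and "\<zero> \<in> carrier M"
    and "x \<in> carrier M \<Longrightarrow> \<ominus> x \<in> carrier M"
    and "x \<in> carrier M \<Longrightarrow> y \<in> carrier M \<Longrightarrow> x \<ominus> y \<in> carrier M"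
proof -
  interpret Module.module scalars M by fact
  show "x \<in> carrier M \<Longrightarrow> c \<odot> x \<in> carrier M"
    and "x \<in> carrier M \<Longrightarrow> y \<in> carrier M \<Longrightarrow> x \<oplus> y \<in> carrier M"
    and "\<zero> \<in> carrier M"
    and "x \<in> carrier M \<Longrightarrow> \<ominus> x \<in> carrier M"
    and "x \<in> carrier M \<Longrightarrow> y \<in> carrier M \<Longrightarrow> x \<ominus> y \<in> carrier M"
    by auto
qed

lemma kspace_minus_one:
  fixes M :: "('k::field, 'a, 'm) module_scheme" (structure)
  assumes "kspace M" "x \<in> carrier M"
  shows "(- 1) \<odot> x = \<ominus> x"
proof -
  interpret Module.module scalars M by fact
  have "\<ominus>\<^bsub>scalars\<^esub> \<one>\<^bsub>scalars\<^esub> = - (\<one>\<^bsub>scalars\<^esub> :: 'k)"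
    by (rule R.minus_equality) (auto)
  with smult_l_minus[of "\<one>\<^bsub>scalars\<^esub>" x] assms smult_one[of x] show ?thesis by simp
qed

lemma linear_form_add: "linear_form M f \<Longrightarrow> x \<in> carrier M \<Longrightarrow> y \<in> carrier M \<Longrightarrow> f (x \<oplus>\<^bsub>M\<^esub> y) = f x + f y"
  by (simp add: linear_form_def)

lemma linear_form_smult: "linear_form M f \<Longrightarrow> x \<in> carrier M \<Longrightarrow> f (c \<odot>\<^bsub>M\<^esub> x) = c * f x"
  by (simp add: linear_form_def)

lemma linear_form_zero:
  fixes M (structure)
  assumes "kspace M" "linear_form M f"
  shows "f \<zero> = 0"
proof -
  interpret Module.module scalars M by fact
  have "f \<zero> = f (0 \<odot> \<zero>)" using smult_l_null[of "\<zero>"] by simp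
  also have "\<dots> = 0" using linear_form_smult[OF assms(2), of "\<zero>" 0] by simp
  finally show ?thesis .
qed

lemma linear_form_diff:
  assumes "kspace M" "linear_form M f" "x \<in> carrier M" "y \<in> carrier M"
  shows "f (x \<ominus>\<^bsub>M\<^esub> y) = f x - f y"
  unfolding a_minus_def kspace_minus_one[OF assms(1,4), symmetric]
  using assms by (simp add: linear_form_add linear_form_smult kspace_closed)

lemma lf_mult_left: "linear_form M f \<Longrightarrow> linear_form M (\<lambda>x. c * f x)"
  by (auto simp: linear_form_def algebra_simps)

lemma lf_mult_right: "linear_form M f \<Longrightarrow> linear_form M (\<lambda>x. f x * c)"
  by (auto simp: linear_form_def algebra_simps)

lemma lf_plus: "linear_form M f \<Longrightarrow> linear_form M g \<Longrightarrow> linear_form M (\<lambda>x. f x + g x)"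
  by (auto simp: linear_form_def algebra_simps)

lemma lf_comp: "lin_map M N h \<Longrightarrow> linear_form N f \<Longrightarrow> linear_form M (\<lambda>x. f (h x))"
  unfolding lin_map_def linear_form_def by (auto simp: Pi_iff)

lemmas lf_intros = lf_mult_left lf_mult_right lf_plus lf_comp

lemma bilinear_formI:
  assumes "\<And>y. y \<in> carrier N \<Longrightarrow> linear_form M (\<lambda>x. \<beta> x y)"
    and "\<And>x. x \<in> carrier M \<Longrightarrow> linear_form N (\<beta> x)"
  shows "bilinear_form M N \<beta>"
  using assms by (simp add: bilinear_form_def)

lemma bilinear_formD1: "bilinear_form M N \<beta> \<Longrightarrow> y \<in> carrier N \<Longrightarrow> linear_form M (\<lambda>x. \<beta> x y)"
  by (simp add: bilinear_form_def)

lemma bilinear_formD2: "bilinear_form M N \<beta> \<Longrightarrow> x \<in> carrier M \<Longrightarrow> linear_form N (\<beta> x)"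
  by (simp add: bilinear_form_def)

lemma bilinear_mult:
  "linear_form M f \<Longrightarrow> linear_form N g \<Longrightarrow> bilinear_form M N (\<lambda>x y. f x * g y)"
  by (auto intro!: bilinear_formI lf_intros)

lemma lin_mapI:
  assumes "\<And>x. x \<in> carrier M \<Longrightarrow> f x \<in> carrier N"
    and "\<And>x y. x \<in> carrier M \<Longrightarrow> y \<in> carrier M \<Longrightarrow> f (x \<oplus>\<^bsub>M\<^esub> y) = f x \<oplus>\<^bsub>N\<^esub> f y"
    and "\<And>c x. x \<in> carrier M \<Longrightarrow> f (c \<odot>\<^bsub>M\<^esub> x) = c \<odot>\<^bsub>N\<^esub> f x"
  shows "lin_map M N f"
  using assms by (auto simp: lin_map_def)

section \<open>Tensor products\<close>

abbreviation tensors where "tensors M N \<equiv> carrier (tensor_product M N)"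

lemma sum_list_pair_add:
  "(\<Sum>(a, b)\<leftarrow>L. f a b + g a b) = (\<Sum>(a, b)\<leftarrow>L. f a b) + (\<Sum>(a, b)\<leftarrow>L. g a b :: 'k::semiring_0)"
  by (induction L) (auto simp: algebra_simps)

lemma sum_list_pair_cmult:
  "(\<Sum>(a, b)\<leftarrow>L. c * f a b) = c * (\<Sum>(a, b)\<leftarrow>L. f a b :: 'k::semiring_0)"
  by (induction L) (auto simp: algebra_simps)

lemma sum_list_pair_swap:
  "(\<Sum>(a, b)\<leftarrow>L. \<Sum>(a', b')\<leftarrow>L'. f a b a' b') = (\<Sum>(a', b')\<leftarrow>L'. \<Sum>(a, b)\<leftarrow>L. f a b a' b' :: 'k::semiring_0)"
  by (induction L) (auto simp: sum_list_pair_add split_def sum_list_addf)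

lemma sum_list_pair_cong:
  assumes "\<And>a b. (a, b) \<in> set L \<Longrightarrow> f a b = g a b"
  shows "(\<Sum>(a, b)\<leftarrow>L. f a b) = (\<Sum>(a, b)\<leftarrow>L. g a b)"
  using assms by (intro arg_cong[where f = sum_list] map_cong) auto

lemma tensor_product_simps [simp]:
  "zero (tensor_product M N) = (\<lambda>\<beta>. 0)"
  "add (tensor_product M N) = (\<lambda>S T \<beta>. S \<beta> + T \<beta>)"
  "smult (tensor_product M N) = (\<lambda>c T \<beta>. c * T \<beta>)"
  "one (tensor_product M N) = pure_tensor M N \<one>\<^bsub>M\<^esub> \<one>\<^bsub>N\<^esub>"
  by (simp_all add: tensor_product_def)

lemma tensor_carrier: "T \<in> tensors M N \<longleftrightarrow> (\<exists>L. T = tensor_sum M N L \<and> set L \<subseteq> carrier M \<times> carrier N)"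
  by (auto simp: tensor_product_def)

lemma tensor_sum_eval:
  "tensor_sum M N L \<beta> = (if bilinear_form M N \<beta> then \<Sum>(a, b)\<leftarrow>L. \<beta> a b else 0)"
  by (auto simp: tensor_sum_def pure_tensor_def split_def)

lemma tensor_rep:
  assumes "T \<in> tensors M N"
  obtains L where "set L \<subseteq> carrier M \<times> carrier N" "T = tensor_sum M N L"
    "\<And>\<beta>. bilinear_form M N \<beta> \<Longrightarrow> T \<beta> = (\<Sum>(a, b)\<leftarrow>L. \<beta> a b)"
  using assms by (auto simp: tensor_carrier tensor_sum_eval)

lemma tensor_not_bilinear:
  "T \<in> tensors M N \<Longrightarrow> \<not> bilinear_form M N \<beta> \<Longrightarrow> T \<beta> = 0"
  by (auto simp: tensor_carrier tensor_sum_eval)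

lemma tensor_eqI:
  assumes "S \<in> tensors M N" "T \<in> tensors M N"
    and "\<And>\<beta>. bilinear_form M N \<beta> \<Longrightarrow> S \<beta> = T \<beta>"
  shows "S = T"
proof (rule ext)
  fix \<beta> show "S \<beta> = T \<beta>"
    by (cases "bilinear_form M N \<beta>") (simp_all add: assms(3) tensor_not_bilinear[OF assms(1)] tensor_not_bilinear[OF assms(2)])
qed

lemma pure_tensor_sum: "pure_tensor M N a b = tensor_sum M N [(a, b)]"
  by (auto simp: fun_eq_iff tensor_sum_def)

lemma pure_tensor_closed:
  "a \<in> carrier M \<Longrightarrow> b \<in> carrier N \<Longrightarrow> pure_tensor M N a b \<in> tensors M N"
  unfolding tensor_carrier pure_tensor_sum by (rule exI[of _ "[(a, b)]"]) auto

lemma tensor_sum_append: "(\<lambda>\<beta>. tensor_sum M N L \<beta> + tensor_sum M N L' \<beta>) = tensor_sum M N (L @ L')"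
  by (auto simp: tensor_sum_def)

lemma tensor_sum_smult:
  assumes "set L \<subseteq> carrier M \<times> carrier N"
  shows "(\<lambda>\<beta>. c * tensor_sum M N L \<beta>) = tensor_sum M N (map (\<lambda>(a, b). (c \<odot>\<^bsub>M\<^esub> a, b)) L)"
proof (rule ext)
  fix \<beta>
  show "c * tensor_sum M N L \<beta> = tensor_sum M N (map (\<lambda>(a, b). (c \<odot>\<^bsub>M\<^esub> a, b)) L) \<beta>"
  proof (cases "bilinear_form M N \<beta>")
    case True
    have "c * (\<Sum>(a, b)\<leftarrow>L. \<beta> a b) = (\<Sum>(a, b)\<leftarrow>L. \<beta> (c \<odot>\<^bsub>M\<^esub> a) b)"
      unfolding sum_list_pair_cmult[symmetric] using assms True
      by (intro sum_list_pair_cong) (auto simp: linear_form_smult[OF bilinear_formD1[OF True]])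
    with True show ?thesis by (simp add: tensor_sum_eval split_def o_def)
  qed (simp add: tensor_sum_eval)
qed

lemma kspace_tensor_product:
  assumes "kspace M" "kspace N"
  shows "kspace (tensor_product M N)"
proof (rule kspaceI)
  fix x y assume "x \<in> tensors M N" "y \<in> tensors M N"
  then show "x \<oplus>\<^bsub>tensor_product M N\<^esub> y \<in> tensors M N"
    by (auto simp: tensor_carrier tensor_sum_append) (metis set_append Un_least)
next
  show "\<zero>\<^bsub>tensor_product M N\<^esub> \<in> tensors M N"
    by (auto simp: tensor_carrier tensor_sum_def intro!: exI[of _ "[]"])
next
  fix c x assume "x \<in> tensors M N"
  then obtain L where L: "x = tensor_sum M N L" "set L \<subseteq> carrier M \<times> carrier N"
    by (auto simp: tensor_carrier)
  have "set (map (\<lambda>(a, b). (c \<odot>\<^bsub>M\<^esub> a, b)) L) \<subseteq> carrier M \<times> carrier N"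
    using L assms by (auto simp: kspace_closed)
  with L show "c \<odot>\<^bsub>tensor_product M N\<^esub> x \<in> tensors M N"
    unfolding tensor_carrier tensor_product_simps L(1) tensor_sum_smult[OF L(2)] by blast
qed (auto simp: fun_eq_iff algebra_simps)

lemma lf_tensor_eval: "linear_form (tensor_product M N) (\<lambda>T. T \<beta>)"
  by (auto simp: linear_form_def)

text \<open>Tensors take arbitrary HOL functions as arguments. Their values, and the test of
  bilinearity that triggers the default 0, depend on the argument only through its values on the
  carriers. This permits rewriting under a tensor with facts that hold for elements of the carriers
  only.\<close>

lemma tensor_cong:
  assumes "kspace M" "kspace N" "T \<in> tensors M N"
    and eq: "\<And>a b. a \<in> carrier M \<Longrightarrow> b \<in> carrier N \<Longrightarrow> \<beta> a b = \<beta>' a b"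
  shows "T \<beta> = T \<beta>'"
proof -
  have "bilinear_form M N \<beta> \<longleftrightarrow> bilinear_form M N \<beta>'"
    using assms by (auto simp: bilinear_form_def linear_form_def kspace_closed)
  moreover obtain L where L: "set L \<subseteq> carrier M \<times> carrier N" "T = tensor_sum M N L"
    using assms(3) by (auto simp: tensor_carrier)
  ultimately show ?thesis
    by (auto simp: tensor_sum_eval intro!: sum_list_pair_cong eq)
qed

lemma linear_form_sum_list:
  assumes "kspace P" "\<And>a b. (a, b) \<in> set L \<Longrightarrow> linear_form P (\<lambda>x. f x a b)"
  shows "linear_form P (\<lambda>x. \<Sum>(a, b)\<leftarrow>L. f x a b)"
  using assms by (induction L) (auto simp: linear_form_def algebra_simps)

lemma linear_form_cong:
  assumes "kspace P" "\<And>x. x \<in> carrier P \<Longrightarrow> f x = g x"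
  shows "linear_form P f \<longleftrightarrow> linear_form P g"
  using assms by (auto simp: linear_form_def kspace_closed)

text \<open>Needed to nest tensors: the bilinearity of every \<open>\<beta> x\<close> keeps
  \<open>T\<close> away from its default value, where it is a finite sum over one list that does not
  depend on \<open>x\<close>.\<close>

lemma lf_tensor:
  assumes "kspace P" "T \<in> tensors M N"
    and bil: "\<And>x. x \<in> carrier P \<Longrightarrow> bilinear_form M N (\<beta> x)"
    and lin: "\<And>a b. a \<in> carrier M \<Longrightarrow> b \<in> carrier N \<Longrightarrow> linear_form P (\<lambda>x. \<beta> x a b)"
  shows "linear_form P (\<lambda>x. T (\<beta> x))"
proof -
  obtain L where L: "set L \<subseteq> carrier M \<times> carrier N" "T = tensor_sum M N L"
    using assms(2) by (auto simp: tensor_carrier)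
  have "linear_form P (\<lambda>x. \<Sum>(a, b)\<leftarrow>L. \<beta> x a b)"
    using L by (intro linear_form_sum_list assms) auto
  moreover have "\<And>x. x \<in> carrier P \<Longrightarrow> T (\<beta> x) = (\<Sum>(a, b)\<leftarrow>L. \<beta> x a b)"
    using bil L by (auto simp: tensor_sum_eval)
  ultimately show ?thesis
    using linear_form_cong[OF assms(1), of "\<lambda>x. T (\<beta> x)" "\<lambda>x. \<Sum>(a, b)\<leftarrow>L. \<beta> x a b"] by simp
qed

lemma tensor_add_form:
  assumes "T \<in> tensors M N" "bilinear_form M N \<beta>" "bilinear_form M N \<beta>'"
  shows "T (\<lambda>a b. \<beta> a b + \<beta>' a b) = T \<beta> + T \<beta>'"
proof -
  have "bilinear_form M N (\<lambda>a b. \<beta> a b + \<beta>' a b)"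
    using assms by (auto simp: bilinear_form_def intro: lf_plus)
  then show ?thesis using assms by (elim tensor_rep) (auto simp: sum_list_pair_add)
qed

lemma tensor_cmult_form:
  assumes "T \<in> tensors M N" "bilinear_form M N \<beta>"
  shows "T (\<lambda>a b. c * \<beta> a b) = c * T \<beta>"
proof -
  have "bilinear_form M N (\<lambda>a b. c * \<beta> a b)"
    using assms by (auto simp: bilinear_form_def intro: lf_mult_left)
  then show ?thesis using assms by (elim tensor_rep) (auto simp: sum_list_pair_cmult)
qed

lemma tensor_cmult_form2:
  assumes "T \<in> tensors M N" "bilinear_form M N \<beta>"
  shows "T (\<lambda>a b. \<beta> a b * c) = T \<beta> * c"
  using tensor_cmult_form[OF assms, of c] by (simp add: mult.commute)

text \<open>Fubini for two finite sums. Bilinearity in each pair of variables enters because a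
  tensor is such a sum only on bilinear forms.\<close>

lemma tensor_swap:
  assumes S: "S \<in> tensors M N" and T: "T \<in> tensors M' N'"
    and sp: "kspace M" "kspace N" "kspace M'" "kspace N'"
    and 1: "\<And>a b. a \<in> carrier M \<Longrightarrow> b \<in> carrier N \<Longrightarrow> bilinear_form M' N' (\<psi> a b)"
    and 2: "\<And>a b. a \<in> carrier M' \<Longrightarrow> b \<in> carrier N' \<Longrightarrow> bilinear_form M N (\<lambda>x y. \<psi> x y a b)"
  shows "S (\<lambda>a b. T (\<psi> a b)) = T (\<lambda>a' b'. S (\<lambda>a b. \<psi> a b a' b'))"
proof -
  from S obtain L where L: "set L \<subseteq> carrier M \<times> carrier N"
    "\<And>\<beta>. bilinear_form M N \<beta> \<Longrightarrow> S \<beta> = (\<Sum>(a, b)\<leftarrow>L. \<beta> a b)" by (elim tensor_rep) blast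
  from T obtain L' where L': "set L' \<subseteq> carrier M' \<times> carrier N'"
    "\<And>\<beta>. bilinear_form M' N' \<beta> \<Longrightarrow> T \<beta> = (\<Sum>(a, b)\<leftarrow>L'. \<beta> a b)" by (elim tensor_rep) blast
  have "bilinear_form M N (\<lambda>a b. T (\<psi> a b))"
    by (intro bilinear_formI lf_tensor[OF _ T] sp 1) (auto dest: bilinear_formD1[OF 2] bilinear_formD2[OF 2])
  then have "S (\<lambda>a b. T (\<psi> a b)) = (\<Sum>(a, b)\<leftarrow>L. T (\<psi> a b))" by (rule L(2))
  also have "\<dots> = (\<Sum>(a, b)\<leftarrow>L. \<Sum>(a', b')\<leftarrow>L'. \<psi> a b a' b')"
    using L(1) by (intro sum_list_pair_cong L'(2) 1) auto
  also have "\<dots> = (\<Sum>(a', b')\<leftarrow>L'. \<Sum>(a, b)\<leftarrow>L. \<psi> a b a' b')"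
    by (rule sum_list_pair_swap)
  also have "\<dots> = (\<Sum>(a', b')\<leftarrow>L'. S (\<lambda>a b. \<psi> a b a' b'))"
    using L'(1) by (intro sum_list_pair_cong L(2)[symmetric] 2) auto
  also have "\<dots> = T (\<lambda>a' b'. S (\<lambda>a b. \<psi> a b a' b'))"
    by (rule L'(2)[symmetric], intro bilinear_formI lf_tensor[OF _ S] sp 2) (auto dest: bilinear_formD1[OF 1] bilinear_formD2[OF 1])
  finally show ?thesis .
qed

section \<open>Separating families of linear forms\<close>

definition separating :: "('k::field, 'a, 'm) module_scheme \<Rightarrow> ('a \<Rightarrow> 'k) set \<Rightarrow> bool" where
  "separating M \<Lambda> \<longleftrightarrow> (\<forall>f\<in>\<Lambda>. linear_form M f)
     \<and> (\<forall>x\<in>carrier M. (\<forall>f\<in>\<Lambda>. f x = 0) \<longrightarrow> x = \<zero>\<^bsub>M\<^esub>)"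

lemma separatingD:
  assumes "separating M \<Lambda>" "kspace M" "x \<in> carrier M" "y \<in> carrier M"
    and "\<And>f. f \<in> \<Lambda> \<Longrightarrow> f x = f y"
  shows "x = y"
proof -
  interpret Module.module scalars M by fact
  have "x \<ominus>\<^bsub>M\<^esub> y = \<zero>\<^bsub>M\<^esub>"
    using assms unfolding separating_def by (simp add: linear_form_diff[OF assms(2)])
  then show ?thesis using assms by (metis M.minus_eq M.minus_equality M.minus_minus M.a_inv_closed M.a_comm)
qed

lemma separating_linear: "separating M \<Lambda> \<Longrightarrow> f \<in> \<Lambda> \<Longrightarrow> linear_form M f"
  by (simp add: separating_def)

definition tensor_forms :: "('a \<Rightarrow> 'k::field) set \<Rightarrow> ('b \<Rightarrow> 'k) set \<Rightarrow> (('k, 'a, 'b) tensor \<Rightarrow> 'k) set" where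
  "tensor_forms \<Lambda> \<Lambda>' = {\<lambda>T. T (\<lambda>a b. f a * g b) | f g. f \<in> \<Lambda> \<and> g \<in> \<Lambda>'}"

lemma foldr_linear:
  assumes "kspace P" "\<And>a b. (a, b) \<in> set L \<Longrightarrow> h a b \<in> carrier P"
  shows "foldr (\<lambda>(a, b) w. h a b \<oplus>\<^bsub>P\<^esub> w) L \<zero>\<^bsub>P\<^esub> \<in> carrier P
    \<and> (\<forall>f. linear_form P f \<longrightarrow> f (foldr (\<lambda>(a, b) w. h a b \<oplus>\<^bsub>P\<^esub> w) L \<zero>\<^bsub>P\<^esub>) = (\<Sum>(a, b)\<leftarrow>L. f (h a b)))"
  using assms by (induction L) (auto simp: kspace_closed linear_form_zero linear_form_add)

lemma tensor_list_separation:
  assumes "kspace M" "kspace N" "separating M \<Lambda>" "separating N \<Lambda>'"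
    and "set L \<subseteq> carrier M \<times> carrier N"
    and "\<And>f g. f \<in> \<Lambda> \<Longrightarrow> g \<in> \<Lambda>' \<Longrightarrow> (\<Sum>(a, b)\<leftarrow>L. f a * g b) = 0"
    and "bilinear_form M N \<beta>"
  shows "(\<Sum>(a, b)\<leftarrow>L. \<beta> a b) = 0"
  using assms(5-6)
proof (induction "length L" arbitrary: L)
  case 0
  then show ?case by simp
next
  case (Suc n)
  then obtain a b L' where L: "L = (a, b) # L'" by (cases L) auto
  from Suc L have car: "a \<in> carrier M" "b \<in> carrier N" "set L' \<subseteq> carrier M \<times> carrier N" by auto
  show ?case
  proof (cases "\<forall>g\<in>\<Lambda>'. g b = 0")
    case True
    then have b: "b = \<zero>\<^bsub>N\<^esub>" using assms(4) car by (auto simp: separating_def)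
    have "(\<Sum>(a, b)\<leftarrow>L'. f a * g b) = 0" if "f \<in> \<Lambda>" "g \<in> \<Lambda>'" for f g
      using Suc(4)[OF that] bspec[OF True that(2)] by (simp add: L)
    with Suc(1)[of L'] Suc(2) L car have "(\<Sum>(a, b)\<leftarrow>L'. \<beta> a b) = 0" by simp
    then show ?thesis
      using linear_form_zero[OF assms(2) bilinear_formD2[OF assms(7) car(1)]] by (simp add: L b)
  next
    case False
    then obtain g0 where g0: "g0 \<in> \<Lambda>'" "g0 b \<noteq> 0" by auto
    \<comment> \<open>Solving the relation given by \<open>f\<close> and \<open>g0\<close> for
      \<open>f a\<close> yields \<open>t y\<close> as the coefficient of \<open>f x\<close>, for
      each remaining pair \<open>(x, y)\<close>.\<close>
    define t where "t y = - (g0 y / g0 b)" for y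
    define s where "s = foldr (\<lambda>(x, y) w. t y \<odot>\<^bsub>M\<^esub> x \<oplus>\<^bsub>M\<^esub> w) L' \<zero>\<^bsub>M\<^esub>"
    have s: "s \<in> carrier M" "\<And>f. linear_form M f \<Longrightarrow> f s = (\<Sum>(x, y)\<leftarrow>L'. f (t y \<odot>\<^bsub>M\<^esub> x))"
      using foldr_linear[of M L' "\<lambda>x y. t y \<odot>\<^bsub>M\<^esub> x", OF assms(1)] car kspace_closed(1)[OF assms(1)]
      unfolding s_def by blast+
    have s': "f s = (\<Sum>(x, y)\<leftarrow>L'. t y * f x)" if "linear_form M f" for f
      using car that unfolding s(2)[OF that] by (intro sum_list_pair_cong) (auto simp: linear_form_smult)
    have "a = s"
    proof (rule separatingD[OF assms(3,1) car(1) s(1)])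
      fix f assume f: "f \<in> \<Lambda>"
      have "f a * g0 b = - (\<Sum>(x, y)\<leftarrow>L'. f x * g0 y)"
        using Suc(4)[OF f g0(1)] by (simp add: L eq_neg_iff_add_eq_0)
      also have "\<dots> = (\<Sum>(x, y)\<leftarrow>L'. g0 b * (t y * f x))"
        using g0 by (induction L') (auto simp: t_def field_simps)
      also have "\<dots> = g0 b * f s"
        using f by (subst s') (auto simp: separating_linear[OF assms(3)] sum_list_pair_cmult)
      finally show "f a = f s" using g0 by simp
    qed
    \<comment> \<open>With \<open>a\<close> replaced by the combination \<open>s\<close>, the tensor
      of \<open>a\<close> and \<open>b\<close> is distributed over the remaining pairs: each second
      leg absorbs a multiple of \<open>b\<close>.\<close>
    define L2 where "L2 = map (\<lambda>(x, y). (x, y \<oplus>\<^bsub>N\<^esub> t y \<odot>\<^bsub>N\<^esub> b)) L'"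
    have L2: "(\<Sum>(x, y)\<leftarrow>L2. \<gamma> x y) = (\<Sum>(x, y)\<leftarrow>L. \<gamma> x y)" if \<gamma>: "bilinear_form M N \<gamma>" for \<gamma>
    proof -
      have "(\<Sum>(x, y)\<leftarrow>L2. \<gamma> x y) = (\<Sum>(x, y)\<leftarrow>L'. \<gamma> x (y \<oplus>\<^bsub>N\<^esub> t y \<odot>\<^bsub>N\<^esub> b))"
        by (simp add: L2_def split_def o_def)
      also have "\<dots> = (\<Sum>(x, y)\<leftarrow>L'. \<gamma> x y + t y * \<gamma> x b)"
        using car assms(2)
        by (intro sum_list_pair_cong)
          (auto simp: linear_form_add[OF bilinear_formD2[OF \<gamma>]] linear_form_smult[OF bilinear_formD2[OF \<gamma>]] kspace_closed)
      also have "\<dots> = (\<Sum>(x, y)\<leftarrow>L'. \<gamma> x y) + \<gamma> s b"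
        using s'[OF bilinear_formD1[OF \<gamma> car(2)]] by (simp add: sum_list_pair_add)
      finally show ?thesis using \<open>a = s\<close> by (simp add: L)
    qed
    have "(\<Sum>(x, y)\<leftarrow>L2. \<beta> x y) = 0"
    proof (rule Suc(1))
      show "n = length L2" using Suc(2) by (simp add: L L2_def)
      show "set L2 \<subseteq> carrier M \<times> carrier N"
        using car assms(2) by (auto simp: L2_def kspace_closed)
      show "(\<Sum>(a, b)\<leftarrow>L2. f a * g b) = 0" if "f \<in> \<Lambda>" "g \<in> \<Lambda>'" for f g
        using that Suc(4) assms(3,4) by (subst L2) (auto intro!: bilinear_mult separating_linear)
    qed
    with L2[OF assms(7)] show ?thesis by simp
  qed
qed

text \<open>A tensor is zero as soon as it vanishes on bilinear forms, and by
  \<open>tensor_list_separation\<close> products of test forms already decide this.\<close>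

lemma separating_tensor:
  assumes "kspace M" "kspace N" "separating M \<Lambda>" "separating N \<Lambda>'"
  shows "separating (tensor_product M N) (tensor_forms \<Lambda> \<Lambda>')"
  unfolding separating_def
proof (intro conjI ballI impI)
  fix F assume "F \<in> tensor_forms \<Lambda> \<Lambda>'"
  then show "linear_form (tensor_product M N) F" by (auto simp: tensor_forms_def lf_tensor_eval)
next
  fix T assume T: "T \<in> tensors M N" and 0: "\<forall>F\<in>tensor_forms \<Lambda> \<Lambda>'. F T = 0"
  from T obtain L where L: "set L \<subseteq> carrier M \<times> carrier N"
    "\<And>\<beta>. bilinear_form M N \<beta> \<Longrightarrow> T \<beta> = (\<Sum>(a, b)\<leftarrow>L. \<beta> a b)" by (elim tensor_rep) blast
  have *: "(\<Sum>(a, b)\<leftarrow>L. f a * g b) = 0" if "f \<in> \<Lambda>" "g \<in> \<Lambda>'" for f g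
  proof -
    have "T (\<lambda>a b. f a * g b) = 0" using 0 that by (auto simp: tensor_forms_def)
    then show ?thesis using that assms by (subst (asm) L(2)) (auto intro!: bilinear_mult separating_linear)
  qed
  show "T = \<zero>\<^bsub>tensor_product M N\<^esub>"
  proof (rule tensor_eqI[OF T])
    show "\<zero>\<^bsub>tensor_product M N\<^esub> \<in> tensors M N"
      using kspace_tensor_product[OF assms(1,2)] by (rule kspace_closed)
    show "T \<beta> = \<zero>\<^bsub>tensor_product M N\<^esub> \<beta>" if "bilinear_form M N \<beta>" for \<beta>
      using tensor_list_separation[OF assms L(1) * that] L(2)[OF that] by simp
  qed
qed

text \<open>The image under \<open>f\<close> of the vector computed from a list representing
  \<open>T\<close> is the value of \<open>T\<close> at \<open>\<lambda>a b. f (h a b)\<close>, which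
  does not mention the list. As the forms in \<open>\<Lambda>\<close> separate, the vector is unique
  and the definite description is legitimate.\<close>

lemma tensor_lift:
  assumes "kspace P" "separating P \<Lambda>" "T \<in> tensors M N"
    and "\<And>a b. a \<in> carrier M \<Longrightarrow> b \<in> carrier N \<Longrightarrow> h a b \<in> carrier P"
    and "\<And>f. f \<in> \<Lambda> \<Longrightarrow> bilinear_form M N (\<lambda>a b. f (h a b))"
  shows "tensor_lift M N P h T \<in> carrier P"
    and "f \<in> \<Lambda> \<Longrightarrow> f (tensor_lift M N P h T) = T (\<lambda>a b. f (h a b))"
proof -
  let ?v = "\<lambda>L. foldr (\<lambda>(a, b) w. h a b \<oplus>\<^bsub>P\<^esub> w) L \<zero>\<^bsub>P\<^esub>"
  have v: "?v L \<in> carrier P \<and> (\<forall>f\<in>\<Lambda>. f (?v L) = T (\<lambda>a b. f (h a b)))"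
    if "set L \<subseteq> carrier M \<times> carrier N" "T = tensor_sum M N L" for L
  proof -
    have "?v L \<in> carrier P \<and> (\<forall>f. linear_form P f \<longrightarrow> f (?v L) = (\<Sum>(a, b)\<leftarrow>L. f (h a b)))"
      using that assms(4) by (intro foldr_linear assms(1)) auto
    with that assms(5) show ?thesis
      by (auto simp: tensor_sum_eval separating_linear[OF assms(2)])
  qed
  obtain L where L: "set L \<subseteq> carrier M \<times> carrier N" "T = tensor_sum M N L"
    using assms(3) by (auto simp: tensor_carrier)
  have "tensor_lift M N P h T = ?v L"
    unfolding tensor_lift_def
  proof (rule the_equality)
    show "\<exists>K. set K \<subseteq> carrier M \<times> carrier N \<and> T = tensor_sum M N K \<and> ?v L = ?v K"
      using L by blast
    fix w assume "\<exists>K. set K \<subseteq> carrier M \<times> carrier N \<and> T = tensor_sum M N K \<and> w = ?v K"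
    then obtain K where K: "set K \<subseteq> carrier M \<times> carrier N" "T = tensor_sum M N K" "w = ?v K" by auto
    show "w = ?v L"
      using v[OF K(1,2)] v[OF L] K(3) by (intro separatingD[OF assms(2,1)]) auto
  qed
  with v[OF L] show "tensor_lift M N P h T \<in> carrier P"
    and "f \<in> \<Lambda> \<Longrightarrow> f (tensor_lift M N P h T) = T (\<lambda>a b. f (h a b))" by auto
qed

lemma bilinear_form_cong:
  assumes "kspace M" "kspace N" "\<And>a b. a \<in> carrier M \<Longrightarrow> b \<in> carrier N \<Longrightarrow> \<beta> a b = \<beta>' a b"
  shows "bilinear_form M N \<beta> \<longleftrightarrow> bilinear_form M N \<beta>'"
  using assms by (auto simp: bilinear_form_def linear_form_def kspace_closed)

text \<open>Names the test form by an expression \<open>\<beta> f\<close> that agrees with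
  \<open>f (h a b)\<close> on the carriers only, as happens when the two are related by the laws of
  an algebra.\<close>

lemma tensor_lift_test:
  assumes "kspace M" "kspace N" "kspace P" "separating P \<Lambda>" "T \<in> tensors M N"
    and "\<And>a b. a \<in> carrier M \<Longrightarrow> b \<in> carrier N \<Longrightarrow> h a b \<in> carrier P"
    and test: "\<And>f. f \<in> \<Lambda> \<Longrightarrow> bilinear_form M N (\<beta> f)"
    "\<And>f a b. f \<in> \<Lambda> \<Longrightarrow> a \<in> carrier M \<Longrightarrow> b \<in> carrier N \<Longrightarrow> f (h a b) = \<beta> f a b"
  shows "tensor_lift M N P h T \<in> carrier P"
    and "f \<in> \<Lambda> \<Longrightarrow> f (tensor_lift M N P h T) = T (\<beta> f)"
proof -
  have bil: "bilinear_form M N (\<lambda>a b. f (h a b))" if "f \<in> \<Lambda>" for f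
    using test(1)[OF that] test(2)[OF that] bilinear_form_cong[OF assms(1,2), of "\<lambda>a b. f (h a b)" "\<beta> f"] by simp
  note l = tensor_lift[where h = h, OF assms(3-5)]
  show "tensor_lift M N P h T \<in> carrier P" by (rule l(1)) (use assms(6) bil in auto)
  show "f (tensor_lift M N P h T) = T (\<beta> f)" if f: "f \<in> \<Lambda>"
  proof -
    have "f (tensor_lift M N P h T) = T (\<lambda>a b. f (h a b))"
      by (rule l(2)) (use assms(6) bil f in auto)
    also have "\<dots> = T (\<beta> f)"
      by (rule tensor_cong[OF assms(1,2,5)]) (rule test(2)[OF f])
    finally show ?thesis .
  qed
qed

lemma tensor_lift_eqI:
  assumes "kspace M" "kspace N" "kspace P" "separating P \<Lambda>" "T \<in> tensors M N"
    and "\<And>a b. a \<in> carrier M \<Longrightarrow> b \<in> carrier N \<Longrightarrow> h a b \<in> carrier P"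
    and "\<And>f. f \<in> \<Lambda> \<Longrightarrow> bilinear_form M N (\<beta> f)"
    and "\<And>f a b. f \<in> \<Lambda> \<Longrightarrow> a \<in> carrier M \<Longrightarrow> b \<in> carrier N \<Longrightarrow> f (h a b) = \<beta> f a b"
    and "v \<in> carrier P" "\<And>f. f \<in> \<Lambda> \<Longrightarrow> T (\<beta> f) = f v"
  shows "tensor_lift M N P h T = v"
proof (rule separatingD[OF assms(4,3) _ assms(9)])
  note l = tensor_lift_test[where h = h and \<beta> = \<beta>, OF assms(1-5)]
  show "tensor_lift M N P h T \<in> carrier P" by (rule l(1)) (use assms in auto)
  show "f (tensor_lift M N P h T) = f v" if "f \<in> \<Lambda>" for f
    using assms(10)[OF that] by (subst l(2)) (use assms that in auto)
qed

lemma pure_tensor_eval: "bilinear_form M N \<beta> \<Longrightarrow> pure_tensor M N a b \<beta> = \<beta> a b"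
  by (simp add: pure_tensor_def)

section \<open>The product of the tensor product of two algebras\<close>

lemma assoc_algebraD: "assoc_algebra M \<Longrightarrow> kspace M" "assoc_algebra M \<Longrightarrow> ring M"
  by (auto simp: assoc_algebra_def)

lemma algebra_closed:
  fixes M (structure)
  assumes "assoc_algebra M"
  shows "x \<in> carrier M \<Longrightarrow> y \<in> carrier M \<Longrightarrow> x \<otimes> y \<in> carrier M" and "\<one> \<in> carrier M"
proof -
  interpret ring M using assms by (rule assoc_algebraD)
  show "x \<in> carrier M \<Longrightarrow> y \<in> carrier M \<Longrightarrow> x \<otimes> y \<in> carrier M" and "\<one> \<in> carrier M" by auto
qed

lemma lin_map_mult:
  fixes M (structure)
  assumes "assoc_algebra M" "y \<in> carrier M"
  shows "lin_map M M (\<lambda>x. x \<otimes> y)" "lin_map M M (\<lambda>x. y \<otimes> x)"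
proof -
  interpret ring M using assms by (auto simp: assoc_algebraD)
  show "lin_map M M (\<lambda>x. x \<otimes> y)" "lin_map M M (\<lambda>x. y \<otimes> x)"
    using assms by (auto intro!: lin_mapI simp: l_distr r_distr assoc_algebra_def)
qed

lemma sum_list_product:
  "(\<Sum>(x, y)\<leftarrow>concat (map (\<lambda>(a, b). map (\<lambda>(a', b'). (f a a', g b b')) L') L). \<gamma> x y)
    = (\<Sum>(a, b)\<leftarrow>L. \<Sum>(a', b')\<leftarrow>L'. \<gamma> (f a a') (g b b') :: 'k::semiring_0)"
  by (induction L) (auto simp: split_def o_def)

lemma bilinear_product_form:
  assumes "assoc_algebra M" "assoc_algebra N" "bilinear_form M N \<beta>" "a \<in> carrier M" "b \<in> carrier N"
  shows "bilinear_form M N (\<lambda>a' b'. \<beta> (a \<otimes>\<^bsub>M\<^esub> a') (b \<otimes>\<^bsub>N\<^esub> b'))"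
    and "bilinear_form M N (\<lambda>a' b'. \<beta> (a' \<otimes>\<^bsub>M\<^esub> a) (b' \<otimes>\<^bsub>N\<^esub> b))"
proof -
  note 1 = lf_comp[OF lin_map_mult(2)[OF assms(1,4)] bilinear_formD1[OF assms(3)]]
    and 2 = lf_comp[OF lin_map_mult(2)[OF assms(2,5)] bilinear_formD2[OF assms(3)]]
    and 3 = lf_comp[OF lin_map_mult(1)[OF assms(1,4)] bilinear_formD1[OF assms(3)]]
    and 4 = lf_comp[OF lin_map_mult(1)[OF assms(2,5)] bilinear_formD2[OF assms(3)]]
  show "bilinear_form M N (\<lambda>a' b'. \<beta> (a \<otimes>\<^bsub>M\<^esub> a') (b \<otimes>\<^bsub>N\<^esub> b'))"
    by (rule bilinear_formI[OF 1 2]) (simp_all add: algebra_closed assms)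
  show "bilinear_form M N (\<lambda>a' b'. \<beta> (a' \<otimes>\<^bsub>M\<^esub> a) (b' \<otimes>\<^bsub>N\<^esub> b))"
    by (rule bilinear_formI[OF 3 4]) (simp_all add: algebra_closed assms)
qed

lemma bilinear_tensor_product_form:
  assumes "assoc_algebra M" "assoc_algebra N" "T \<in> tensors M N" "bilinear_form M N \<beta>"
  shows "bilinear_form M N (\<lambda>a b. T (\<lambda>a' b'. \<beta> (a \<otimes>\<^bsub>M\<^esub> a') (b \<otimes>\<^bsub>N\<^esub> b')))"
proof -
  note sp = assoc_algebraD(1)[OF assms(1)] assoc_algebraD(1)[OF assms(2)]
  note 1 = bilinear_product_form(1)[OF assms(1,2,4)] and 2 = bilinear_product_form(2)[OF assms(1,2,4)]
  show ?thesis
    by (intro bilinear_formI lf_tensor[OF _ assms(3)] sp 1) (auto dest: bilinear_formD1[OF 2] bilinear_formD2[OF 2])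
qed

text \<open>The list \<open>?K\<close> of all pairwise products represents the product of the two
  finite sums.\<close>

lemma tensor_mult_closed:
  assumes "assoc_algebra M" "assoc_algebra N"
    and S: "S \<in> tensors M N" and T: "T \<in> tensors M N"
  shows "S \<otimes>\<^bsub>tensor_product M N\<^esub> T \<in> tensors M N"
proof -
  from S obtain L where L: "set L \<subseteq> carrier M \<times> carrier N"
    "\<And>\<beta>. bilinear_form M N \<beta> \<Longrightarrow> S \<beta> = (\<Sum>(a, b)\<leftarrow>L. \<beta> a b)" by (elim tensor_rep) blast
  from T obtain L' where L': "set L' \<subseteq> carrier M \<times> carrier N"
    "\<And>\<beta>. bilinear_form M N \<beta> \<Longrightarrow> T \<beta> = (\<Sum>(a, b)\<leftarrow>L'. \<beta> a b)" by (elim tensor_rep) blast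
  let ?K = "concat (map (\<lambda>(a, b). map (\<lambda>(a', b'). (a \<otimes>\<^bsub>M\<^esub> a', b \<otimes>\<^bsub>N\<^esub> b')) L') L)"
  have "S \<otimes>\<^bsub>tensor_product M N\<^esub> T = tensor_sum M N ?K"
  proof (rule ext)
    fix \<beta>
    show "(S \<otimes>\<^bsub>tensor_product M N\<^esub> T) \<beta> = tensor_sum M N ?K \<beta>"
    proof (cases "bilinear_form M N \<beta>")
      case True
      have "S (\<lambda>a b. T (\<lambda>a' b'. \<beta> (a \<otimes>\<^bsub>M\<^esub> a') (b \<otimes>\<^bsub>N\<^esub> b')))
        = (\<Sum>(a, b)\<leftarrow>L. T (\<lambda>a' b'. \<beta> (a \<otimes>\<^bsub>M\<^esub> a') (b \<otimes>\<^bsub>N\<^esub> b')))"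
        by (rule L(2)[OF bilinear_tensor_product_form[OF assms(1,2) T True]])
      also have "\<dots> = (\<Sum>(a, b)\<leftarrow>L. \<Sum>(a', b')\<leftarrow>L'. \<beta> (a \<otimes>\<^bsub>M\<^esub> a') (b \<otimes>\<^bsub>N\<^esub> b'))"
        using L(1) by (intro sum_list_pair_cong L'(2) bilinear_product_form(1)[OF assms(1,2) True]) auto
      also have "\<dots> = tensor_sum M N ?K \<beta>"
        using True by (simp add: tensor_sum_eval sum_list_product)
      finally show ?thesis using True by (simp add: tensor_product_def)
    qed (simp add: tensor_product_def tensor_sum_eval)
  qed
  moreover have "set ?K \<subseteq> carrier M \<times> carrier N"
    using L(1) L'(1) by (fastforce simp: algebra_closed[OF assms(1)] algebra_closed[OF assms(2)])
  ultimately show ?thesis unfolding tensor_carrier by blast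
qed

lemma tensor_mult_eval:
  assumes "bilinear_form M N \<beta>"
  shows "(S \<otimes>\<^bsub>tensor_product M N\<^esub> T) \<beta> = S (\<lambda>a b. T (\<lambda>a' b'. \<beta> (a \<otimes>\<^bsub>M\<^esub> a') (b \<otimes>\<^bsub>N\<^esub> b')))"
  using assms by (simp add: tensor_product_def)

section \<open>Hopf algebras of functions and their duals\<close>

lemma kspace_HHH: "kspace H \<Longrightarrow> kspace (tensor_product H (tensor_product H H))"
  by (intro kspace_tensor_product)

text \<open>Reduces coassociativity, an equation between two iterated lifts in a threefold tensor
  product, to scalars: the products \<open>t f g h\<close> of three forms from
  \<open>\<Lambda>\<close> separate that space, and on them each lift becomes a nested application
  of coproducts. \<open>I\<close> and \<open>J\<close> are the two iterated maps of the
  axiom.\<close>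

lemma hopf_coassoc_forms:
  assumes sp: "kspace H" and x: "x \<in> carrier H"
    and cc: "\<And>a. a \<in> carrier H \<Longrightarrow> comult H a \<in> tensors H H"
    and cl: "lin_map H (tensor_product H H) (comult H)"
    and sep: "separating H \<Lambda>"
  defines "t \<equiv> \<lambda>f g h a T. f a * T (\<lambda>b c. g b * h c)"
  defines "p3 \<equiv> \<lambda>a1 a2 b. pure_tensor H (tensor_product H H) a1 (pure_tensor H H a2 b)"
  defines "HHH \<equiv> tensor_product H (tensor_product H H)"
  defines "I \<equiv> \<lambda>a b. tensor_lift H H HHH
                 (\<lambda>a1 a2. p3 a1 a2 b) (comult H a)"
  defines "J \<equiv> \<lambda>a b. pure_tensor H (tensor_product H H) a (comult H b)"
  shows "tensor_lift H H HHH I (comult H x) \<in> carrier HHH"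
    and "tensor_lift H H HHH J (comult H x) \<in> carrier HHH"
    and "f \<in> \<Lambda> \<Longrightarrow> g \<in> \<Lambda> \<Longrightarrow> h \<in> \<Lambda> \<Longrightarrow>
      tensor_lift H H HHH I (comult H x) (t f g h)
        = comult H x (\<lambda>a b. comult H a (\<lambda>a1 a2. f a1 * g a2) * h b)"
    and "f \<in> \<Lambda> \<Longrightarrow> g \<in> \<Lambda> \<Longrightarrow> h \<in> \<Lambda> \<Longrightarrow>
      tensor_lift H H HHH J (comult H x) (t f g h)
        = comult H x (\<lambda>a b. f a * comult H b (\<lambda>b1 b2. g b1 * h b2))"
proof -
  define \<Lambda>3 where "\<Lambda>3 = tensor_forms \<Lambda> (tensor_forms \<Lambda> \<Lambda>)"
  have spH: "kspace HHH" and sp2: "kspace (tensor_product H H)"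
    using sp by (simp_all add: HHH_def kspace_tensor_product)
  have sep3: "separating HHH \<Lambda>3"
    unfolding HHH_def \<Lambda>3_def using sp sep by (intro separating_tensor kspace_tensor_product)
  have lf: "linear_form H f" if "f \<in> \<Lambda>" for f using sep that by (rule separating_linear)
  have lfc: "linear_form H (\<lambda>a. comult H a \<beta>)" for \<beta>
    by (rule lf_comp[OF cl lf_tensor_eval])
  have bil3: "bilinear_form H (tensor_product H H) (t f g h)" if "f \<in> \<Lambda>" for f g h
    unfolding t_def by (intro bilinear_mult lf that lf_tensor_eval)
  have ev3: "\<exists>f\<in>\<Lambda>. \<exists>g\<in>\<Lambda>. \<exists>h\<in>\<Lambda>. F = (\<lambda>T. T (t f g h))" if "F \<in> \<Lambda>3" for F
    using that by (auto simp: \<Lambda>3_def tensor_forms_def t_def)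
  have mem3: "(\<lambda>T. T (t f g h)) \<in> \<Lambda>3" if "f \<in> \<Lambda>" "g \<in> \<Lambda>" "h \<in> \<Lambda>" for f g h
    unfolding \<Lambda>3_def tensor_forms_def t_def
    by (rule CollectI, rule exI[of _ f], rule exI[of _ "\<lambda>T. T (\<lambda>b c. g b * h c)"]) (use that in blast)
  have pureI: "p3 a1 a2 b (t f g h)
      = f a1 * (g a2 * h b)" if "f \<in> \<Lambda>" "g \<in> \<Lambda>" "h \<in> \<Lambda>" for f g h a1 a2 b
    using that by (simp add: p3_def pure_tensor_eval bil3) (simp add: t_def pure_tensor_eval bilinear_mult lf)
  have Jev: "J a b (t f g h) = f a * comult H b (\<lambda>b1 b2. g b1 * h b2)"
    if "f \<in> \<Lambda>" for f g h a b
    unfolding J_def using that by (simp add: pure_tensor_eval bil3) (simp add: t_def)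
  have pc: "p3 a1 a2 b \<in> carrier HHH"
    if "a1 \<in> carrier H" "a2 \<in> carrier H" "b \<in> carrier H" for a1 a2 b
    using that by (simp add: HHH_def p3_def pure_tensor_closed)
  have bI: "bilinear_form H H (\<lambda>a1 a2. F (p3 a1 a2 b))"
    if F: "F \<in> \<Lambda>3" for F b
  proof -
    obtain f g h where *: "f \<in> \<Lambda>" "g \<in> \<Lambda>" "h \<in> \<Lambda>" "F = (\<lambda>T. T (t f g h))"
      using ev3[OF F] by blast
    show ?thesis unfolding *(4) pureI[OF *(1-3)]
      by (intro bilinear_mult lf_mult_right lf *)
  qed
  have I: "I a b \<in> carrier HHH" "\<And>F. F \<in> \<Lambda>3 \<Longrightarrow> F (I a b) =
      comult H a (\<lambda>a1 a2. F (p3 a1 a2 b))"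
    if ab: "a \<in> carrier H" "b \<in> carrier H" for a b
  proof -
    note l = tensor_lift[where h = "\<lambda>a1 a2. p3 a1 a2 b", OF spH sep3 cc[OF ab(1)]]
    show "I a b \<in> carrier HHH" unfolding I_def by (rule l(1)) (use pc bI ab in auto)
    show "F (I a b) = comult H a (\<lambda>a1 a2. F (p3 a1 a2 b))"
      if "F \<in> \<Lambda>3" for F
      unfolding I_def by (rule l(2)) (use pc bI ab that in auto)
  qed
  have Iev: "I a b (t f g h) = comult H a (\<lambda>a1 a2. f a1 * g a2) * h b"
    if "f \<in> \<Lambda>" "g \<in> \<Lambda>" "h \<in> \<Lambda>" "a \<in> carrier H" "b \<in> carrier H" for f g h a b
  proof -
    have "I a b (t f g h) = comult H a (\<lambda>a1 a2. f a1 * g a2 * h b)"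
      using I(2)[OF that(4,5) mem3[OF that(1-3)]] by (simp add: pureI that mult.assoc)
    also have "\<dots> = comult H a (\<lambda>a1 a2. f a1 * g a2) * h b"
      by (rule tensor_cmult_form2[OF cc]) (auto intro!: bilinear_mult lf that)
    finally show ?thesis .
  qed
  have bI2: "bilinear_form H H (\<lambda>a b. F (I a b))" if F: "F \<in> \<Lambda>3" for F
  proof -
    obtain f g h where *: "f \<in> \<Lambda>" "g \<in> \<Lambda>" "h \<in> \<Lambda>" "F = (\<lambda>T. T (t f g h))"
      using ev3[OF F] by blast
    have "bilinear_form H H (\<lambda>a b. comult H a (\<lambda>a1 a2. f a1 * g a2) * h b)"
      by (intro bilinear_mult lfc lf *)
    then show ?thesis unfolding *(4)
      using bilinear_form_cong[OF sp sp, of "\<lambda>a b. I a b (t f g h)"] Iev[OF *(1-3)] by simp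
  qed
  note lI = tensor_lift[where h = I, OF spH sep3 cc[OF x]]
  show "tensor_lift H H HHH I (comult H x) \<in> carrier HHH" by (rule lI(1)) (use I bI2 in auto)
  show "tensor_lift H H HHH I (comult H x) (t f g h)
        = comult H x (\<lambda>a b. comult H a (\<lambda>a1 a2. f a1 * g a2) * h b)"
    if fgh: "f \<in> \<Lambda>" "g \<in> \<Lambda>" "h \<in> \<Lambda>"
  proof -
    have "tensor_lift H H HHH I (comult H x) (t f g h)
      = comult H x (\<lambda>a b. I a b (t f g h))"
      by (rule lI(2)[OF _ _ mem3[OF fgh]]) (use I bI2 in auto)
    also have "\<dots> = comult H x (\<lambda>a b. comult H a (\<lambda>a1 a2. f a1 * g a2) * h b)"
      by (rule tensor_cong[OF sp sp cc[OF x]]) (rule Iev[OF fgh])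
    finally show ?thesis .
  qed
  have Jc: "J a b \<in> carrier HHH" if "a \<in> carrier H" "b \<in> carrier H" for a b
    using that by (simp add: J_def HHH_def pure_tensor_closed cc)
  have bJ: "bilinear_form H H (\<lambda>a b. F (J a b))" if F: "F \<in> \<Lambda>3" for F
  proof -
    obtain f g h where *: "f \<in> \<Lambda>" "g \<in> \<Lambda>" "h \<in> \<Lambda>" "F = (\<lambda>T. T (t f g h))"
      using ev3[OF F] by blast
    show ?thesis unfolding *(4) Jev[OF *(1)]
      by (intro bilinear_mult lfc lf *)
  qed
  note lJ = tensor_lift[where h = J, OF spH sep3 cc[OF x]]
  show "tensor_lift H H HHH J (comult H x) \<in> carrier HHH" by (rule lJ(1)) (use Jc bJ in auto)
  show "tensor_lift H H HHH J (comult H x) (t f g h)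
        = comult H x (\<lambda>a b. f a * comult H b (\<lambda>b1 b2. g b1 * h b2))"
    if fgh: "f \<in> \<Lambda>" "g \<in> \<Lambda>" "h \<in> \<Lambda>"
  proof -
    have "tensor_lift H H HHH J (comult H x) (t f g h)
      = comult H x (\<lambda>a b. J a b (t f g h))"
      by (rule lJ(2)[OF _ _ mem3[OF fgh]]) (use Jc bJ in auto)
    then show ?thesis by (simp add: Jev[OF fgh(1)])
  qed
qed

text \<open>
  For a function algebra \<open>\<Lambda>\<close> consists of evaluations at points, for a dual of evaluations
  at the elements of the predual.
\<close>

lemma hopf_algebraI:
  fixes H :: "('k::field, 'a, 'm) hopf_scheme" (structure)
  assumes alg: "assoc_algebra H" and sep: "separating H \<Lambda>"
    and cc: "\<And>x. x \<in> carrier H \<Longrightarrow> comult H x \<in> tensors H H"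
    and comult_add: "\<And>f g x y. f \<in> \<Lambda> \<Longrightarrow> g \<in> \<Lambda> \<Longrightarrow> x \<in> carrier H \<Longrightarrow> y \<in> carrier H \<Longrightarrow>
      comult H (x \<oplus> y) (\<lambda>a b. f a * g b) = comult H x (\<lambda>a b. f a * g b) + comult H y (\<lambda>a b. f a * g b)"
    and comult_smult: "\<And>f g c x. f \<in> \<Lambda> \<Longrightarrow> g \<in> \<Lambda> \<Longrightarrow> x \<in> carrier H \<Longrightarrow>
      comult H (c \<odot> x) (\<lambda>a b. f a * g b) = c * comult H x (\<lambda>a b. f a * g b)"
    and comult_mult: "\<And>f g x y. f \<in> \<Lambda> \<Longrightarrow> g \<in> \<Lambda> \<Longrightarrow> x \<in> carrier H \<Longrightarrow> y \<in> carrier H \<Longrightarrow>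
      comult H (x \<otimes> y) (\<lambda>a b. f a * g b)
        = comult H x (\<lambda>a b. comult H y (\<lambda>a' b'. f (a \<otimes> a') * g (b \<otimes> b')))"
    and comult_one: "\<And>f g. f \<in> \<Lambda> \<Longrightarrow> g \<in> \<Lambda> \<Longrightarrow> comult H \<one> (\<lambda>a b. f a * g b) = f \<one> * g \<one>"
    and counit_hom: "counit H \<in> ring_hom H scalars" "linear_form H (counit H)"
    and antipode_closed: "\<And>x. x \<in> carrier H \<Longrightarrow> antipode H x \<in> carrier H"
    and antipode_add: "\<And>f x y. f \<in> \<Lambda> \<Longrightarrow> x \<in> carrier H \<Longrightarrow> y \<in> carrier H \<Longrightarrow>
      f (antipode H (x \<oplus> y)) = f (antipode H x) + f (antipode H y)"
    and antipode_smult: "\<And>f c x. f \<in> \<Lambda> \<Longrightarrow> x \<in> carrier H \<Longrightarrow> f (antipode H (c \<odot> x)) = c * f (antipode H x)"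
    and coassoc: "\<And>f g h x. f \<in> \<Lambda> \<Longrightarrow> g \<in> \<Lambda> \<Longrightarrow> h \<in> \<Lambda> \<Longrightarrow> x \<in> carrier H \<Longrightarrow>
      comult H x (\<lambda>a b. comult H a (\<lambda>a1 a2. f a1 * g a2) * h b)
        = comult H x (\<lambda>a b. f a * comult H b (\<lambda>b1 b2. g b1 * h b2))"
    and counit: "\<And>f x. f \<in> \<Lambda> \<Longrightarrow> x \<in> carrier H \<Longrightarrow> comult H x (\<lambda>a b. counit H a * f b) = f x"
      "\<And>f x. f \<in> \<Lambda> \<Longrightarrow> x \<in> carrier H \<Longrightarrow> comult H x (\<lambda>a b. counit H b * f a) = f x"
    and antipode: "\<And>f x. f \<in> \<Lambda> \<Longrightarrow> x \<in> carrier H \<Longrightarrow>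
        comult H x (\<lambda>a b. f (antipode H a \<otimes> b)) = counit H x * f \<one>"
      "\<And>f x. f \<in> \<Lambda> \<Longrightarrow> x \<in> carrier H \<Longrightarrow> comult H x (\<lambda>a b. f (a \<otimes> antipode H b)) = counit H x * f \<one>"
  shows "hopf_algebra H"
proof -
  have sp: "kspace H" using alg by (rule assoc_algebraD)
  have sp2: "kspace (tensor_product H H)" using sp by (simp add: kspace_tensor_product)
  have sep2: "separating (tensor_product H H) (tensor_forms \<Lambda> \<Lambda>)"
    using sp sep by (intro separating_tensor)
  have lf: "linear_form H f" if "f \<in> \<Lambda>" for f using sep that by (rule separating_linear)
  have eq2: "S = T" if "S \<in> tensors H H" "T \<in> tensors H H"
    "\<And>f g. f \<in> \<Lambda> \<Longrightarrow> g \<in> \<Lambda> \<Longrightarrow> S (\<lambda>a b. f a * g b) = T (\<lambda>a b. f a * g b)" for S T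
    using that by (intro separatingD[OF sep2 sp2]) (auto simp: tensor_forms_def)
  have cl: "lin_map H (tensor_product H H) (comult H)"
  proof (rule lin_mapI)
    fix x y assume "x \<in> carrier H" "y \<in> carrier H"
    then show "comult H (x \<oplus> y) = comult H x \<oplus>\<^bsub>tensor_product H H\<^esub> comult H y"
      by (intro eq2) (simp_all add: cc kspace_closed[OF sp] kspace_closed[OF sp2] comult_add
        del: tensor_product_simps(2), simp add: comult_add)
  next
    fix c x assume "x \<in> carrier H"
    then show "comult H (c \<odot> x) = c \<odot>\<^bsub>tensor_product H H\<^esub> comult H x"
      by (intro eq2) (simp_all add: cc kspace_closed[OF sp] kspace_closed[OF sp2] comult_smult
        del: tensor_product_simps(3), simp add: comult_smult)
  qed (rule cc)
  have al: "lin_map H H (antipode H)"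
    by (rule lin_mapI; (rule separatingD[OF sep sp])?)
      (simp_all add: antipode_closed kspace_closed[OF sp] antipode_add antipode_smult
        linear_form_add[OF lf] linear_form_smult[OF lf])
  have ring: "comult H \<in> ring_hom H (tensor_product H H)"
  proof (rule ring_hom_memI)
    fix x y assume xy: "x \<in> carrier H" "y \<in> carrier H"
    show "comult H (x \<otimes> y) = comult H x \<otimes>\<^bsub>tensor_product H H\<^esub> comult H y"
      using xy by (intro eq2)
        (simp_all add: cc algebra_closed[OF alg] tensor_mult_closed[OF alg alg] comult_mult
          tensor_mult_eval bilinear_mult lf)
    show "comult H (x \<oplus> y) = comult H x \<oplus>\<^bsub>tensor_product H H\<^esub> comult H y"
      using cl xy by (simp add: lin_map_def)
  next
    show "comult H \<one> = \<one>\<^bsub>tensor_product H H\<^esub>"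
      by (rule eq2) (simp_all add: cc algebra_closed[OF alg] pure_tensor_closed comult_one
        pure_tensor_eval bilinear_mult lf)
  qed (rule cc)
  let ?HHH = "tensor_product H (tensor_product H H)"
  have spH: "kspace ?HHH" using sp by (rule kspace_HHH)
  have sep3: "separating ?HHH (tensor_forms \<Lambda> (tensor_forms \<Lambda> \<Lambda>))"
    using sp sep by (intro separating_tensor kspace_tensor_product)
  have coass: "tensor_lift H H ?HHH
              (\<lambda>a b. tensor_lift H H ?HHH
                 (\<lambda>a1 a2. pure_tensor H (tensor_product H H) a1 (pure_tensor H H a2 b))
                 (comult H a)) (comult H x)
            = tensor_lift H H ?HHH
                (\<lambda>a b. pure_tensor H (tensor_product H H) a (comult H b)) (comult H x)"
    if x: "x \<in> carrier H" for x
    using hopf_coassoc_forms[OF sp x cc cl sep] coassoc[OF _ _ _ x]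
    by (intro separatingD[OF sep3 spH]) (auto simp: tensor_forms_def)
  have fc: "f (c \<odot> y) = c * f y" if "f \<in> \<Lambda>" "y \<in> carrier H" for f c y
    using that by (simp add: linear_form_smult[OF lf])
  have bl: "bilinear_form H H (\<lambda>a b. counit H b * f a)" if "f \<in> \<Lambda>" for f
    by (intro bilinear_formI lf_mult_left lf_mult_right counit_hom lf that)
  have c1: "tensor_lift H H H (\<lambda>a b. counit H a \<odot> b) (comult H x) = x"
    and c2: "tensor_lift H H H (\<lambda>a b. counit H b \<odot> a) (comult H x) = x" if x: "x \<in> carrier H" for x
    by (rule tensor_lift_eqI[OF sp sp sp sep cc[OF x], where \<beta> = "\<lambda>f a b. counit H a * f b"],
       simp_all add: x kspace_closed[OF sp] fc counit bilinear_mult counit_hom lf,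
       rule tensor_lift_eqI[OF sp sp sp sep cc[OF x], where \<beta> = "\<lambda>f a b. counit H b * f a"],
       simp_all add: x kspace_closed[OF sp] fc counit(2)[OF _ x] bl)
  have am: "f (counit H x \<odot> \<one>) = counit H x * f \<one>" if "f \<in> \<Lambda>" for f x
    using that by (simp add: fc algebra_closed[OF alg])
  have b1: "bilinear_form H H (\<lambda>a b. f (antipode H a \<otimes> b))" if f: "f \<in> \<Lambda>" for f
  proof (rule bilinear_formI)
    fix y assume y: "y \<in> carrier H"
    show "linear_form H (\<lambda>a. f (antipode H a \<otimes> y))"
      by (rule lf_comp[OF al lf_comp[OF lin_map_mult(1)[OF alg y] lf[OF f]]])
    show "linear_form H (\<lambda>b. f (antipode H y \<otimes> b))"
      by (rule lf_comp[OF lin_map_mult(2)[OF alg antipode_closed[OF y]] lf[OF f]])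
  qed
  have b2: "bilinear_form H H (\<lambda>a b. f (a \<otimes> antipode H b))" if f: "f \<in> \<Lambda>" for f
  proof (rule bilinear_formI)
    fix y assume y: "y \<in> carrier H"
    show "linear_form H (\<lambda>b. f (y \<otimes> antipode H b))"
      by (rule lf_comp[OF al lf_comp[OF lin_map_mult(2)[OF alg y] lf[OF f]]])
    show "linear_form H (\<lambda>a. f (a \<otimes> antipode H y))"
      by (rule lf_comp[OF lin_map_mult(1)[OF alg antipode_closed[OF y]] lf[OF f]])
  qed
  have a1: "tensor_lift H H H (\<lambda>a b. antipode H a \<otimes> b) (comult H x) = counit H x \<odot> \<one>"
    if x: "x \<in> carrier H" for x
    by (rule tensor_lift_eqI[OF sp sp sp sep cc[OF x], where \<beta> = "\<lambda>f a b. f (antipode H a \<otimes> b)"])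
      (simp_all add: x b1 kspace_closed[OF sp] antipode_closed algebra_closed[OF alg] am antipode)
  have a2: "tensor_lift H H H (\<lambda>a b. a \<otimes> antipode H b) (comult H x) = counit H x \<odot> \<one>"
    if x: "x \<in> carrier H" for x
    by (rule tensor_lift_eqI[OF sp sp sp sep cc[OF x], where \<beta> = "\<lambda>f a b. f (a \<otimes> antipode H b)"])
      (simp_all add: x b2 kspace_closed[OF sp] antipode_closed algebra_closed[OF alg] am antipode)
  show ?thesis
    unfolding hopf_algebra_def Let_def
    using alg ring cl counit_hom al coass c1 c2 a1 a2 by blast
qed

text \<open>Tested on evaluations, every axiom becomes a law of the group: coassociativity is
  associativity, the counit axioms are the unit laws, the antipode axioms are the inverse laws.
  Coproduct and product are compatible because evaluations are multiplicative.\<close>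

lemma function_hopf_algebra:
  fixes H :: "('k::field, 'a, 'm) hopf_scheme" (structure) and \<Gamma> :: "('g, 'n) monoid_scheme"
    and ev :: "'g \<Rightarrow> 'a \<Rightarrow> 'k"
  assumes grp: "Group.group \<Gamma>" and alg: "assoc_algebra H" and sep: "separating H (ev ` carrier \<Gamma>)"
    and ev: "\<And>g. g \<in> carrier \<Gamma> \<Longrightarrow> ev g \<in> ring_hom H scalars"
    and cc: "\<And>x. x \<in> carrier H \<Longrightarrow> comult H x \<in> tensors H H"
    and comult: "\<And>x g h. x \<in> carrier H \<Longrightarrow> g \<in> carrier \<Gamma> \<Longrightarrow> h \<in> carrier \<Gamma> \<Longrightarrow>
      comult H x (\<lambda>a b. ev g a * ev h b) = ev (g \<otimes>\<^bsub>\<Gamma>\<^esub> h) x"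
    and counit: "counit H = ev \<one>\<^bsub>\<Gamma>\<^esub>"
    and antipode_closed: "\<And>x. x \<in> carrier H \<Longrightarrow> antipode H x \<in> carrier H"
    and antipode: "\<And>x g. x \<in> carrier H \<Longrightarrow> g \<in> carrier \<Gamma> \<Longrightarrow> ev g (antipode H x) = ev (inv\<^bsub>\<Gamma>\<^esub> g) x"
  shows "hopf_algebra H"
proof (rule hopf_algebraI[OF alg sep cc])
  interpret \<Gamma>: Group.group \<Gamma> by fact
  note sp = assoc_algebraD(1)[OF alg]
  note cl = kspace_closed[OF sp] algebra_closed[OF alg]
  have lf: "linear_form H (ev g)" if "g \<in> carrier \<Gamma>" for g
    using sep that by (auto intro: separating_linear)
  have ev1: "ev g \<one> = 1" if "g \<in> carrier \<Gamma>" for g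
    using ring_hom_one[OF ev[OF that]] by simp
  have evm: "ev g (x \<otimes> y) = ev g x * ev g y" if "g \<in> carrier \<Gamma>" "x \<in> carrier H" "y \<in> carrier H" for g x y
    using ring_hom_mult[OF ev[OF that(1)] that(2,3)] by simp
  note lin = linear_form_add[OF lf] linear_form_smult[OF lf]
  note bil = bilinear_mult[OF lf lf]
  have cong: "comult H x \<beta> = comult H x \<beta>'"
    if "x \<in> carrier H" "\<And>a b. a \<in> carrier H \<Longrightarrow> b \<in> carrier H \<Longrightarrow> \<beta> a b = \<beta>' a b" for x \<beta> \<beta>'
    by (rule tensor_cong[OF sp sp cc[OF that(1)]]) (rule that(2))
  show "counit H \<in> ring_hom H scalars" "linear_form H (counit H)"
    unfolding counit by (simp_all add: ev lf)
  show "comult H \<one> (\<lambda>a b. f a * g b) = f \<one> * g \<one>"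
    if "f \<in> ev ` carrier \<Gamma>" "g \<in> ev ` carrier \<Gamma>" for f g
    using that by (auto simp: comult cl ev1)
  fix f x assume "f \<in> ev ` carrier \<Gamma>" and x: "x \<in> carrier H"
  then obtain k where k: "k \<in> carrier \<Gamma>" "f = ev k" by auto
  show "comult H x (\<lambda>a b. counit H a * f b) = f x" "comult H x (\<lambda>a b. counit H b * f a) = f x"
    using comult[OF x \<Gamma>.one_closed k(1)] comult[OF x k(1) \<Gamma>.one_closed] k
    by (simp_all add: counit mult.commute)
  have "comult H x (\<lambda>a b. f (antipode H a \<otimes> b)) = comult H x (\<lambda>a b. ev (inv\<^bsub>\<Gamma>\<^esub> k) a * ev k b)"
    by (rule cong[OF x]) (simp add: k evm antipode_closed antipode)
  then show "comult H x (\<lambda>a b. f (antipode H a \<otimes> b)) = counit H x * f \<one>"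
    using k x by (simp add: comult counit ev1)
  have "comult H x (\<lambda>a b. f (a \<otimes> antipode H b)) = comult H x (\<lambda>a b. ev k a * ev (inv\<^bsub>\<Gamma>\<^esub> k) b)"
    by (rule cong[OF x]) (simp add: k evm antipode_closed antipode)
  then show "comult H x (\<lambda>a b. f (a \<otimes> antipode H b)) = counit H x * f \<one>"
    using k x by (simp add: comult counit ev1)
  show "f (antipode H (c \<odot> x)) = c * f (antipode H x)" for c
    using k x by (simp add: antipode cl lin)
  show "f (antipode H (x \<oplus> y)) = f (antipode H x) + f (antipode H y)" if "y \<in> carrier H" for y
    using k x that by (simp add: antipode cl lin)
  fix g assume "g \<in> ev ` carrier \<Gamma>"
  then obtain l where l: "l \<in> carrier \<Gamma>" "g = ev l" by auto
  show "comult H (c \<odot> x) (\<lambda>a b. f a * g b) = c * comult H x (\<lambda>a b. f a * g b)" for c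
    using k l x by (simp add: comult cl lin)
  show "comult H (x \<oplus> y) (\<lambda>a b. f a * g b) = comult H x (\<lambda>a b. f a * g b) + comult H y (\<lambda>a b. f a * g b)"
    if "y \<in> carrier H" for y
    using k l x that by (simp add: comult cl lin)
  show "comult H (x \<otimes> y) (\<lambda>a b. f a * g b)
      = comult H x (\<lambda>a b. comult H y (\<lambda>a' b'. f (a \<otimes> a') * g (b \<otimes> b')))" if y: "y \<in> carrier H" for y
  proof -
    have "comult H x (\<lambda>a b. comult H y (\<lambda>a' b'. f (a \<otimes> a') * g (b \<otimes> b')))
      = comult H x (\<lambda>a b. (ev k a * ev l b) * ev (k \<otimes>\<^bsub>\<Gamma>\<^esub> l) y)"
    proof (rule cong[OF x])
      fix a b assume ab: "a \<in> carrier H" "b \<in> carrier H"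
      have "comult H y (\<lambda>a' b'. f (a \<otimes> a') * g (b \<otimes> b'))
        = comult H y (\<lambda>a' b'. (ev k a * ev l b) * (ev k a' * ev l b'))"
        by (rule cong[OF y]) (simp add: k l ab evm)
      also have "\<dots> = (ev k a * ev l b) * comult H y (\<lambda>a' b'. ev k a' * ev l b')"
        by (rule tensor_cmult_form[OF cc[OF y]]) (simp add: bil k l)
      finally show "comult H y (\<lambda>a' b'. f (a \<otimes> a') * g (b \<otimes> b')) = (ev k a * ev l b) * ev (k \<otimes>\<^bsub>\<Gamma>\<^esub> l) y"
        using y k l by (simp add: comult)
    qed
    also have "\<dots> = comult H x (\<lambda>a b. ev k a * ev l b) * ev (k \<otimes>\<^bsub>\<Gamma>\<^esub> l) y"
      by (rule tensor_cmult_form2[OF cc[OF x]]) (simp add: bil k l)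
    finally show ?thesis
      using x y k l by (simp add: comult cl evm)
  qed
  fix h assume "h \<in> ev ` carrier \<Gamma>"
  then obtain m where m: "m \<in> carrier \<Gamma>" "h = ev m" by auto
  have "comult H x (\<lambda>a b. comult H a (\<lambda>a1 a2. f a1 * g a2) * h b)
      = comult H x (\<lambda>a b. ev (k \<otimes>\<^bsub>\<Gamma>\<^esub> l) a * ev m b)"
    by (rule cong[OF x]) (simp add: k l m comult)
  moreover have "comult H x (\<lambda>a b. f a * comult H b (\<lambda>b1 b2. g b1 * h b2))
      = comult H x (\<lambda>a b. ev k a * ev (l \<otimes>\<^bsub>\<Gamma>\<^esub> m) b)"
    by (rule cong[OF x]) (simp add: k l m comult)
  ultimately show "comult H x (\<lambda>a b. comult H a (\<lambda>a1 a2. f a1 * g a2) * h b)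
        = comult H x (\<lambda>a b. f a * comult H b (\<lambda>b1 b2. g b1 * h b2))"
    using k l m x by (simp add: comult \<Gamma>.m_assoc)
qed (simp_all add: antipode_closed)

text \<open>The axioms are stated with \<open>tensor_lift\<close>, which can be computed once linear
  forms separate points. The lemmas of the locale restate them as identities between linear forms,
  the shape in which they transpose to a dual.\<close>

locale separated_hopf =
  fixes H :: "('k::field, 'a, 'm) hopf_scheme" (structure)
  assumes hopf: "hopf_algebra H" and separated: "separating H {f. linear_form H f}"
begin

lemma alg: "assoc_algebra H" using hopf by (simp add: hopf_algebra_def Let_def)
lemma sp: "kspace H" using alg by (rule assoc_algebraD)
lemmas closed = kspace_closed[OF sp] algebra_closed[OF alg]

lemma comult_lin: "lin_map H (tensor_product H H) (comult H)"
  using hopf by (simp add: hopf_algebra_def Let_def)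

lemma comult_closed: "x \<in> carrier H \<Longrightarrow> comult H x \<in> tensors H H"
  using comult_lin by (auto simp: lin_map_def)

lemma lf_comult: "linear_form H (\<lambda>x. comult H x \<beta>)"
  by (rule lf_comp[OF comult_lin lf_tensor_eval])

lemma counit_lin: "linear_form H (counit H)"
  using hopf by (simp add: hopf_algebra_def Let_def)

lemma counit_mult: "x \<in> carrier H \<Longrightarrow> y \<in> carrier H \<Longrightarrow> counit H (x \<otimes> y) = counit H x * counit H y"
  and counit_one: "counit H \<one> = 1"
proof -
  have r: "counit H \<in> ring_hom H scalars" using hopf by (simp add: hopf_algebra_def Let_def)
  show "x \<in> carrier H \<Longrightarrow> y \<in> carrier H \<Longrightarrow> counit H (x \<otimes> y) = counit H x * counit H y"
    using ring_hom_mult[OF r, of x y] by simp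
  show "counit H \<one> = 1" using ring_hom_one[OF r] by simp
qed

lemma antipode_lin: "lin_map H H (antipode H)"
  using hopf by (simp add: hopf_algebra_def Let_def)

lemma antipode_closed: "x \<in> carrier H \<Longrightarrow> antipode H x \<in> carrier H"
  using antipode_lin by (auto simp: lin_map_def)

lemma comult_mult:
  assumes "x \<in> carrier H" "y \<in> carrier H" "bilinear_form H H \<beta>"
  shows "comult H (x \<otimes> y) \<beta> = comult H x (\<lambda>a b. comult H y (\<lambda>a' b'. \<beta> (a \<otimes> a') (b \<otimes> b')))"
proof -
  have "comult H \<in> ring_hom H (tensor_product H H)"
    using hopf by (simp add: hopf_algebra_def Let_def)
  from ring_hom_mult[OF this assms(1,2)] show ?thesis
    using assms(3) by (simp add: tensor_mult_eval)
qed

lemma comult_one: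
  assumes "bilinear_form H H \<beta>"
  shows "comult H \<one> \<beta> = \<beta> \<one> \<one>"
proof -
  have "comult H \<in> ring_hom H (tensor_product H H)"
    using hopf by (simp add: hopf_algebra_def Let_def)
  from ring_hom_one[OF this] show ?thesis
    using assms by (simp add: pure_tensor_eval)
qed

lemma comult_cong:
  assumes "x \<in> carrier H" "\<And>a b. a \<in> carrier H \<Longrightarrow> b \<in> carrier H \<Longrightarrow> \<beta> a b = \<beta>' a b"
  shows "comult H x \<beta> = comult H x \<beta>'"
  by (rule tensor_cong[OF sp sp comult_closed[OF assms(1)]]) (rule assms(2))

lemma comult_counit:
  assumes "x \<in> carrier H" "linear_form H f"
  shows "comult H x (\<lambda>a b. counit H a * f b) = f x" "comult H x (\<lambda>a b. counit H b * f a) = f x"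
proof -
  have 1: "tensor_lift H H H (\<lambda>a b. counit H a \<odot> b) (comult H x) = x"
    and 2: "tensor_lift H H H (\<lambda>a b. counit H b \<odot> a) (comult H x) = x"
    using hopf assms by (simp_all add: hopf_algebra_def Let_def)
  have "f (tensor_lift H H H (\<lambda>a b. counit H a \<odot> b) (comult H x)) = comult H x (\<lambda>a b. counit H a * f b)"
    by (rule tensor_lift_test(2)[OF sp sp sp separated comult_closed, where \<beta> = "\<lambda>f a b. counit H a * f b"])
      (simp_all add: assms closed linear_form_smult bilinear_mult counit_lin)
  then show "comult H x (\<lambda>a b. counit H a * f b) = f x" by (simp add: 1)
  have "f (tensor_lift H H H (\<lambda>a b. counit H b \<odot> a) (comult H x)) = comult H x (\<lambda>a b. f a * counit H b)"
    by (rule tensor_lift_test(2)[OF sp sp sp separated comult_closed, where \<beta> = "\<lambda>f a b. f a * counit H b"])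
      (simp_all add: assms closed linear_form_smult bilinear_mult counit_lin)
  then show "comult H x (\<lambda>a b. counit H b * f a) = f x" by (simp add: 2 mult.commute)
qed

lemma comult_antipode:
  assumes "x \<in> carrier H" "linear_form H f"
  shows "comult H x (\<lambda>a b. f (antipode H a \<otimes> b)) = counit H x * f \<one>"
    "comult H x (\<lambda>a b. f (a \<otimes> antipode H b)) = counit H x * f \<one>"
proof -
  have 1: "tensor_lift H H H (\<lambda>a b. antipode H a \<otimes> b) (comult H x) = counit H x \<odot> \<one>"
    and 2: "tensor_lift H H H (\<lambda>a b. a \<otimes> antipode H b) (comult H x) = counit H x \<odot> \<one>"
    using hopf assms by (simp_all add: hopf_algebra_def Let_def)
  have b1: "bilinear_form H H (\<lambda>a b. f (antipode H a \<otimes> b))" if f: "linear_form H f" for f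
  proof (rule bilinear_formI)
    fix y assume y: "y \<in> carrier H"
    show "linear_form H (\<lambda>a. f (antipode H a \<otimes> y))"
      by (rule lf_comp[OF antipode_lin lf_comp[OF lin_map_mult(1)[OF alg y] f]])
    show "linear_form H (\<lambda>b. f (antipode H y \<otimes> b))"
      by (rule lf_comp[OF lin_map_mult(2)[OF alg antipode_closed[OF y]] f])
  qed
  have b2: "bilinear_form H H (\<lambda>a b. f (a \<otimes> antipode H b))" if f: "linear_form H f" for f
  proof (rule bilinear_formI)
    fix y assume y: "y \<in> carrier H"
    show "linear_form H (\<lambda>b. f (y \<otimes> antipode H b))"
      by (rule lf_comp[OF antipode_lin lf_comp[OF lin_map_mult(2)[OF alg y] f]])
    show "linear_form H (\<lambda>a. f (a \<otimes> antipode H y))"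
      by (rule lf_comp[OF lin_map_mult(1)[OF alg antipode_closed[OF y]] f])
  qed
  have "f (tensor_lift H H H (\<lambda>a b. antipode H a \<otimes> b) (comult H x)) = comult H x (\<lambda>a b. f (antipode H a \<otimes> b))"
    by (rule tensor_lift_test(2)[OF sp sp sp separated comult_closed, where \<beta> = "\<lambda>f a b. f (antipode H a \<otimes> b)"])
      (simp_all add: assms closed b1 antipode_closed)
  then show "comult H x (\<lambda>a b. f (antipode H a \<otimes> b)) = counit H x * f \<one>"
    using assms by (simp add: 1 linear_form_smult closed)
  have "f (tensor_lift H H H (\<lambda>a b. a \<otimes> antipode H b) (comult H x)) = comult H x (\<lambda>a b. f (a \<otimes> antipode H b))"
    by (rule tensor_lift_test(2)[OF sp sp sp separated comult_closed, where \<beta> = "\<lambda>f a b. f (a \<otimes> antipode H b)"])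
      (simp_all add: assms closed b2 antipode_closed)
  then show "comult H x (\<lambda>a b. f (a \<otimes> antipode H b)) = counit H x * f \<one>"
    using assms by (simp add: 2 linear_form_smult closed)
qed

lemma comult_coassoc:
  assumes x: "x \<in> carrier H" and "linear_form H f" "linear_form H g" "linear_form H h"
  shows "comult H x (\<lambda>a b. comult H a (\<lambda>a1 a2. f a1 * g a2) * h b)
    = comult H x (\<lambda>a b. f a * comult H b (\<lambda>b1 b2. g b1 * h b2))"
proof -
  let ?HHH = "tensor_product H (tensor_product H H)"
  have "tensor_lift H H ?HHH
              (\<lambda>a b. tensor_lift H H ?HHH
                 (\<lambda>a1 a2. pure_tensor H (tensor_product H H) a1 (pure_tensor H H a2 b))
                 (comult H a)) (comult H x)
            = tensor_lift H H ?HHH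
                (\<lambda>a b. pure_tensor H (tensor_product H H) a (comult H b)) (comult H x)"
    using hopf x by (simp add: hopf_algebra_def Let_def)
  then show ?thesis
    using hopf_coassoc_forms(3,4)[OF sp x comult_closed comult_lin separated, of f g h] assms by simp
qed

end

section \<open>Transport of a Hopf structure along a perfect pairing\<close>

lemma module_extend_simps [simp]:
  "carrier (module.extend M X) = carrier M" "mult (module.extend M X) = mult M"
  "one (module.extend M X) = one M" "zero (module.extend M X) = zero M"
  "add (module.extend M X) = add M" "smult (module.extend M X) = smult M"
  "module.more (module.extend M X) = X" "module.truncate (module.extend M X) = M"
  by (simp_all add: module.defs)

lemma hopf_extend_simps [simp]:
  "comult (module.extend M \<lparr>comult = c, counit = e, antipode = s\<rparr>) = c"
  "counit (module.extend M \<lparr>comult = c, counit = e, antipode = s\<rparr>) = e"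
  "antipode (module.extend M \<lparr>comult = c, counit = e, antipode = s\<rparr>) = s"
  by (simp_all add: module.defs)

lemma linear_form_extend [simp]: "linear_form (module.extend M X) = linear_form M"
  by (simp add: fun_eq_iff linear_form_def)

lemma bilinear_form_extend [simp]:
  "bilinear_form (module.extend M X) (module.extend M X) = bilinear_form M M"
  by (simp add: fun_eq_iff bilinear_form_def)

lemma tensor_product_extend [simp]:
  "tensor_product (module.extend M X) (module.extend M X) = tensor_product M M"
  by (simp add: tensor_product_def tensor_sum_def pure_tensor_def cong: if_cong)

lemma kspace_extend:
  assumes "kspace M"
  shows "kspace (module.extend M X)"
proof -
  interpret Module.module scalars M by fact
  show ?thesis
    by (rule kspaceI)
      (simp_all add: M.a_ac M.r_neg smult_l_distr[simplified] smult_r_distr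
        smult_assoc1[simplified] smult_one[simplified] kspace_minus_one[OF assms] M.l_neg)
qed

lemma assoc_algebra_extend:
  assumes "assoc_algebra M"
  shows "assoc_algebra (module.extend M X)"
proof -
  interpret R: ring M using assms by (rule assoc_algebraD)
  have sp: "kspace (module.extend M X)" using assms by (intro kspace_extend assoc_algebraD)
  have "ring (module.extend M X)"
  proof (rule ringI)
    show "abelian_group (module.extend M X)" using sp by (simp add: Module.module_def)
    show "Group.monoid (module.extend M X)"
      by (rule monoidI) (simp_all add: R.m_assoc)
  qed (simp_all add: R.l_distr R.r_distr)
  with sp assms show ?thesis by (simp add: assoc_algebra_def)
qed

definition eval_forms :: "('u \<Rightarrow> 'a \<Rightarrow> 'k) \<Rightarrow> 'a set \<Rightarrow> ('u \<Rightarrow> 'k) set" where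
  "eval_forms P S = {\<lambda>u. P u x | x. x \<in> S}"

text \<open>A perfect pairing: \<open>pair_surj\<close> and \<open>pair_nondeg\<close> identify
  \<open>U0\<close> with the graded dual as a space, \<open>pair_mult\<close> and
  \<open>pair_one\<close> match its product with convolution. The last two assumptions say that the
  transposes of the product and of the antipode of \<open>H\<close> stay within the graded dual; for
  the product this means a finite sum of products of forms.\<close>

locale graded_dual_pairing = separated_hopf H
  for H :: "('k::field, 'a, 'm) hopf_scheme" (structure) +
  fixes n :: nat and Hc :: "expo \<Rightarrow> 'a set" and U0 :: "('k, 'u) module" and pair :: "'u \<Rightarrow> 'a \<Rightarrow> 'k"
  assumes algU: "assoc_algebra U0"
    and pair_lin: "\<And>x. x \<in> carrier H \<Longrightarrow> linear_form U0 (\<lambda>u. pair u x)"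
    and pair_dual: "\<And>u. u \<in> carrier U0 \<Longrightarrow> restrict (pair u) (carrier H) \<in> carrier (graded_dual n H Hc)"
    and pair_surj: "\<And>f. f \<in> carrier (graded_dual n H Hc) \<Longrightarrow> \<exists>u\<in>carrier U0. \<forall>x\<in>carrier H. pair u x = f x"
    and pair_nondeg: "\<And>u. u \<in> carrier U0 \<Longrightarrow> \<forall>x\<in>carrier H. pair u x = 0 \<Longrightarrow> u = \<zero>\<^bsub>U0\<^esub>"
    and pair_mult: "\<And>u v x. u \<in> carrier U0 \<Longrightarrow> v \<in> carrier U0 \<Longrightarrow> x \<in> carrier H \<Longrightarrow>
      pair (u \<otimes>\<^bsub>U0\<^esub> v) x = comult H x (\<lambda>a b. pair u a * pair v b)"
    and pair_one: "\<And>x. x \<in> carrier H \<Longrightarrow> pair \<one>\<^bsub>U0\<^esub> x = counit H x"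
    and dual_comult: "\<And>f. f \<in> carrier (graded_dual n H Hc) \<Longrightarrow> \<exists>L. set L \<subseteq> carrier (graded_dual n H Hc) \<times> carrier (graded_dual n H Hc)
        \<and> (\<forall>x\<in>carrier H. \<forall>y\<in>carrier H. f (x \<otimes> y) = (\<Sum>(a, b)\<leftarrow>L. a x * b y))"
    and dual_antipode: "\<And>f. f \<in> carrier (graded_dual n H Hc) \<Longrightarrow>
        (\<lambda>x\<in>carrier H. f (antipode H x)) \<in> carrier (graded_dual n H Hc)"
begin

abbreviation "D \<equiv> graded_dual n H Hc"

lemma D_simps:
  "carrier D = {f \<in> extensional (carrier H). linear_form H f \<and> finite {\<alpha>\<in>expos n. \<exists>x\<in>Hc \<alpha>. f x \<noteq> 0}}"
  "mult D = (\<lambda>f g. \<lambda>x\<in>carrier H. comult H x (\<lambda>a b. f a * g b))"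
  "one D = (\<lambda>x\<in>carrier H. counit H x)"
  "zero D = (\<lambda>x\<in>carrier H. 0)"
  "add D = (\<lambda>f g. \<lambda>x\<in>carrier H. f x + g x)"
  "smult D = (\<lambda>c f. \<lambda>x\<in>carrier H. c * f x)"
  "counit D = (\<lambda>f. f \<one>)"
  "antipode D = (\<lambda>f. \<lambda>x\<in>carrier H. f (antipode H x))"
  by (simp_all add: graded_dual_def graded_dual_algebra_def Let_def)

text \<open>The inverse of the map from \<open>U0\<close> to the graded dual given by the pairing;
  it will be the isomorphism of Hopf algebras.\<close>

definition pre :: "('a \<Rightarrow> 'k) \<Rightarrow> 'u" where
  "pre f = (THE u. u \<in> carrier U0 \<and> (\<forall>x\<in>carrier H. pair u x = f x))"

lemma spU: "kspace U0" using algU by (rule assoc_algebraD)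
lemmas closedU = kspace_closed[OF spU] algebra_closed[OF algU]

lemma sepU: "separating U0 (eval_forms pair (carrier H))"
  using pair_lin pair_nondeg by (auto simp: separating_def eval_forms_def)

lemma U_eqI:
  assumes "u \<in> carrier U0" "v \<in> carrier U0" "\<And>x. x \<in> carrier H \<Longrightarrow> pair u x = pair v x"
  shows "u = v"
  using assms by (intro separatingD[OF sepU spU]) (auto simp: eval_forms_def)

lemma pre: "f \<in> carrier D \<Longrightarrow> pre f \<in> carrier U0"
  "f \<in> carrier D \<Longrightarrow> x \<in> carrier H \<Longrightarrow> pair (pre f) x = f x"
proof -
  have *: "pre f \<in> carrier U0 \<and> (\<forall>x\<in>carrier H. pair (pre f) x = f x)" if f: "f \<in> carrier D"
    unfolding pre_def
  proof (rule theI')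
    obtain u where "u \<in> carrier U0" "\<forall>x\<in>carrier H. pair u x = f x" using pair_surj[OF f] by blast
    then show "\<exists>!u. u \<in> carrier U0 \<and> (\<forall>x\<in>carrier H. pair u x = f x)"
      by (intro ex1I[of _ u]) (auto intro: U_eqI)
  qed
  show "f \<in> carrier D \<Longrightarrow> pre f \<in> carrier U0"
    "f \<in> carrier D \<Longrightarrow> x \<in> carrier H \<Longrightarrow> pair (pre f) x = f x"
    using * by auto
qed

lemma pre_eqI: "f \<in> carrier D \<Longrightarrow> u \<in> carrier U0 \<Longrightarrow> (\<And>x. x \<in> carrier H \<Longrightarrow> f x = pair u x) \<Longrightarrow> pre f = u"
  by (rule U_eqI) (simp_all add: pre)

lemma pair_lin2:
  assumes "u \<in> carrier U0" shows "linear_form H (pair u)"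
proof -
  have "linear_form H (restrict (pair u) (carrier H))"
    using pair_dual[OF assms] by (simp add: D_simps)
  then show ?thesis
    using linear_form_cong[OF sp, of "restrict (pair u) (carrier H)" "pair u"] by simp
qed

text \<open>The transposed structure maps of \<open>H\<close>. The descriptions are unique because
  pairings with elements of \<open>H\<close> separate \<open>U0\<close> and its tensor
  square.\<close>

definition dual_hopf :: "('k, 'u) hopf" where
  "dual_hopf = module.extend U0
     \<lparr>comult = (\<lambda>u. THE T. T \<in> tensors U0 U0
        \<and> (\<forall>x\<in>carrier H. \<forall>y\<in>carrier H. T (\<lambda>a b. pair a x * pair b y) = pair u (x \<otimes> y))),
      counit = (\<lambda>u. pair u \<one>),
      antipode = (\<lambda>u. THE v. v \<in> carrier U0 \<and> (\<forall>x\<in>carrier H. pair v x = pair u (antipode H x)))\<rparr>"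

lemma dual_simps [simp]:
  "carrier dual_hopf = carrier U0" "mult dual_hopf = mult U0" "one dual_hopf = one U0"
  "zero dual_hopf = zero U0" "add dual_hopf = add U0" "smult dual_hopf = smult U0"
  "tensor_product dual_hopf dual_hopf = tensor_product U0 U0"
  "linear_form dual_hopf = linear_form U0"
  "bilinear_form dual_hopf dual_hopf = bilinear_form U0 U0"
  "counit dual_hopf u = pair u \<one>"
  "module.truncate dual_hopf = U0"
  by (simp_all add: dual_hopf_def)

lemma sepUU: "separating (tensor_product U0 U0) (tensor_forms (eval_forms pair (carrier H)) (eval_forms pair (carrier H)))"
  by (intro separating_tensor spU sepU)

lemma UU_eqI:
  assumes "S \<in> tensors U0 U0" "T \<in> tensors U0 U0"
    and "\<And>x y. x \<in> carrier H \<Longrightarrow> y \<in> carrier H \<Longrightarrow> S (\<lambda>a b. pair a x * pair b y) = T (\<lambda>a b. pair a x * pair b y)"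
  shows "S = T"
  using assms by (intro separatingD[OF sepUU kspace_tensor_product[OF spU spU]]) (auto simp: tensor_forms_def eval_forms_def)

lemma bilinear_pair: "x \<in> carrier H \<Longrightarrow> y \<in> carrier H \<Longrightarrow> bilinear_form U0 U0 (\<lambda>a b. pair a x * pair b y)"
  by (intro bilinear_mult pair_lin)

lemma comult_dual:
  assumes u: "u \<in> carrier U0"
  shows "comult dual_hopf u \<in> tensors U0 U0"
    "x \<in> carrier H \<Longrightarrow> y \<in> carrier H \<Longrightarrow> comult dual_hopf u (\<lambda>a b. pair a x * pair b y) = pair u (x \<otimes> y)"
proof -
  let ?P = "\<lambda>T. T \<in> tensors U0 U0
        \<and> (\<forall>x\<in>carrier H. \<forall>y\<in>carrier H. T (\<lambda>a b. pair a x * pair b y) = pair u (x \<otimes> y))"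
  obtain L where L: "set L \<subseteq> carrier D \<times> carrier D"
    "\<And>x y. x \<in> carrier H \<Longrightarrow> y \<in> carrier H \<Longrightarrow> restrict (pair u) (carrier H) (x \<otimes> y) = (\<Sum>(a, b)\<leftarrow>L. a x * b y)"
    using dual_comult[OF pair_dual[OF u]] by blast
  \<comment> \<open>The decomposition of the transposed product in the graded dual, with both legs
    carried back to \<open>U0\<close>.\<close>
  define T where "T = tensor_sum U0 U0 (map (\<lambda>(a, b). (pre a, pre b)) L)"
  have "?P (comult dual_hopf u)"
    unfolding dual_hopf_def hopf_extend_simps
  proof (rule theI[where a = T])
    show P: "?P T"
    proof (intro conjI ballI)
      have "set (map (\<lambda>(a, b). (pre a, pre b)) L) \<subseteq> carrier U0 \<times> carrier U0"
        using L(1) by (auto simp: pre)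
      then show "T \<in> tensors U0 U0"
        unfolding T_def tensor_carrier by blast
      fix x y assume xy: "x \<in> carrier H" "y \<in> carrier H"
      have "T (\<lambda>a b. pair a x * pair b y) = (\<Sum>(a, b)\<leftarrow>L. pair (pre a) x * pair (pre b) y)"
        by (simp add: T_def tensor_sum_eval bilinear_pair xy split_def o_def)
      also have "\<dots> = (\<Sum>(a, b)\<leftarrow>L. a x * b y)"
        using L(1) xy by (intro sum_list_pair_cong) (auto simp: pre)
      also have "\<dots> = pair u (x \<otimes> y)" using L(2)[OF xy] xy closed by simp
      finally show "T (\<lambda>a b. pair a x * pair b y) = pair u (x \<otimes> y)" .
    qed
    show "S = T" if "?P S" for S using that P by (intro UU_eqI) auto
  qed
  then show "comult dual_hopf u \<in> tensors U0 U0"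
    "x \<in> carrier H \<Longrightarrow> y \<in> carrier H \<Longrightarrow> comult dual_hopf u (\<lambda>a b. pair a x * pair b y) = pair u (x \<otimes> y)"
    by auto
qed

lemma antipode_dual:
  assumes u: "u \<in> carrier U0"
  shows "antipode dual_hopf u \<in> carrier U0"
    "x \<in> carrier H \<Longrightarrow> pair (antipode dual_hopf u) x = pair u (antipode H x)"
proof -
  let ?P = "\<lambda>v. v \<in> carrier U0 \<and> (\<forall>x\<in>carrier H. pair v x = pair u (antipode H x))"
  let ?v = "pre (\<lambda>x\<in>carrier H. restrict (pair u) (carrier H) (antipode H x))"
  have "?P (antipode dual_hopf u)"
    unfolding dual_hopf_def hopf_extend_simps
  proof (rule theI[where a = ?v])
    show P: "?P ?v"
      using dual_antipode[OF pair_dual[OF u]] by (simp add: pre antipode_closed)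
    show "v = ?v" if "?P v" for v using that P by (intro U_eqI) auto
  qed
  then show "antipode dual_hopf u \<in> carrier U0"
    "x \<in> carrier H \<Longrightarrow> pair (antipode dual_hopf u) x = pair u (antipode H x)" by auto
qed

text \<open>In the antipode axioms of the dual, a tensor over \<open>U0\<close> meets a coproduct in
  \<open>H\<close>; \<open>h\<close> will be the antipode, applied to one leg.\<close>

lemma comult_swap:
  assumes S: "S \<in> tensors U0 U0" and x: "x \<in> carrier H"
    and h: "lin_map H H h"
  shows "S (\<lambda>a b. comult H x (\<lambda>x1 x2. pair a (h x1) * pair b x2))
    = comult H x (\<lambda>x1 x2. S (\<lambda>a b. pair a (h x1) * pair b x2))"
    and "S (\<lambda>a b. comult H x (\<lambda>x1 x2. pair a x1 * pair b (h x2)))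
    = comult H x (\<lambda>x1 x2. S (\<lambda>a b. pair a x1 * pair b (h x2)))"
proof -
  have hc: "h a \<in> carrier H" if "a \<in> carrier H" for a using h that by (auto simp: lin_map_def)
  show "S (\<lambda>a b. comult H x (\<lambda>x1 x2. pair a (h x1) * pair b x2))
    = comult H x (\<lambda>x1 x2. S (\<lambda>a b. pair a (h x1) * pair b x2))"
    and "S (\<lambda>a b. comult H x (\<lambda>x1 x2. pair a x1 * pair b (h x2)))
    = comult H x (\<lambda>x1 x2. S (\<lambda>a b. pair a x1 * pair b (h x2)))"
    by (rule tensor_swap[OF S comult_closed[OF x] spU spU sp sp],
        simp_all add: bilinear_pair hc bilinear_mult lf_comp[OF h] pair_lin2)+
qed

lemma comult_U_cong:
  assumes "u \<in> carrier U0" "\<And>a b. a \<in> carrier U0 \<Longrightarrow> b \<in> carrier U0 \<Longrightarrow> \<beta> a b = \<beta>' a b"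
  shows "comult dual_hopf u \<beta> = comult dual_hopf u \<beta>'"
  by (rule tensor_cong[OF spU spU comult_dual(1)[OF assms(1)]]) (rule assms(2))

text \<open>Tested against elements of \<open>H\<close>, each axiom transposes a law of
  \<open>H\<close>: coassociativity comes from associativity, the counit axioms from the unit, the
  antipode axioms from those of \<open>H\<close>.\<close>

theorem hopf_dual: "hopf_algebra dual_hopf"
proof (rule hopf_algebraI[where \<Lambda> = "eval_forms pair (carrier H)"])
  show "assoc_algebra dual_hopf" unfolding dual_hopf_def by (rule assoc_algebra_extend[OF algU])
  show "separating dual_hopf (eval_forms pair (carrier H))"
    using sepU by (simp add: separating_def)
  have lin: "pair (u \<oplus>\<^bsub>U0\<^esub> v) x = pair u x + pair v x" "pair (c \<odot>\<^bsub>U0\<^esub> u) x = c * pair u x"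
    if "u \<in> carrier U0" "v \<in> carrier U0" "x \<in> carrier H" for u v c x
    using linear_form_add[OF pair_lin[OF that(3)] that(1,2)] linear_form_smult[OF pair_lin[OF that(3)] that(1)]
    by simp_all
  have one: "pair (u \<otimes>\<^bsub>U0\<^esub> v) \<one> = pair u \<one> * pair v \<one>" if "u \<in> carrier U0" "v \<in> carrier U0" for u v
    using that by (simp add: pair_mult closed comult_one bilinear_mult pair_lin2)
  show "counit dual_hopf \<in> ring_hom dual_hopf scalars"
    by (rule ring_hom_memI) (simp_all add: one lin closed pair_one counit_one)
  have "counit dual_hopf = (\<lambda>u. pair u \<one>)" by (rule ext) simp
  then show "linear_form dual_hopf (counit dual_hopf)"
    using pair_lin[OF closed(7)] by simp
  show "comult dual_hopf \<one>\<^bsub>dual_hopf\<^esub> (\<lambda>a b. f a * g b) = f \<one>\<^bsub>dual_hopf\<^esub> * g \<one>\<^bsub>dual_hopf\<^esub>"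
    if "f \<in> eval_forms pair (carrier H)" "g \<in> eval_forms pair (carrier H)" for f g
    using that by (auto simp: eval_forms_def comult_dual closedU closed pair_one counit_mult)
  fix u assume "u \<in> carrier dual_hopf"
  then have u: "u \<in> carrier U0" by simp
  show "comult dual_hopf u \<in> tensors dual_hopf dual_hopf"
    using comult_dual[OF u] by simp
  show "antipode dual_hopf u \<in> carrier dual_hopf" using antipode_dual[OF u] by simp
  fix f assume "f \<in> eval_forms pair (carrier H)"
  then obtain x where x: "x \<in> carrier H" "f = (\<lambda>u. pair u x)" by (auto simp: eval_forms_def)
  show "comult dual_hopf u (\<lambda>a b. counit dual_hopf a * f b) = f u"
    "comult dual_hopf u (\<lambda>a b. counit dual_hopf b * f a) = f u"
  proof -
    interpret ring H using alg by (rule assoc_algebraD)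
    show "comult dual_hopf u (\<lambda>a b. counit dual_hopf a * f b) = f u"
      using comult_dual(2)[OF u closed(7) x(1)] x by simp
    show "comult dual_hopf u (\<lambda>a b. counit dual_hopf b * f a) = f u"
      using comult_dual(2)[OF u x(1) closed(7)] x by (simp add: mult.commute)
  qed
  show "comult dual_hopf u (\<lambda>a b. f (antipode dual_hopf a \<otimes>\<^bsub>dual_hopf\<^esub> b)) = counit dual_hopf u * f \<one>\<^bsub>dual_hopf\<^esub>"
  proof -
    have "comult dual_hopf u (\<lambda>a b. f (antipode dual_hopf a \<otimes>\<^bsub>dual_hopf\<^esub> b))
      = comult dual_hopf u (\<lambda>a b. comult H x (\<lambda>x1 x2. pair a (antipode H x1) * pair b x2))"
    proof (rule comult_U_cong[OF u])
      fix a b assume ab: "a \<in> carrier U0" "b \<in> carrier U0"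
      show "f (antipode dual_hopf a \<otimes>\<^bsub>dual_hopf\<^esub> b) = comult H x (\<lambda>x1 x2. pair a (antipode H x1) * pair b x2)"
        by (simp add: x ab antipode_dual pair_mult) (rule comult_cong, simp_all add: x antipode_dual ab)
    qed
    also have "\<dots> = comult H x (\<lambda>x1 x2. comult dual_hopf u (\<lambda>a b. pair a (antipode H x1) * pair b x2))"
      by (rule comult_swap(1)[OF comult_dual(1)[OF u] x(1) antipode_lin])
    also have "\<dots> = comult H x (\<lambda>x1 x2. pair u (antipode H x1 \<otimes> x2))"
      by (rule comult_cong[OF x(1)]) (simp add: comult_dual u antipode_closed)
    also have "\<dots> = counit H x * pair u \<one>" by (rule comult_antipode[OF x(1) pair_lin2[OF u]])
    finally show ?thesis using x by (simp add: pair_one)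
  qed
  show "comult dual_hopf u (\<lambda>a b. f (a \<otimes>\<^bsub>dual_hopf\<^esub> antipode dual_hopf b)) = counit dual_hopf u * f \<one>\<^bsub>dual_hopf\<^esub>"
  proof -
    have "comult dual_hopf u (\<lambda>a b. f (a \<otimes>\<^bsub>dual_hopf\<^esub> antipode dual_hopf b))
      = comult dual_hopf u (\<lambda>a b. comult H x (\<lambda>x1 x2. pair a x1 * pair b (antipode H x2)))"
    proof (rule comult_U_cong[OF u])
      fix a b assume ab: "a \<in> carrier U0" "b \<in> carrier U0"
      show "f (a \<otimes>\<^bsub>dual_hopf\<^esub> antipode dual_hopf b) = comult H x (\<lambda>x1 x2. pair a x1 * pair b (antipode H x2))"
        by (simp add: x ab antipode_dual pair_mult) (rule comult_cong, simp_all add: x antipode_dual ab)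
    qed
    also have "\<dots> = comult H x (\<lambda>x1 x2. comult dual_hopf u (\<lambda>a b. pair a x1 * pair b (antipode H x2)))"
      by (rule comult_swap(2)[OF comult_dual(1)[OF u] x(1) antipode_lin])
    also have "\<dots> = comult H x (\<lambda>x1 x2. pair u (x1 \<otimes> antipode H x2))"
      by (rule comult_cong[OF x(1)]) (simp add: comult_dual u antipode_closed)
    also have "\<dots> = counit H x * pair u \<one>" by (rule comult_antipode[OF x(1) pair_lin2[OF u]])
    finally show ?thesis using x by (simp add: pair_one)
  qed
  show "f (antipode dual_hopf (c \<odot>\<^bsub>dual_hopf\<^esub> u)) = c * f (antipode dual_hopf u)" for c
    using u x by (simp add: antipode_dual closedU lin antipode_closed)
  show "f (antipode dual_hopf (u \<oplus>\<^bsub>dual_hopf\<^esub> v)) = f (antipode dual_hopf u) + f (antipode dual_hopf v)"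
    if "v \<in> carrier dual_hopf" for v
    using u x that by (simp add: antipode_dual closedU lin antipode_closed)
  fix g assume "g \<in> eval_forms pair (carrier H)"
  then obtain y where y: "y \<in> carrier H" "g = (\<lambda>u. pair u y)" by (auto simp: eval_forms_def)
  show "comult dual_hopf (c \<odot>\<^bsub>dual_hopf\<^esub> u) (\<lambda>a b. f a * g b) = c * comult dual_hopf u (\<lambda>a b. f a * g b)" for c
    using u x y by (simp add: comult_dual closedU lin closed)
  show "comult dual_hopf (u \<oplus>\<^bsub>dual_hopf\<^esub> v) (\<lambda>a b. f a * g b)
      = comult dual_hopf u (\<lambda>a b. f a * g b) + comult dual_hopf v (\<lambda>a b. f a * g b)"
    if "v \<in> carrier dual_hopf" for v
    using u x y that by (simp add: comult_dual closedU lin closed)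
  \<comment> \<open>Compatibility of product and coproduct is self-dual. Both sides are brought to
    the pairing of \<open>u\<close> and \<open>v\<close> with the legs of the coproduct of
    \<open>x \<otimes> y\<close>, which takes four exchanges of a coproduct in \<open>U0\<close>
    with one in \<open>H\<close>.\<close>
  show "comult dual_hopf (u \<otimes>\<^bsub>dual_hopf\<^esub> v) (\<lambda>a b. f a * g b)
        = comult dual_hopf u (\<lambda>a b. comult dual_hopf v (\<lambda>a' b'. f (a \<otimes>\<^bsub>dual_hopf\<^esub> a') * g (b \<otimes>\<^bsub>dual_hopf\<^esub> b')))"
    if "v \<in> carrier dual_hopf" for v
  proof -
    have v: "v \<in> carrier U0" using that by simp
    have bil: "bilinear_form H H (\<lambda>a b. pair u' a * pair v' b)" if "u' \<in> carrier U0" "v' \<in> carrier U0" for u' v'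
      using that by (intro bilinear_mult pair_lin2)
    have inner: "comult dual_hopf v (\<lambda>a' b'. pair (a \<otimes>\<^bsub>U0\<^esub> a') x * pair (b \<otimes>\<^bsub>U0\<^esub> b') y)
      = comult H x (\<lambda>x1 x2. comult H y (\<lambda>y1 y2. (pair a x1 * pair b y1) * pair v (x2 \<otimes> y2)))"
      if ab: "a \<in> carrier U0" "b \<in> carrier U0" for a b
    proof -
      have "comult dual_hopf v (\<lambda>a' b'. pair (a \<otimes>\<^bsub>U0\<^esub> a') x * pair (b \<otimes>\<^bsub>U0\<^esub> b') y)
        = comult dual_hopf v (\<lambda>a' b'. comult H x (\<lambda>x1 x2. comult H y (\<lambda>y1 y2. (pair a x1 * pair b y1) * (pair a' x2 * pair b' y2))))"
      proof (rule comult_U_cong[OF v])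
        fix a' b' assume ab': "a' \<in> carrier U0" "b' \<in> carrier U0"
        have "pair (a \<otimes>\<^bsub>U0\<^esub> a') x * pair (b \<otimes>\<^bsub>U0\<^esub> b') y
          = comult H x (\<lambda>x1 x2. (pair a x1 * pair a' x2) * comult H y (\<lambda>y1 y2. pair b y1 * pair b' y2))"
          using ab ab' x y by (simp add: pair_mult tensor_cmult_form2[OF comult_closed] bil)
        also have "\<dots> = comult H x (\<lambda>x1 x2. comult H y (\<lambda>y1 y2. (pair a x1 * pair a' x2) * (pair b y1 * pair b' y2)))"
          using ab ab' x y by (simp add: tensor_cmult_form[OF comult_closed] bil)
        finally show "pair (a \<otimes>\<^bsub>U0\<^esub> a') x * pair (b \<otimes>\<^bsub>U0\<^esub> b') y
          = comult H x (\<lambda>x1 x2. comult H y (\<lambda>y1 y2. (pair a x1 * pair b y1) * (pair a' x2 * pair b' y2)))"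
          by (simp add: mult.commute mult.left_commute mult.assoc)
      qed
      also have "\<dots> = comult H x (\<lambda>x1 x2. comult dual_hopf v (\<lambda>a' b'. comult H y (\<lambda>y1 y2. (pair a x1 * pair b y1) * (pair a' x2 * pair b' y2))))"
        using ab x y
        by (intro tensor_swap[OF comult_dual(1)[OF v] comult_closed spU spU sp sp] bilinear_formI
              lf_tensor[OF _ comult_closed] sp spU)
          (auto intro!: bilinear_formI lf_mult_left lf_mult_right pair_lin pair_lin2)
      also have "\<dots> = comult H x (\<lambda>x1 x2. comult H y (\<lambda>y1 y2. comult dual_hopf v (\<lambda>a' b'. (pair a x1 * pair b y1) * (pair a' x2 * pair b' y2))))"
        using ab x y
        by (intro comult_cong tensor_swap[OF comult_dual(1)[OF v] comult_closed spU spU sp sp] bilinear_formI)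
          (auto intro!: lf_mult_left lf_mult_right pair_lin pair_lin2)
      also have "\<dots> = comult H x (\<lambda>x1 x2. comult H y (\<lambda>y1 y2. (pair a x1 * pair b y1) * pair v (x2 \<otimes> y2)))"
        using ab x y v
        by (intro comult_cong) (simp_all add: tensor_cmult_form[OF comult_dual(1)] bilinear_pair comult_dual)
      finally show ?thesis .
    qed
    have "comult dual_hopf u (\<lambda>a b. comult dual_hopf v (\<lambda>a' b'. f (a \<otimes>\<^bsub>dual_hopf\<^esub> a') * g (b \<otimes>\<^bsub>dual_hopf\<^esub> b')))
      = comult dual_hopf u (\<lambda>a b. comult H x (\<lambda>x1 x2. comult H y (\<lambda>y1 y2. (pair a x1 * pair b y1) * pair v (x2 \<otimes> y2))))"
      by (rule comult_U_cong[OF u]) (simp add: x y inner)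
    also have "\<dots> = comult H x (\<lambda>x1 x2. comult dual_hopf u (\<lambda>a b. comult H y (\<lambda>y1 y2. (pair a x1 * pair b y1) * pair v (x2 \<otimes> y2))))"
      using x y v
      by (intro tensor_swap[OF comult_dual(1)[OF u] comult_closed spU spU sp sp] bilinear_formI
              lf_tensor[OF _ comult_closed] sp spU)
          (auto intro!: bilinear_formI lf_mult_left lf_mult_right pair_lin pair_lin2
            lf_comp[OF lin_map_mult(1)[OF alg]] lf_comp[OF lin_map_mult(2)[OF alg]])
    also have "\<dots> = comult H x (\<lambda>x1 x2. comult H y (\<lambda>y1 y2. comult dual_hopf u (\<lambda>a b. (pair a x1 * pair b y1) * pair v (x2 \<otimes> y2))))"
      using x y v
      by (intro comult_cong tensor_swap[OF comult_dual(1)[OF u] comult_closed spU spU sp sp] bilinear_formI)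
          (auto intro!: lf_mult_left lf_mult_right pair_lin pair_lin2 lf_comp[OF lin_map_mult(1)[OF alg]] lf_comp[OF lin_map_mult(2)[OF alg]])
    also have "\<dots> = comult H x (\<lambda>x1 x2. comult H y (\<lambda>y1 y2. pair u (x1 \<otimes> y1) * pair v (x2 \<otimes> y2)))"
      using x y u
        by (intro comult_cong) (simp_all add: tensor_cmult_form2[OF comult_dual(1)] bilinear_pair comult_dual)
    also have "\<dots> = comult H (x \<otimes> y) (\<lambda>a b. pair u a * pair v b)"
      using x y u v by (intro comult_mult[symmetric] bil)
    also have "\<dots> = comult dual_hopf (u \<otimes>\<^bsub>dual_hopf\<^esub> v) (\<lambda>a b. f a * g b)"
      using x y u v by (simp add: comult_dual closedU pair_mult closed)
    finally show ?thesis by simp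
  qed
  fix h assume "h \<in> eval_forms pair (carrier H)"
  then obtain z where z: "z \<in> carrier H" "h = (\<lambda>u. pair u z)" by (auto simp: eval_forms_def)
  have "comult dual_hopf u (\<lambda>a b. comult dual_hopf a (\<lambda>a1 a2. f a1 * g a2) * h b)
      = comult dual_hopf u (\<lambda>a b. pair a (x \<otimes> y) * pair b z)"
    by (rule comult_U_cong[OF u]) (simp add: x y z comult_dual)
  moreover have "comult dual_hopf u (\<lambda>a b. f a * comult dual_hopf b (\<lambda>b1 b2. g b1 * h b2))
      = comult dual_hopf u (\<lambda>a b. pair a x * pair b (y \<otimes> z))"
    by (rule comult_U_cong[OF u]) (simp add: x y z comult_dual)
  moreover have "(x \<otimes> y) \<otimes> z = x \<otimes> (y \<otimes> z)"
  proof -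
    interpret ring H using alg by (rule assoc_algebraD)
    show ?thesis using x y z by (simp add: m_assoc)
  qed
  ultimately show "comult dual_hopf u (\<lambda>a b. comult dual_hopf a (\<lambda>a1 a2. f a1 * g a2) * h b)
        = comult dual_hopf u (\<lambda>a b. f a * comult dual_hopf b (\<lambda>b1 b2. g b1 * h b2))"
    using u x y z by (simp add: comult_dual closed)
qed

text \<open>Sums and multiples in the graded dual are images of sums and multiples in
  \<open>U0\<close>, so closure, including the finiteness of the set of degrees, is inherited
  through the pairing.\<close>

lemma spD: "kspace D"
proof (rule kspaceI)
  fix f g assume f: "f \<in> carrier D" and g: "g \<in> carrier D"
  from pre[OF f] pre[OF g] have fg: "f \<oplus>\<^bsub>D\<^esub> g = restrict (pair (pre f \<oplus>\<^bsub>U0\<^esub> pre g)) (carrier H)"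
    by (auto simp: D_simps fun_eq_iff linear_form_add[OF pair_lin])
  show "f \<oplus>\<^bsub>D\<^esub> g \<in> carrier D"
    unfolding fg using pre(1)[OF f] pre(1)[OF g] by (intro pair_dual closedU)
next
  have "restrict (pair \<zero>\<^bsub>U0\<^esub>) (carrier H) = \<zero>\<^bsub>D\<^esub>"
    by (auto simp: D_simps fun_eq_iff linear_form_zero[OF spU pair_lin])
  then show "\<zero>\<^bsub>D\<^esub> \<in> carrier D" using pair_dual[OF closedU(3)] by simp
next
  fix c f assume f: "f \<in> carrier D"
  have cf: "c \<odot>\<^bsub>D\<^esub> f = restrict (pair (c \<odot>\<^bsub>U0\<^esub> pre f)) (carrier H)"
    using pre[OF f] by (auto simp: D_simps fun_eq_iff linear_form_smult[OF pair_lin])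
  show "c \<odot>\<^bsub>D\<^esub> f \<in> carrier D"
    unfolding cf using pre(1)[OF f] by (intro pair_dual closedU)
qed (auto simp: D_simps fun_eq_iff algebra_simps extensional_def linear_form_def closed)

lemma pre_restrict: "u \<in> carrier U0 \<Longrightarrow> pre (restrict (pair u) (carrier H)) = u"
  by (rule pre_eqI) (simp_all add: pair_dual)

lemma D_eq_restrict: "f \<in> carrier D \<Longrightarrow> f = restrict (pair (pre f)) (carrier H)"
  by (auto simp: fun_eq_iff pre) (auto simp: D_simps extensional_def)

lemma pre_bij: "bij_betw pre (carrier D) (carrier U0)"
  by (rule bij_betw_byWitness[where f' = "\<lambda>u. restrict (pair u) (carrier H)"])
    (auto simp: pre pre_restrict pair_dual D_eq_restrict[symmetric])

lemma sepD: "separating D (eval_forms (\<lambda>f. f) (carrier H))"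
  unfolding separating_def
proof (intro conjI ballI impI)
  fix F :: "('a \<Rightarrow> 'k) \<Rightarrow> 'k" assume "F \<in> eval_forms (\<lambda>f. f) (carrier H)"
  then show "linear_form D F" by (auto simp: eval_forms_def linear_form_def D_simps)
next
  fix f assume f: "f \<in> carrier D" and 0: "\<forall>F\<in>eval_forms (\<lambda>f. f) (carrier H). F f = 0"
  have "f x = 0" if "x \<in> carrier H" for x using 0 that by (auto simp: eval_forms_def)
  then show "f = \<zero>\<^bsub>D\<^esub>" using f by (auto simp: D_simps fun_eq_iff extensional_def)
qed

lemma bilinear_evalD: "x \<in> carrier H \<Longrightarrow> y \<in> carrier H \<Longrightarrow> bilinear_form D D (\<lambda>a b. a x * b y)"
  by (auto intro!: bilinear_mult simp: linear_form_def D_simps)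

text \<open>Justifies the definite description in \<open>graded_dual\<close>: existence is
  \<open>dual_comult\<close>, uniqueness holds because evaluations at elements of \<open>H\<close>
  separate tensors.\<close>

lemma comult_D:
  assumes f: "f \<in> carrier D"
  shows "comult D f \<in> tensors D D"
    "x \<in> carrier H \<Longrightarrow> y \<in> carrier H \<Longrightarrow> comult D f (\<lambda>a b. a x * b y) = f (x \<otimes> y)"
proof -
  let ?P = "\<lambda>T. T \<in> tensors D D
        \<and> (\<forall>x\<in>carrier H. \<forall>y\<in>carrier H. T (\<lambda>g h. g x * h y) = f (x \<otimes> y))"
  obtain L where L: "set L \<subseteq> carrier D \<times> carrier D"
    "\<And>x y. x \<in> carrier H \<Longrightarrow> y \<in> carrier H \<Longrightarrow> f (x \<otimes> y) = (\<Sum>(a, b)\<leftarrow>L. a x * b y)"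
    using dual_comult[OF f] by blast
  have "comult D f = (THE T. ?P T)"
    by (simp add: graded_dual_def Let_def)
  moreover have "?P (THE T. ?P T)"
  proof (rule theI[where a = "tensor_sum D D L"])
    show P: "?P (tensor_sum D D L)"
      using L by (auto simp: tensor_carrier tensor_sum_eval bilinear_evalD)
    show "S = tensor_sum D D L" if "?P S" for S
    proof (rule separatingD[OF separating_tensor[OF spD spD sepD sepD] kspace_tensor_product[OF spD spD]])
      show "F S = F (tensor_sum D D L)"
        if "F \<in> tensor_forms (eval_forms (\<lambda>f. f) (carrier H)) (eval_forms (\<lambda>f. f) (carrier H))" for F
        using that \<open>?P S\<close> P by (auto simp: tensor_forms_def eval_forms_def)
    qed (use that P in auto)
  qed
  ultimately show "comult D f \<in> tensors D D"
    "x \<in> carrier H \<Longrightarrow> y \<in> carrier H \<Longrightarrow> comult D f (\<lambda>a b. a x * b y) = f (x \<otimes> y)"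
    by auto
qed

theorem pre_hopf_iso: "pre \<in> hopf_iso D dual_hopf"
proof -
  have prod: "f \<otimes>\<^bsub>D\<^esub> g = restrict (pair (pre f \<otimes>\<^bsub>U0\<^esub> pre g)) (carrier H)"
    if "f \<in> carrier D" "g \<in> carrier D" for f g
  proof (rule ext)
    fix x
    show "(f \<otimes>\<^bsub>D\<^esub> g) x = restrict (pair (pre f \<otimes>\<^bsub>U0\<^esub> pre g)) (carrier H) x"
    proof (cases "x \<in> carrier H")
      case True
      have "comult H x (\<lambda>a b. f a * g b) = comult H x (\<lambda>a b. pair (pre f) a * pair (pre g) b)"
        using that by (intro comult_cong[OF True]) (simp add: pre)
      with True that show ?thesis by (simp add: D_simps(2) pair_mult pre)
    qed (simp add: D_simps(2))
  qed
  have lin: "lin_map D dual_hopf pre"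
  proof (rule lin_mapI)
    fix f g assume f: "f \<in> carrier D" and g: "g \<in> carrier D"
    show "pre (f \<oplus>\<^bsub>D\<^esub> g) = pre f \<oplus>\<^bsub>dual_hopf\<^esub> pre g"
      using f g kspace_closed[OF spD]
      by (intro pre_eqI) (auto simp: closedU pre linear_form_add[OF pair_lin], simp add: D_simps)
  next
    fix c f assume f: "f \<in> carrier D"
    show "pre (c \<odot>\<^bsub>D\<^esub> f) = c \<odot>\<^bsub>dual_hopf\<^esub> pre f"
      using f kspace_closed[OF spD]
      by (intro pre_eqI) (auto simp: closedU pre linear_form_smult[OF pair_lin], simp add: D_simps)
  qed (simp add: pre)
  have one: "\<one>\<^bsub>D\<^esub> = restrict (pair \<one>\<^bsub>U0\<^esub>) (carrier H)"
    by (auto simp: D_simps fun_eq_iff pair_one)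
  have "pre \<in> ring_hom D dual_hopf"
  proof (rule ring_hom_memI)
    fix f g assume f: "f \<in> carrier D" and g: "g \<in> carrier D"
    show "pre (f \<otimes>\<^bsub>D\<^esub> g) = pre f \<otimes>\<^bsub>dual_hopf\<^esub> pre g"
      using f g by (simp add: prod pre_restrict pre closedU)
    show "pre (f \<oplus>\<^bsub>D\<^esub> g) = pre f \<oplus>\<^bsub>dual_hopf\<^esub> pre g"
      using lin f g by (simp add: lin_map_def)
  qed (simp_all add: pre one pre_restrict closedU)
  moreover have "tensor_lift D D (tensor_product dual_hopf dual_hopf)
      (\<lambda>a b. pure_tensor dual_hopf dual_hopf (pre a) (pre b)) (comult D f) = comult dual_hopf (pre f)"
    if f: "f \<in> carrier D" for f
  proof -
    have pt: "pure_tensor dual_hopf dual_hopf = pure_tensor U0 U0"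
      by (simp add: pure_tensor_def fun_eq_iff)
    show ?thesis
      unfolding pt dual_simps
    proof (rule tensor_lift_eqI[OF spD spD kspace_tensor_product[OF spU spU] sepUU comult_D(1)[OF f],
          where \<beta> = "\<lambda>F a b. F (pure_tensor U0 U0 (pre a) (pre b))"])
      fix F assume F: "F \<in> tensor_forms (eval_forms pair (carrier H)) (eval_forms pair (carrier H))"
      then obtain x y where xy: "x \<in> carrier H" "y \<in> carrier H" "F = (\<lambda>T. T (\<lambda>a b. pair a x * pair b y))"
        by (auto simp: tensor_forms_def eval_forms_def)
      have eq: "F (pure_tensor U0 U0 (pre a) (pre b)) = a x * b y" if "a \<in> carrier D" "b \<in> carrier D" for a b
        using that xy by (simp add: pure_tensor_eval bilinear_pair pre)
      show "bilinear_form D D (\<lambda>a b. F (pure_tensor U0 U0 (pre a) (pre b)))"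
        using bilinear_form_cong[OF spD spD, of "\<lambda>a b. F (pure_tensor U0 U0 (pre a) (pre b))" "\<lambda>a b. a x * b y"]
          eq bilinear_evalD[OF xy(1,2)] by simp
      have "comult D f (\<lambda>a b. F (pure_tensor U0 U0 (pre a) (pre b))) = comult D f (\<lambda>a b. a x * b y)"
        by (rule tensor_cong[OF spD spD comult_D(1)[OF f]]) (rule eq)
      then show "comult D f (\<lambda>a b. F (pure_tensor U0 U0 (pre a) (pre b))) = F (comult dual_hopf (pre f))"
        using f xy by (simp add: comult_D comult_dual pre closed)
    qed (use f in \<open>auto simp: pure_tensor_closed pre comult_dual\<close>)
  qed
  moreover have "counit dual_hopf (pre f) = counit D f" if "f \<in> carrier D" for f
    using that by (simp add: pre closed D_simps(7))
  moreover have "antipode dual_hopf (pre f) = pre (antipode D f)" if f: "f \<in> carrier D" for f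
  proof -
    have a: "antipode D f \<in> carrier D" using dual_antipode[OF f] by (simp add: D_simps(8))
    show ?thesis
      by (rule U_eqI) (simp_all add: pre f a antipode_dual antipode_closed, simp add: D_simps(8))
  qed
  ultimately show ?thesis
    unfolding hopf_iso_def ring_iso_def using lin pre_bij by simp
qed

end

section \<open>Polynomials as finitely supported functions on monomials\<close>

abbreviation keys where "keys \<equiv> Poly_Mapping.keys"
abbreviation lookup where "lookup \<equiv> Poly_Mapping.lookup"
abbreviation single where "single \<equiv> Poly_Mapping.single"
abbreviation scale where "scale c \<equiv> Poly_Mapping.map ((*) c)"

lemma keys_empty_iff: "keys P = {} \<longleftrightarrow> P = 0"
  by (auto simp: in_keys_iff intro!: poly_mapping_eqI)

type_synonym 'x mon = "'x \<Rightarrow>\<^sub>0 nat"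

lemma finite_bounded_mons:
  assumes "finite A"
  shows "finite {m :: 'x mon. keys m \<subseteq> A \<and> (\<forall>x. lookup m x \<le> k)}"
proof (rule finite_imageD[of lookup])
  have "lookup ` {m :: 'x mon. keys m \<subseteq> A \<and> (\<forall>x. lookup m x \<le> k)}
    \<subseteq> {f. \<forall>x. (x \<in> A \<longrightarrow> f x \<in> {..k}) \<and> (x \<notin> A \<longrightarrow> f x = 0)}"
  proof (rule image_subsetI, rule CollectI, intro allI conjI impI)
    fix m :: "'x mon" and x
    assume m: "m \<in> {m. keys m \<subseteq> A \<and> (\<forall>x. lookup m x \<le> k)}"
    then show "lookup m x \<in> {..k}" by simp
    show "lookup m x = 0" if "x \<notin> A"
    proof -
      have "x \<notin> keys m" using m that by auto
      then show ?thesis by (simp add: not_in_keys_iff_lookup_eq_zero)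
    qed
  qed
  then show "finite (lookup ` {m :: 'x mon. keys m \<subseteq> A \<and> (\<forall>x. lookup m x \<le> k)})"
    by (rule finite_subset) (rule finite_set_of_finite_funs[OF assms finite_atMost])
  show "inj_on lookup {m :: 'x mon. keys m \<subseteq> A \<and> (\<forall>x. lookup m x \<le> k)}"
    by (rule inj_onI) simp
qed

text \<open>A summand has no other variables than the sum, and its exponents are bounded by the
  total degree. This makes products of power series finite sums in each coefficient.\<close>

lemma finite_mon_summands: "finite {a :: 'x mon. \<exists>b. a + b = m}"
proof -
  have "{a. \<exists>b. a + b = m} \<subseteq> {a. keys a \<subseteq> keys m \<and> (\<forall>x. lookup a x \<le> (\<Sum>y\<in>keys m. lookup m y))}"
  proof safe
    fix a b :: "'x mon" and x
    assume x: "x \<in> keys a"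
    then show "x \<in> keys (a + b)" by (simp add: in_keys_iff lookup_add)
  next
    fix a b :: "'x mon" and x
    show "lookup a x \<le> (\<Sum>y\<in>keys (a + b). lookup (a + b) y)"
    proof (cases "x \<in> keys (a + b)")
      case True
      have "lookup a x \<le> lookup (a + b) x" by (simp add: lookup_add)
      also have "\<dots> \<le> (\<Sum>y\<in>keys (a + b). lookup (a + b) y)"
        using True by (intro member_le_sum) auto
      finally show ?thesis .
    qed (simp add: in_keys_iff lookup_add)
  qed
  then show ?thesis by (rule finite_subset) (simp add: finite_bounded_mons)
qed

lemma finite_mon_sum: "finite {(a, b). a + b = (m :: 'x mon)}"
proof (rule finite_subset)
  show "{(a, b). a + b = m} \<subseteq> (\<lambda>a. (a, m - a)) ` {a. \<exists>b. a + b = m}" by force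
qed (simp add: finite_mon_summands)

definition mon_size :: "'x mon \<Rightarrow> nat" where
  "mon_size m = (\<Sum>x\<in>keys m. lookup m x)"

lemma mon_size_superset: "finite A \<Longrightarrow> keys m \<subseteq> A \<Longrightarrow> mon_size m = (\<Sum>x\<in>A. lookup m x)"
  unfolding mon_size_def by (rule sum.mono_neutral_left) (auto simp: in_keys_iff)

lemma keys_add_nat: "keys (a + b :: 'x mon) = keys a \<union> keys b"
  by (auto simp: in_keys_iff lookup_add)

lemma mon_size_add: "mon_size (a + b) = mon_size a + mon_size b"
  using mon_size_superset[of "keys (a + b)"]
  by (simp add: keys_add_nat lookup_add sum.distrib)

lemma mon_size_single [simp]: "mon_size (single x k) = k"
  by (cases "k = 0") (auto simp: mon_size_def)

lemma mon_size_0 [simp]: "mon_size 0 = 0"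
  by (simp add: mon_size_def)

lemma mon_size_eq_0 [simp]: "mon_size m = 0 \<longleftrightarrow> m = 0"
proof
  assume "mon_size m = 0"
  then have "\<forall>x\<in>keys m. lookup m x = 0" by (simp add: mon_size_def)
  then have "keys m = {}" by (metis equals0I lookup_eq_zero_in_keys_contradict)
  then show "m = 0" by (simp add: keys_empty_iff)
qed simp

lemma mon_decomp:
  assumes "x \<in> keys m"
  shows "m = (m - single x 1) + single x (1 :: nat)"
  using assms
  by (intro poly_mapping_eqI) (auto simp: lookup_add lookup_minus lookup_single in_keys_iff when_def)

lemma mon_induct [consumes 1, case_names zero add]:
  assumes "keys (m :: 'x mon) \<subseteq> X" "P 0"
    and "\<And>m x. P m \<Longrightarrow> keys m \<subseteq> X \<Longrightarrow> x \<in> X \<Longrightarrow> P (m + single x 1)"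
  shows "P m"
  using assms(1)
proof (induction "mon_size m" arbitrary: m)
  case 0 then show ?case using assms(2) by simp
next
  case (Suc k)
  then have "m \<noteq> 0" by auto
  then obtain x where x: "x \<in> keys m" using keys_empty_iff[of m] by blast
  let ?m = "m - single x 1"
  have m: "m = ?m + single x 1" by (rule mon_decomp[OF x])
  have "mon_size m = mon_size ?m + 1" by (subst m) (simp only: mon_size_add mon_size_single)
  moreover have "keys m = keys ?m \<union> {x}" by (subst m) (simp only: keys_add_nat, simp)
  ultimately have "P ?m" "keys ?m \<subseteq> X" using Suc by auto
  then have "P (?m + single x 1)" using x Suc by (intro assms(3)) auto
  then show ?case using m by simp
qed

section \<open>Evaluation of polynomials\<close>

definition meval :: "('x \<Rightarrow> 'k::comm_semiring_1) \<Rightarrow> 'x mon \<Rightarrow> 'k" where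
  "meval g m = (\<Prod>x\<in>keys m. g x ^ lookup m x)"

lemma meval_superset: "finite A \<Longrightarrow> keys m \<subseteq> A \<Longrightarrow> meval g m = (\<Prod>x\<in>A. g x ^ lookup m x)"
  unfolding meval_def by (rule prod.mono_neutral_left) (auto simp: in_keys_iff)

lemma meval_add: "meval g (a + b) = meval g a * meval g b"
  using meval_superset[of "keys (a + b)" a g] meval_superset[of "keys (a + b)" b g]
    meval_superset[of "keys (a + b)" "a + b" g]
  by (simp add: keys_add_nat lookup_add power_add prod.distrib)

lemma meval_0 [simp]: "meval g 0 = 1" by (simp add: meval_def)

lemma meval_single [simp]: "meval g (single x k) = g x ^ k"
  by (cases "k = 0") (auto simp: meval_def)

type_synonym ('x, 'k) mpoly = "'x mon \<Rightarrow>\<^sub>0 'k"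

definition peval :: "('x \<Rightarrow> 'k::field) \<Rightarrow> ('x, 'k) mpoly \<Rightarrow> 'k" where
  "peval g P = (\<Sum>m\<in>keys P. lookup P m * meval g m)"

lemma linear_sum_superset:
  "finite A \<Longrightarrow> keys (P :: 'a \<Rightarrow>\<^sub>0 'k::field) \<subseteq> A \<Longrightarrow> (\<Sum>m\<in>keys P. lookup P m * f m) = (\<Sum>m\<in>A. lookup P m * f m)"
  by (rule sum.mono_neutral_left) (auto simp: in_keys_iff)

lemma linear_sum_add:
  "(\<Sum>m\<in>keys (P + Q). lookup (P + Q) m * f m)
    = (\<Sum>m\<in>keys P. lookup P m * f m) + (\<Sum>m\<in>keys Q. lookup Q m * (f m :: 'k::field))"
  using linear_sum_superset[of "keys P \<union> keys Q" "P + Q" f] linear_sum_superset[of "keys P \<union> keys Q" P f]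
    linear_sum_superset[of "keys P \<union> keys Q" Q f] Poly_Mapping.keys_add[of P Q]
  by (simp add: lookup_add sum.distrib algebra_simps)

lemma lookup_map_mult [simp]: "lookup (scale c P) m = c * (lookup P m :: 'k::field)"
  by transfer (auto simp: when_def)

lemma keys_map_mult: "keys (scale c (P :: 'a \<Rightarrow>\<^sub>0 'k::field)) \<subseteq> keys P"
  by (auto simp: in_keys_iff)

lemma linear_sum_map:
  "(\<Sum>m\<in>keys (scale c P). lookup (scale c P) m * f m)
    = c * (\<Sum>m\<in>keys P. lookup P m * (f m :: 'k::field))"
  using linear_sum_superset[of "keys P" "scale c P" f] keys_map_mult[of c P]
  by (simp add: sum_distrib_left mult.assoc)

lemma poly_mapping_sum_singles: "(P :: 'a \<Rightarrow>\<^sub>0 'k::comm_monoid_add) = (\<Sum>m\<in>keys P. single m (lookup P m))"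
proof (rule poly_mapping_eqI)
  fix k
  have "lookup (\<Sum>m\<in>keys P. single m (lookup P m)) k = (\<Sum>m\<in>keys P. if k = m then lookup P k else 0)"
    by (auto simp: lookup_sum lookup_single when_def intro!: sum.cong)
  then show "lookup P k = lookup (\<Sum>m\<in>keys P. single m (lookup P m)) k"
    by (simp add: in_keys_iff)
qed

lemma poly_mapping_induct [consumes 1, case_names zero single add]:
  assumes "keys (P :: 'a \<Rightarrow>\<^sub>0 'k::field) \<subseteq> K" "Q 0" "\<And>(m :: 'a) c. m \<in> K \<Longrightarrow> Q (single m c)"
    "\<And>P P'. Q P \<Longrightarrow> Q P' \<Longrightarrow> keys P \<subseteq> K \<Longrightarrow> keys P' \<subseteq> K \<Longrightarrow> Q (P + P')"
  shows "Q P"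
proof -
  have "Q (\<Sum>m\<in>A. single m (lookup P m)) \<and> keys (\<Sum>m\<in>A. single m (lookup P m)) \<subseteq> K"
    if "finite A" "A \<subseteq> keys P" for A
    using that
  proof (induction A)
    case (insert m A)
    then have "m \<in> K" using assms(1) by auto
    moreover have "keys (single m (lookup P m)) \<subseteq> K" using \<open>m \<in> K\<close> by simp
    moreover have "Q (\<Sum>m\<in>A. single m (lookup P m))" "keys (\<Sum>m\<in>A. single m (lookup P m)) \<subseteq> K"
      using insert by auto
    ultimately have "Q (single m (lookup P m) + (\<Sum>m\<in>A. single m (lookup P m)))"
      "keys (single m (lookup P m) + (\<Sum>m\<in>A. single m (lookup P m))) \<subseteq> K"
      using assms(4)[OF assms(3)[OF \<open>m \<in> K\<close>]]
        order_trans[OF Poly_Mapping.keys_add[of "single m (lookup P m)" "\<Sum>m\<in>A. single m (lookup P m)"]]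
      by blast+
    then show ?case using insert(1,2) by simp
  qed (simp add: assms)
  from this[of "keys P"] show ?thesis using poly_mapping_sum_singles[of P] by simp
qed

lemma peval_0 [simp]: "peval g 0 = 0"
  by (simp add: peval_def)

lemma peval_add: "peval g (P + Q) = peval g P + peval g Q"
  unfolding peval_def by (rule linear_sum_add)

lemma peval_single [simp]: "peval g (single m c) = c * meval g m"
  by (cases "c = 0") (auto simp: peval_def)

lemma peval_map [simp]: "peval g (scale c P) = c * peval g P"
  unfolding peval_def by (rule linear_sum_map)

lemma peval_1 [simp]: "peval g 1 = 1"
  unfolding single_one[symmetric] by (simp del: single_one)

lemma peval_mult: "peval g (P * Q) = peval g P * peval g Q"
  using subset_UNIV[of "keys P"]
proof (induction P rule: poly_mapping_induct)
  case (single m c)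
  show ?case
    using subset_UNIV[of "keys Q"]
    by (induction Q rule: poly_mapping_induct)
      (simp_all add: mult_single meval_add peval_add distrib_left)
qed (simp_all add: peval_add distrib_right)

lemma peval_cong:
  assumes "\<And>m x. m \<in> keys P \<Longrightarrow> x \<in> keys m \<Longrightarrow> g x = h x"
  shows "peval g P = peval h P"
  unfolding peval_def meval_def using assms by (intro sum.cong prod.cong refl arg_cong2[of _ _ _ _ "(*)"]) auto

text \<open>Distinct monomials differ after doubling a suitable coordinate, as characters do in Dedekind's lemma.\<close>

lemma peval_eq_0_imp:
  fixes P :: "('x, 'k::field_char_0) mpoly"
  assumes "\<And>g. (\<And>x. \<exists>k. g x = of_nat k) \<Longrightarrow> peval g P = 0"
  shows "P = 0"
  using assms
proof (induction "card (keys P)" arbitrary: P rule: less_induct)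
  case less
  show ?case
  proof (rule ccontr)
    assume "P \<noteq> 0"
    then obtain m where m: "m \<in> keys P" using keys_empty_iff[of P] by blast
    show False
    proof (cases "keys P = {m}")
      case True
      have "peval (\<lambda>_. 1) P = lookup P m" by (simp add: peval_def True meval_def)
      moreover have "peval (\<lambda>_. 1) P = 0" by (rule less.prems) (rule exI[of _ 1], simp)
      ultimately show False using m by (simp add: in_keys_iff)
    next
      case False
      then obtain m' where m': "m' \<in> keys P" "m' \<noteq> m" using m by auto
      then obtain x where x: "lookup m' x \<noteq> lookup m x" using poly_mapping_eqI[of m' m] by blast
      \<comment> \<open>\<open>Q\<close> is \<open>P\<close> with \<open>x\<close> doubled, minus
        \<open>2 ^ lookup m x\<close> times \<open>P\<close>. It loses the monomial
        \<open>m\<close>, keeps \<open>m'\<close> because the powers of 2 are distinct in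
        characteristic zero, and still vanishes at all points with natural coordinates, which
        doubling preserves.\<close>
      define t where "t k = (2 :: 'k) ^ lookup k x - 2 ^ lookup m x" for k :: "'x mon"
      define Q where "Q = (\<Sum>k\<in>keys P. single k (lookup P k * t k))"
      have lQ: "lookup Q k = lookup P k * t k" for k
      proof -
        have "lookup Q k = (\<Sum>j\<in>keys P. if k = j then lookup P k * t k else 0)"
          unfolding Q_def by (auto simp: lookup_sum lookup_single when_def intro!: sum.cong)
        then show ?thesis by (simp add: in_keys_iff)
      qed
      have sub: "keys Q \<subseteq> keys P - {m}" by (auto simp: in_keys_iff lQ t_def)
      then have "card (keys Q) < card (keys P)"
        using m by (intro psubset_card_mono) auto
      moreover have "peval g Q = 0" if g: "\<And>x. \<exists>k. g x = of_nat k" for g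
      proof -
        let ?g = "g(x := 2 * g x)"
        have g': "\<exists>k. ?g y = of_nat k" for y
        proof (cases "y = x")
          case True
          obtain k where "g x = of_nat k" using g by blast
          then show ?thesis using True by (intro exI[of _ "2 * k"]) simp
        qed (use g in simp)
        have scale: "meval ?g k = 2 ^ lookup k x * meval g k" for k
        proof -
          have "meval ?g k = (\<Prod>y\<in>insert x (keys k). (if y = x then 2 ^ lookup k x else 1) * g y ^ lookup k y)"
            unfolding meval_superset[of "insert x (keys k)" k, OF finite.insertI[OF finite_keys] subset_insertI]
            by (intro prod.cong) (auto simp: power_mult_distrib)
          also have "\<dots> = 2 ^ lookup k x * meval g k"
            unfolding meval_superset[of "insert x (keys k)" k, OF finite.insertI[OF finite_keys] subset_insertI]
            by (simp only: prod.distrib) (simp add: prod.insert_remove)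
          finally show ?thesis .
        qed
        have "peval g Q = (\<Sum>k\<in>keys P. lookup Q k * meval g k)"
          unfolding peval_def using sub by (intro linear_sum_superset) auto
        also have "\<dots> = (\<Sum>k\<in>keys P. lookup P k * (2 ^ lookup k x * meval g k))
            - 2 ^ lookup m x * (\<Sum>k\<in>keys P. lookup P k * meval g k)"
          by (simp add: lQ t_def sum_subtractf sum_distrib_left algebra_simps)
        also have "(\<Sum>k\<in>keys P. lookup P k * (2 ^ lookup k x * meval g k)) = (\<Sum>k\<in>keys P. lookup P k * meval ?g k)"
          by (simp only: scale)
        also have "(\<Sum>k\<in>keys P. lookup P k * meval ?g k) - 2 ^ lookup m x * (\<Sum>k\<in>keys P. lookup P k * meval g k)
            = peval ?g P - 2 ^ lookup m x * peval g P"
          by (simp only: peval_def)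
        also have "\<dots> = 0" by (simp only: less.prems[OF g'] less.prems[OF g] mult_zero_right diff_self)
        finally show ?thesis .
      qed
      ultimately have "Q = 0" by (rule less.hyps)
      moreover have "lookup Q m' \<noteq> 0"
      proof -
        have "(2 :: 'k) ^ lookup m' x \<noteq> 2 ^ lookup m x"
        proof
          assume "(2 :: 'k) ^ lookup m' x = 2 ^ lookup m x"
          then have "of_nat (2 ^ lookup m' x) = (of_nat (2 ^ lookup m x) :: 'k)" by simp
          then show False using x by (simp only: of_nat_eq_iff) simp
        qed
        then show ?thesis using m' by (simp add: lQ t_def in_keys_iff)
      qed
      ultimately show False by simp
    qed
  qed
qed

definition var :: "'x \<Rightarrow> ('x, 'k::field) mpoly" where
  "var x = single (single x 1) 1"

lemma peval_var [simp]: "peval g (var x) = g x"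
  by (simp add: var_def)

lemma single_add_var: "single (m + single x 1) c = single m c * (var x :: ('x, 'k::field) mpoly)"
  by (simp add: var_def mult_single)

section \<open>Graded polynomial algebras\<close>

definition poly_algebra :: "'x set \<Rightarrow> ('k::field, ('x, 'k) mpoly) module" where
  "poly_algebra X = \<lparr>carrier = {P. \<forall>m\<in>keys P. keys m \<subseteq> X}, mult = (*), one = 1, zero = 0, add = (+),
     smult = scale\<rparr>"

lemma poly_algebra_simps [simp]:
  "mult (poly_algebra X) = (*)" "one (poly_algebra X) = 1" "zero (poly_algebra X) = 0"
  "add (poly_algebra X) = (+)" "smult (poly_algebra X) = scale"
  by (simp_all add: poly_algebra_def)

lemma poly_carrier: "P \<in> carrier (poly_algebra X) \<longleftrightarrow> keys P \<subseteq> {m. keys m \<subseteq> X}"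
  by (auto simp: poly_algebra_def)

lemma poly_closed:
  "P \<in> carrier (poly_algebra X) \<Longrightarrow> Q \<in> carrier (poly_algebra X) \<Longrightarrow> P + Q \<in> carrier (poly_algebra X)"
  "P \<in> carrier (poly_algebra X) \<Longrightarrow> Q \<in> carrier (poly_algebra X) \<Longrightarrow> P * Q \<in> carrier (poly_algebra X)"
  "P \<in> carrier (poly_algebra X) \<Longrightarrow> scale c P \<in> carrier (poly_algebra X)"
  "0 \<in> carrier (poly_algebra X)" "1 \<in> carrier (poly_algebra X)"
  "keys m \<subseteq> X \<Longrightarrow> single m c \<in> carrier (poly_algebra X)"
  "x \<in> X \<Longrightarrow> var x \<in> carrier (poly_algebra X)"
proof -
  show "P + Q \<in> carrier (poly_algebra X)" if "P \<in> carrier (poly_algebra X)" "Q \<in> carrier (poly_algebra X)"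
    using that Poly_Mapping.keys_add[of P Q] by (auto simp: poly_carrier)
  show "P * Q \<in> carrier (poly_algebra X)" if "P \<in> carrier (poly_algebra X)" "Q \<in> carrier (poly_algebra X)"
    unfolding poly_carrier
  proof
    fix m assume "m \<in> keys (P * Q)"
    then obtain a b where "m = a + b" "a \<in> keys P" "b \<in> keys Q" using keys_mult[of P Q] by blast
    then show "m \<in> {m. keys m \<subseteq> X}" using that by (auto simp: poly_carrier keys_add_nat)
  qed
  show "P \<in> carrier (poly_algebra X) \<Longrightarrow> scale c P \<in> carrier (poly_algebra X)"
    using keys_map_mult[of c P] by (auto simp: poly_carrier)
qed (auto simp: poly_carrier var_def)

lemma map_mult_add:
  "scale c (P + Q) = scale c P + scale c (Q :: 'a \<Rightarrow>\<^sub>0 'k::field)"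
  "scale ((c + d)) P = scale c P + scale d P"
  "scale ((c * d)) P = scale c (scale d P)"
  "scale 1 P = P"
  "scale (- 1) P = - P"
  by (rule poly_mapping_eqI, simp add: lookup_add algebra_simps)+

lemma poly_assoc_algebra: "assoc_algebra (poly_algebra X :: ('k::field, ('x, 'k) mpoly) module)"
  and poly_cring: "cring (poly_algebra X :: ('k::field, ('x, 'k) mpoly) module)"
proof -
  let ?A = "poly_algebra X :: ('k::field, ('x, 'k) mpoly) module"
  have sp: "kspace ?A"
    by (rule kspaceI) (simp_all add: poly_closed map_mult_add algebra_simps)
  show "cring ?A"
  proof (rule cringI)
    show "abelian_group ?A" using sp by (simp add: Module.module_def)
    show "Group.comm_monoid ?A" by (rule comm_monoidI) (simp_all add: poly_closed algebra_simps)
  qed (simp add: algebra_simps)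
  then interpret cring ?A .
  show "assoc_algebra ?A"
    unfolding assoc_algebra_def using sp ring_axioms
    by (simp add: mult_map_scale_conv_mult algebra_simps)
qed

lemma linear_form_poly:
  assumes "linear_form (poly_algebra X) f" "P \<in> carrier (poly_algebra X)"
  shows "f P = (\<Sum>m\<in>keys P. lookup P m * f (single m 1))"
proof -
  have sp: "kspace (poly_algebra X)" using poly_assoc_algebra by (rule assoc_algebraD)
  from assms(2) have "keys P \<subseteq> {m. keys m \<subseteq> X}" by (simp add: poly_carrier)
  then show ?thesis
  proof (induction P rule: poly_mapping_induct)
    case zero show ?case using linear_form_zero[OF sp assms(1)] by simp
  next
    case (single m c)
    have "single m c = scale c (single m 1)" by simp
    then have "f (single m c) = c * f (single m 1)"
      using linear_form_smult[OF assms(1), of "single m 1" c] single by (simp add: poly_closed)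
    then show ?case by (cases "c = 0") auto
  next
    case (add P P')
    then show ?case using linear_form_add[OF assms(1), of P P'] unfolding linear_sum_add
      by (simp add: poly_carrier)
  qed
qed

text \<open>Exponents carry the convolution product of \<open>poly_mapping\<close>, for which
  \<open>of_nat k * \<alpha>\<close> is the \<open>k\<close>-fold sum of \<alpha>.\<close>

definition wdeg :: "('x \<Rightarrow> expo) \<Rightarrow> 'x mon \<Rightarrow> expo" where
  "wdeg d m = (\<Sum>x\<in>keys m. of_nat (lookup m x) * d x)"

lemma wdeg_superset: "finite A \<Longrightarrow> keys m \<subseteq> A \<Longrightarrow> wdeg d m = (\<Sum>x\<in>A. of_nat (lookup m x) * d x)"
  unfolding wdeg_def by (rule sum.mono_neutral_left) (auto simp: in_keys_iff)

lemma wdeg_add: "wdeg d (a + b) = wdeg d a + wdeg d b"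
  using wdeg_superset[of "keys (a + b)"]
  by (simp add: keys_add_nat lookup_add sum.distrib distrib_right)

lemma wdeg_0 [simp]: "wdeg d 0 = 0" by (simp add: wdeg_def)

lemma wdeg_single [simp]: "wdeg d (single x k) = of_nat k * d x"
  by (cases "k = 0") (auto simp: wdeg_def)

definition hcomp :: "'x set \<Rightarrow> ('x \<Rightarrow> expo) \<Rightarrow> expo \<Rightarrow> ('x, 'k::field) mpoly set" where
  "hcomp X d \<alpha> = {P \<in> carrier (poly_algebra X). \<forall>m\<in>keys P. wdeg d m = \<alpha>}"

lemma hcomp_closed:
  "P \<in> hcomp X d \<alpha> \<Longrightarrow> Q \<in> hcomp X d \<alpha> \<Longrightarrow> P + Q \<in> hcomp X d \<alpha>"
  "P \<in> hcomp X d \<alpha> \<Longrightarrow> Q \<in> hcomp X d \<beta> \<Longrightarrow> P * Q \<in> hcomp X d (\<alpha> + \<beta>)"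
  "P \<in> hcomp X d \<alpha> \<Longrightarrow> scale c P \<in> hcomp X d \<alpha>"
  "0 \<in> hcomp X d \<alpha>" "1 \<in> hcomp X d 0"
  "keys m \<subseteq> X \<Longrightarrow> single m c \<in> hcomp X d (wdeg d m)"
  "x \<in> X \<Longrightarrow> var x \<in> hcomp X d (d x)"
proof -
  show "P + Q \<in> hcomp X d \<alpha>" if "P \<in> hcomp X d \<alpha>" "Q \<in> hcomp X d \<alpha>"
    using that Poly_Mapping.keys_add[of P Q] by (auto simp: hcomp_def poly_closed)
  show "P * Q \<in> hcomp X d (\<alpha> + \<beta>)" if "P \<in> hcomp X d \<alpha>" "Q \<in> hcomp X d \<beta>"
  proof -
    have "wdeg d m = \<alpha> + \<beta>" if m: "m \<in> keys (P * Q)" for m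
    proof -
      from m obtain a b where "m = a + b" "a \<in> keys P" "b \<in> keys Q" using keys_mult[of P Q] by blast
      then show ?thesis using \<open>P \<in> _\<close> \<open>Q \<in> _\<close> by (simp add: hcomp_def wdeg_add)
    qed
    then show ?thesis using that by (auto simp: hcomp_def poly_closed)
  qed
  show "P \<in> hcomp X d \<alpha> \<Longrightarrow> scale c P \<in> hcomp X d \<alpha>"
    using keys_map_mult[of c P] by (auto simp: hcomp_def poly_closed)
qed (auto simp: hcomp_def poly_closed var_def)

lemma hcomp_carrier: "P \<in> hcomp X d \<alpha> \<Longrightarrow> P \<in> carrier (poly_algebra X)"
  by (simp add: hcomp_def)

text \<open>Isolates an induction over polynomials that is used twice: for functions of two group
  elements given by homogeneous tensors, which yields the coproduct, and for functions of one group
  element given by homogeneous polynomials, which yields the antipode.\<close>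

lemma peval_in_graded_family:
  assumes one: "PF 0 (\<lambda>s. 1)" and zero: "\<And>\<alpha>. PF \<alpha> (\<lambda>s. 0)"
    and add: "\<And>\<alpha> f g. PF \<alpha> f \<Longrightarrow> PF \<alpha> g \<Longrightarrow> PF \<alpha> (\<lambda>s. f s + g s)"
    and cmult: "\<And>\<alpha> c f. PF \<alpha> f \<Longrightarrow> PF \<alpha> (\<lambda>s. c * f s)"
    and mult: "\<And>\<alpha> \<beta> f g. PF \<alpha> f \<Longrightarrow> PF \<beta> g \<Longrightarrow> PF (\<alpha> + \<beta>) (\<lambda>s. f s * g s)"
    and vars: "\<And>x. x \<in> X \<Longrightarrow> PF (d x) (\<lambda>s. \<xi> s x)"
    and P: "P \<in> hcomp X d \<gamma>"
  shows "PF \<gamma> (\<lambda>s. peval (\<xi> s) P :: 'k::field)"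
proof -
  have mon: "PF (wdeg d m) (\<lambda>s. meval (\<xi> s) m)" if "keys m \<subseteq> X" for m
    using that
  proof (induction m rule: mon_induct)
    case zero then show ?case using one by simp
  next
    case (add m x)
    then show ?case using mult[OF add(1) vars[OF add(3)]] by (simp add: meval_add wdeg_add)
  qed
  have "keys P \<subseteq> {m. keys m \<subseteq> X \<and> wdeg d m = \<gamma>}" using P by (auto simp: hcomp_def poly_carrier)
  then show ?thesis
  proof (induction P rule: poly_mapping_induct)
    case zero then show ?case using \<open>\<And>\<alpha>. PF \<alpha> (\<lambda>s. 0)\<close> by simp
  next
    case (single m c) then show ?case using cmult[OF mon] by auto
  next
    case (add P P') then show ?case by (simp add: peval_add assms(3))
  qed
qed

section \<open>Linear spans and subspaces\<close>

lemma lin_span_superset: "S \<subseteq> lin_span M S"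
  unfolding lin_span_def by (rule hull_subset)

lemma lin_span_minimal: "submodule W scalars M \<Longrightarrow> S \<subseteq> W \<Longrightarrow> lin_span M S \<subseteq> W"
  unfolding lin_span_def by (rule hull_minimal)

lemma lin_span_induct:
  assumes "\<And>W. submodule W scalars M \<Longrightarrow> S \<subseteq> W \<Longrightarrow> x \<in> W"
  shows "x \<in> lin_span M S"
  using assms by (auto simp: lin_span_def hull_def)

lemma submoduleI':
  assumes sp: "kspace M" and "W \<subseteq> carrier M" "\<zero>\<^bsub>M\<^esub> \<in> W"
    "\<And>x y. x \<in> W \<Longrightarrow> y \<in> W \<Longrightarrow> x \<oplus>\<^bsub>M\<^esub> y \<in> W" "\<And>c x. x \<in> W \<Longrightarrow> c \<odot>\<^bsub>M\<^esub> x \<in> W"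
  shows "submodule W scalars M"
proof -
  interpret Module.module scalars M by fact
  have "\<ominus>\<^bsub>M\<^esub> a \<in> W" if "a \<in> W" for a
    using that assms(2) assms(5)[OF that, of "- 1"] kspace_minus_one[OF sp, of a] by auto
  with assms show ?thesis by (intro submoduleI) auto
qed

lemma submoduleD:
  assumes sp: "kspace M" and W: "submodule W scalars M"
  shows "W \<subseteq> carrier M" "\<zero>\<^bsub>M\<^esub> \<in> W" "x \<in> W \<Longrightarrow> y \<in> W \<Longrightarrow> x \<oplus>\<^bsub>M\<^esub> y \<in> W" "x \<in> W \<Longrightarrow> c \<odot>\<^bsub>M\<^esub> x \<in> W"
proof -
  interpret Module.module scalars M by fact
  show "W \<subseteq> carrier M" using submoduleE(1)[OF W] .
  show "x \<in> W \<Longrightarrow> y \<in> W \<Longrightarrow> x \<oplus>\<^bsub>M\<^esub> y \<in> W" using submoduleE(5)[OF W] .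
  show s: "x \<in> W \<Longrightarrow> c \<odot>\<^bsub>M\<^esub> x \<in> W" for x c using submoduleE(4)[OF W] by simp
  obtain z where z: "z \<in> W" using submoduleE(2)[OF W] by auto
  then have "0 \<odot>\<^bsub>M\<^esub> z = \<zero>\<^bsub>M\<^esub>" using smult_l_null[of z] \<open>W \<subseteq> carrier M\<close> by auto
  with s[OF z, of 0] show "\<zero>\<^bsub>M\<^esub> \<in> W" by simp
qed

lemma submodule_lin_span:
  assumes sp: "kspace M" and S: "S \<subseteq> carrier M"
  shows "submodule (lin_span M S) scalars M"
proof (rule submoduleI'[OF sp])
  interpret Module.module scalars M by fact
  show "lin_span M S \<subseteq> carrier M" by (rule lin_span_minimal[OF carrier_is_submodule S])
qed (auto intro!: lin_span_induct intro: submoduleD[OF sp] dest: lin_span_minimal subsetD)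

section \<open>Groups with polynomial coordinates\<close>

lemma sum_list_mult_pairs:
  "(\<Sum>(a, b)\<leftarrow>L. f a b) * (\<Sum>(a, b)\<leftarrow>L'. g a b) = (\<Sum>(a, b)\<leftarrow>L. \<Sum>(a', b')\<leftarrow>L'. f a b * g a' b' :: 'k::comm_semiring_0)"
  by (induction L) (auto simp: distrib_right sum_list_pair_cmult)

lemma expos_closed:
  "0 \<in> expos n" "\<alpha> \<in> expos n \<Longrightarrow> \<beta> \<in> expos n \<Longrightarrow> \<alpha> + \<beta> \<in> expos n"
  "\<alpha> \<in> expos n \<Longrightarrow> of_nat k * \<alpha> \<in> expos n"
  "\<alpha> + \<beta> \<in> expos n \<Longrightarrow> \<alpha> \<in> expos n" "\<alpha> + \<beta> \<in> expos n \<Longrightarrow> \<beta> \<in> expos n"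
proof -
  show add: "\<alpha> \<in> expos n \<Longrightarrow> \<beta> \<in> expos n \<Longrightarrow> \<alpha> + \<beta> \<in> expos n" for \<alpha> \<beta>
    by (simp add: expos_def keys_add_nat)
  show "\<alpha> \<in> expos n \<Longrightarrow> of_nat k * \<alpha> \<in> expos n"
    by (induction k) (auto simp: distrib_right add, simp add: expos_def)
qed (auto simp: expos_def keys_add_nat)

lemma total_degree_eq: "total_degree = mon_size"
  by (simp add: fun_eq_iff total_degree_def mon_size_def)

lemma finsum_poly_algebra:
  assumes "finite S" "\<And>i. i \<in> S \<Longrightarrow> f i \<in> carrier (poly_algebra X)" "abelian_monoid M"
    "carrier M = carrier (poly_algebra X)" "add M = (+)" "zero M = (0 :: ('x, 'k::field) mpoly)"
  shows "finsum M f S = sum f S"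
proof -
  interpret abelian_monoid M by fact
  from assms(1,2) show ?thesis
  proof (induction S)
    case empty then show ?case using assms(6) finsum_empty[of f] by simp
  next
    case (insert i S)
    then have "finsum M f (insert i S) = f i \<oplus>\<^bsub>M\<^esub> finsum M f S"
      using assms(4) by (intro finsum_insert) auto
    with insert assms(5) show ?case by simp
  qed
qed

text \<open>The coordinates identify the group with the space of all functions on \<open>X\<close>,
  so that its elements are all the points at which polynomials in these coordinates are evaluated.
  Nonzero degrees, each taken by finitely many coordinates, make the homogeneous components
  finite-dimensional; homogeneity of the group law makes coproduct and antipode respect the
  grading.\<close>

locale graded_coord_group =
  fixes n :: nat and X :: "'x set" and deg :: "'x \<Rightarrow> expo" and \<Gamma> :: "('g, 'c) monoid_scheme"
    and \<kappa> :: "'g \<Rightarrow> 'x \<Rightarrow> 'k::field_char_0"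
  assumes grp: "Group.group \<Gamma>"
    and deg: "\<And>x. x \<in> X \<Longrightarrow> deg x \<in> expos n" "\<And>x. x \<in> X \<Longrightarrow> deg x \<noteq> 0"
    and fin_deg: "\<And>\<alpha>. finite {x \<in> X. deg x = \<alpha>}"
    and coord_surj: "\<And>\<phi>. \<exists>g\<in>carrier \<Gamma>. \<forall>x\<in>X. \<kappa> g x = \<phi> x"
    and coord_inj: "\<And>g h. g \<in> carrier \<Gamma> \<Longrightarrow> h \<in> carrier \<Gamma> \<Longrightarrow> (\<And>x. x \<in> X \<Longrightarrow> \<kappa> g x = \<kappa> h x) \<Longrightarrow> g = h"
    and coord_one: "\<And>x. x \<in> X \<Longrightarrow> \<kappa> \<one>\<^bsub>\<Gamma>\<^esub> x = 0"
    and coord_mult: "\<And>x. x \<in> X \<Longrightarrow> \<exists>L. (\<forall>(a, b)\<in>set L. \<exists>\<alpha> \<beta>. \<alpha> + \<beta> = deg x \<and> a \<in> hcomp X deg \<alpha> \<and> b \<in> hcomp X deg \<beta>)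
        \<and> (\<forall>g\<in>carrier \<Gamma>. \<forall>h\<in>carrier \<Gamma>. \<kappa> (g \<otimes>\<^bsub>\<Gamma>\<^esub> h) x = (\<Sum>(a, b)\<leftarrow>L. peval (\<kappa> g) a * peval (\<kappa> h) b))"
    and coord_inv: "\<And>x. x \<in> X \<Longrightarrow> \<exists>P\<in>hcomp X deg (deg x). \<forall>g\<in>carrier \<Gamma>. \<kappa> (inv\<^bsub>\<Gamma>\<^esub> g) x = peval (\<kappa> g) P"
begin

abbreviation "A \<equiv> poly_algebra X :: ('k, ('x, 'k) mpoly) module"
abbreviation "Hc \<equiv> hcomp X deg :: expo \<Rightarrow> ('x, 'k) mpoly set"
abbreviation "ev g \<equiv> peval (\<kappa> g)"

lemmas algA = poly_assoc_algebra[where 'k = 'k, of X]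
lemmas spA = assoc_algebraD(1)[OF algA]

lemma wdeg_expos: "keys m \<subseteq> X \<Longrightarrow> wdeg deg m \<in> expos n"
  by (induction m rule: mon_induct) (simp_all add: expos_closed(1,2) wdeg_add deg)

text \<open>Each occurrence of a variable contributes a nonzero degree. Together with
  \<open>fin_deg\<close> this leaves finitely many monomials of a given weight.\<close>

lemma lookup_le_wdeg:
  assumes "keys m \<subseteq> X"
  shows "lookup m x \<le> mon_size (wdeg deg m)"
  using assms
proof (induction m rule: mon_induct)
  case (add m y)
  have "mon_size (deg y) > 0" using deg(2)[OF add(3)] by (cases "mon_size (deg y)") auto
  moreover have "lookup (m + single y 1) x \<le> lookup m x + 1"
    by (simp add: lookup_add lookup_single when_def)
  moreover have "mon_size (wdeg deg (m + single y 1)) = mon_size (wdeg deg m) + mon_size (deg y)"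
    by (simp add: wdeg_add mon_size_add)
  ultimately show ?case using add(1) by linarith
qed simp

lemma finite_mons_deg: "finite {m. keys m \<subseteq> X \<and> wdeg deg m = \<alpha>}"
proof -
  \<comment> \<open>Only variables whose degree is a summand of \<alpha> can occur in a monomial of
    weight \<alpha>.\<close>
  let ?A = "\<Union>\<beta>\<in>{\<beta>. \<exists>\<delta>. \<beta> + \<delta> = \<alpha>}. {x \<in> X. deg x = \<beta>}"
  have fin: "finite ?A" using finite_mon_summands fin_deg by blast
  have "{m. keys m \<subseteq> X \<and> wdeg deg m = \<alpha>} \<subseteq> {m. keys m \<subseteq> ?A \<and> (\<forall>x. lookup m x \<le> mon_size \<alpha>)}"
  proof safe
    fix m x assume m: "keys m \<subseteq> X" "\<alpha> = wdeg deg m" and x: "x \<in> keys m"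
    have "wdeg deg m = wdeg deg (m - single x 1) + deg x"
      by (subst mon_decomp[OF x]) (simp add: wdeg_add)
    then have "deg x + wdeg deg (m - single x 1) = wdeg deg m" by (simp add: add.commute)
    then show "x \<in> (\<Union>\<beta>\<in>{\<beta>. \<exists>\<delta>. \<beta> + \<delta> = wdeg deg m}. {x \<in> X. deg x = \<beta>})" using m x by auto
  qed (use lookup_le_wdeg in auto)
  then show ?thesis by (rule finite_subset) (rule finite_bounded_mons[OF fin])
qed

lemma lf_ev: "linear_form A (ev g)"
  by (simp add: linear_form_def peval_add)

lemma bil_ev: "bilinear_form A A (\<lambda>a b. ev g a * ev h b)"
  by (intro bilinear_mult lf_ev)

text \<open>By \<open>coord_surj\<close> every point is the coordinate vector of a group element,
  and a polynomial vanishing at all points is zero by \<open>peval_eq_0_imp\<close>.\<close>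

lemma sep_ev: "separating A (ev ` carrier \<Gamma>)"
  unfolding separating_def
proof (intro conjI ballI impI)
  fix P assume P: "P \<in> carrier A" and 0: "\<forall>f\<in>ev ` carrier \<Gamma>. f P = 0"
  have "peval \<phi> P = 0" for \<phi>
  proof -
    obtain g where g: "g \<in> carrier \<Gamma>" "\<And>x. x \<in> X \<Longrightarrow> \<kappa> g x = \<phi> x" using coord_surj[of \<phi>] by auto
    have "peval \<phi> P = ev g P" using P by (intro peval_cong g(2)[symmetric]) (auto simp: poly_carrier)
    then show ?thesis using 0 g by auto
  qed
  then show "P = \<zero>\<^bsub>A\<^esub>" by (simp add: peval_eq_0_imp)
qed (auto simp: lf_ev)

definition graded_tensors :: "expo \<Rightarrow> ('k, ('x, 'k) mpoly, ('x, 'k) mpoly) tensor set" where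
  "graded_tensors \<gamma> = {pure_tensor A A a b | a b \<alpha> \<beta>. \<alpha> \<in> expos n \<and> \<beta> \<in> expos n \<and> \<alpha> + \<beta> = \<gamma> \<and> a \<in> Hc \<alpha> \<and> b \<in> Hc \<beta>}"

lemma graded_tensors_closed: "graded_tensors \<gamma> \<subseteq> tensors A A"
  by (auto simp: graded_tensors_def intro!: pure_tensor_closed dest: hcomp_carrier)

lemma spAA: "kspace (tensor_product A A)" by (intro kspace_tensor_product spA)

text \<open>Existence of the coproduct and its homogeneity are obtained together: the functions of
  two group elements given by lists of pairs with degrees adding up to \<gamma> form a graded
  algebra, and the coordinates of a product of two elements belong to it.\<close>

lemma comult_graded:
  assumes P: "P \<in> Hc \<gamma>" and \<gamma>: "\<gamma> \<in> expos n"
  shows "\<exists>T\<in>lin_span (tensor_product A A) (graded_tensors \<gamma>).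
    \<forall>g\<in>carrier \<Gamma>. \<forall>h\<in>carrier \<Gamma>. T (\<lambda>a b. ev g a * ev h b) = ev (g \<otimes>\<^bsub>\<Gamma>\<^esub> h) P"
proof -
  define GP where "GP \<gamma> = {L :: (('x, 'k) mpoly \<times> ('x, 'k) mpoly) list.
    \<forall>(a, b)\<in>set L. \<exists>\<alpha> \<beta>. \<alpha> + \<beta> = \<gamma> \<and> a \<in> Hc \<alpha> \<and> b \<in> Hc \<beta>}" for \<gamma>
  define PF where "PF \<gamma> \<phi> \<longleftrightarrow> (\<exists>L\<in>GP \<gamma>. \<forall>g\<in>carrier \<Gamma>. \<forall>h\<in>carrier \<Gamma>. \<phi> (g, h) = (\<Sum>(a, b)\<leftarrow>L. ev g a * ev h b))"
    for \<gamma> and \<phi> :: "'g \<times> 'g \<Rightarrow> 'k"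
  have "PF \<gamma> (\<lambda>s. peval (\<kappa> (fst s \<otimes>\<^bsub>\<Gamma>\<^esub> snd s)) P)"
  proof (rule peval_in_graded_family[OF _ _ _ _ _ _ P])
    have "[(1, 1)] \<in> GP 0" by (auto simp: GP_def hcomp_closed intro!: exI[of _ 0])
    then show "PF 0 (\<lambda>s. 1)" unfolding PF_def by (intro bexI[of _ "[(1, 1)]"]) auto
    have "[] \<in> GP \<alpha>" for \<alpha> by (simp add: GP_def)
    then show "PF \<alpha> (\<lambda>s. 0)" for \<alpha> unfolding PF_def by (intro bexI[of _ "[]"]) auto
    show "PF \<alpha> (\<lambda>s. f s + g s)" if "PF \<alpha> f" "PF \<alpha> g" for \<alpha> f g
    proof -
      from that obtain L L' where L: "L \<in> GP \<alpha>" "\<forall>x\<in>carrier \<Gamma>. \<forall>h\<in>carrier \<Gamma>. f (x, h) = (\<Sum>(a, b)\<leftarrow>L. ev x a * ev h b)"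
        and L': "L' \<in> GP \<alpha>" "\<forall>x\<in>carrier \<Gamma>. \<forall>h\<in>carrier \<Gamma>. g (x, h) = (\<Sum>(a, b)\<leftarrow>L'. ev x a * ev h b)"
        unfolding PF_def by blast
      have "L @ L' \<in> GP \<alpha>" using L(1) L'(1) by (auto simp: GP_def)
      with L L' show ?thesis unfolding PF_def by (intro bexI[of _ "L @ L'"]) auto
    qed
    show "PF \<alpha> (\<lambda>s. c * f s)" if "PF \<alpha> f" for \<alpha> c f
    proof -
      from that obtain L where L: "L \<in> GP \<alpha>" "\<forall>x\<in>carrier \<Gamma>. \<forall>h\<in>carrier \<Gamma>. f (x, h) = (\<Sum>(a, b)\<leftarrow>L. ev x a * ev h b)"
        unfolding PF_def by blast
      have "map (\<lambda>(a, b). (scale c a, b)) L \<in> GP \<alpha>"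
        using L(1) by (fastforce simp: GP_def hcomp_closed)
      with L show ?thesis unfolding PF_def
        by (intro bexI[of _ "map (\<lambda>(a, b). (scale c a, b)) L"])
          (auto simp: split_def o_def sum_list_const_mult[symmetric] mult.assoc)
    qed
    show "PF (\<alpha> + \<beta>) (\<lambda>s. f s * g s)" if "PF \<alpha> f" "PF \<beta> g" for \<alpha> \<beta> f g
    proof -
      from that obtain L L' where L: "L \<in> GP \<alpha>" "\<forall>x\<in>carrier \<Gamma>. \<forall>h\<in>carrier \<Gamma>. f (x, h) = (\<Sum>(a, b)\<leftarrow>L. ev x a * ev h b)"
        and L': "L' \<in> GP \<beta>" "\<forall>x\<in>carrier \<Gamma>. \<forall>h\<in>carrier \<Gamma>. g (x, h) = (\<Sum>(a, b)\<leftarrow>L'. ev x a * ev h b)"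
        unfolding PF_def by blast
      let ?K = "concat (map (\<lambda>(a, b). map (\<lambda>(a', b'). (a * a', b * b')) L') L)"
      have "?K \<in> GP (\<alpha> + \<beta>)"
        unfolding GP_def
      proof (rule CollectI, rule ballI, clarify)
        fix u v assume "(u, v) \<in> set ?K"
        then obtain a b a' b' where ab: "(a, b) \<in> set L" "(a', b') \<in> set L'" "u = a * a'" "v = b * b'" by auto
        from ab L(1) obtain \<alpha>1 \<beta>1 where 1: "\<alpha>1 + \<beta>1 = \<alpha>" "a \<in> Hc \<alpha>1" "b \<in> Hc \<beta>1" by (auto simp: GP_def)
        from ab L'(1) obtain \<alpha>2 \<beta>2 where 2: "\<alpha>2 + \<beta>2 = \<beta>" "a' \<in> Hc \<alpha>2" "b' \<in> Hc \<beta>2" by (auto simp: GP_def)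
        show "\<exists>\<alpha>' \<beta>'. \<alpha>' + \<beta>' = \<alpha> + \<beta> \<and> u \<in> Hc \<alpha>' \<and> v \<in> Hc \<beta>'"
          using 1 2 ab(3,4) hcomp_closed(2)[OF 1(2) 2(2)] hcomp_closed(2)[OF 1(3) 2(3)]
          by (intro exI[of _ "\<alpha>1 + \<alpha>2"] exI[of _ "\<beta>1 + \<beta>2"]) (auto simp: ac_simps)
      qed
      moreover have "(\<Sum>(a, b)\<leftarrow>L. ev x a * ev h b) * (\<Sum>(a, b)\<leftarrow>L'. ev x a * ev h b) = (\<Sum>(a, b)\<leftarrow>?K. ev x a * ev h b)" for x h
        unfolding sum_list_mult_pairs sum_list_product[where f = "(*)" and g = "(*)"] peval_mult
        by (simp only: ac_simps)
      ultimately show ?thesis using L L' unfolding PF_def by (intro bexI[of _ ?K]) auto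
    qed
    show "PF (deg x) (\<lambda>s. \<kappa> (fst s \<otimes>\<^bsub>\<Gamma>\<^esub> snd s) x)" if "x \<in> X" for x
      using coord_mult[OF that] by (auto simp: PF_def GP_def)
  qed
  then obtain L where L: "L \<in> GP \<gamma>" "\<And>g h. g \<in> carrier \<Gamma> \<Longrightarrow> h \<in> carrier \<Gamma> \<Longrightarrow>
      ev (g \<otimes>\<^bsub>\<Gamma>\<^esub> h) P = (\<Sum>(a, b)\<leftarrow>L. ev g a * ev h b)" by (auto simp: PF_def)
  note W = submoduleD[OF spAA submodule_lin_span[OF spAA graded_tensors_closed[of \<gamma>]]]
  from L(1) have "tensor_sum A A L \<in> lin_span (tensor_product A A) (graded_tensors \<gamma>)"
  proof (induction L)
    case Nil
    then show ?case using W(2) by (simp add: tensor_sum_def)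
  next
    case (Cons p L)
    obtain a b where p: "p = (a, b)" by (cases p)
    from Cons(2) have "L \<in> GP \<gamma>" by (simp add: GP_def)
    moreover from Cons(2) obtain \<alpha> \<beta> where "\<alpha> + \<beta> = \<gamma>" "a \<in> Hc \<alpha>" "b \<in> Hc \<beta>" by (auto simp: GP_def p)
    then have "pure_tensor A A a b \<in> lin_span (tensor_product A A) (graded_tensors \<gamma>)"
      using \<gamma> expos_closed(4,5)[of \<alpha> \<beta> n] lin_span_superset[of "graded_tensors \<gamma>"] by (fastforce simp: graded_tensors_def)
    ultimately show ?case
      using W(3)[of "pure_tensor A A a b" "tensor_sum A A L"] Cons(1) by (simp add: p tensor_sum_def)
  qed
  then show ?thesis
    using L(2) by (intro bexI[of _ "tensor_sum A A L"]) (auto simp: tensor_sum_eval bil_ev)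
qed

lemma antipode_graded:
  assumes P: "P \<in> Hc \<gamma>"
  shows "\<exists>Q\<in>Hc \<gamma>. \<forall>g\<in>carrier \<Gamma>. ev g Q = ev (inv\<^bsub>\<Gamma>\<^esub> g) P"
proof -
  define PF where "PF \<gamma> \<phi> \<longleftrightarrow> (\<exists>Q\<in>Hc \<gamma>. \<forall>g\<in>carrier \<Gamma>. \<phi> g = ev g Q)" for \<gamma> and \<phi> :: "'g \<Rightarrow> 'k"
  have "PF \<gamma> (\<lambda>g. peval (\<kappa> (inv\<^bsub>\<Gamma>\<^esub> g)) P)"
  proof (rule peval_in_graded_family[OF _ _ _ _ _ _ P])
    show "PF 0 (\<lambda>s. 1)" unfolding PF_def by (intro bexI[of _ 1]) (auto simp: hcomp_closed)
    show "PF \<alpha> (\<lambda>s. 0)" for \<alpha> unfolding PF_def by (intro bexI[of _ 0]) (auto simp: hcomp_closed)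
    show "PF \<alpha> (\<lambda>s. f s + g s)" if "PF \<alpha> f" "PF \<alpha> g" for \<alpha> f g
    proof -
      from that obtain Q Q' where "Q \<in> Hc \<alpha>" "Q' \<in> Hc \<alpha>" "\<forall>x\<in>carrier \<Gamma>. f x = ev x Q" "\<forall>x\<in>carrier \<Gamma>. g x = ev x Q'"
        unfolding PF_def by blast
      then show ?thesis unfolding PF_def by (intro bexI[of _ "Q + Q'"]) (auto simp: peval_add hcomp_closed)
    qed
    show "PF \<alpha> (\<lambda>s. c * f s)" if "PF \<alpha> f" for \<alpha> c f
    proof -
      from that obtain Q where "Q \<in> Hc \<alpha>" "\<forall>x\<in>carrier \<Gamma>. f x = ev x Q" unfolding PF_def by blast
      then show ?thesis unfolding PF_def by (intro bexI[of _ "scale c Q"]) (auto simp: hcomp_closed)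
    qed
    show "PF (\<alpha> + \<beta>) (\<lambda>s. f s * g s)" if "PF \<alpha> f" "PF \<beta> g" for \<alpha> \<beta> f g
    proof -
      from that obtain Q Q' where "Q \<in> Hc \<alpha>" "Q' \<in> Hc \<beta>" "\<forall>x\<in>carrier \<Gamma>. f x = ev x Q" "\<forall>x\<in>carrier \<Gamma>. g x = ev x Q'"
        unfolding PF_def by blast
      then show ?thesis unfolding PF_def by (intro bexI[of _ "Q * Q'"]) (auto simp: peval_mult hcomp_closed)
    qed
    show "PF (deg x) (\<lambda>g. \<kappa> (inv\<^bsub>\<Gamma>\<^esub> g) x)" if "x \<in> X" for x
      using coord_inv[OF that] by (auto simp: PF_def)
  qed
  then show ?thesis by (auto simp: PF_def)
qed

text \<open>Coproduct and antipode are pinned down by their values on group elements: existence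
  comes from the polynomial group law, uniqueness from \<open>sep_ev\<close>.\<close>

definition coord_hopf :: "('k, ('x, 'k) mpoly) hopf" where
  "coord_hopf = module.extend A
     \<lparr>comult = (\<lambda>P. THE T. T \<in> tensors A A
        \<and> (\<forall>g\<in>carrier \<Gamma>. \<forall>h\<in>carrier \<Gamma>. T (\<lambda>a b. ev g a * ev h b) = ev (g \<otimes>\<^bsub>\<Gamma>\<^esub> h) P)),
      counit = ev \<one>\<^bsub>\<Gamma>\<^esub>,
      antipode = (\<lambda>P. THE Q. Q \<in> carrier A \<and> (\<forall>g\<in>carrier \<Gamma>. ev g Q = ev (inv\<^bsub>\<Gamma>\<^esub> g) P))\<rparr>"

lemma coord_simps [simp]:
  "carrier coord_hopf = carrier A" "mult coord_hopf = (*)" "one coord_hopf = 1"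
  "zero coord_hopf = 0" "add coord_hopf = (+)" "smult coord_hopf = scale"
  "tensor_product coord_hopf coord_hopf = tensor_product A A"
  "pure_tensor coord_hopf coord_hopf = pure_tensor A A"
  "linear_form coord_hopf = linear_form A"
  "bilinear_form coord_hopf coord_hopf = bilinear_form A A"
  "counit coord_hopf = ev \<one>\<^bsub>\<Gamma>\<^esub>"
  by (simp_all add: coord_hopf_def pure_tensor_def fun_eq_iff)

lemma AA_eqI:
  assumes "S \<in> tensors A A" "T \<in> tensors A A"
    and "\<And>g h. g \<in> carrier \<Gamma> \<Longrightarrow> h \<in> carrier \<Gamma> \<Longrightarrow> S (\<lambda>a b. ev g a * ev h b) = T (\<lambda>a b. ev g a * ev h b)"
  shows "S = T"
  using assms by (intro separatingD[OF separating_tensor[OF spA spA sep_ev sep_ev] spAA]) (auto simp: tensor_forms_def)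

lemma A_eqI:
  assumes "P \<in> carrier A" "Q \<in> carrier A" "\<And>g. g \<in> carrier \<Gamma> \<Longrightarrow> ev g P = ev g Q"
  shows "P = Q"
  using assms by (intro separatingD[OF sep_ev spA]) auto

text \<open>A polynomial is a sum of single terms, and these are homogeneous, so that
  \<open>comult_graded\<close> applies to each of them.\<close>

lemma comult_exists:
  assumes "P \<in> carrier A"
  shows "\<exists>T. T \<in> tensors A A
        \<and> (\<forall>g\<in>carrier \<Gamma>. \<forall>h\<in>carrier \<Gamma>. T (\<lambda>a b. ev g a * ev h b) = ev (g \<otimes>\<^bsub>\<Gamma>\<^esub> h) P)"
  using assms unfolding poly_carrier
proof (induction P rule: poly_mapping_induct)
  case zero
  show ?case using kspace_closed(3)[OF spAA] by (intro exI[of _ "\<lambda>\<beta>. 0"]) auto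
next
  case (single m c)
  then have m: "keys m \<subseteq> X" by simp
  show ?case
    using comult_graded[OF hcomp_closed(6)[OF m] wdeg_expos[OF m], of c]
      submoduleD(1)[OF spAA submodule_lin_span[OF spAA graded_tensors_closed]] by blast
next
  case (add P P')
  then obtain T T' where "T \<in> tensors A A" "T' \<in> tensors A A"
    "\<forall>g\<in>carrier \<Gamma>. \<forall>h\<in>carrier \<Gamma>. T (\<lambda>a b. ev g a * ev h b) = ev (g \<otimes>\<^bsub>\<Gamma>\<^esub> h) P"
    "\<forall>g\<in>carrier \<Gamma>. \<forall>h\<in>carrier \<Gamma>. T' (\<lambda>a b. ev g a * ev h b) = ev (g \<otimes>\<^bsub>\<Gamma>\<^esub> h) P'" by blast
  then show ?case
    using kspace_closed(2)[OF spAA, of T T'] by (intro exI[of _ "\<lambda>\<beta>. T \<beta> + T' \<beta>"]) (auto simp: peval_add)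
qed

lemma comult_coord:
  assumes "P \<in> carrier A"
  shows "comult coord_hopf P \<in> tensors A A"
    "g \<in> carrier \<Gamma> \<Longrightarrow> h \<in> carrier \<Gamma> \<Longrightarrow> comult coord_hopf P (\<lambda>a b. ev g a * ev h b) = ev (g \<otimes>\<^bsub>\<Gamma>\<^esub> h) P"
proof -
  let ?P = "\<lambda>T. T \<in> tensors A A
        \<and> (\<forall>g\<in>carrier \<Gamma>. \<forall>h\<in>carrier \<Gamma>. T (\<lambda>a b. ev g a * ev h b) = ev (g \<otimes>\<^bsub>\<Gamma>\<^esub> h) P)"
  obtain T where T: "?P T" using comult_exists[OF assms] by blast
  have "?P (comult coord_hopf P)"
    unfolding coord_hopf_def hopf_extend_simps
  proof (rule theI[where a = T])
    show "?P T" by (rule T)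
    show "S = T" if "?P S" for S using that T by (intro AA_eqI) auto
  qed
  then show "comult coord_hopf P \<in> tensors A A"
    "g \<in> carrier \<Gamma> \<Longrightarrow> h \<in> carrier \<Gamma> \<Longrightarrow> comult coord_hopf P (\<lambda>a b. ev g a * ev h b) = ev (g \<otimes>\<^bsub>\<Gamma>\<^esub> h) P" by auto
qed

lemma antipode_exists:
  assumes "P \<in> carrier A"
  shows "\<exists>Q. Q \<in> carrier A \<and> (\<forall>g\<in>carrier \<Gamma>. ev g Q = ev (inv\<^bsub>\<Gamma>\<^esub> g) P)"
  using assms unfolding poly_carrier
proof (induction P rule: poly_mapping_induct)
  case zero
  show ?case by (intro exI[of _ 0]) auto
next
  case (single m c)
  then have m: "keys m \<subseteq> X" by simp
  show ?case
    using antipode_graded[OF hcomp_closed(6)[OF m], of c] unfolding poly_carrier[symmetric] by (blast dest: hcomp_carrier)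
next
  case (add P P')
  then obtain Q Q' where "Q \<in> carrier A" "Q' \<in> carrier A" "\<forall>g\<in>carrier \<Gamma>. ev g Q = ev (inv\<^bsub>\<Gamma>\<^esub> g) P"
    "\<forall>g\<in>carrier \<Gamma>. ev g Q' = ev (inv\<^bsub>\<Gamma>\<^esub> g) P'" unfolding poly_carrier by blast
  then show ?case unfolding poly_carrier[symmetric]
    by (intro exI[of _ "Q + Q'"]) (auto simp: peval_add poly_closed)
qed

lemma antipode_coord:
  assumes "P \<in> carrier A"
  shows "antipode coord_hopf P \<in> carrier A"
    "g \<in> carrier \<Gamma> \<Longrightarrow> ev g (antipode coord_hopf P) = ev (inv\<^bsub>\<Gamma>\<^esub> g) P"
proof -
  let ?P = "\<lambda>Q. Q \<in> carrier A \<and> (\<forall>g\<in>carrier \<Gamma>. ev g Q = ev (inv\<^bsub>\<Gamma>\<^esub> g) P)"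
  obtain Q where Q: "?P Q" using antipode_exists[OF assms] by blast
  have "?P (antipode coord_hopf P)"
    unfolding coord_hopf_def hopf_extend_simps
  proof (rule theI[where a = Q])
    show "?P Q" by (rule Q)
    show "S = Q" if "?P S" for S using that Q by (intro A_eqI) auto
  qed
  then show "antipode coord_hopf P \<in> carrier A"
    "g \<in> carrier \<Gamma> \<Longrightarrow> ev g (antipode coord_hopf P) = ev (inv\<^bsub>\<Gamma>\<^esub> g) P" by auto
qed

lemma alg_coord: "assoc_algebra coord_hopf"
  unfolding coord_hopf_def by (rule assoc_algebra_extend[OF algA])

lemma sep_coord: "separating coord_hopf (ev ` carrier \<Gamma>)"
  using sep_ev by (simp add: separating_def)

theorem hopf_coord: "hopf_algebra coord_hopf"
proof (rule function_hopf_algebra[OF grp alg_coord sep_coord])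
  show "ev g \<in> ring_hom coord_hopf scalars" for g
    by (rule ring_hom_memI) (auto simp: peval_add peval_mult)
qed (simp_all add: comult_coord antipode_coord)

lemma separated_hopf_coord: "separated_hopf coord_hopf"
proof
  show "hopf_algebra coord_hopf" by (rule hopf_coord)
  have "ev ` carrier \<Gamma> \<subseteq> {f. linear_form coord_hopf f}" by (auto simp: lf_ev)
  then show "separating coord_hopf {f. linear_form coord_hopf f}"
    using sep_coord unfolding separating_def by blast
qed

lemma cring_coord: "cring coord_hopf"
proof -
  interpret ring coord_hopf using alg_coord by (rule assoc_algebraD)
  show ?thesis by unfold_locales (simp add: mult.commute)
qed

text \<open>The identity of the group is the origin of the coordinates, where only the constant term
  survives.\<close>

lemma ev_one_eq:
  assumes "P \<in> carrier A"
  shows "ev \<one>\<^bsub>\<Gamma>\<^esub> P = lookup P 0"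
proof -
  have "meval (\<kappa> \<one>\<^bsub>\<Gamma>\<^esub>) m = (if m = 0 then 1 else 0)" if "keys m \<subseteq> X" for m
    using that
  proof (induction m rule: mon_induct)
    case (add m x)
    have "mon_size (m + single x 1) \<noteq> 0" by (simp only: mon_size_add mon_size_single)
    then have "m + single x 1 \<noteq> 0" by (simp only: mon_size_eq_0 not_False_eq_True)
    with add(3) show ?case by (simp add: meval_add coord_one)
  qed simp
  then have "ev \<one>\<^bsub>\<Gamma>\<^esub> P = (\<Sum>m\<in>keys P. lookup P m * (if m = 0 then 1 else 0))"
    using assms unfolding peval_def poly_carrier by (intro sum.cong) auto
  also have "\<dots> = (\<Sum>m\<in>keys P. if m = 0 then lookup P 0 else 0)" by (intro sum.cong) auto
  also have "\<dots> = lookup P 0" by (simp add: in_keys_iff)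
  finally show ?thesis .
qed

lemma submodule_hcomp: "submodule (Hc \<alpha>) scalars coord_hopf"
  by (rule submoduleI'[OF assoc_algebraD(1)[OF alg_coord]]) (auto simp: hcomp_closed dest: hcomp_carrier)

lemma hcomp_span: "Hc \<alpha> = lin_span coord_hopf ((\<lambda>m. single m 1) ` {m. keys m \<subseteq> X \<and> wdeg deg m = \<alpha>})"
  (is "_ = lin_span _ ?S")
proof
  show "lin_span coord_hopf ?S \<subseteq> Hc \<alpha>"
    by (rule lin_span_minimal[OF submodule_hcomp]) (auto intro: hcomp_closed)
  show "Hc \<alpha> \<subseteq> lin_span coord_hopf ?S"
  proof
    fix P assume P: "P \<in> Hc \<alpha>"
    have S: "?S \<subseteq> carrier coord_hopf" by (auto simp: poly_closed)
    note w = submoduleD[OF assoc_algebraD(1)[OF alg_coord] submodule_lin_span[OF assoc_algebraD(1)[OF alg_coord] S], simplified]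
    from P have "keys P \<subseteq> {m. keys m \<subseteq> X \<and> wdeg deg m = \<alpha>}" by (auto simp: hcomp_def poly_carrier)
    then show "P \<in> lin_span coord_hopf ?S"
    proof (induction P rule: poly_mapping_induct)
      case (single m c)
      then have "single m 1 \<in> lin_span coord_hopf ?S"
        using lin_span_superset[of ?S] by blast
      from w(4)[OF this, of c] show ?case by simp
    qed (simp_all add: w)
  qed
qed

definition hpart :: "expo \<Rightarrow> ('x, 'k) mpoly \<Rightarrow> ('x, 'k) mpoly" where
  "hpart \<alpha> P = (\<Sum>m\<in>{m \<in> keys P. wdeg deg m = \<alpha>}. single m (lookup P m))"

lemma lookup_hpart: "lookup (hpart \<alpha> P) m = (if wdeg deg m = \<alpha> then lookup P m else 0)"
proof -
  have "lookup (hpart \<alpha> P) m = (\<Sum>k\<in>{k \<in> keys P. wdeg deg k = \<alpha>}. if m = k then lookup P m else 0)"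
    unfolding hpart_def by (auto simp: lookup_sum lookup_single when_def intro!: sum.cong)
  then show ?thesis by (simp add: in_keys_iff)
qed

lemma hpart_hcomp: "P \<in> carrier A \<Longrightarrow> hpart \<alpha> P \<in> Hc \<alpha>"
  by (auto simp: hcomp_def poly_carrier in_keys_iff lookup_hpart subset_iff split: if_splits)

lemma hcomp_decomposition:
  assumes P: "P \<in> carrier coord_hopf"
  shows "\<exists>!c. c \<in> (\<Pi>\<^sub>E \<alpha>\<in>expos n. Hc \<alpha>) \<and> finite {\<alpha>\<in>expos n. c \<alpha> \<noteq> \<zero>\<^bsub>coord_hopf\<^esub>}
    \<and> P = (\<Oplus>\<^bsub>coord_hopf\<^esub>\<alpha>\<in>{\<alpha>\<in>expos n. c \<alpha> \<noteq> \<zero>\<^bsub>coord_hopf\<^esub>}. c \<alpha>)"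
proof -
  interpret R: ring coord_hopf using alg_coord by (rule assoc_algebraD)
  have fs: "(\<Oplus>\<^bsub>coord_hopf\<^esub>\<alpha>\<in>S. c \<alpha>) = (\<Sum>\<alpha>\<in>S. c \<alpha>)" if "finite S" "\<And>\<alpha>. \<alpha> \<in> S \<Longrightarrow> c \<alpha> \<in> Hc \<alpha>" for c S
    using that by (intro finsum_poly_algebra[where X = X]) (auto dest: hcomp_carrier intro: R.abelian_monoid_axioms)
  \<comment> \<open>A monomial can only occur in the component of its own weight, so a coefficient
    of the sum is a coefficient of a single component. This gives existence as well as uniqueness of
    the decomposition.\<close>
  have look: "lookup (\<Sum>\<alpha>\<in>{\<alpha>\<in>expos n. c \<alpha> \<noteq> 0}. c \<alpha>) m = (if keys m \<subseteq> X then lookup (c (wdeg deg m)) m else 0)"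
    if c: "\<And>\<alpha>. \<alpha> \<in> expos n \<Longrightarrow> c \<alpha> \<in> Hc \<alpha>" "finite {\<alpha>\<in>expos n. c \<alpha> \<noteq> 0}" for c :: "expo \<Rightarrow> ('x, 'k) mpoly" and m
  proof -
    have zero: "lookup (c \<alpha>) m = 0" if "\<alpha> \<in> expos n" "\<not> (wdeg deg m = \<alpha> \<and> keys m \<subseteq> X)" for \<alpha>
      using c(1)[OF that(1)] that(2) by (auto simp: hcomp_def poly_carrier in_keys_iff)
    have "lookup (\<Sum>\<alpha>\<in>{\<alpha>\<in>expos n. c \<alpha> \<noteq> 0}. c \<alpha>) m
      = (\<Sum>\<alpha>\<in>{\<alpha>\<in>expos n. c \<alpha> \<noteq> 0}. if \<alpha> = wdeg deg m then if keys m \<subseteq> X then lookup (c (wdeg deg m)) m else 0 else 0)"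
      unfolding lookup_sum using zero by (intro sum.cong) auto
    also have "\<dots> = (if keys m \<subseteq> X then lookup (c (wdeg deg m)) m else 0)"
      using c(2) wdeg_expos[of m] by auto
    finally show ?thesis .
  qed
  define c where "c = (\<lambda>\<alpha>\<in>expos n. hpart \<alpha> P)"
  have c: "c \<in> (\<Pi>\<^sub>E \<alpha>\<in>expos n. Hc \<alpha>)" using P by (auto simp: c_def hpart_hcomp)
  have fin: "finite {\<alpha>\<in>expos n. c \<alpha> \<noteq> 0}"
  proof (rule finite_subset)
    show "{\<alpha>\<in>expos n. c \<alpha> \<noteq> 0} \<subseteq> wdeg deg ` keys P"
    proof safe
      fix \<alpha> assume "\<alpha> \<in> expos n" "c \<alpha> \<noteq> 0"
      then obtain m where "lookup (hpart \<alpha> P) m \<noteq> 0" using poly_mapping_eqI[of "hpart \<alpha> P" 0] by (auto simp: c_def)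
      then show "\<alpha> \<in> wdeg deg ` keys P" by (auto simp: lookup_hpart in_keys_iff split: if_splits)
    qed
  qed simp
  have sum: "P = (\<Sum>\<alpha>\<in>{\<alpha>\<in>expos n. c \<alpha> \<noteq> 0}. c \<alpha>)"
  proof (rule poly_mapping_eqI)
    fix m
    have "lookup P m = 0" if "\<not> keys m \<subseteq> X" using that P by (auto simp: poly_carrier in_keys_iff)
    then show "lookup P m = lookup (\<Sum>\<alpha>\<in>{\<alpha>\<in>expos n. c \<alpha> \<noteq> 0}. c \<alpha>) m"
      using c fin by (subst look) (auto simp: c_def lookup_hpart wdeg_expos PiE_mem)
  qed
  show ?thesis
  proof (rule ex1I[of _ c])
    show "c \<in> (\<Pi>\<^sub>E \<alpha>\<in>expos n. Hc \<alpha>) \<and> finite {\<alpha>\<in>expos n. c \<alpha> \<noteq> \<zero>\<^bsub>coord_hopf\<^esub>}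
      \<and> P = (\<Oplus>\<^bsub>coord_hopf\<^esub>\<alpha>\<in>{\<alpha>\<in>expos n. c \<alpha> \<noteq> \<zero>\<^bsub>coord_hopf\<^esub>}. c \<alpha>)"
      using c fin sum by (subst fs) auto
    fix c' assume c': "c' \<in> (\<Pi>\<^sub>E \<alpha>\<in>expos n. Hc \<alpha>) \<and> finite {\<alpha>\<in>expos n. c' \<alpha> \<noteq> \<zero>\<^bsub>coord_hopf\<^esub>}
      \<and> P = (\<Oplus>\<^bsub>coord_hopf\<^esub>\<alpha>\<in>{\<alpha>\<in>expos n. c' \<alpha> \<noteq> \<zero>\<^bsub>coord_hopf\<^esub>}. c' \<alpha>)"
    then have fin': "finite {\<alpha>\<in>expos n. c' \<alpha> \<noteq> 0}" by simp
    have "(\<Oplus>\<^bsub>coord_hopf\<^esub>\<alpha>\<in>{\<alpha>\<in>expos n. c' \<alpha> \<noteq> 0}. c' \<alpha>) = (\<Sum>\<alpha>\<in>{\<alpha>\<in>expos n. c' \<alpha> \<noteq> 0}. c' \<alpha>)"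
      using c' fin' by (intro fs) auto
    with c' have P': "P = (\<Sum>\<alpha>\<in>{\<alpha>\<in>expos n. c' \<alpha> \<noteq> 0}. c' \<alpha>)" by simp
    have hc': "c' \<alpha> \<in> Hc \<alpha>" if "\<alpha> \<in> expos n" for \<alpha> using c' that by auto
    show "c' = c"
    proof (rule ext)
      fix \<alpha>
      show "c' \<alpha> = c \<alpha>"
      proof (cases "\<alpha> \<in> expos n")
        case True
        have "lookup (c' \<alpha>) m = (if wdeg deg m = \<alpha> then lookup P m else 0)" for m
        proof (cases "wdeg deg m = \<alpha> \<and> keys m \<subseteq> X")
          case True
          then show ?thesis by (subst P') (simp add: look[OF hc' fin'])
        next
          case False
          then have "lookup (c' \<alpha>) m = 0"
            using hc'[OF True] by (auto simp: hcomp_def poly_carrier in_keys_iff)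
          moreover have "lookup P m = 0" if "\<not> keys m \<subseteq> X" using that P by (auto simp: poly_carrier in_keys_iff)
          ultimately show ?thesis using False by auto
        qed
        then show ?thesis using True by (intro poly_mapping_eqI) (simp add: c_def lookup_hpart)
      qed (use c c' in \<open>auto simp: PiE_def extensional_def\<close>)
    qed
  qed
qed

theorem graded_hopf_coord: "graded_hopf_algebra n coord_hopf Hc"
  unfolding graded_hopf_algebra_def
proof (intro conjI ballI)
  show "hopf_algebra coord_hopf" by (rule hopf_coord)
  show "submodule (Hc \<alpha>) scalars coord_hopf" for \<alpha> by (rule submodule_hcomp)
  show "\<exists>S. finite S \<and> S \<subseteq> carrier coord_hopf \<and> Hc \<alpha> = lin_span coord_hopf S" for \<alpha>
    by (rule exI[of _ "(\<lambda>m. single m 1) ` {m. keys m \<subseteq> X \<and> wdeg deg m = \<alpha>}"])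
      (auto simp: finite_mons_deg poly_closed hcomp_span[symmetric])
  show "\<one>\<^bsub>coord_hopf\<^esub> \<in> Hc 0" by (simp add: hcomp_closed)
  show "x \<otimes>\<^bsub>coord_hopf\<^esub> y \<in> Hc (\<alpha> + \<beta>)" if "x \<in> Hc \<alpha>" "y \<in> Hc \<beta>" for x y \<alpha> \<beta>
    using that by (simp add: hcomp_closed)
  show "counit coord_hopf x = 0" if "\<alpha> \<in> expos n - {0}" "x \<in> Hc \<alpha>" for \<alpha> x
  proof -
    have "0 \<notin> keys x" using that by (auto simp: hcomp_def)
    then have "lookup x 0 = 0" by (simp add: in_keys_iff)
    with that show ?thesis by (simp add: ev_one_eq hcomp_carrier)
  qed
  show "antipode coord_hopf x \<in> Hc \<alpha>" if x: "x \<in> Hc \<alpha>" for x \<alpha>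
  proof -
    obtain Q where Q: "Q \<in> Hc \<alpha>" "\<forall>g\<in>carrier \<Gamma>. ev g Q = ev (inv\<^bsub>\<Gamma>\<^esub> g) x" using antipode_graded[OF x] by blast
    have "antipode coord_hopf x = Q"
      using x Q by (intro A_eqI) (auto simp: antipode_coord dest: hcomp_carrier)
    with Q show ?thesis by simp
  qed
  show "comult coord_hopf x \<in> lin_span (tensor_product coord_hopf coord_hopf)
           {pure_tensor coord_hopf coord_hopf a b | a b \<alpha> \<beta>. \<alpha> \<in> expos n \<and> \<beta> \<in> expos n \<and> \<alpha> + \<beta> = \<gamma> \<and> a \<in> Hc \<alpha> \<and> b \<in> Hc \<beta>}"
    if \<gamma>: "\<gamma> \<in> expos n" and x: "x \<in> Hc \<gamma>" for \<gamma> x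
  proof -
    obtain T where T: "T \<in> lin_span (tensor_product A A) (graded_tensors \<gamma>)"
      "\<forall>g\<in>carrier \<Gamma>. \<forall>h\<in>carrier \<Gamma>. T (\<lambda>a b. ev g a * ev h b) = ev (g \<otimes>\<^bsub>\<Gamma>\<^esub> h) x"
      using comult_graded[OF x \<gamma>] by blast
    have "T \<in> tensors A A"
      using T(1) submoduleD(1)[OF spAA submodule_lin_span[OF spAA graded_tensors_closed]] by blast
    then have "comult coord_hopf x = T"
      using x T(2) by (intro AA_eqI) (auto simp: comult_coord dest: hcomp_carrier)
    with T(1) show ?thesis by (simp add: graded_tensors_def)
  qed
qed (rule hcomp_decomposition)

text \<open>A character is determined by its values on the variables, and by
  \<open>coord_surj\<close> these values are the coordinates of a group element. Convolution
  evaluates the coproduct at two points, hence corresponds to the product of the group.\<close>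

theorem iso_characters: "\<Gamma> \<cong> character_group coord_hopf"
proof -
  define h where "h g = restrict (ev g) (carrier A)" for g
  have hom: "h g \<in> ring_hom coord_hopf scalars" for g
    by (rule ring_hom_memI) (auto simp: h_def peval_add peval_mult poly_closed)
  have lin: "linear_form A (h g)" for g
    using linear_form_cong[OF spA, of "h g" "ev g"] by (simp add: h_def lf_ev)
  have "h \<in> hom \<Gamma> (character_group coord_hopf)"
  proof (rule homI)
    show "h g \<in> carrier (character_group coord_hopf)" for g
      using hom lin by (simp add: character_group_def) (simp add: h_def)
    fix g k assume g: "g \<in> carrier \<Gamma>" "k \<in> carrier \<Gamma>"
    show "h (g \<otimes>\<^bsub>\<Gamma>\<^esub> k) = h g \<otimes>\<^bsub>character_group coord_hopf\<^esub> h k"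
    proof (rule ext)
      fix P
      show "h (g \<otimes>\<^bsub>\<Gamma>\<^esub> k) P = (h g \<otimes>\<^bsub>character_group coord_hopf\<^esub> h k) P"
      proof (cases "P \<in> carrier A")
        case True
        have "comult coord_hopf P (\<lambda>a b. h g a * h k b) = comult coord_hopf P (\<lambda>a b. ev g a * ev k b)"
          by (rule tensor_cong[OF spA spA comult_coord(1)[OF True]]) (simp add: h_def)
        with True g show ?thesis by (simp add: character_group_def comult_coord) (simp add: h_def)
      qed (simp add: character_group_def h_def)
    qed
  qed
  moreover have "bij_betw h (carrier \<Gamma>) (carrier (character_group coord_hopf))"
  proof (rule bij_betwI')
    fix g k assume g: "g \<in> carrier \<Gamma>" "k \<in> carrier \<Gamma>"
    show "h g = h k \<longleftrightarrow> g = k"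
    proof
      assume eq: "h g = h k"
      show "g = k"
      proof (rule coord_inj[OF g])
        fix x assume "x \<in> X"
        then show "\<kappa> g x = \<kappa> k x" using fun_cong[OF eq, of "var x"] by (simp add: h_def poly_closed)
      qed
    qed simp
  next
    show "h g \<in> carrier (character_group coord_hopf)" for g
      using hom lin by (simp add: character_group_def) (simp add: h_def)
  next
    fix \<chi> assume "\<chi> \<in> carrier (character_group coord_hopf)"
    then have \<chi>: "\<chi> \<in> extensional (carrier A)" "\<chi> \<in> ring_hom coord_hopf scalars" "linear_form A \<chi>"
      by (auto simp: character_group_def)
    obtain g where g: "g \<in> carrier \<Gamma>" "\<And>x. x \<in> X \<Longrightarrow> \<kappa> g x = \<chi> (var x)" using coord_surj[of "\<lambda>x. \<chi> (var x)"] by auto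
    have mon: "\<chi> (single m 1) = meval (\<kappa> g) m" if "keys m \<subseteq> X" for m
      using that
    proof (induction m rule: mon_induct)
      case zero
      then show ?case using ring_hom_one[OF \<chi>(2)] by simp
    next
      case (add m x)
      then show ?case
        using ring_hom_mult[OF \<chi>(2), of "single m 1" "var x"]
        by (simp only: single_add_var) (simp add: poly_closed meval_add g)
    qed
    have "\<chi> P = ev g P" if P: "P \<in> carrier A" for P
      using P mon unfolding linear_form_poly[OF \<chi>(3) P] peval_def poly_carrier by (intro sum.cong) auto
    then have "\<chi> = h g" using \<chi>(1) by (auto simp: h_def fun_eq_iff extensional_def)
    with g(1) show "\<exists>g\<in>carrier \<Gamma>. \<chi> = h g" by blast
  qed
  ultimately show ?thesis unfolding is_iso_def iso_def by blast
qed

end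

section \<open>Quotient algebras and free algebras\<close>

text \<open>Scaling by \<open>c\<close> is multiplication by the element
  \<open>c \<odot> \<one>\<close> of the algebra.\<close>

lemma ideal_smult_closed:
  assumes "assoc_algebra A" "ideal I A" "i \<in> I"
  shows "c \<odot>\<^bsub>A\<^esub> i \<in> I"
proof -
  interpret ideal I A by fact
  have i: "i \<in> carrier A" using assms(3) by (rule a_Hcarr)
  have "c \<odot>\<^bsub>A\<^esub> i = (c \<odot>\<^bsub>A\<^esub> \<one>\<^bsub>A\<^esub>) \<otimes>\<^bsub>A\<^esub> i"
    using assms(1) i by (simp add: assoc_algebra_def)
  then show ?thesis
    using assms i by (simp add: I_l_closed kspace_closed assoc_algebraD)
qed

lemma quotient_algebra_fields:
  "carrier (quotient_algebra A I) = carrier (A Quot I)" "mult (quotient_algebra A I) = mult (A Quot I)"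
  "one (quotient_algebra A I) = one (A Quot I)" "zero (quotient_algebra A I) = zero (A Quot I)"
  "add (quotient_algebra A I) = add (A Quot I)"
  "smult (quotient_algebra A I) = (\<lambda>c X. \<Union>x\<in>X. I +>\<^bsub>A\<^esub> (c \<odot>\<^bsub>A\<^esub> x))"
  by (simp_all add: quotient_algebra_def ring.defs)

lemma quotient_algebra:
  fixes A (structure)
  assumes alg: "assoc_algebra A" and I: "ideal I A"
  shows "carrier (quotient_algebra A I) = (\<lambda>x. I +> x) ` carrier A"
    and "x \<in> carrier A \<Longrightarrow> y \<in> carrier A \<Longrightarrow> (I +> x) \<otimes>\<^bsub>quotient_algebra A I\<^esub> (I +> y) = I +> (x \<otimes> y)"
    and "x \<in> carrier A \<Longrightarrow> y \<in> carrier A \<Longrightarrow> (I +> x) \<oplus>\<^bsub>quotient_algebra A I\<^esub> (I +> y) = I +> (x \<oplus> y)"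
    and "x \<in> carrier A \<Longrightarrow> c \<odot>\<^bsub>quotient_algebra A I\<^esub> (I +> x) = I +> (c \<odot> x)"
    and "\<one>\<^bsub>quotient_algebra A I\<^esub> = I +> \<one>"
    and "\<zero>\<^bsub>quotient_algebra A I\<^esub> = I +> \<zero>"
    and "assoc_algebra (quotient_algebra A I)"
proof -
  interpret I: ideal I A by fact
  interpret M: Module.module scalars A using alg by (rule assoc_algebraD)
  let ?Q = "quotient_algebra A I" and ?c = "\<lambda>x. I +> x"
  have hom: "?c \<in> ring_hom A (A Quot I)" by (rule I.rcos_ring_hom)
  have R: "ring (A Quot I)" by (rule I.quotient_is_ring)
  show car: "carrier ?Q = ?c ` carrier A"
    by (auto simp: quotient_algebra_fields FactRing_def A_RCOSETS_def')
  show mult: "?c x \<otimes>\<^bsub>?Q\<^esub> ?c y = ?c (x \<otimes> y)" if "x \<in> carrier A" "y \<in> carrier A" for x y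
    using ring_hom_mult[OF hom that] by (simp add: quotient_algebra_fields)
  show add: "?c x \<oplus>\<^bsub>?Q\<^esub> ?c y = ?c (x \<oplus> y)" if "x \<in> carrier A" "y \<in> carrier A" for x y
    using ring_hom_add[OF hom that] by (simp add: quotient_algebra_fields)
  show one: "\<one>\<^bsub>?Q\<^esub> = ?c \<one>"
    using ring_hom_one[OF hom] by (simp add: quotient_algebra_fields)
  show zero: "\<zero>\<^bsub>?Q\<^esub> = ?c \<zero>"
    using ring_hom_zero[OF hom I.ring_axioms R] by (simp add: quotient_algebra_fields)
  show smult: "c \<odot>\<^bsub>?Q\<^esub> ?c x = ?c (c \<odot> x)" if x: "x \<in> carrier A" for c x
  proof -
    \<comment> \<open>The union over a coset that defines the scalar multiplication of the quotient
      is a union of equal cosets.\<close>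
    have eq: "?c (c \<odot> z) = ?c (c \<odot> x)" if z: "z \<in> ?c x" for z
    proof -
      have zc: "z \<in> carrier A" using z x I.a_elemrcos_carrier by blast
      have "?c z = ?c x" using I.a_repr_independence'[OF z x] by simp
      then have "z \<ominus> x \<in> I" using I.quotient_eq_iff_same_a_r_cos[OF I zc x] by simp
      then have "c \<odot> (z \<ominus> x) \<in> I" by (rule ideal_smult_closed[OF alg I])
      moreover have "c \<odot> (z \<ominus> x) = (c \<odot> z) \<ominus> (c \<odot> x)"
        using zc x by (simp add: a_minus_def M.smult_r_distr[simplified] M.smult_r_minus[simplified])
      ultimately show ?thesis
        using I.quotient_eq_iff_same_a_r_cos[OF I, of "c \<odot> z" "c \<odot> x"] zc x kspace_closed(1)[OF M.module_axioms]
        by metis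
    qed
    have "x \<in> ?c x" using x by (rule I.a_rcos_self)
    have "(\<Union>z\<in>?c x. ?c (c \<odot> z)) = (\<Union>z\<in>?c x. ?c (c \<odot> x))"
      by (rule SUP_cong[OF refl eq])
    also have "\<dots> = ?c (c \<odot> x)" using \<open>x \<in> ?c x\<close> by (intro SUP_const) blast
    finally show ?thesis by (simp add: quotient_algebra_fields)
  qed
  have sp: "kspace ?Q"
  proof (rule kspaceI)
    show "\<zero>\<^bsub>?Q\<^esub> \<in> carrier ?Q" by (simp add: zero car)
    note cl = kspace_closed[OF M.module_axioms]
    fix u v assume "u \<in> carrier ?Q" "v \<in> carrier ?Q"
    then obtain x y where x: "x \<in> carrier A" "u = ?c x" and y: "y \<in> carrier A" "v = ?c y" by (auto simp: car)
    show "u \<oplus>\<^bsub>?Q\<^esub> v \<in> carrier ?Q" using x y cl by (simp add: car add)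
    show "u \<oplus>\<^bsub>?Q\<^esub> v = v \<oplus>\<^bsub>?Q\<^esub> u" using x y cl I.a_comm[of x y] by (simp add: add)
    show "c \<odot>\<^bsub>?Q\<^esub> (u \<oplus>\<^bsub>?Q\<^esub> v) = c \<odot>\<^bsub>?Q\<^esub> u \<oplus>\<^bsub>?Q\<^esub> c \<odot>\<^bsub>?Q\<^esub> v" for c
      using x y cl M.smult_r_distr[of c x y] by (simp add: add smult)
    fix w assume "w \<in> carrier ?Q"
    then obtain z where z: "z \<in> carrier A" "w = ?c z" by (auto simp: car)
    show "u \<oplus>\<^bsub>?Q\<^esub> v \<oplus>\<^bsub>?Q\<^esub> w = u \<oplus>\<^bsub>?Q\<^esub> (v \<oplus>\<^bsub>?Q\<^esub> w)"
      using x y z cl I.a_assoc[of x y z] by (simp add: add)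
  next
    note cl = kspace_closed[OF M.module_axioms]
    fix u assume "u \<in> carrier ?Q"
    then obtain x where x: "x \<in> carrier A" "u = ?c x" by (auto simp: car)
    show "c \<odot>\<^bsub>?Q\<^esub> u \<in> carrier ?Q" for c using x cl by (simp add: car smult)
    show "\<zero>\<^bsub>?Q\<^esub> \<oplus>\<^bsub>?Q\<^esub> u = u" using x cl by (simp add: zero add)
    show "(- 1) \<odot>\<^bsub>?Q\<^esub> u \<oplus>\<^bsub>?Q\<^esub> u = \<zero>\<^bsub>?Q\<^esub>"
      using x cl by (simp add: zero add smult kspace_minus_one[OF M.module_axioms] I.l_neg)
    show "(c + d) \<odot>\<^bsub>?Q\<^esub> u = c \<odot>\<^bsub>?Q\<^esub> u \<oplus>\<^bsub>?Q\<^esub> d \<odot>\<^bsub>?Q\<^esub> u" for c d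
      using x cl M.smult_l_distr[of c d x] by (simp add: add smult)
    show "(c * d) \<odot>\<^bsub>?Q\<^esub> u = c \<odot>\<^bsub>?Q\<^esub> (d \<odot>\<^bsub>?Q\<^esub> u)" for c d
      using x cl M.smult_assoc1[of c d x] by (simp add: smult)
    show "1 \<odot>\<^bsub>?Q\<^esub> u = u" using x M.smult_one[of x] by (simp add: smult)
  qed
  moreover have "ring ?Q"
  proof (rule ringI)
    show "abelian_group ?Q" using sp by (simp add: Module.module_def)
    show "Group.monoid ?Q" by (rule monoidI) (auto simp: car mult one I.m_assoc)
  qed (auto simp: car mult add I.l_distr I.r_distr)
  ultimately show "assoc_algebra ?Q"
    using alg by (auto simp: assoc_algebra_def car mult smult kspace_closed[OF M.module_axioms])
qed

text \<open>The linear extension to the free algebra of a function \<Phi> on words. Elements are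
  compared through all such extensions; as these turn products into nested sums, the associative and
  unit laws need no manipulation of \<open>take\<close> and \<open>drop\<close>.\<close>

definition fsum :: "('w \<Rightarrow> 'k::field) \<Rightarrow> ('w \<Rightarrow> 'k) \<Rightarrow> 'k" where
  "fsum F \<Phi> = (\<Sum>w\<in>{w. F w \<noteq> 0}. F w * \<Phi> w)"

lemma fsum_superset: "finite S \<Longrightarrow> {w. F w \<noteq> 0} \<subseteq> S \<Longrightarrow> fsum F \<Phi> = (\<Sum>w\<in>S. F w * \<Phi> w)"
  unfolding fsum_def by (rule sum.mono_neutral_left) auto

lemma fsum_add:
  assumes "finite {w. F w \<noteq> 0}" "finite {w. G w \<noteq> 0}"
  shows "fsum (\<lambda>w. F w + G w) \<Phi> = fsum F \<Phi> + fsum G \<Phi>"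
proof -
  let ?S = "{w. F w \<noteq> 0} \<union> {w. G w \<noteq> 0}"
  have "fsum F \<Phi> = (\<Sum>w\<in>?S. F w * \<Phi> w)" "fsum G \<Phi> = (\<Sum>w\<in>?S. G w * \<Phi> w)"
    "fsum (\<lambda>w. F w + G w) \<Phi> = (\<Sum>w\<in>?S. (F w + G w) * \<Phi> w)"
    using assms by (auto intro!: fsum_superset)
  then show ?thesis by (simp add: distrib_right sum.distrib)
qed

lemma fsum_smult: "fsum (\<lambda>w. c * F w) \<Phi> = c * fsum F \<Phi>"
  by (cases "c = 0") (auto simp: fsum_def sum_distrib_left mult.assoc)

lemma fsum_word [simp]: "fsum (word v) \<Phi> = \<Phi> v"
  by (subst fsum_superset[of "{v}"]) (auto simp: word_def)

lemma fsum_point: "finite {w. F w \<noteq> 0} \<Longrightarrow> fsum F (word w) = F w"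
  by (subst fsum_superset[of "insert w {w. F w \<noteq> 0}"]) (auto simp: word_def)

lemma fsum_eqI:
  fixes F G :: "'x list \<Rightarrow> 'k::field"
  assumes "finite {w. F w \<noteq> 0}" "finite {w. G w \<noteq> 0}" "\<And>\<Phi>. fsum F \<Phi> = fsum G \<Phi>"
  shows "F = G"
proof (rule ext)
  fix w show "F w = G w"
    using fsum_point[OF assms(1), of w] fsum_point[OF assms(2), of w] assms(3)[of "word w"] by simp
qed

lemma free_simps [simp]:
  "one (free_algebra X) = word []" "zero (free_algebra X) = (\<lambda>w. 0)"
  "add (free_algebra X) = (\<lambda>f g w. f w + g w)" "smult (free_algebra X) = (\<lambda>c f w. c * f w)"
  by (auto simp: free_algebra_def word_def)

lemma free_carrier: "F \<in> carrier (free_algebra X) \<longleftrightarrow> finite {w. F w \<noteq> 0} \<and> {w. F w \<noteq> 0} \<subseteq> lists X"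
  by (simp add: free_algebra_def)

lemma free_mult_sum: "(F \<otimes>\<^bsub>free_algebra X\<^esub> G) w = (\<Sum>(u, v)\<in>{(u, v). u @ v = w}. F u * G v)"
proof -
  have "bij_betw (\<lambda>i. (take i w, drop i w)) {..length w} {(u, v). u @ v = w}"
    by (rule bij_betwI[where g = "\<lambda>(u, v). length u"]) auto
  from sum.reindex_bij_betw[OF this, of "\<lambda>(u, v). F u * G v"] show ?thesis
    by (simp add: free_algebra_def)
qed

lemma free_mult_support:
  assumes "finite {w. F w \<noteq> 0}" "finite {w. G w \<noteq> 0}"
  shows "{w. (F \<otimes>\<^bsub>free_algebra X\<^esub> G) w \<noteq> 0} \<subseteq> (\<lambda>(u, v). u @ v) ` ({w. F w \<noteq> 0} \<times> {w. G w \<noteq> 0})"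
proof
  fix w assume "w \<in> {w. (F \<otimes>\<^bsub>free_algebra X\<^esub> G) w \<noteq> 0}"
  then have "(\<Sum>(u, v)\<in>{(u, v). u @ v = w}. F u * G v) \<noteq> 0" by (simp add: free_mult_sum)
  then obtain p where "p \<in> {(u, v). u @ v = w}" "(case p of (u, v) \<Rightarrow> F u * G v) \<noteq> 0"
    by (rule sum.not_neutral_contains_not_neutral)
  then show "w \<in> (\<lambda>(u, v). u @ v) ` ({w. F w \<noteq> 0} \<times> {w. G w \<noteq> 0})" by force
qed

lemma fsum_mult:
  fixes F G :: "'x list \<Rightarrow> 'k::field"
  assumes "finite {w. F w \<noteq> 0}" "finite {w. G w \<noteq> 0}"
  shows "fsum (F \<otimes>\<^bsub>free_algebra X\<^esub> G) \<Phi> = fsum F (\<lambda>u. fsum G (\<lambda>v. \<Phi> (u @ v)))"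
proof -
  let ?S = "{w. F w \<noteq> 0} \<times> {w. G w \<noteq> 0}" and ?c = "\<lambda>(u :: 'x list, v). u @ v"
  have S: "finite ?S" using assms by simp
  have "fsum (F \<otimes>\<^bsub>free_algebra X\<^esub> G) \<Phi> = (\<Sum>w\<in>?c ` ?S. (F \<otimes>\<^bsub>free_algebra X\<^esub> G) w * \<Phi> w)"
    using S free_mult_support[OF assms] by (intro fsum_superset) auto
  \<comment> \<open>The sum over pairs of words is grouped by their concatenation.\<close>
  also have "\<dots> = (\<Sum>w\<in>?c ` ?S. \<Sum>p\<in>{p\<in>?S. ?c p = w}. F (fst p) * G (snd p) * \<Phi> (?c p))"
  proof (rule sum.cong[OF refl])
    fix w :: "'x list"
    have fin: "finite {(u, v). u @ v = w}"
    proof (rule finite_subset)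
      show "{(u, v). u @ v = w} \<subseteq> (\<lambda>i. (take i w, drop i w)) ` {..length w}"
      proof clarify
        fix u v assume "w = u @ v"
        then show "(u, v) \<in> (\<lambda>i. (take i (u @ v), drop i (u @ v))) ` {..length (u @ v)}"
          by (intro image_eqI[of _ _ "length u"]) auto
      qed
    qed simp
    have "(\<Sum>p\<in>{p\<in>?S. ?c p = w}. F (fst p) * G (snd p) * \<Phi> (?c p)) = (\<Sum>p\<in>{p\<in>?S. ?c p = w}. F (fst p) * G (snd p)) * \<Phi> w"
      by (auto simp: sum_distrib_right intro!: sum.cong)
    also have "(\<Sum>p\<in>{p\<in>?S. ?c p = w}. F (fst p) * G (snd p)) = (\<Sum>p\<in>{(u, v). u @ v = w}. F (fst p) * G (snd p))"
      by (rule sum.mono_neutral_left) (use fin in auto)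
    also have "\<dots> = (F \<otimes>\<^bsub>free_algebra X\<^esub> G) w" by (simp add: free_mult_sum split_def)
    finally show "(F \<otimes>\<^bsub>free_algebra X\<^esub> G) w * \<Phi> w = (\<Sum>p\<in>{p\<in>?S. ?c p = w}. F (fst p) * G (snd p) * \<Phi> (?c p))" by simp
  qed
  also have "\<dots> = (\<Sum>p\<in>?S. F (fst p) * G (snd p) * \<Phi> (?c p))"
    using sum.group[of ?S "?c ` ?S" ?c "\<lambda>p. F (fst p) * G (snd p) * \<Phi> (?c p)"] S by blast
  also have "\<dots> = fsum F (\<lambda>u. fsum G (\<lambda>v. \<Phi> (u @ v)))"
    by (simp add: fsum_def sum.cartesian_product sum_distrib_left split_def mult.assoc)
  finally show ?thesis .
qed

lemma free_closed:
  "F \<in> carrier (free_algebra X) \<Longrightarrow> G \<in> carrier (free_algebra X) \<Longrightarrow> (\<lambda>w. F w + G w) \<in> carrier (free_algebra X)"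
  "F \<in> carrier (free_algebra X) \<Longrightarrow> (\<lambda>w. c * F w) \<in> carrier (free_algebra X)"
  "F \<in> carrier (free_algebra X) \<Longrightarrow> G \<in> carrier (free_algebra X) \<Longrightarrow> F \<otimes>\<^bsub>free_algebra X\<^esub> G \<in> carrier (free_algebra X)"
  "w \<in> lists X \<Longrightarrow> word w \<in> carrier (free_algebra X)"
  "(\<lambda>w. 0) \<in> carrier (free_algebra X)"
proof -
  show "(\<lambda>w. F w + G w) \<in> carrier (free_algebra X)" if "F \<in> carrier (free_algebra X)" "G \<in> carrier (free_algebra X)"
  proof -
    have "{w. F w + G w \<noteq> 0} \<subseteq> {w. F w \<noteq> 0} \<union> {w. G w \<noteq> 0}" by auto
    with that show ?thesis unfolding free_carrier by (meson finite_UnI finite_subset le_sup_iff order_trans)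
  qed
  show "(\<lambda>w. c * F w) \<in> carrier (free_algebra X)" if "F \<in> carrier (free_algebra X)"
    using that by (cases "c = 0") (auto simp: free_carrier)
  show "F \<otimes>\<^bsub>free_algebra X\<^esub> G \<in> carrier (free_algebra X)"
    if F: "F \<in> carrier (free_algebra X)" and G: "G \<in> carrier (free_algebra X)"
  proof -
    let ?S = "(\<lambda>(u, v). u @ v) ` ({w. F w \<noteq> 0} \<times> {w. G w \<noteq> 0})"
    have fin: "finite {w. F w \<noteq> 0}" "finite {w. G w \<noteq> 0}" using F G by (auto simp: free_carrier)
    have sub: "{w. (F \<otimes>\<^bsub>free_algebra X\<^esub> G) w \<noteq> 0} \<subseteq> ?S" by (rule free_mult_support[OF fin])
    have "finite ?S" using fin by simp
    moreover have "?S \<subseteq> lists X"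
    proof (rule image_subsetI)
      fix p assume "p \<in> {w. F w \<noteq> 0} \<times> {w. G w \<noteq> 0}"
      then have p: "fst p \<in> {w. F w \<noteq> 0}" "snd p \<in> {w. G w \<noteq> 0}" by (simp_all add: mem_Times_iff)
      have "{w. F w \<noteq> 0} \<subseteq> lists X" "{w. G w \<noteq> 0} \<subseteq> lists X" using F G by (simp_all add: free_carrier)
      then have "fst p \<in> lists X" "snd p \<in> lists X" using p by (simp_all only: subsetD)
      then show "(case p of (u, v) \<Rightarrow> u @ v) \<in> lists X" by (simp add: split_def)
    qed
    ultimately show ?thesis
      unfolding free_carrier using finite_subset[OF sub] order_trans[OF sub] by simp
  qed
qed (auto simp: free_carrier word_def)

lemma free_assoc_algebra: "assoc_algebra (free_algebra X :: ('k::field, 'x list \<Rightarrow> 'k) module)"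
proof -
  let ?F = "free_algebra X :: ('k::field, 'x list \<Rightarrow> 'k) module"
  have sp: "kspace ?F"
    by (rule kspaceI) (simp_all add: free_closed(1,2,5) algebra_simps)
  have fin: "finite {w. F w \<noteq> 0}" if "F \<in> carrier ?F" for F using that by (simp add: free_carrier)
  have "ring ?F"
  proof (rule ringI)
    show "abelian_group ?F" using sp by (simp add: Module.module_def)
    show "Group.monoid ?F"
    proof (rule monoidI)
      show "\<one>\<^bsub>?F\<^esub> \<in> carrier ?F" by (simp add: free_closed)
      show "F \<otimes>\<^bsub>?F\<^esub> G \<in> carrier ?F" if "F \<in> carrier ?F" "G \<in> carrier ?F" for F G using that by (rule free_closed)
      show "F \<otimes>\<^bsub>?F\<^esub> G \<otimes>\<^bsub>?F\<^esub> K = F \<otimes>\<^bsub>?F\<^esub> (G \<otimes>\<^bsub>?F\<^esub> K)"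
        if "F \<in> carrier ?F" "G \<in> carrier ?F" "K \<in> carrier ?F" for F G K
      proof (rule fsum_eqI)
        have 1: "F \<otimes>\<^bsub>?F\<^esub> G \<in> carrier ?F" "G \<otimes>\<^bsub>?F\<^esub> K \<in> carrier ?F" using that free_closed(3) by blast+
        show "finite {w. (F \<otimes>\<^bsub>?F\<^esub> G \<otimes>\<^bsub>?F\<^esub> K) w \<noteq> 0}" by (rule fin[OF free_closed(3)[OF 1(1) that(3)]])
        show "finite {w. (F \<otimes>\<^bsub>?F\<^esub> (G \<otimes>\<^bsub>?F\<^esub> K)) w \<noteq> 0}" by (rule fin[OF free_closed(3)[OF that(1) 1(2)]])
        show "fsum (F \<otimes>\<^bsub>?F\<^esub> G \<otimes>\<^bsub>?F\<^esub> K) \<Phi> = fsum (F \<otimes>\<^bsub>?F\<^esub> (G \<otimes>\<^bsub>?F\<^esub> K)) \<Phi>" for \<Phi>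
          using fin[OF that(1)] fin[OF that(2)] fin[OF that(3)] fin[OF 1(1)] fin[OF 1(2)] by (simp add: fsum_mult)
      qed
      have one: "\<one>\<^bsub>?F\<^esub> \<in> carrier ?F" by (simp add: free_closed)
      show "\<one>\<^bsub>?F\<^esub> \<otimes>\<^bsub>?F\<^esub> F = F" "F \<otimes>\<^bsub>?F\<^esub> \<one>\<^bsub>?F\<^esub> = F" if F: "F \<in> carrier ?F" for F
      proof -
        show "\<one>\<^bsub>?F\<^esub> \<otimes>\<^bsub>?F\<^esub> F = F"
          by (rule fsum_eqI[OF fin[OF free_closed(3)[OF one F]] fin[OF F]])
            (simp only: fsum_mult[OF fin[OF one] fin[OF F]], simp)
        show "F \<otimes>\<^bsub>?F\<^esub> \<one>\<^bsub>?F\<^esub> = F"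
          by (rule fsum_eqI[OF fin[OF free_closed(3)[OF F one]] fin[OF F]])
            (simp only: fsum_mult[OF fin[OF F] fin[OF one]], simp)
      qed
    qed
    show "(F \<oplus>\<^bsub>?F\<^esub> G) \<otimes>\<^bsub>?F\<^esub> K = F \<otimes>\<^bsub>?F\<^esub> K \<oplus>\<^bsub>?F\<^esub> G \<otimes>\<^bsub>?F\<^esub> K" for F G K
      by (rule ext) (simp add: free_mult_sum distrib_right sum.distrib split_def)
    show "K \<otimes>\<^bsub>?F\<^esub> (F \<oplus>\<^bsub>?F\<^esub> G) = K \<otimes>\<^bsub>?F\<^esub> F \<oplus>\<^bsub>?F\<^esub> K \<otimes>\<^bsub>?F\<^esub> G" for F G K
      by (rule ext) (simp add: free_mult_sum distrib_left sum.distrib split_def)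
  qed
  moreover have "(c \<odot>\<^bsub>?F\<^esub> x) \<otimes>\<^bsub>?F\<^esub> y = c \<odot>\<^bsub>?F\<^esub> (x \<otimes>\<^bsub>?F\<^esub> y)" for c x y
    by (rule ext) (simp add: free_mult_sum sum_distrib_left split_def mult.assoc)
  moreover have "x \<otimes>\<^bsub>?F\<^esub> (c \<odot>\<^bsub>?F\<^esub> y) = c \<odot>\<^bsub>?F\<^esub> (x \<otimes>\<^bsub>?F\<^esub> y)" for c x y
    by (rule ext) (simp add: free_mult_sum sum_distrib_left split_def mult.left_commute)
  ultimately show ?thesis
    unfolding assoc_algebra_def using sp by blast
qed

lemma word_mult: "word u \<otimes>\<^bsub>free_algebra X\<^esub> word v = (word (u @ v) :: 'x list \<Rightarrow> 'k::field)"
proof -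
  have fin: "finite {w. word v w \<noteq> (0::'k)}" for v :: "'x list" by (simp add: word_def)
  have "finite {w. (word u \<otimes>\<^bsub>free_algebra X\<^esub> word v) w \<noteq> (0::'k)}"
    using free_mult_support[OF fin fin] by (rule finite_subset) (simp add: fin)
  then show ?thesis
    by (rule fsum_eqI[OF _ fin]) (simp add: fsum_mult[OF fin fin])
qed

lemma free_induct:
  assumes F: "F \<in> carrier (free_algebra X)" and zero: "P (\<lambda>w. 0)"
    and step: "\<And>F c w. F \<in> carrier (free_algebra X) \<Longrightarrow> P F \<Longrightarrow> w \<in> lists X \<Longrightarrow> P (\<lambda>v. F v + c * word w v)"
  shows "P (F :: 'x list \<Rightarrow> 'k::field)"
  using F
proof (induction "card {w. F w \<noteq> 0}" arbitrary: F)
  case 0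
  then have "F = (\<lambda>w. 0)" by (auto simp: free_carrier)
  then show ?case using zero by simp
next
  case (Suc n)
  then have "{w. F w \<noteq> 0} \<noteq> {}" by (intro notI) simp
  then obtain w where w: "F w \<noteq> 0" by blast
  let ?G = "F(w := 0)"
  have s: "{v. ?G v \<noteq> 0} = {v. F v \<noteq> 0} - {w}" by auto
  have "card {v. ?G v \<noteq> 0} = n" using Suc w unfolding s by (auto simp: free_carrier)
  moreover have G: "?G \<in> carrier (free_algebra X)" using Suc(3) unfolding free_carrier s by auto
  ultimately have "P ?G" using Suc(1) by blast
  moreover have "w \<in> lists X" using Suc(3) w by (auto simp: free_carrier)
  ultimately have "P (\<lambda>v. ?G v + F w * word w v)" using G by (intro step)
  moreover have "(\<lambda>v. ?G v + F w * word w v) = F" by (auto simp: word_def fun_eq_iff)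
  ultimately show ?case by simp
qed

section \<open>Enveloping algebras paired with Hopf algebras\<close>

lemma tensor_sum_form:
  assumes T: "T \<in> tensors M N" and "finite S" "\<And>i. i \<in> S \<Longrightarrow> bilinear_form M N (\<beta> i)"
  shows "T (\<lambda>a b. \<Sum>i\<in>S. \<beta> i a b) = (\<Sum>i\<in>S. T (\<beta> i)) \<and> bilinear_form M N (\<lambda>a b. \<Sum>i\<in>S. \<beta> i a b)"
  using assms(2,3)
proof (induction S)
  case empty
  have b: "bilinear_form M N (\<lambda>a b. 0)" by (simp add: bilinear_form_def linear_form_def)
  have "T (\<lambda>a b. 0) = 0" using tensor_cmult_form[OF T b, of 0] by simp
  with b show ?case by simp
next
  case (insert i S)
  then have b: "bilinear_form M N (\<beta> i)" "bilinear_form M N (\<lambda>a b. \<Sum>i\<in>S. \<beta> i a b)" by auto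
  have "bilinear_form M N (\<lambda>a b. \<beta> i a b + (\<Sum>i\<in>S. \<beta> i a b))"
    using b by (auto simp: bilinear_form_def intro: lf_plus)
  with insert b show ?case by (simp add: tensor_add_form[OF T])
qed

lemma linear_form_fsum:
  assumes "\<And>w. linear_form M (\<Phi> w)"
  shows "linear_form M (\<lambda>x. fsum F (\<lambda>w. \<Phi> w x))"
  using assms by (simp add: linear_form_def fsum_def sum_distrib_left distrib_left sum.distrib mult.left_commute)

text \<open>\<epsilon> represents the Lie algebra \<open>L\<close> by linear forms on
  \<open>H\<close>, with the commutator of convolution as bracket. This is what is needed to send
  the tensor algebra, and then the enveloping algebra, to linear forms under convolution.\<close>

locale env_pairing = separated_hopf H
  for H :: "('k::field, 'a, 'm) hopf_scheme" (structure) +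
  fixes L :: "('k, 'l) module" and \<epsilon> :: "'l \<Rightarrow> 'a \<Rightarrow> 'k"
  assumes spL: "kspace L"
    and bracket_closed: "\<And>x y. x \<in> carrier L \<Longrightarrow> y \<in> carrier L \<Longrightarrow> x \<otimes>\<^bsub>L\<^esub> y \<in> carrier L"
    and eps_lin: "\<And>l. linear_form H (\<epsilon> l)"
    and eps_add: "\<And>x y p. x \<in> carrier L \<Longrightarrow> y \<in> carrier L \<Longrightarrow> p \<in> carrier H \<Longrightarrow> \<epsilon> (x \<oplus>\<^bsub>L\<^esub> y) p = \<epsilon> x p + \<epsilon> y p"
    and eps_smult: "\<And>c x p. x \<in> carrier L \<Longrightarrow> p \<in> carrier H \<Longrightarrow> \<epsilon> (c \<odot>\<^bsub>L\<^esub> x) p = c * \<epsilon> x p"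
    and eps_bracket: "\<And>x y p. x \<in> carrier L \<Longrightarrow> y \<in> carrier L \<Longrightarrow> p \<in> carrier H \<Longrightarrow>
      \<epsilon> (x \<otimes>\<^bsub>L\<^esub> y) p = comult H p (\<lambda>a b. \<epsilon> x a * \<epsilon> y b) - comult H p (\<lambda>a b. \<epsilon> y a * \<epsilon> x b)"
begin

text \<open>The convolution product of the forms attached to the letters, with the counit as empty
  product.\<close>

fun \<Phi> :: "'l list \<Rightarrow> 'a \<Rightarrow> 'k" where
  "\<Phi> [] = counit H"
| "\<Phi> (l # w) = (\<lambda>p. comult H p (\<lambda>a b. \<epsilon> l a * \<Phi> w b))"

lemma \<Phi>_lin: "linear_form H (\<Phi> w)"
  by (cases w) (auto intro: counit_lin lf_comult)

text \<open>Coassociativity makes concatenation of words correspond to convolution.\<close>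

lemma \<Phi>_append: "p \<in> carrier H \<Longrightarrow> \<Phi> (u @ v) p = comult H p (\<lambda>a b. \<Phi> u a * \<Phi> v b)"
proof (induction u arbitrary: p)
  case Nil
  then show ?case by (simp add: comult_counit \<Phi>_lin)
next
  case (Cons l u)
  have "\<Phi> ((l # u) @ v) p = comult H p (\<lambda>a b. \<epsilon> l a * comult H b (\<lambda>b1 b2. \<Phi> u b1 * \<Phi> v b2))"
    by (simp, rule comult_cong[OF Cons(2)]) (simp add: Cons(1))
  also have "\<dots> = comult H p (\<lambda>a b. \<Phi> (l # u) a * \<Phi> v b)"
    using comult_coassoc[OF Cons(2) eps_lin \<Phi>_lin \<Phi>_lin] by simp
  finally show ?case .
qed

lemma \<Phi>_single: "p \<in> carrier H \<Longrightarrow> \<Phi> [l] p = \<epsilon> l p"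
  using comult_counit(2)[of p "\<epsilon> l"] by (simp add: eps_lin mult.commute)

abbreviation "F \<equiv> free_algebra (carrier L) :: ('k, 'l list \<Rightarrow> 'k) module"
abbreviation "I \<equiv> enveloping_ideal L"
abbreviation "U0 \<equiv> enveloping_algebra L"
abbreviation "cls G \<equiv> I +>\<^bsub>F\<^esub> G"

lemmas algF = free_assoc_algebra[where 'k = 'k, of "carrier L"]
lemmas spF = assoc_algebraD(1)[OF algF]

definition pairF :: "('l list \<Rightarrow> 'k) \<Rightarrow> 'a \<Rightarrow> 'k" where
  "pairF G p = fsum G (\<lambda>w. \<Phi> w p)"

lemma pairF_lin: "linear_form H (pairF G)"
  using linear_form_fsum[of H \<Phi> G] \<Phi>_lin by (simp add: pairF_def[abs_def])

lemma pairF_linF: "linear_form F (\<lambda>G. pairF G p)"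
  by (simp add: linear_form_def pairF_def fsum_add fsum_smult free_carrier)

lemma pairF_word [simp]: "pairF (word w) p = \<Phi> w p"
  by (simp add: pairF_def)

text \<open>Bilinear extension of \<open>\<Phi>_append\<close> from words to the free algebra; the
  coproduct is a tensor and passes through finite sums of bilinear forms.\<close>

lemma pairF_mult:
  assumes G: "G \<in> carrier F" and K: "K \<in> carrier F" and p: "p \<in> carrier H"
  shows "pairF (G \<otimes>\<^bsub>F\<^esub> K) p = comult H p (\<lambda>a b. pairF G a * pairF K b)"
proof -
  have fin: "finite {w. G w \<noteq> 0}" "finite {w. K w \<noteq> 0}" using G K by (auto simp: free_carrier)
  have "comult H p (\<lambda>a b. pairF G a * pairF K b)
    = comult H p (\<lambda>a b. \<Sum>u\<in>{w. G w \<noteq> 0}. \<Sum>v\<in>{w. K w \<noteq> 0}. (G u * K v) * (\<Phi> u a * \<Phi> v b))"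
    by (simp add: pairF_def fsum_def sum_product mult_ac)
  also have "\<dots> = (\<Sum>u\<in>{w. G w \<noteq> 0}. comult H p (\<lambda>a b. \<Sum>v\<in>{w. K w \<noteq> 0}. (G u * K v) * (\<Phi> u a * \<Phi> v b)))"
  proof (rule conjunct1[OF tensor_sum_form[OF comult_closed[OF p] fin(1)]])
    fix u
    show "bilinear_form H H (\<lambda>a b. \<Sum>v\<in>{w. K w \<noteq> 0}. (G u * K v) * (\<Phi> u a * \<Phi> v b))"
      by (rule conjunct2[OF tensor_sum_form[OF comult_closed[OF p] fin(2)]])
        (auto intro!: bilinear_formI lf_mult_left lf_mult_right \<Phi>_lin)
  qed
  also have "\<dots> = (\<Sum>u\<in>{w. G w \<noteq> 0}. \<Sum>v\<in>{w. K w \<noteq> 0}. comult H p (\<lambda>a b. (G u * K v) * (\<Phi> u a * \<Phi> v b)))"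
    by (rule sum.cong[OF refl], rule conjunct1[OF tensor_sum_form[OF comult_closed[OF p] fin(2)]])
      (auto intro!: bilinear_formI lf_mult_left lf_mult_right \<Phi>_lin)
  also have "\<dots> = (\<Sum>u\<in>{w. G w \<noteq> 0}. \<Sum>v\<in>{w. K w \<noteq> 0}. (G u * K v) * \<Phi> (u @ v) p)"
    using p by (simp add: \<Phi>_append tensor_cmult_form[OF comult_closed[OF p]] bilinear_mult \<Phi>_lin)
  also have "\<dots> = pairF (G \<otimes>\<^bsub>F\<^esub> K) p"
    unfolding pairF_def fsum_mult[OF fin] by (simp add: fsum_def sum_distrib_left mult.assoc)
  finally show ?thesis by simp
qed

definition relations :: "('l list \<Rightarrow> 'k) set" where
  "relations = {(\<lambda>w. word [x \<oplus>\<^bsub>L\<^esub> y] w - word [x] w - word [y] w) | x y. x \<in> carrier L \<and> y \<in> carrier L}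
      \<union> {(\<lambda>w. word [c \<odot>\<^bsub>L\<^esub> x] w - c * word [x] w) | c x. x \<in> carrier L}
      \<union> {(\<lambda>w. word [x, y] w - word [y, x] w - word [x \<otimes>\<^bsub>L\<^esub> y] w) | x y. x \<in> carrier L \<and> y \<in> carrier L}"

lemma ideal_eq: "I = genideal F relations"
  by (simp add: enveloping_ideal_def relations_def)

lemma free_diff_eq: "(\<lambda>w. f w - g w) = (\<lambda>w. f w + (-1) * (g w :: 'k))"
  by simp

lemma free_diff_closed: "f \<in> carrier F \<Longrightarrow> g \<in> carrier F \<Longrightarrow> (\<lambda>w. f w - g w) \<in> carrier F"
  unfolding free_diff_eq by (intro free_closed)

lemma free_minus: "f \<in> carrier F \<Longrightarrow> g \<in> carrier F \<Longrightarrow> f \<ominus>\<^bsub>F\<^esub> g = (\<lambda>w. f w - g w)"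
proof -
  assume "g \<in> carrier F"
  then have "\<ominus>\<^bsub>F\<^esub> g = (\<lambda>w. - g w)" using kspace_minus_one[OF spF, of g] by simp
  then show "f \<ominus>\<^bsub>F\<^esub> g = (\<lambda>w. f w - g w)" by (simp add: a_minus_def)
qed

lemma relations_closed: "relations \<subseteq> carrier F"
  unfolding relations_def
  by (auto intro!: free_diff_closed free_closed simp: kspace_closed[OF spL] bracket_closed)

lemma ideal_I: "ideal I F"
proof -
  interpret ring F using algF by (rule assoc_algebraD)
  show ?thesis unfolding ideal_eq by (rule genideal_ideal[OF relations_closed])
qed

lemma relations_I: "relations \<subseteq> I"
proof -
  interpret ring F using algF by (rule assoc_algebraD)
  show ?thesis unfolding ideal_eq by (rule genideal_self[OF relations_closed])
qed

lemma pairF_diff: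
  assumes "f \<in> carrier F" "g \<in> carrier F"
  shows "pairF (\<lambda>w. f w - g w) p = pairF f p - pairF g p"
  using linear_form_diff[OF spF pairF_linF assms, of p] assms by (simp add: free_minus)

lemma pairF_relations:
  assumes "r \<in> relations" "p \<in> carrier H"
  shows "pairF r p = 0"
proof -
  note c = free_closed(4) kspace_closed[OF spL] bracket_closed free_diff_closed free_closed(2)
  have w2: "\<Phi> [x, y] p = comult H p (\<lambda>a b. \<epsilon> x a * \<epsilon> y b)" for x y
    unfolding \<Phi>.simps(2)[of x "[y]"]
    by (rule comult_cong[OF assms(2)]) (simp only: \<Phi>_single)
  have s: "pairF (\<lambda>w. c * f w) p = c * pairF f p" if "f \<in> carrier F" for c f
    using linear_form_smult[OF pairF_linF that, of c p] by simp
  from assms(1) show ?thesis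
    unfolding relations_def
    by (elim UnE CollectE exE conjE)
      (simp_all only: pairF_diff s pairF_word \<Phi>_single[OF assms(2)] w2 eps_add eps_smult eps_bracket assms(2) c
        lists.intros, simp_all add: c)
qed

text \<open>The elements pairing to zero with all of \<open>H\<close> form a two-sided ideal,
  because products are sent to convolution products. It contains the relations, hence the ideal they
  generate.\<close>

lemma pairF_ideal:
  assumes "G \<in> I" "p \<in> carrier H"
  shows "pairF G p = 0"
proof -
  interpret ring F using algF by (rule assoc_algebraD)
  let ?K = "{G \<in> carrier F. \<forall>p\<in>carrier H. pairF G p = 0}"
  have zero: "pairF (\<lambda>w. 0) p = 0" for p by (simp add: pairF_def fsum_def)
  have "submodule ?K scalars F"
    by (rule submoduleI'[OF spF])
      (auto simp: free_closed zero linear_form_add[OF pairF_linF, simplified] linear_form_smult[OF pairF_linF, simplified])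
  then have sub: "subgroup ?K (add_monoid F)" by (simp add: submodule_def)
  have z: "comult H p (\<lambda>a b. 0) = 0" if "p \<in> carrier H" for p
    using tensor_cmult_form[OF comult_closed[OF that] bilinear_mult[OF counit_lin counit_lin], of 0] by simp
  have "ideal ?K F"
  proof (rule idealI[OF ring_axioms sub])
    fix G K assume GK: "G \<in> ?K" "K \<in> carrier F"
    have "pairF (K \<otimes>\<^bsub>F\<^esub> G) p = 0" "pairF (G \<otimes>\<^bsub>F\<^esub> K) p = 0" if p: "p \<in> carrier H" for p
    proof -
      have "comult H p (\<lambda>a b. pairF K a * pairF G b) = comult H p (\<lambda>a b. 0)"
        "comult H p (\<lambda>a b. pairF G a * pairF K b) = comult H p (\<lambda>a b. 0)"
        using GK by (auto intro!: comult_cong[OF p])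
      with GK p z show "pairF (K \<otimes>\<^bsub>F\<^esub> G) p = 0" "pairF (G \<otimes>\<^bsub>F\<^esub> K) p = 0" by (auto simp: pairF_mult)
    qed
    with GK show "K \<otimes>\<^bsub>F\<^esub> G \<in> ?K" "G \<otimes>\<^bsub>F\<^esub> K \<in> ?K" by (auto simp: free_closed)
  qed
  moreover have "relations \<subseteq> ?K" using relations_closed pairF_relations by auto
  ultimately have "I \<subseteq> ?K" unfolding ideal_eq by (rule genideal_minimal)
  with assms show ?thesis by auto
qed

lemmas quot = quotient_algebra[OF algF ideal_I, folded enveloping_algebra_def]

lemma cls_eq_iff: "G \<in> carrier F \<Longrightarrow> K \<in> carrier F \<Longrightarrow> cls G = cls K \<longleftrightarrow> (\<lambda>w. G w - K w) \<in> I"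
proof -
  interpret ring F using algF by (rule assoc_algebraD)
  show "G \<in> carrier F \<Longrightarrow> K \<in> carrier F \<Longrightarrow> cls G = cls K \<longleftrightarrow> (\<lambda>w. G w - K w) \<in> I"
    using quotient_eq_iff_same_a_r_cos[OF ideal_I, of G K] by (simp add: free_minus)
qed

text \<open>Computed on an arbitrary representative of the class; by \<open>pairF_ideal\<close> the
  choice does not affect the values on \<open>carrier H\<close>.\<close>

definition pairU :: "('l list \<Rightarrow> 'k) set \<Rightarrow> 'a \<Rightarrow> 'k" where
  "pairU u = pairF (SOME G. G \<in> carrier F \<and> u = cls G)"

lemma pairU_cls:
  assumes "G \<in> carrier F" "p \<in> carrier H"
  shows "pairU (cls G) p = pairF G p"
proof -
  let ?G = "SOME K. K \<in> carrier F \<and> cls G = cls K"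
  have G: "?G \<in> carrier F \<and> cls G = cls ?G" by (rule someI[of _ G]) (simp add: assms)
  then have "(\<lambda>w. G w - ?G w) \<in> I" using cls_eq_iff assms by blast
  then have "pairF (\<lambda>w. G w - ?G w) p = 0" using assms by (intro pairF_ideal)
  with G assms show ?thesis unfolding pairU_def by (simp add: pairF_diff)
qed

lemma cls_closed: "G \<in> carrier F \<Longrightarrow> cls G \<in> carrier U0"
  by (simp add: quot)

lemma U0_cases:
  assumes "u \<in> carrier U0" obtains G where "G \<in> carrier F" "u = cls G"
  using assms by (auto simp: quot)

lemma pairU_lin: "p \<in> carrier H \<Longrightarrow> linear_form U0 (\<lambda>u. pairU u p)"
  unfolding linear_form_def
  using linear_form_add[OF pairF_linF, of _ _ p] linear_form_smult[OF pairF_linF, of _ _ p]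
  by (auto elim!: U0_cases simp: quot(3,4) pairU_cls free_closed)

lemma pairU_lin2: "u \<in> carrier U0 \<Longrightarrow> linear_form H (pairU u)"
  unfolding pairU_def by (rule pairF_lin)

lemma pairU_mult:
  assumes "u \<in> carrier U0" "v \<in> carrier U0" "p \<in> carrier H"
  shows "pairU (u \<otimes>\<^bsub>U0\<^esub> v) p = comult H p (\<lambda>a b. pairU u a * pairU v b)"
proof -
  obtain G K where GK: "G \<in> carrier F" "u = cls G" "K \<in> carrier F" "v = cls K" using assms by (elim U0_cases)
  have "pairU (u \<otimes>\<^bsub>U0\<^esub> v) p = comult H p (\<lambda>a b. pairF G a * pairF K b)"
    using GK assms(3) by (simp add: quot(2) pairU_cls free_closed pairF_mult)
  also have "\<dots> = comult H p (\<lambda>a b. pairU u a * pairU v b)"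
    by (rule comult_cong[OF assms(3)]) (simp add: GK pairU_cls)
  finally show ?thesis .
qed

abbreviation "ew w \<equiv> env_word L w"

lemma ew_closed: "w \<in> lists (carrier L) \<Longrightarrow> ew w \<in> carrier U0"
  unfolding env_word_def by (intro cls_closed free_closed)

lemma pairU_ew: "w \<in> lists (carrier L) \<Longrightarrow> p \<in> carrier H \<Longrightarrow> pairU (ew w) p = \<Phi> w p"
  unfolding env_word_def by (simp add: pairU_cls free_closed)

lemma ew_append: "u \<in> lists (carrier L) \<Longrightarrow> v \<in> lists (carrier L) \<Longrightarrow> ew (u @ v) = ew u \<otimes>\<^bsub>U0\<^esub> ew v"
  unfolding env_word_def by (subst quot(2)) (auto simp: free_closed word_mult)

lemma ew_Nil: "ew [] = \<one>\<^bsub>U0\<^esub>"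
  unfolding env_word_def by (simp add: quot(5))

lemma pairU_one: "p \<in> carrier H \<Longrightarrow> pairU \<one>\<^bsub>U0\<^esub> p = counit H p"
  using pairU_ew[of "[]" p] by (simp add: ew_Nil)

lemma ew_add: "x \<in> carrier L \<Longrightarrow> y \<in> carrier L \<Longrightarrow> ew [x \<oplus>\<^bsub>L\<^esub> y] = ew [x] \<oplus>\<^bsub>U0\<^esub> ew [y]"
  and ew_smult: "x \<in> carrier L \<Longrightarrow> ew [c \<odot>\<^bsub>L\<^esub> x] = c \<odot>\<^bsub>U0\<^esub> ew [x]"
  and ew_bracket: "x \<in> carrier L \<Longrightarrow> y \<in> carrier L \<Longrightarrow> ew [x, y] = ew [y, x] \<oplus>\<^bsub>U0\<^esub> ew [x \<otimes>\<^bsub>L\<^esub> y]"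
proof -
  note c = free_closed kspace_closed[OF spL] bracket_closed
  show "ew [x \<oplus>\<^bsub>L\<^esub> y] = ew [x] \<oplus>\<^bsub>U0\<^esub> ew [y]" if "x \<in> carrier L" "y \<in> carrier L"
  proof -
    have "(\<lambda>w. word [x \<oplus>\<^bsub>L\<^esub> y] w - (word [x] w + word [y] w)) \<in> I"
      unfolding diff_diff_eq[symmetric] by (rule subsetD[OF relations_I]) (use that in \<open>unfold relations_def, blast\<close>)
    then show ?thesis using that unfolding env_word_def
      by (subst quot(3)) (auto simp: c cls_eq_iff)
  qed
  show "ew [c \<odot>\<^bsub>L\<^esub> x] = c \<odot>\<^bsub>U0\<^esub> ew [x]" if "x \<in> carrier L"
  proof -
    have "(\<lambda>w. word [c \<odot>\<^bsub>L\<^esub> x] w - c * word [x] w) \<in> I"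
      by (rule subsetD[OF relations_I]) (use that in \<open>unfold relations_def, blast\<close>)
    then show ?thesis using that unfolding env_word_def
      by (subst quot(4)) (auto simp: c cls_eq_iff)
  qed
  show "ew [x, y] = ew [y, x] \<oplus>\<^bsub>U0\<^esub> ew [x \<otimes>\<^bsub>L\<^esub> y]" if "x \<in> carrier L" "y \<in> carrier L"
  proof -
    have "(\<lambda>w. word [x, y] w - (word [y, x] w + word [x \<otimes>\<^bsub>L\<^esub> y] w)) \<in> I"
      unfolding diff_diff_eq[symmetric] by (rule subsetD[OF relations_I]) (use that in \<open>unfold relations_def, blast\<close>)
    then show ?thesis using that unfolding env_word_def
      by (subst quot(3)) (auto simp: c cls_eq_iff)
  qed
qed

text \<open>The defining relations hold inside any word, by distributivity in the quotient. The
  third one exchanges two neighbouring letters at the cost of a word with one letter less.\<close>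

lemma ew_middle:
  assumes "u \<in> lists (carrier L)" "v \<in> lists (carrier L)"
  shows "x \<in> carrier L \<Longrightarrow> y \<in> carrier L \<Longrightarrow> ew (u @ [x \<oplus>\<^bsub>L\<^esub> y] @ v) = ew (u @ [x] @ v) \<oplus>\<^bsub>U0\<^esub> ew (u @ [y] @ v)"
    and "x \<in> carrier L \<Longrightarrow> ew (u @ [c \<odot>\<^bsub>L\<^esub> x] @ v) = c \<odot>\<^bsub>U0\<^esub> ew (u @ [x] @ v)"
    and "x \<in> carrier L \<Longrightarrow> y \<in> carrier L \<Longrightarrow>
      ew (u @ [x, y] @ v) = ew (u @ [y, x] @ v) \<oplus>\<^bsub>U0\<^esub> ew (u @ [x \<otimes>\<^bsub>L\<^esub> y] @ v)"
proof -
  interpret U: ring U0 using quot(7) by (rule assoc_algebraD)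
  note c = kspace_closed[OF spL] bracket_closed assms
  have app: "ew (u @ t @ v) = ew u \<otimes>\<^bsub>U0\<^esub> (ew t \<otimes>\<^bsub>U0\<^esub> ew v)" if "t \<in> lists (carrier L)" for t
    using that assms by (simp add: ew_append)
  show "ew (u @ [x \<oplus>\<^bsub>L\<^esub> y] @ v) = ew (u @ [x] @ v) \<oplus>\<^bsub>U0\<^esub> ew (u @ [y] @ v)"
    if "x \<in> carrier L" "y \<in> carrier L"
    using that by (subst (1 2 3) app) (simp_all add: c ew_add ew_closed U.l_distr U.r_distr)
  show "ew (u @ [c \<odot>\<^bsub>L\<^esub> x] @ v) = c \<odot>\<^bsub>U0\<^esub> ew (u @ [x] @ v)" if "x \<in> carrier L"
    using that quot(7) by (subst (1 2) app) (simp_all add: c ew_smult ew_closed assoc_algebra_def)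
  show "ew (u @ [x, y] @ v) = ew (u @ [y, x] @ v) \<oplus>\<^bsub>U0\<^esub> ew (u @ [x \<otimes>\<^bsub>L\<^esub> y] @ v)"
    if "x \<in> carrier L" "y \<in> carrier L"
    using that by (subst (1 2 3) app) (simp_all add: c ew_bracket[OF that] ew_closed U.l_distr U.r_distr)
qed

lemma U0_spanned:
  assumes W: "submodule W scalars U0" and w: "\<And>w. w \<in> lists (carrier L) \<Longrightarrow> ew w \<in> W"
  shows "W = carrier U0"
proof
  note s = submoduleD[OF assoc_algebraD(1)[OF quot(7)] W]
  show "W \<subseteq> carrier U0" by (rule s)
  show "carrier U0 \<subseteq> W"
  proof
    fix u assume "u \<in> carrier U0"
    then obtain G where G: "G \<in> carrier F" "u = cls G" by (rule U0_cases)
    from G(1) have "cls G \<in> W"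
    proof (rule free_induct)
      show "cls (\<lambda>w. 0) \<in> W" using s(2) by (simp add: quot(6))
      fix K c v assume K: "K \<in> carrier F" "cls K \<in> W" "v \<in> lists (carrier L)"
      have "cls K \<oplus>\<^bsub>U0\<^esub> c \<odot>\<^bsub>U0\<^esub> ew v \<in> W" using K w s by blast
      moreover have "cls K \<oplus>\<^bsub>U0\<^esub> c \<odot>\<^bsub>U0\<^esub> ew v = cls (\<lambda>x. K x + c * word v x)"
        using K unfolding env_word_def by (simp add: quot(3,4) free_closed)
      ultimately show "cls (\<lambda>x. K x + c * word v x) \<in> W" by simp
    qed
    with G show "u \<in> W" by simp
  qed
qed

end

section \<open>The Poincare-Birkhoff-Witt theorem for the Lie algebra of a coordinate group\<close>

lemma tensor_four:
  assumes T: "T \<in> tensors M N"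
    and "linear_form M f" "linear_form M g" "linear_form N h" "linear_form N k"
  shows "T (\<lambda>a b. c1 * (f a * h b) + c2 * (f a * k b) + c3 * (g a * h b) + c4 * (g a * k b))
    = c1 * T (\<lambda>a b. f a * h b) + c2 * T (\<lambda>a b. f a * k b) + c3 * T (\<lambda>a b. g a * h b) + c4 * T (\<lambda>a b. g a * (k b :: 'k::field))"
proof -
  note b = bilinear_mult[OF assms(2) assms(4)] bilinear_mult[OF assms(2) assms(5)]
    bilinear_mult[OF assms(3) assms(4)] bilinear_mult[OF assms(3) assms(5)]
  have add: "bilinear_form M N (\<lambda>a b. \<beta> a b + \<gamma> a b)" if "bilinear_form M N \<beta>" "bilinear_form M N \<gamma>" for \<beta> \<gamma>
    using that by (simp add: bilinear_form_def lf_plus)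
  have cm: "bilinear_form M N (\<lambda>a b. c * \<beta> a b)" if "bilinear_form M N \<beta>" for c \<beta>
    using that by (simp add: bilinear_form_def lf_mult_left)
  show ?thesis
    by (simp add: tensor_add_form[OF T] tensor_cmult_form[OF T] b cm add)
qed

definition mon_of :: "'x list \<Rightarrow> 'x mon" where
  "mon_of as = (\<Sum>a\<leftarrow>as. single a 1)"

lemma mon_of_simps [simp]:
  "mon_of [] = 0" "mon_of (a # as) = single a 1 + mon_of as"
  "mon_of (as @ bs) = mon_of as + mon_of bs"
  by (auto simp: mon_of_def)

lemma mon_size_mon_of [simp]: "mon_size (mon_of as) = length as"
  by (induction as) (auto simp: mon_size_add)

lemma keys_mon_of [simp]: "keys (mon_of as) = set as"
  by (induction as) (auto simp: keys_add_nat)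

lemma single_1_eq_iff: "single x (1::nat) = single y 1 \<longleftrightarrow> x = y"
  by (metis keys_single one_neq_zero singleton_inject)

lemma map_mult_0 [simp]: "scale 0 (P :: 'a \<Rightarrow>\<^sub>0 'k::field) = 0"
  "scale c (0 :: 'a \<Rightarrow>\<^sub>0 'k::field) = 0"
  by (rule poly_mapping_eqI, simp)+

lemma ex_mon_of: "keys m \<subseteq> X \<Longrightarrow> \<exists>as. mon_of as = m"
proof (induction m rule: mon_induct)
  case (add m x)
  then obtain as where "mon_of as = m" by blast
  then have "mon_of (x # as) = m + single x 1" by (simp add: add.commute)
  then show ?case by blast
qed (auto intro: exI[of _ "[]"])

text \<open>One arbitrarily ordered word for each monomial. These words take the place of the
  increasing words in the Poincare-Birkhoff-Witt theorem, without an order on the letters.\<close>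

definition canon :: "'x mon \<Rightarrow> 'x list" where
  "canon m = (SOME as. mon_of as = m)"

lemma mon_of_canon [simp]: "mon_of (canon m) = m"
  unfolding canon_def by (rule someI_ex) (rule ex_mon_of[OF order_refl])

lemma length_canon [simp]: "length (canon m) = mon_size m"
  using mon_size_mon_of[of "canon m"] by simp

lemma set_canon [simp]: "set (canon m) = keys m"
  using keys_mon_of[of "canon m"] by simp

text \<open>The filtration by order of vanishing at the origin, which is the identity of the
  group.\<close>

definition min_size :: "nat \<Rightarrow> ('x, 'k::field) mpoly \<Rightarrow> bool" where
  "min_size k P \<longleftrightarrow> (\<forall>m\<in>keys P. k \<le> mon_size m)"

lemma min_size_closed:
  "min_size k P \<Longrightarrow> min_size k Q \<Longrightarrow> min_size k (P + Q)"
  "min_size k P \<Longrightarrow> min_size l Q \<Longrightarrow> min_size (k + l) (P * Q)"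
  "min_size k 0" "min_size 0 P"
  "k \<le> mon_size m \<Longrightarrow> min_size k (single m c)"
  "min_size k P \<Longrightarrow> l \<le> k \<Longrightarrow> min_size l P"
proof -
  show "min_size k P \<Longrightarrow> min_size k Q \<Longrightarrow> min_size k (P + Q)"
    using Poly_Mapping.keys_add[of P Q] unfolding min_size_def by blast
  show "min_size (k + l) (P * Q)" if "min_size k P" "min_size l Q"
    unfolding min_size_def
  proof
    fix m assume "m \<in> keys (P * Q)"
    then obtain a b where "m = a + b" "a \<in> keys P" "b \<in> keys Q" using keys_mult[of P Q] by blast
    then show "k + l \<le> mon_size m" using that by (simp add: min_size_def mon_size_add add_mono)
  qed
qed (auto simp: min_size_def)

lemma of_nat_mult_poly: "of_nat k * (P :: ('x, 'k::field) mpoly) = scale ((of_nat k)) P"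
  by (simp add: mult_map_scale_conv_mult)

definition sgl :: "'x \<Rightarrow> 'x \<Rightarrow>\<^sub>0 'k::field" where
  "sgl a = single a 1"

text \<open>The derivative at the origin in the direction \<open>l\<close>.\<close>

definition eps :: "('x \<Rightarrow>\<^sub>0 'k::field) \<Rightarrow> ('x, 'k) mpoly \<Rightarrow> 'k" where
  "eps l P = (\<Sum>x\<in>keys l. lookup l x * lookup P (single x 1))"

lemma eps_sgl [simp]: "eps (sgl a) P = lookup P (single a 1)"
  by (simp add: eps_def sgl_def)

lemma eps_add_left: "eps (x + y) P = eps x P + eps y P"
  unfolding eps_def by (rule linear_sum_add)

lemma eps_smult_left: "eps (scale c x) P = c * eps x P"
  unfolding eps_def by (rule linear_sum_map)

lemma eps_add_right: "eps x (P + Q) = eps x P + eps x Q"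
  by (simp add: eps_def lookup_add distrib_left sum.distrib)

lemma eps_smult_right: "eps x (scale c P) = c * eps x P"
  by (simp add: eps_def sum_distrib_left mult.left_commute)

text \<open>Leibniz rule at the origin: a single variable factors only as itself times 1.\<close>

lemma lookup_mult_single:
  "lookup (P * Q) (single x 1) = lookup P (single x 1) * lookup Q 0
    + lookup P 0 * lookup (Q :: ('x, 'k::field) mpoly) (single x 1)"
  using subset_UNIV[of "keys P"]
proof (induction P rule: poly_mapping_induct)
  case (single m c)
  show ?case
    using subset_UNIV[of "keys Q"]
  proof (induction Q rule: poly_mapping_induct)
    case (single m' c')
    have ne: "single x (1::nat) \<noteq> 0" by (metis mon_size_single mon_size_0 zero_neq_one)
    have iff: "m + m' = single x 1 \<longleftrightarrow> (m = single x 1 \<and> m' = 0) \<or> (m = 0 \<and> m' = single x 1)"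
    proof
      assume eq: "m + m' = single x 1"
      then have "mon_size m + mon_size m' = 1" by (metis mon_size_add mon_size_single)
      then have "mon_size m = 0 \<or> mon_size m' = 0" by linarith
      then have "m = 0 \<or> m' = 0" by simp
      with eq show "(m = single x 1 \<and> m' = 0) \<or> (m = 0 \<and> m' = single x 1)" by auto
    qed auto
    show ?case unfolding mult_single lookup_single iff when_def using ne by auto
  qed (simp_all add: lookup_add algebra_simps)
qed (simp_all add: lookup_add algebra_simps)

text \<open>By \<open>L_bracket\<close> the bracket is the antisymmetrized bilinear part of the
  coproduct, prescribed on pairs of basis vectors and on coordinates only. The components
  \<open>Lc\<close> are constrained from above by the degrees of their elements and from below by
  the basis vectors.\<close>

locale coord_lie = graded_coord_group n X deg \<Gamma> \<kappa>
  for n and X :: "'x set" and deg and \<Gamma> :: "('g, 'c) monoid_scheme" and \<kappa> :: "'g \<Rightarrow> 'x \<Rightarrow> 'k::field_char_0" +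
  fixes L :: "('k, 'x \<Rightarrow>\<^sub>0 'k) module" and Lc :: "expo \<Rightarrow> ('x \<Rightarrow>\<^sub>0 'k) set"
  assumes L_simps [simp]: "carrier L = {l. keys l \<subseteq> X}" "zero L = 0" "add L = (+)" "smult L = scale"
    and L_closed: "\<And>x y. keys x \<subseteq> X \<Longrightarrow> keys y \<subseteq> X \<Longrightarrow> keys (x \<otimes>\<^bsub>L\<^esub> y) \<subseteq> X"
    and L_bilin: "\<And>x y z. x \<in> carrier L \<Longrightarrow> y \<in> carrier L \<Longrightarrow> z \<in> carrier L \<Longrightarrow> (x + y) \<otimes>\<^bsub>L\<^esub> z = x \<otimes>\<^bsub>L\<^esub> z + y \<otimes>\<^bsub>L\<^esub> z"
      "\<And>x y z. x \<in> carrier L \<Longrightarrow> y \<in> carrier L \<Longrightarrow> z \<in> carrier L \<Longrightarrow> z \<otimes>\<^bsub>L\<^esub> (x + y) = z \<otimes>\<^bsub>L\<^esub> x + z \<otimes>\<^bsub>L\<^esub> y"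
      "\<And>c x y. x \<in> carrier L \<Longrightarrow> y \<in> carrier L \<Longrightarrow> scale c x \<otimes>\<^bsub>L\<^esub> y = scale c (x \<otimes>\<^bsub>L\<^esub> y)"
      "\<And>c x y. x \<in> carrier L \<Longrightarrow> y \<in> carrier L \<Longrightarrow> y \<otimes>\<^bsub>L\<^esub> scale c x = scale c (y \<otimes>\<^bsub>L\<^esub> x)"
    and L_bracket: "\<And>a b c. a \<in> X \<Longrightarrow> b \<in> X \<Longrightarrow> c \<in> X \<Longrightarrow> lookup (sgl a \<otimes>\<^bsub>L\<^esub> sgl b) c
      = comult coord_hopf (var c) (\<lambda>p q. lookup p (single a 1) * lookup q (single b 1))
      - comult coord_hopf (var c) (\<lambda>p q. lookup p (single b 1) * lookup q (single a 1))"
    and Lc_deg: "\<And>\<alpha> l. l \<in> Lc \<alpha> \<Longrightarrow> keys l \<subseteq> {x \<in> X. deg x = \<alpha>}"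
    and Lc_sgl: "\<And>x. x \<in> X \<Longrightarrow> sgl x \<in> Lc (deg x)"
begin

sublocale H: separated_hopf coord_hopf
  by (rule separated_hopf_coord)

abbreviation "\<eta> \<equiv> counit coord_hopf"

declare coord_simps(11) [simp del]

lemma eta_eq: "P \<in> carrier A \<Longrightarrow> \<eta> P = lookup P 0"
  by (simp add: ev_one_eq coord_simps(11))

lemma eta_lin: "linear_form A \<eta>" by (simp add: lf_ev coord_simps(11))

lemma eps_lin: "linear_form A (eps l)"
  by (simp add: linear_form_def eps_add_right eps_smult_right)

lemma eps_mult:
  assumes "P \<in> carrier A" "Q \<in> carrier A"
  shows "eps l (P * Q) = eps l P * \<eta> Q + \<eta> P * eps l Q"
proof -
  have "eps l (P * Q) = eps l P * lookup Q 0 + lookup P 0 * eps l Q"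
    unfolding eps_def lookup_mult_single by (simp add: sum_distrib_left sum_distrib_right sum.distrib algebra_simps)
  with assms show ?thesis by (simp only: eta_eq)
qed

lemma eps_one: "eps (l :: 'x \<Rightarrow>\<^sub>0 'k) 1 = 0"
proof -
  have "lookup (1 :: ('x, 'k) mpoly) (single x 1) = 0" for x :: 'x
  proof -
    have "single x (1::nat) \<noteq> 0" by (metis mon_size_single mon_size_0 zero_neq_one)
    then show ?thesis by (simp add: lookup_one when_def)
  qed
  then show ?thesis by (simp add: eps_def)
qed

text \<open>By the Leibniz rule and induction on monomials, a derivation at the origin is determined
  by its values on the variables.\<close>

lemma derivations_eqI:
  assumes "linear_form A f" "linear_form A g" "f 1 = 0" "g 1 = 0"
    and "\<And>P Q. P \<in> carrier A \<Longrightarrow> Q \<in> carrier A \<Longrightarrow> f (P * Q) = f P * \<eta> Q + \<eta> P * f Q"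
    and "\<And>P Q. P \<in> carrier A \<Longrightarrow> Q \<in> carrier A \<Longrightarrow> g (P * Q) = g P * \<eta> Q + \<eta> P * g Q"
    and "\<And>x. x \<in> X \<Longrightarrow> f (var x) = g (var x)" "P \<in> carrier A"
  shows "f P = g P"
proof -
  have "f (single m 1) = g (single m 1)" if "keys m \<subseteq> X" for m
    using that
  proof (induction m rule: mon_induct)
    case zero
    then show ?case using assms(3,4) by simp
  next
    case (add m x)
    then have "single m 1 \<in> carrier A" "var x \<in> carrier A" by (simp_all add: poly_closed)
    then show ?case unfolding single_add_var using add assms(5-7) by simp
  qed
  then show ?thesis
    using assms(8) unfolding linear_form_poly[OF assms(1,8)] linear_form_poly[OF assms(2,8)] poly_carrier
    by (intro sum.cong) auto
qed

text \<open>The convolution of two derivations at the origin is not a derivation. The defect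
  consists of the two mixed terms; together they are symmetric in \<open>f\<close> and
  \<open>g\<close> and cancel in the commutator.\<close>

lemma comult_mult_forms:
  assumes P: "P \<in> carrier A" and Q: "Q \<in> carrier A"
    and f: "linear_form A f" "\<And>P Q. P \<in> carrier A \<Longrightarrow> Q \<in> carrier A \<Longrightarrow> f (P * Q) = f P * \<eta> Q + \<eta> P * f Q"
    and g: "linear_form A g" "\<And>P Q. P \<in> carrier A \<Longrightarrow> Q \<in> carrier A \<Longrightarrow> g (P * Q) = g P * \<eta> Q + \<eta> P * g Q"
  shows "comult coord_hopf (P * Q) (\<lambda>a b. f a * g b)
    = comult coord_hopf P (\<lambda>a b. f a * g b) * \<eta> Q + f P * g Q + g P * f Q + \<eta> P * comult coord_hopf Q (\<lambda>a b. f a * g b)"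
proof -
  let ?C = "comult coord_hopf"
  have c: "?C P (\<lambda>a b. f a * \<eta> b) = f P" "?C P (\<lambda>a b. \<eta> a * g b) = g P"
    "?C P (\<lambda>a b. \<eta> a * \<eta> b) = \<eta> P" if "P \<in> carrier A" for P
    using H.comult_counit[of P f] H.comult_counit[of P g] H.comult_counit[of P \<eta>] that f(1) g(1) eta_lin
    by (simp_all add: mult.commute)
  have inner: "?C Q (\<lambda>a' b'. f (a * a') * g (b * b')) = f a * g b * \<eta> Q + f a * \<eta> b * g Q + \<eta> a * g b * f Q
      + \<eta> a * \<eta> b * ?C Q (\<lambda>a b. f a * g b)" if ab: "a \<in> carrier A" "b \<in> carrier A" for a b
  proof -
    have "?C Q (\<lambda>a' b'. f (a * a') * g (b * b')) = ?C Q (\<lambda>a' b'. (\<eta> a * \<eta> b) * (f a' * g b') + (\<eta> a * g b) * (f a' * \<eta> b')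
        + (f a * \<eta> b) * (\<eta> a' * g b') + (f a * g b) * (\<eta> a' * \<eta> b'))"
      by (rule H.comult_cong) (use ab Q in \<open>simp_all add: f(2) g(2) algebra_simps\<close>)
    also have "\<dots> = \<eta> a * \<eta> b * ?C Q (\<lambda>a b. f a * g b) + \<eta> a * g b * f Q + f a * \<eta> b * g Q + f a * g b * \<eta> Q"
      by (simp add: tensor_four[OF comult_coord(1)[OF Q] f(1) eta_lin g(1) eta_lin] c Q)
    finally show ?thesis by (simp add: algebra_simps)
  qed
  have "?C (P * Q) (\<lambda>a b. f a * g b) = ?C P (\<lambda>a b. ?C Q (\<lambda>a' b'. f (a * a') * g (b * b')))"
    using H.comult_mult[of P Q "\<lambda>a b. f a * g b"] P Q f g by (simp add: bilinear_mult)
  also have "\<dots> = ?C P (\<lambda>a b. \<eta> Q * (f a * g b) + g Q * (f a * \<eta> b) + f Q * (\<eta> a * g b) + ?C Q (\<lambda>a b. f a * g b) * (\<eta> a * \<eta> b))"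
    by (rule H.comult_cong) (use P in \<open>simp_all add: inner algebra_simps\<close>)
  also have "\<dots> = \<eta> Q * ?C P (\<lambda>a b. f a * g b) + g Q * f P + f Q * g P + ?C Q (\<lambda>a b. f a * g b) * \<eta> P"
    by (simp add: tensor_four[OF comult_coord(1)[OF P] f(1) eta_lin g(1) eta_lin] c P)
  finally show ?thesis by (simp add: algebra_simps)
qed

lemma comult_one_forms: "linear_form A f \<Longrightarrow> linear_form A g \<Longrightarrow> comult coord_hopf 1 (\<lambda>a b. f a * g b) = f 1 * g 1"
  using H.comult_one[of "\<lambda>a b. f a * g b"] by (simp add: bilinear_mult)

lemma eps_var: "eps l (var x) = lookup l x"
proof -
  have "eps l (var x) = (\<Sum>y\<in>keys l. if y = x then lookup l x else 0)"
    unfolding eps_def var_def by (intro sum.cong) (auto simp: lookup_single when_def single_1_eq_iff[simplified])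
  then show ?thesis by (simp add: in_keys_iff)
qed

lemma spL: "kspace L"
proof (rule kspaceI)
  show "x \<oplus>\<^bsub>L\<^esub> y \<in> carrier L" if "x \<in> carrier L" "y \<in> carrier L" for x y
    using that Poly_Mapping.keys_add[of x y] by auto
  show "c \<odot>\<^bsub>L\<^esub> x \<in> carrier L" if "x \<in> carrier L" for c x
    using that keys_map_mult[of c x] by auto
qed (simp_all add: map_mult_add algebra_simps)

text \<open>Bilinear extension of \<open>L_bracket\<close> from pairs of basis vectors.\<close>

lemma comult_var_bracket:
  assumes "x \<in> carrier L" "y \<in> carrier L" "c \<in> X"
  shows "lookup (x \<otimes>\<^bsub>L\<^esub> y) c = comult coord_hopf (var c) (\<lambda>a b. eps x a * eps y b) - comult coord_hopf (var c) (\<lambda>a b. eps y a * eps x b)"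
proof -
  let ?T = "comult coord_hopf (var c)"
  have T: "?T \<in> tensors A A" using assms(3) by (intro comult_coord poly_closed)
  have bil: "bilinear_form A A (\<lambda>a b. eps u a * eps v b)" for u v
    by (intro bilinear_mult eps_lin)
  have T0: "?T (\<lambda>a b. eps 0 a * eps v b) = 0" "?T (\<lambda>a b. eps v a * eps 0 b) = 0" for v
    using tensor_cmult_form[OF T bil[of v v], of 0] by (simp_all add: eps_def)
  have Tadd: "?T (\<lambda>a b. eps (u + u') a * eps v b) = ?T (\<lambda>a b. eps u a * eps v b) + ?T (\<lambda>a b. eps u' a * eps v b)"
     "?T (\<lambda>a b. eps v a * eps (u + u') b) = ?T (\<lambda>a b. eps v a * eps u b) + ?T (\<lambda>a b. eps v a * eps u' b)" for u u' v
    by (simp_all add: eps_add_left distrib_right distrib_left tensor_add_form[OF T bil bil])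
  have sgl_mult: "single a d = scale d (sgl a)" for a and d :: 'k
    by (simp add: sgl_def)
  have sm: "?T (\<lambda>a b. eps (scale d u) a * eps v b) = d * ?T (\<lambda>a b. eps u a * eps v b)"
     "?T (\<lambda>a b. eps v a * eps (scale d u) b) = d * ?T (\<lambda>a b. eps v a * eps u b)" for u v d
    using tensor_cmult_form[OF T bil[of u v], of d] tensor_cmult_form[OF T bil[of v u], of d]
    by (simp_all add: eps_smult_left mult_ac)
  have sc: "sgl a \<in> carrier L" if "a \<in> X" for a using that by (simp add: sgl_def)
  have br: "lookup (sgl a \<otimes>\<^bsub>L\<^esub> sgl b) c = ?T (\<lambda>p q. eps (sgl a) p * eps (sgl b) q) - ?T (\<lambda>p q. eps (sgl b) p * eps (sgl a) q)"
    if "a \<in> X" "b \<in> X" for a b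
    using L_bracket[OF that assms(3)] by simp
  have m0: "0 \<otimes>\<^bsub>L\<^esub> v = 0" "v \<otimes>\<^bsub>L\<^esub> 0 = 0" if "v \<in> carrier L" for v
    using L_bilin(3)[of 0 v 0] L_bilin(4)[of 0 v 0] that by simp_all
  from assms(1) have "keys x \<subseteq> X" by simp
  then show ?thesis
  proof (induction x rule: poly_mapping_induct)
    case zero
    show ?case using assms by (simp add: m0 T0)
  next
    case (single a d)
    from assms(2) have "keys y \<subseteq> X" by simp
    then show ?case
    proof (induction y rule: poly_mapping_induct)
      case zero
      show ?case using single by (simp add: m0 T0)
    next
      case (single b e)
      show ?case
        unfolding sgl_mult
        using \<open>a \<in> X\<close> \<open>b \<in> X\<close> br[of a b] sc[of a] sc[of b] kspace_closed(1)[OF spL, of "sgl b" e]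
        by (simp add: L_bilin sm del: eps_sgl) (simp add: right_diff_distrib mult.left_commute)
    next
      case (add y y')
      then show ?case using single by (simp add: L_bilin lookup_add Tadd)
    qed
  next
    case (add x x')
    then show ?case using assms by (simp add: L_bilin lookup_add Tadd)
  qed
qed

text \<open>Both sides are derivations at the origin, the right one by
  \<open>comult_mult_forms\<close>, and they agree on the variables by
  \<open>comult_var_bracket\<close>.\<close>

lemma eps_bracket:
  assumes "x \<in> carrier L" "y \<in> carrier L" "P \<in> carrier A"
  shows "eps (x \<otimes>\<^bsub>L\<^esub> y) P = comult coord_hopf P (\<lambda>a b. eps x a * eps y b) - comult coord_hopf P (\<lambda>a b. eps y a * eps x b)"
proof (rule derivations_eqI[where g = "\<lambda>P. comult coord_hopf P (\<lambda>a b. eps x a * eps y b) - comult coord_hopf P (\<lambda>a b. eps y a * eps x b)", OF eps_lin])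
  show "linear_form A (\<lambda>P. comult coord_hopf P (\<lambda>a b. eps x a * eps y b) - comult coord_hopf P (\<lambda>a b. eps y a * eps x b))"
    using H.lf_comult[of "\<lambda>a b. eps x a * eps y b"] H.lf_comult[of "\<lambda>a b. eps y a * eps x b"]
    by (simp add: linear_form_def algebra_simps)
  show "comult coord_hopf 1 (\<lambda>a b. eps x a * eps y b) - comult coord_hopf 1 (\<lambda>a b. eps y a * eps x b) = 0"
    using comult_one_forms[OF eps_lin eps_lin, of x y] comult_one_forms[OF eps_lin eps_lin, of y x] by (simp add: eps_one)
  fix P Q assume PQ: "P \<in> carrier A" "Q \<in> carrier A"
  show "comult coord_hopf (P * Q) (\<lambda>a b. eps x a * eps y b) - comult coord_hopf (P * Q) (\<lambda>a b. eps y a * eps x b)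
    = (comult coord_hopf P (\<lambda>a b. eps x a * eps y b) - comult coord_hopf P (\<lambda>a b. eps y a * eps x b)) * \<eta> Q
      + \<eta> P * (comult coord_hopf Q (\<lambda>a b. eps x a * eps y b) - comult coord_hopf Q (\<lambda>a b. eps y a * eps x b))"
    using comult_mult_forms[OF PQ eps_lin eps_mult eps_lin eps_mult, of x y]
      comult_mult_forms[OF PQ eps_lin eps_mult eps_lin eps_mult, of y x]
    by (simp only: algebra_simps)
qed (use assms in \<open>simp_all only: eps_one eps_mult eps_var comult_var_bracket\<close>)

lemma env_pairing_L: "env_pairing coord_hopf L eps"
proof (intro env_pairing.intro env_pairing_axioms.intro separated_hopf_coord spL)
  show "linear_form coord_hopf (eps l)" for l by (simp add: eps_lin)
  show "eps (x \<otimes>\<^bsub>L\<^esub> y) p = comult coord_hopf p (\<lambda>a b. eps x a * eps y b) - comult coord_hopf p (\<lambda>a b. eps y a * eps x b)"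
    if "x \<in> carrier L" "y \<in> carrier L" "p \<in> carrier coord_hopf" for x y p
    using eps_bracket[OF that(1,2), of p] that(3) by simp
qed (simp_all add: L_closed eps_add_left eps_smult_left)

sublocale E: env_pairing coord_hopf L eps
  by (rule env_pairing_L)

end

section \<open>Triangularity of the pairing between words and monomials\<close>

context coord_lie
begin

declare eps_sgl [simp del]

abbreviation "\<Psi> as \<equiv> E.\<Phi> (map sgl as)"

lemma sepA: "separating A {f. linear_form A f}"
  using H.separated by (simp add: separating_def)

text \<open>The derivative at the identity in the direction \<open>a\<close> is applied to the left
  leg of the coproduct. This is the vector field with that value at the identity which is invariant
  under right translations.\<close>

definition der :: "'x \<Rightarrow> ('x, 'k) mpoly \<Rightarrow> ('x, 'k) mpoly" where
  "der a P = tensor_lift A A A (\<lambda>u v. scale ((eps (sgl a) u)) v) (comult coord_hopf P)"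

lemma der:
  assumes P: "P \<in> carrier A"
  shows "der a P \<in> carrier A"
    and "linear_form A f \<Longrightarrow> f (der a P) = comult coord_hopf P (\<lambda>u v. eps (sgl a) u * f v)"
proof -
  have s: "f (scale c v) = c * f v" if "linear_form A f" "v \<in> carrier A" for f c v
    using linear_form_smult[OF that, of c] by simp
  note l = tensor_lift_test[OF spA spA spA sepA comult_coord(1)[OF P],
      where h = "\<lambda>u v. scale ((eps (sgl a) u)) v" and \<beta> = "\<lambda>f u v. eps (sgl a) u * f v", folded der_def]
  show "der a P \<in> carrier A"
    by (rule l(1)) (auto simp: poly_closed s intro!: bilinear_mult eps_lin)
  show "f (der a P) = comult coord_hopf P (\<lambda>u v. eps (sgl a) u * f v)" if "linear_form A f"
    by (rule l(2)) (auto simp: poly_closed s that intro!: bilinear_mult eps_lin)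
qed

lemma der_eqI:
  assumes "P \<in> carrier A" "Q \<in> carrier A" "\<And>f. linear_form A f \<Longrightarrow> f P = f Q"
  shows "P = Q"
  using assms by (intro separatingD[OF sepA spA]) auto

lemma der_add:
  assumes "P \<in> carrier A" "Q \<in> carrier A"
  shows "der a (P + Q) = der a P + der a Q"
proof (rule der_eqI)
  fix f assume f: "linear_form A f"
  show "f (der a (P + Q)) = f (der a P + der a Q)"
    using linear_form_add[OF f der(1)[OF assms(1)] der(1)[OF assms(2)]]
      linear_form_add[OF H.lf_comult[of "\<lambda>u v. eps (sgl a) u * f v"], of P Q] assms
    by (simp add: der(2)[OF _ f] poly_closed)
qed (simp_all add: der assms poly_closed)

lemma der_smult:
  assumes "P \<in> carrier A"
  shows "der a (scale c P) = scale c (der a P)"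
proof (rule der_eqI)
  fix f assume f: "linear_form A f"
  show "f (der a (scale c P)) = f (scale c (der a P))"
    using linear_form_smult[OF f der(1)[OF assms(1)], of c]
      linear_form_smult[OF H.lf_comult[of "\<lambda>u v. eps (sgl a) u * f v"], of P c] assms
    by (simp add: der(2)[OF _ f] poly_closed)
qed (simp_all add: der assms poly_closed)

lemma der_mult:
  assumes P: "P \<in> carrier A" and Q: "Q \<in> carrier A"
  shows "der a (P * Q) = der a P * Q + P * der a Q"
proof (rule A_eqI)
  let ?C = "comult coord_hopf" and ?e = "eps (sgl a)"
  note cl = der(1) poly_closed assms
  show "der a (P * Q) \<in> carrier A" "der a P * Q + P * der a Q \<in> carrier A" by (simp_all add: cl)
  fix g
  have c: "?C P (\<lambda>u v. \<eta> u * ev g v) = ev g P" if "P \<in> carrier A" for P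
    using H.comult_counit(1)[of P "ev g"] that lf_ev by simp
  have d: "?C P (\<lambda>u v. ?e u * ev g v) = ev g (der a P)" if "P \<in> carrier A" for P
    using der(2)[OF that lf_ev] by simp
  have inner: "?C Q (\<lambda>u' v'. ?e (u * u') * ev g (v * v')) = ?e u * ev g v * ev g Q + \<eta> u * ev g v * ev g (der a Q)"
    if uv: "u \<in> carrier A" "v \<in> carrier A" for u v
  proof -
    have "?C Q (\<lambda>u' v'. ?e (u * u') * ev g (v * v'))
      = ?C Q (\<lambda>u' v'. (?e u * ev g v) * (\<eta> u' * ev g v') + (\<eta> u * ev g v) * (?e u' * ev g v'))"
      by (rule H.comult_cong) (use uv Q in \<open>simp_all add: eps_mult peval_mult algebra_simps\<close>)
    also have "\<dots> = ?C Q (\<lambda>u' v'. (?e u * ev g v) * (\<eta> u' * ev g v')) + ?C Q (\<lambda>u' v'. (\<eta> u * ev g v) * (?e u' * ev g v'))"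
      by (rule tensor_add_form[OF comult_coord(1)[OF Q]])
        (auto intro!: bilinear_formI lf_mult_left lf_mult_right eps_lin eta_lin lf_ev)
    finally show ?thesis
      using Q by (simp add: tensor_cmult_form[OF comult_coord(1)[OF Q]] bilinear_mult eps_lin eta_lin lf_ev c d)
  qed
  have "ev g (der a (P * Q)) = ?C (P * Q) (\<lambda>u v. ?e u * ev g v)"
    by (rule der(2)[OF _ lf_ev]) (simp add: poly_closed P Q)
  also have "\<dots> = ?C P (\<lambda>u v. ?C Q (\<lambda>u' v'. ?e (u * u') * ev g (v * v')))"
    using H.comult_mult[of P Q "\<lambda>u v. ?e u * ev g v"] P Q by (simp add: bilinear_mult eps_lin lf_ev)
  also have "\<dots> = ?C P (\<lambda>u v. ev g Q * (?e u * ev g v) + ev g (der a Q) * (\<eta> u * ev g v))"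
  proof (rule H.comult_cong)
    fix u v assume "u \<in> carrier coord_hopf" "v \<in> carrier coord_hopf"
    then show "?C Q (\<lambda>u' v'. ?e (u * u') * ev g (v * v')) = ev g Q * (?e u * ev g v) + ev g (der a Q) * (\<eta> u * ev g v)"
      using inner[of u v] by (simp add: mult_ac)
  qed (simp add: P)
  also have "\<dots> = ?C P (\<lambda>u v. ev g Q * (?e u * ev g v)) + ?C P (\<lambda>u v. ev g (der a Q) * (\<eta> u * ev g v))"
    by (rule tensor_add_form[OF comult_coord(1)[OF P]])
      (auto intro!: bilinear_formI lf_mult_left lf_mult_right eps_lin eta_lin lf_ev)
  also have "\<dots> = ev g Q * ev g (der a P) + ev g (der a Q) * ev g P"
    using P by (simp add: tensor_cmult_form[OF comult_coord(1)[OF P]] bilinear_mult eps_lin eta_lin lf_ev c d)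
  finally show "ev g (der a (P * Q)) = ev g (der a P * Q + P * der a Q)"
    by (simp add: peval_add peval_mult algebra_simps)
qed

lemma Psi_lin: "linear_form A (E.\<Phi> w)"
  using E.\<Phi>_lin[of w] by simp

text \<open>Iterated, this shows that pairing with a word applies the vector fields of its letters
  from the first to the last and then evaluates at the identity.\<close>

lemma Psi_Cons: "P \<in> carrier A \<Longrightarrow> \<Psi> (a # w) P = \<Psi> w (der a P)"
  using der(2)[OF _ Psi_lin[of "map sgl w"], of P a] by simp

text \<open>At the identity the vector field \<open>der a\<close> is the partial derivative along
  \<open>a\<close>; applied to a variable it thus has constant term 1 or 0.\<close>

lemma min_size_der_var: "x \<in> X \<Longrightarrow> min_size 1 (der a (var x) - of_bool (a = x))"
proof -
  assume x: "x \<in> X"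
  have "lookup (der a (var x)) 0 = \<eta> (der a (var x))"
    using x by (simp add: eta_eq der poly_closed)
  also have "\<dots> = eps (sgl a) (var x)"
    using der(2)[OF _ eta_lin, of "var x" a] H.comult_counit(2)[of "var x" "eps (sgl a)"] x
    by (simp add: poly_closed eps_lin mult.commute)
  also have "\<dots> = of_bool (a = x)" by (simp add: eps_var sgl_def lookup_single when_def)
  finally have "lookup (der a (var x) - of_bool (a = x)) 0 = 0"
    by (simp add: lookup_minus)
  then have "0 \<notin> keys (der a (var x) - of_bool (a = x))" by (simp add: in_keys_iff)
  then show ?thesis unfolding min_size_def
    by (metis One_nat_def Suc_leI gr0I mon_size_eq_0)
qed

text \<open>\<open>der a\<close> is the partial derivative along \<open>a\<close> up to coefficients
  vanishing at the origin. On a monomial of size \<open>k\<close> it therefore gives the partial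
  derivative, of size \<open>k - 1\<close>, up to terms of size at least \<open>k\<close>. If
  \<open>a\<close> does not occur in \<open>m\<close>, the truncated subtraction
  \<open>m - single a 1\<close> returns \<open>m\<close>, but with coefficient 0.\<close>

lemma der_leading:
  assumes "keys m \<subseteq> X"
  shows "min_size (mon_size m) (der a (single m 1) - of_nat (lookup m a) * single (m - single a 1) 1)"
  using assms
proof (induction m rule: mon_induct)
  case zero
  show ?case by (simp only: mon_size_0 min_size_closed)
next
  case (add m b)
  let ?M = "single m 1 :: ('x, 'k) mpoly" and ?N = "single (m - single a 1) 1 :: ('x, 'k) mpoly"
  let ?m = "m + single b 1"
  let ?N' = "single (?m - single a 1) 1 :: ('x, 'k) mpoly"
  define D1 where "D1 = der a ?M - of_nat (lookup m a) * ?N"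
  define D2 where "D2 = der a (var b) - of_bool (a = b)"
  \<comment> \<open>The Leibniz rule for the ordinary partial derivative of \<open>?m\<close>; the
    cases are forced by the truncated subtraction of exponents.\<close>
  have bracket: "of_nat (lookup m a) * ?N * var b + of_bool (a = b) * ?M = of_nat (lookup ?m a) * ?N'"
  proof (cases "lookup m a = 0")
    case True
    then show ?thesis by (cases "a = b") (simp_all add: lookup_add lookup_single when_def)
  next
    case False
    then have a: "a \<in> keys m" by (simp add: in_keys_iff)
    have N: "?N * var b = single (m - single a 1 + single b 1) 1"
      unfolding single_add_var ..
    have eq: "m - single a 1 + single b 1 = ?m - single a 1"
      using False by (intro poly_mapping_eqI) (auto simp: lookup_add lookup_minus lookup_single when_def)
    show ?thesis
    proof (cases "a = b")
      case True
      have "m - single a 1 + single b 1 = m" using mon_decomp[OF a, symmetric] True by simp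
      then have "?N * var b = ?M" by (simp only: N)
      moreover have "?N' = ?M" using True by simp
      ultimately show ?thesis using True by (simp add: lookup_add mult.assoc distrib_right)
    next
      case False
      then show ?thesis using N eq by (simp add: lookup_add lookup_single when_def mult.assoc)
    qed
  qed
  have "single ?m 1 = ?M * var b" by (rule single_add_var)
  then have "der a (single ?m 1) = der a ?M * var b + ?M * der a (var b)"
    using add by (simp add: der_mult poly_closed)
  then have "der a (single ?m 1) - of_nat (lookup ?m a) * ?N' = D1 * var b + ?M * D2"
    unfolding bracket[symmetric] D1_def D2_def by (simp add: algebra_simps)
  moreover have "min_size (mon_size m) D1" "min_size 1 D2"
    using add min_size_der_var by (simp_all add: D1_def D2_def)
  then have "min_size (mon_size m + 1) (D1 * var b)" "min_size (mon_size m + 1) (?M * D2)"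
    by (intro min_size_closed(2); simp add: var_def min_size_closed)+
  ultimately show ?case
    by (simp only: mon_size_add mon_size_single) (rule min_size_closed(1))
qed

lemma min_size_der:
  assumes "P \<in> carrier A" "min_size (k + 1) P"
  shows "min_size k (der a P)"
proof -
  have "keys P \<subseteq> {m. keys m \<subseteq> X \<and> k + 1 \<le> mon_size m}"
    using assms by (auto simp: poly_carrier min_size_def)
  then show ?thesis
  proof (induction P rule: poly_mapping_induct)
    case zero
    have "der a 0 = 0" using der_smult[of 0 a 0] by (simp add: poly_closed)
    then show ?case by (simp add: min_size_closed)
  next
    case (single m c)
    let ?D = "der a (single m 1) - of_nat (lookup m a) * single (m - single a 1) 1"
    have "min_size k ?D" using der_leading[of m a] single by (auto intro: min_size_closed(6))
    moreover have "min_size k (of_nat (lookup m a) * (single (m - single a 1) 1 :: ('x, 'k) mpoly))"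
    proof (cases "lookup m a = 0")
      case False
      then have "a \<in> keys m" by (simp add: in_keys_iff)
      then have "mon_size m = mon_size (m - single a 1) + 1"
        by (subst mon_decomp[of a m], assumption) (simp only: mon_size_add mon_size_single)
      then have "k \<le> mon_size (m - single a 1)" using single by simp
      then show ?thesis
        using min_size_closed(2)[of 0 "of_nat (lookup m a) :: ('x, 'k) mpoly" k "single (m - single a 1) 1"]
        by (simp add: min_size_closed(4,5))
    qed (simp add: min_size_closed)
    ultimately have "min_size k (der a (single m 1))"
      using min_size_closed(1) by fastforce
    then have "min_size k (scale c (der a (single m 1)))"
      using keys_map_mult[of c "der a (single m 1)"] by (auto simp: min_size_def)
    moreover have "single m c = scale c (single m 1)" by simp
    ultimately show ?case using single der_smult[of "single m 1" a c] by (simp add: poly_closed)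
  next
    case (add P P')
    then have "P \<in> carrier A" "P' \<in> carrier A" by (auto simp: poly_carrier)
    with add show ?case by (simp add: der_add min_size_closed)
  qed
qed

text \<open>Each letter lowers the order of vanishing by at most one, so after all letters of the
  word there is still no constant term.\<close>

lemma Psi_eq_0:
  assumes "P \<in> carrier A" "min_size (length as + 1) P"
  shows "\<Psi> as P = 0"
  using assms
proof (induction as arbitrary: P)
  case Nil
  then have "0 \<notin> keys P" by (auto simp: min_size_def)
  with Nil show ?case by (simp add: eta_eq in_keys_iff)
next
  case (Cons a as)
  then show ?case unfolding Psi_Cons[OF Cons(2)]
    using min_size_der[OF Cons(2), of "length as + 1" a] by (intro Cons(1)) (auto simp: der)
qed

text \<open>On monomials whose size is the length of the word only leading terms reach the final
  evaluation, so the vector fields act like commuting partial derivatives. When the monomials match,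
  the integer produced is the product of the factorials of the exponents.\<close>

lemma Psi_leading:
  assumes "keys m \<subseteq> X" "mon_size m = length as"
  shows "\<exists>k>0. \<Psi> as (single m 1) = (if m = mon_of as then of_nat k else 0)"
  using assms
proof (induction as arbitrary: m)
  case Nil
  then show ?case by (simp add: eta_eq poly_closed)
next
  case (Cons a as)
  let ?M = "single m 1 :: ('x, 'k) mpoly" and ?N = "single (m - single a 1) 1 :: ('x, 'k) mpoly"
  define R where "R = der a ?M - of_nat (lookup m a) * ?N"
  have M: "?M \<in> carrier A" using Cons by (simp add: poly_closed)
  have keysN: "keys (m - single a 1) \<subseteq> keys m"
    by (auto simp: in_keys_iff lookup_minus)
  have N: "?N \<in> carrier A" using keysN Cons(2) by (simp add: poly_closed)
  have NN: "of_nat (lookup m a) * ?N \<in> carrier A" unfolding of_nat_mult_poly by (rule poly_closed(3)[OF N])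
  have "R = der a ?M + scale ((-1)) (of_nat (lookup m a) * ?N)" by (simp add: R_def map_mult_add)
  then have RA: "R \<in> carrier A" using poly_closed(1)[OF der(1)[OF M] poly_closed(3)[OF NN]] by simp
  have "min_size (length as + 1) R" using der_leading[OF Cons(2), of a] Cons(3) by (simp add: R_def)
  then have R0: "\<Psi> as R = 0" by (rule Psi_eq_0[OF RA])
  have "\<Psi> (a # as) ?M = \<Psi> as (R + of_nat (lookup m a) * ?N)" unfolding Psi_Cons[OF M] by (simp add: R_def)
  also have "\<dots> = \<Psi> as R + of_nat (lookup m a) * \<Psi> as ?N"
    using linear_form_add[OF Psi_lin RA NN, of "map sgl as"] linear_form_smult[OF Psi_lin N, of "map sgl as" "of_nat (lookup m a)"]
    by (simp add: of_nat_mult_poly)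
  finally have eq: "\<Psi> (a # as) ?M = of_nat (lookup m a) * \<Psi> as ?N" by (simp add: R0)
  show ?case
  proof (cases "lookup m a = 0")
    case True
    then have "m \<noteq> mon_of (a # as)" by (auto simp: lookup_add lookup_single)
    with eq True show ?thesis by (auto intro: exI[of _ 1])
  next
    case False
    then have a: "a \<in> keys m" by (simp add: in_keys_iff)
    have "mon_size m = mon_size (m - single a 1) + 1"
      by (subst mon_decomp[OF a]) (simp only: mon_size_add mon_size_single)
    then have "mon_size (m - single a 1) = length as" using Cons(3) by simp
    then obtain k where k: "k > 0" "\<Psi> as ?N = (if m - single a 1 = mon_of as then of_nat k else 0)"
      using Cons(1)[of "m - single a 1"] keysN Cons(2) by auto
    have iff: "m - single a 1 = mon_of as \<longleftrightarrow> m = mon_of (a # as)"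
    proof
      assume "m - single a 1 = mon_of as"
      with mon_decomp[OF a] show "m = mon_of (a # as)" by (simp add: add.commute)
    qed simp
    show ?thesis
      unfolding eq k(2) iff using k(1) False by (intro exI[of _ "lookup m a * k"]) auto
  qed
qed

text \<open>The tensors killed by the form of the word are a subspace containing every pure tensor
  whose degrees add up to \<gamma>: either the left degree differs from that of the first letter, or
  the right degree differs from that of the remaining word. The coproduct of \<open>P\<close> lies
  in the span of such tensors.\<close>

lemma Phi_graded:
  assumes "list_all2 (\<lambda>l \<alpha>. l \<in> Lc \<alpha>) w \<alpha>s" "P \<in> Hc \<gamma>" "\<gamma> \<in> expos n" "\<gamma> \<noteq> sum_list \<alpha>s"
  shows "E.\<Phi> w P = 0"
  using assms
proof (induction w \<alpha>s arbitrary: P \<gamma> rule: list_all2_induct)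
  case Nil
  then have "0 \<notin> keys P" by (auto simp: hcomp_def)
  with Nil(1) show ?case by (simp add: eta_eq hcomp_carrier in_keys_iff)
next
  case (Cons l w \<alpha> \<alpha>s)
  let ?\<beta> = "\<lambda>a b. eps l a * E.\<Phi> w b"
  let ?W = "{T \<in> tensors A A. T ?\<beta> = 0}"
  have bil: "bilinear_form A A ?\<beta>" by (intro bilinear_mult eps_lin Psi_lin)
  have W: "submodule ?W scalars (tensor_product A A)"
    using kspace_closed[OF spAA] by (intro submoduleI'[OF spAA]) auto
  have "graded_tensors \<gamma> \<subseteq> ?W"
  proof
    fix T assume T: "T \<in> graded_tensors \<gamma>"
    then obtain a b \<alpha>' \<beta>' where ab: "T = pure_tensor A A a b" "\<alpha>' \<in> expos n" "\<beta>' \<in> expos n" "\<alpha>' + \<beta>' = \<gamma>" "a \<in> Hc \<alpha>'" "b \<in> Hc \<beta>'"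
      unfolding graded_tensors_def by blast
    have "eps l a * E.\<Phi> w b = 0"
    proof (cases "\<alpha>' = \<alpha>")
      case True
      then have "\<beta>' \<noteq> sum_list \<alpha>s" using Cons(6) ab(4) by auto
      then show ?thesis using Cons(3)[OF ab(6,3)] by simp
    next
      case False
      have "lookup a (single x 1) = 0" if "x \<in> keys l" for x
      proof (rule ccontr)
        assume "lookup a (single x 1) \<noteq> 0"
        then have "single x 1 \<in> keys a" by (simp add: in_keys_iff)
        then have "wdeg deg (single x 1) = \<alpha>'" using ab(5) unfolding hcomp_def by blast
        then have "deg x = \<alpha>'" by simp
        moreover have "deg x = \<alpha>" using Lc_deg[OF Cons(1)] that by auto
        ultimately show False using False by simp
      qed
      then show ?thesis by (simp add: eps_def)
    qed
    then show "T \<in> ?W" using graded_tensors_closed T bil by (auto simp: ab(1) pure_tensor_eval)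
  qed
  then have "lin_span (tensor_product A A) (graded_tensors \<gamma>) \<subseteq> ?W" by (rule lin_span_minimal[OF W])
  moreover have "comult coord_hopf P \<in> lin_span (tensor_product A A) (graded_tensors \<gamma>)"
    using graded_hopf_coord Cons(4,5) unfolding graded_hopf_algebra_def by (simp add: graded_tensors_def)
  ultimately show ?case by auto
qed

lemma sgl_letters: "set as \<subseteq> X \<Longrightarrow> map sgl as \<in> lists (carrier L)"
proof -
  assume as: "set as \<subseteq> X"
  have "sgl x \<in> carrier L" if "x \<in> X" for x using that by (simp add: sgl_def)
  with as have "set (map sgl as) \<subseteq> carrier L" by (simp only: set_map) blast
  then show ?thesis unfolding in_lists_conv_set by blast
qed

lemma sgl_degrees: "set as \<subseteq> X \<Longrightarrow> list_all2 (\<lambda>l \<alpha>. l \<in> Lc \<alpha>) (map sgl as) (map deg as)"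
  by (simp add: list_all2_conv_all_nth) (use Lc_sgl nth_mem in blast)

lemma Psi_graded:
  assumes "set as \<subseteq> X" "P \<in> Hc \<gamma>" "\<gamma> \<in> expos n" "\<gamma> \<noteq> wdeg deg (mon_of as)"
  shows "\<Psi> as P = 0"
proof (rule Phi_graded[OF _ assms(2,3)])
  show "list_all2 (\<lambda>l \<alpha>. l \<in> Lc \<alpha>) (map sgl as) (map deg as)"
    by (rule sgl_degrees[OF assms(1)])
  have "sum_list (map deg as) = wdeg deg (mon_of as)" by (induction as) (auto simp: wdeg_add)
  then show "\<gamma> \<noteq> sum_list (map deg as)" using assms(4) by simp
qed

section \<open>Dual basis, straightening and nondegeneracy\<close>

abbreviation "U0 \<equiv> E.U0"
abbreviation "pairU \<equiv> E.pairU"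

lemma algU: "assoc_algebra U0" by (rule E.quot(7))
lemmas spU = assoc_algebraD(1)[OF algU]

definition EC :: "expo \<Rightarrow> ('x \<Rightarrow>\<^sub>0 'k) list set" where
  "EC \<gamma> = {w. \<exists>\<alpha>s. set \<alpha>s \<subseteq> expos n \<and> list_all2 (\<lambda>x \<alpha>. x \<in> Lc \<alpha>) w \<alpha>s \<and> sum_list \<alpha>s = \<gamma>}"

lemma EC_letters: "w \<in> EC \<gamma> \<Longrightarrow> w \<in> lists (carrier L)"
proof -
  assume "w \<in> EC \<gamma>"
  then obtain \<alpha>s where "list_all2 (\<lambda>x \<alpha>. x \<in> Lc \<alpha>) w \<alpha>s" unfolding EC_def by blast
  then show "w \<in> lists (carrier L)"
    by (induction w \<alpha>s rule: list_all2_induct) (use Lc_deg in auto)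
qed

lemma component_eq: "enveloping_component n L Lc \<gamma> = lin_span U0 (E.ew ` EC \<gamma>)"
proof -
  have "{E.ew w | w \<alpha>s. set \<alpha>s \<subseteq> expos n \<and> list_all2 (\<lambda>x \<alpha>. x \<in> Lc \<alpha>) w \<alpha>s \<and> sum_list \<alpha>s = \<gamma>} = E.ew ` EC \<gamma>"
    unfolding EC_def by blast
  then show ?thesis unfolding enveloping_component_def by simp
qed

lemma submodule_component: "submodule (enveloping_component n L Lc \<gamma>) scalars U0"
  unfolding component_eq by (rule submodule_lin_span[OF spU]) (use EC_letters E.ew_closed in blast)

lemma dual_combination:
  assumes W: "submodule W scalars U0" and "finite S"
    and "\<And>m. m \<in> S \<Longrightarrow> \<exists>v\<in>W. \<forall>P\<in>carrier A. pairU v P = lookup P m"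
  shows "\<exists>u\<in>W. \<forall>P\<in>carrier A. pairU u P = (\<Sum>m\<in>S. c m * lookup P m)"
  using assms(2,3)
proof (induction S)
  note w = submoduleD[OF spU W]
  case empty
  have "pairU \<zero>\<^bsub>U0\<^esub> P = 0" if "P \<in> carrier A" for P
    using linear_form_zero[OF spU E.pairU_lin, of P] that by simp
  then show ?case using w(2) by auto
next
  note w = submoduleD[OF spU W]
  case (insert m S)
  then obtain u where u: "u \<in> W" "\<And>P. P \<in> carrier A \<Longrightarrow> pairU u P = (\<Sum>m\<in>S. c m * lookup P m)" by blast
  obtain v where v: "v \<in> W" "\<And>P. P \<in> carrier A \<Longrightarrow> pairU v P = lookup P m" using insert(4)[of m] by blast
  have uc: "u \<in> carrier U0" "v \<in> carrier U0" using u v w(1) by auto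
  have "pairU (c m \<odot>\<^bsub>U0\<^esub> v \<oplus>\<^bsub>U0\<^esub> u) P = (\<Sum>m\<in>insert m S. c m * lookup P m)" if P: "P \<in> carrier A" for P
  proof -
    have P': "P \<in> carrier coord_hopf" using P by simp
    show ?thesis
      using insert(1,2) u(2)[OF P] v(2)[OF P] uc
        linear_form_add[OF E.pairU_lin[OF P'], of "c m \<odot>\<^bsub>U0\<^esub> v" u] linear_form_smult[OF E.pairU_lin[OF P'], of v "c m"]
      by (simp add: kspace_closed[OF spU])
  qed
  moreover have "c m \<odot>\<^bsub>U0\<^esub> v \<oplus>\<^bsub>U0\<^esub> u \<in> W" using u v w by blast
  ultimately show ?case by blast
qed

text \<open>Induction on the size of \<open>m\<close>. The word \<open>canon m\<close> pairs with
  \<open>m\<close> to a positive integer, and otherwise at most with smaller monomials of the same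
  weight. These are finitely many and have dual elements by induction; the word is corrected by them
  and divided by the integer, which is nonzero in characteristic zero.\<close>

lemma dual_basis:
  assumes "keys m \<subseteq> X"
  shows "\<exists>u\<in>enveloping_component n L Lc (wdeg deg m). \<forall>P\<in>carrier A. pairU u P = lookup P m"
  using assms
proof (induction "mon_size m" arbitrary: m rule: less_induct)
  case less
  let ?\<gamma> = "wdeg deg m" and ?as = "canon m"
  let ?W = "enveloping_component n L Lc ?\<gamma>"
  note w = submoduleD[OF spU submodule_component[of ?\<gamma>]]
  have as: "set ?as \<subseteq> X" using less(2) by simp
  define S where "S = {m'. keys m' \<subseteq> X \<and> wdeg deg m' = ?\<gamma> \<and> mon_size m' < mon_size m}"
  have fin: "finite S" unfolding S_def by (rule finite_subset[OF _ finite_mons_deg[of ?\<gamma>]]) auto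
  define \<psi> where "\<psi> m' = \<Psi> ?as (single m' 1)" for m'
  obtain k where k: "k > 0" "\<psi> m = of_nat k"
    using Psi_leading[OF less(2), of ?as] unfolding \<psi>_def by auto
  \<comment> \<open>A different weight is excluded by \<open>Psi_graded\<close>, a different
    monomial of the same size by \<open>Psi_leading\<close>, a larger size by
    \<open>Psi_eq_0\<close>.\<close>
  have zero: "\<psi> m' = 0" if "keys m' \<subseteq> X" "m' \<notin> insert m S" for m'
  proof (cases "wdeg deg m' = ?\<gamma>")
    case False
    show ?thesis unfolding \<psi>_def
      using False by (intro Psi_graded[OF as hcomp_closed(6)[OF that(1)] wdeg_expos[OF that(1)]]) simp
  next
    case True
    then have "mon_size m \<le> mon_size m'" using that by (auto simp: S_def)
    show ?thesis
    proof (cases "mon_size m' = mon_size m")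
      case eq: True
      then show ?thesis using Psi_leading[OF that(1), of ?as] that(2) unfolding \<psi>_def by auto
    next
      case False
      then show ?thesis unfolding \<psi>_def using \<open>mon_size m \<le> mon_size m'\<close> that(1)
        by (intro Psi_eq_0) (auto simp: poly_closed intro: min_size_closed(5))
    qed
  qed
  have mS: "m \<notin> S" by (simp add: S_def)
  have ev: "\<Psi> ?as P = of_nat k * lookup P m + (\<Sum>m'\<in>S. \<psi> m' * lookup P m')" if P: "P \<in> carrier A" for P
  proof -
    have "\<Psi> ?as P = (\<Sum>m'\<in>keys P. lookup P m' * \<psi> m')"
      using linear_form_poly[OF Psi_lin P] by (simp add: \<psi>_def)
    also have "\<dots> = (\<Sum>m'\<in>keys P \<union> insert m S. lookup P m' * \<psi> m')"
      using fin by (intro linear_sum_superset) auto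
    also have "\<dots> = (\<Sum>m'\<in>insert m S. lookup P m' * \<psi> m')"
      using fin zero P by (intro sum.mono_neutral_right) (auto simp: poly_carrier)
    also have "\<dots> = of_nat k * lookup P m + (\<Sum>m'\<in>S. \<psi> m' * lookup P m')"
      using fin mS by (simp add: k mult.commute)
    finally show ?thesis .
  qed
  have u0: "E.ew (map sgl ?as) \<in> ?W"
    unfolding component_eq
  proof (rule subsetD[OF lin_span_superset], rule imageI)
    have "sum_list (map deg bs) = wdeg deg (mon_of bs)" for bs by (induction bs) (auto simp: wdeg_add)
    then have "sum_list (map deg ?as) = ?\<gamma>" by simp
    moreover have "list_all2 (\<lambda>x \<alpha>. x \<in> Lc \<alpha>) (map sgl ?as) (map deg ?as)"
      by (rule sgl_degrees[OF as])
    moreover have "set (map deg ?as) \<subseteq> expos n" using less(2) deg(1) by auto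
    ultimately show "map sgl ?as \<in> EC ?\<gamma>" unfolding EC_def by blast
  qed
  obtain u1 where u1: "u1 \<in> ?W" "\<And>P. P \<in> carrier A \<Longrightarrow> pairU u1 P = (\<Sum>m'\<in>S. - \<psi> m' * lookup P m')"
  proof -
    have "\<exists>v\<in>?W. \<forall>P\<in>carrier A. pairU v P = lookup P m'" if "m' \<in> S" for m'
      using less(1)[of m'] that unfolding S_def by auto
    from dual_combination[OF submodule_component fin this, of "\<lambda>m'. - \<psi> m'"] that show thesis by blast
  qed
  let ?u = "(1 / of_nat k) \<odot>\<^bsub>U0\<^esub> (E.ew (map sgl ?as) \<oplus>\<^bsub>U0\<^esub> u1)"
  have c: "E.ew (map sgl ?as) \<in> carrier U0" "u1 \<in> carrier U0" using u0 u1 w(1) by auto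
  have "pairU ?u P = lookup P m" if P: "P \<in> carrier A" for P
  proof -
    have P': "P \<in> carrier coord_hopf" using P by simp
    have "pairU ?u P = (1 / of_nat k) * (pairU (E.ew (map sgl ?as)) P + pairU u1 P)"
      using linear_form_add[OF E.pairU_lin[OF P'] c]
        linear_form_smult[OF E.pairU_lin[OF P'] kspace_closed(2)[OF spU c], of "1 / of_nat k"] by simp
    also have "pairU (E.ew (map sgl ?as)) P = \<Psi> ?as P"
      using E.pairU_ew[OF sgl_letters[OF as] P'] .
    finally show ?thesis using k(1) by (simp add: ev[OF P] u1(2)[OF P] sum_negf)
  qed
  moreover have "?u \<in> ?W" using u0 u1 w by blast
  ultimately show ?case by blast
qed

text \<open>Shorter words lie in \<open>W\<close> by induction, and the bracket of two letters is a
  single letter, so modulo \<open>W\<close> neighbouring basis letters can be exchanged. Any word in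
  basis letters is thus rearranged into the canonical word of its monomial; general letters are
  expanded by multilinearity.\<close>

lemma straighten:
  assumes W: "submodule W scalars U0"
    and can: "\<And>m. keys m \<subseteq> X \<Longrightarrow> E.ew (map sgl (canon m)) \<in> W"
    and "w \<in> lists (carrier L)"
  shows "E.ew w \<in> W"
  using assms(3)
proof (induction "length w" arbitrary: w rule: less_induct)
  case less
  note s = submoduleD[OF spU W]
  define k where "k = length w"
  have short: "E.ew v \<in> W" if "v \<in> lists (carrier L)" "length v < k" for v
    using less(1)[of v] that by (simp add: k_def)
  have diff: "x \<in> W" if "x \<oplus>\<^bsub>U0\<^esub> y \<in> W" "y \<in> W" "x \<in> carrier U0" for x y
  proof -
    interpret U: ring U0 using algU by (rule assoc_algebraD)
    have y: "y \<in> carrier U0" using that s(1) by auto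
    have "x = (x \<oplus>\<^bsub>U0\<^esub> y) \<oplus>\<^bsub>U0\<^esub> (- 1) \<odot>\<^bsub>U0\<^esub> y"
      using that(3) y kspace_minus_one[OF spU y] by (simp add: U.a_assoc U.r_neg)
    moreover have "(x \<oplus>\<^bsub>U0\<^esub> y) \<oplus>\<^bsub>U0\<^esub> (- 1) \<odot>\<^bsub>U0\<^esub> y \<in> W" using that s by blast
    ultimately show ?thesis by simp
  qed
  have swap: "E.ew (map sgl (u @ [b, a] @ v)) \<in> W"
    if "E.ew (map sgl (u @ [a, b] @ v)) \<in> W" "set (u @ [a, b] @ v) \<subseteq> X" "length (u @ [a, b] @ v) = k" for u v a b
  proof -
    have uv: "map sgl u \<in> lists (carrier L)" "map sgl v \<in> lists (carrier L)" "sgl a \<in> carrier L" "sgl b \<in> carrier L"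
      using that(2) sgl_letters[of u] sgl_letters[of v] sgl_letters[of "[a]"] sgl_letters[of "[b]"] by auto
    have m: "sgl a \<otimes>\<^bsub>L\<^esub> sgl b \<in> carrier L" using uv by (simp add: L_closed)
    have "E.ew (map sgl u @ [sgl a \<otimes>\<^bsub>L\<^esub> sgl b] @ map sgl v) \<in> W"
      using uv m that(3) by (intro short) auto
    moreover have "E.ew (map sgl u @ [sgl a, sgl b] @ map sgl v) = E.ew (map sgl u @ [sgl b, sgl a] @ map sgl v) \<oplus>\<^bsub>U0\<^esub>
        E.ew (map sgl u @ [sgl a \<otimes>\<^bsub>L\<^esub> sgl b] @ map sgl v)"
      by (rule E.ew_middle(3)[OF uv])
    moreover have "E.ew (map sgl u @ [sgl b, sgl a] @ map sgl v) \<in> carrier U0"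
      using uv by (intro E.ew_closed) auto
    ultimately show ?thesis using that(1) diff by simp
  qed
  have front: "E.ew (map sgl (u @ [b] @ p @ q)) \<in> W"
    if "E.ew (map sgl (u @ p @ [b] @ q)) \<in> W" "set (u @ p @ [b] @ q) \<subseteq> X" "length (u @ p @ [b] @ q) = k" for u b p q
    using that
  proof (induction p arbitrary: q rule: rev_induct)
    case (snoc a p)
    have "E.ew (map sgl ((u @ p) @ [b, a] @ q)) \<in> W"
      by (rule swap[of "u @ p" a b q]) (use snoc(2-4) in simp_all)
    then have "E.ew (map sgl (u @ [b] @ p @ ([a] @ q))) \<in> W"
      by (intro snoc(1)[of "[a] @ q"]) (use snoc(3,4) in simp_all)
    then show ?case by simp
  qed simp
  \<comment> \<open>Behind the prefix \<open>u\<close>, which is already in place, the next letter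
    required by \<open>bs\<close> is found in \<open>as\<close> and moved to the front.\<close>
  have perm: "E.ew (map sgl (u @ bs)) \<in> W"
    if "E.ew (map sgl (u @ as)) \<in> W" "set (u @ as) \<subseteq> X" "length (u @ as) = k" "mon_of as = mon_of bs" for u as bs
    using that
  proof (induction bs arbitrary: u as)
    case Nil
    then have "length as = 0" using mon_size_mon_of[of as] by simp
    with Nil show ?case by simp
  next
    case (Cons b bs)
    have "set as = set (b # bs)" using Cons(5) keys_mon_of by metis
    then obtain p q where as: "as = p @ [b] @ q" using split_list[of b as] by auto
    have fr: "E.ew (map sgl (u @ [b] @ p @ q)) \<in> W" by (rule front[of u p b q]) (use Cons(2-4) as in simp_all)
    have "mon_of (p @ q) + single b 1 = mon_of bs + single b 1"
      using Cons(5) as by (simp add: ac_simps)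
    then have mon: "mon_of (p @ q) = mon_of bs" by (rule add_right_imp_eq)
    have "E.ew (map sgl ((u @ [b]) @ bs)) \<in> W"
      by (rule Cons(1)[of "u @ [b]" "p @ q"]) (use fr mon Cons(3,4) as in simp_all)
    then show ?case by simp
  qed
  have basis: "E.ew (map sgl as) \<in> W" if "set as \<subseteq> X" "length as = k" for as
    using perm[of "[]" "canon (mon_of as)" as] can[of "mon_of as"] that by simp
  \<comment> \<open>The letters of \<open>as\<close> are basis vectors already; those of
    \<open>v\<close> are expanded one at a time.\<close>
  have "E.ew (map sgl as @ v) \<in> W" if "set as \<subseteq> X" "v \<in> lists (carrier L)" "length as + length v = k" for as v
    using that
  proof (induction v arbitrary: as)
    case Nil
    then show ?case using basis by simp
  next
    case (Cons l v)
    then have l: "keys l \<subseteq> X" and v: "v \<in> lists (carrier L)" by auto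
    note as = sgl_letters[OF Cons(2)]
    have "E.ew (map sgl as @ [l] @ v) \<in> W"
      using l
    proof (induction l rule: poly_mapping_induct)
      case zero
      have "E.ew (map sgl as @ [0 \<odot>\<^bsub>L\<^esub> 0] @ v) = 0 \<odot>\<^bsub>U0\<^esub> E.ew (map sgl as @ [0] @ v)"
        by (rule E.ew_middle(2)[OF as v]) simp
      moreover have "E.ew (map sgl as @ [0] @ v) \<in> carrier U0"
        using as v by (intro E.ew_closed) auto
      then have "0 \<odot>\<^bsub>U0\<^esub> E.ew (map sgl as @ [0] @ v) = \<zero>\<^bsub>U0\<^esub>"
      proof -
        interpret M: Module.module scalars U0 by (rule spU)
        show "E.ew (map sgl as @ [0] @ v) \<in> carrier U0 \<Longrightarrow> ?thesis" using M.smult_l_null by simp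
      qed
      ultimately show ?case using s(2) by simp
    next
      case (single a c)
      have "E.ew (map sgl (as @ [a]) @ v) \<in> W" using Cons v single by (intro Cons(1)) auto
      moreover have "sgl a \<in> carrier L" using single by (simp add: sgl_def)
      moreover have "c \<odot>\<^bsub>L\<^esub> sgl a = single a c" by (simp add: sgl_def)
      ultimately show ?case using E.ew_middle(2)[OF as v, of "sgl a" c] s(4) by simp
    next
      case (add l l')
      then show ?case using E.ew_middle(1)[OF as v, of l l'] s(3) by simp
    qed
    then show ?case by simp
  qed
  from this[of "[]" w] less(2) show ?case by (simp add: k_def)
qed

definition combF :: "('x mon \<Rightarrow>\<^sub>0 'k) \<Rightarrow> ('x \<Rightarrow>\<^sub>0 'k) list \<Rightarrow> 'k" where
  "combF c w = (\<Sum>m\<in>keys c. lookup c m * word (map sgl (canon m)) w)"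

lemma combF_add: "combF (c + d) = (\<lambda>w. combF c w + combF d w)"
  by (rule ext) (simp only: combF_def linear_sum_add)

lemma combF_smult: "combF (scale a c) = (\<lambda>w. a * combF c w)"
  by (rule ext) (simp only: combF_def linear_sum_map)

lemma combF:
  assumes "keys c \<subseteq> {m. keys m \<subseteq> X}"
  shows "combF c \<in> carrier E.F \<and> E.pairF (combF c) P = (\<Sum>m\<in>keys c. lookup c m * \<Psi> (canon m) P)"
  using assms
proof (induction c rule: poly_mapping_induct)
  case zero
  have "combF 0 = (\<lambda>w. 0)" by (rule ext) (simp add: combF_def)
  then show ?case by (simp add: free_closed E.pairF_def fsum_def)
next
  case (single m c)
  have eq: "combF (single m c) = (\<lambda>w. c * word (map sgl (canon m)) w)"
    by (rule ext) (cases "c = 0", simp_all add: combF_def)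
  have w: "word (map sgl (canon m)) \<in> carrier E.F" using single by (intro free_closed sgl_letters) simp
  show ?case
    unfolding eq using free_closed(2)[OF w, of c] linear_form_smult[OF E.pairF_linF w, of c P]
    by (cases "c = 0") simp_all
next
  case (add c d)
  then have cd: "combF c \<in> carrier E.F" "combF d \<in> carrier E.F" by auto
  show ?case unfolding combF_add linear_sum_add
    using add free_closed(1)[OF cd] linear_form_add[OF E.pairF_linF cd, of P] by simp
qed

text \<open>The spanning half of the Poincare-Birkhoff-Witt theorem: classes of combinations of
  canonical words form a subspace that contains all words by \<open>straighten\<close>, hence
  everything by \<open>U0_spanned\<close>.\<close>

lemma U0_combF:
  assumes "u \<in> carrier U0"
  obtains c where "keys c \<subseteq> {m. keys m \<subseteq> X}" "u = E.cls (combF c)"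
    "\<And>P. P \<in> carrier A \<Longrightarrow> pairU u P = (\<Sum>m\<in>keys c. lookup c m * \<Psi> (canon m) P)"
proof -
  let ?W = "{u \<in> carrier U0. \<exists>c. keys c \<subseteq> {m. keys m \<subseteq> X} \<and> u = E.cls (combF c)}"
  have W: "submodule ?W scalars U0"
  proof (rule submoduleI'[OF spU])
    have "combF 0 = (\<lambda>w. 0)" by (rule ext) (simp add: combF_def)
    then have "\<zero>\<^bsub>U0\<^esub> = E.cls (combF 0)" by (simp add: E.quot(6))
    then show "\<zero>\<^bsub>U0\<^esub> \<in> ?W" using kspace_closed(3)[OF spU] by (auto intro!: exI[of _ 0])
    fix u v assume "u \<in> ?W" "v \<in> ?W"
    then obtain c d where c: "u \<in> carrier U0" "keys c \<subseteq> {m. keys m \<subseteq> X}" "u = E.cls (combF c)"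
      and d: "v \<in> carrier U0" "keys d \<subseteq> {m. keys m \<subseteq> X}" "v = E.cls (combF d)" by auto
    have "u \<oplus>\<^bsub>U0\<^esub> v = E.cls (combF (c + d))"
      using E.quot(3)[OF conjunct1[OF combF[OF c(2)]] conjunct1[OF combF[OF d(2)]]]
      by (simp add: c(3) d(3) combF_add del: L_simps)
    moreover have "keys (c + d) \<subseteq> {m. keys m \<subseteq> X}" using c d Poly_Mapping.keys_add[of c d] by blast
    ultimately show "u \<oplus>\<^bsub>U0\<^esub> v \<in> ?W"
      using kspace_closed(2)[OF spU c(1) d(1)] by (intro CollectI conjI exI[of _ "c + d"]) simp_all
  next
    fix a u assume "u \<in> ?W"
    then obtain c where c: "u \<in> carrier U0" "keys c \<subseteq> {m. keys m \<subseteq> X}" "u = E.cls (combF c)" by auto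
    have "a \<odot>\<^bsub>U0\<^esub> u = E.cls (combF (scale a c))"
      using E.quot(4)[OF conjunct1[OF combF[OF c(2)]]]
      by (simp add: c(3) combF_smult del: L_simps)
    moreover have "keys (scale a c) \<subseteq> {m. keys m \<subseteq> X}" using c keys_map_mult[of a c] by blast
    ultimately show "a \<odot>\<^bsub>U0\<^esub> u \<in> ?W"
      using kspace_closed(1)[OF spU c(1)] by blast
  qed blast
  have can: "E.ew (map sgl (canon m)) \<in> ?W" if m: "keys m \<subseteq> X" for m
  proof -
    have "combF (single m 1) = word (map sgl (canon m))" by (rule ext) (simp add: combF_def)
    then have "E.ew (map sgl (canon m)) = E.cls (combF (single m 1))" by (simp add: env_word_def)
    moreover have "keys (single m (1::'k)) \<subseteq> {m. keys m \<subseteq> X}" using m by simp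
    moreover have "E.ew (map sgl (canon m)) \<in> carrier U0" using m by (intro E.ew_closed sgl_letters) simp
    ultimately show ?thesis by blast
  qed
  have "?W = carrier U0" by (rule E.U0_spanned[OF W]) (rule straighten[OF W can])
  then obtain c where c: "keys c \<subseteq> {m. keys m \<subseteq> X}" "u = E.cls (combF c)" using assms by blast
  show thesis
    by (rule that[OF c]) (use E.pairU_cls[OF conjunct1[OF combF[OF c(1)]]] conjunct2[OF combF[OF c(1)]] in
        \<open>simp add: c(2) del: L_simps\<close>)
qed

text \<open>The independence half. In a nonzero combination of canonical words let \<open>m\<close>
  be a monomial of maximal size that occurs. Tested on \<open>m\<close>, shorter words give 0 by
  \<open>Psi_eq_0\<close> and the other words of the same length by \<open>Psi_leading\<close>, so
  the coefficient of \<open>m\<close> times a positive integer vanishes.\<close>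

lemma pairU_nondegenerate:
  assumes u: "u \<in> carrier U0" and 0: "\<forall>P\<in>carrier A. pairU u P = 0"
  shows "u = \<zero>\<^bsub>U0\<^esub>"
proof -
  obtain c where c: "keys c \<subseteq> {m. keys m \<subseteq> X}" "u = E.cls (combF c)"
    "\<And>P. P \<in> carrier A \<Longrightarrow> pairU u P = (\<Sum>m\<in>keys c. lookup c m * \<Psi> (canon m) P)" using U0_combF[OF u] by blast
  have "c = 0"
  proof (rule ccontr)
    assume "c \<noteq> 0"
    then have ne: "keys c \<noteq> {}" by (simp add: keys_empty_iff)
    have "Max (mon_size ` keys c) \<in> mon_size ` keys c" using ne by (intro Max_in) auto
    then obtain m where m: "m \<in> keys c" "\<And>m'. m' \<in> keys c \<Longrightarrow> mon_size m' \<le> mon_size m"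
      by (metis (no_types, lifting) Max_ge finite_imageI finite_keys imageE image_eqI)
    have mX: "keys m \<subseteq> X" using c m by auto
    let ?M = "single m 1 :: ('x, 'k) mpoly"
    obtain k where k: "k > 0" "\<Psi> (canon m) ?M = of_nat k" using Psi_leading[OF mX, of "canon m"] by auto
    have z: "\<Psi> (canon m') ?M = 0" if "m' \<in> keys c" "m' \<noteq> m" for m'
    proof (cases "mon_size m' = mon_size m")
      case True
      then show ?thesis using Psi_leading[OF mX, of "canon m'"] that(2) by auto
    next
      case False
      then show ?thesis using m(2)[OF that(1)] mX by (intro Psi_eq_0) (auto simp: poly_closed intro: min_size_closed(5))
    qed
    have "0 = (\<Sum>m'\<in>keys c. lookup c m' * \<Psi> (canon m') ?M)" using c(3)[of ?M] 0 mX by (simp add: poly_closed)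
    also have "\<dots> = (\<Sum>m'\<in>keys c. if m' = m then lookup c m * of_nat k else 0)"
      using z k by (intro sum.cong) auto
    also have "\<dots> = lookup c m * of_nat k" using m(1) by simp
    finally show False using k(1) m(1) by (simp add: in_keys_iff)
  qed
  moreover have "combF 0 = (\<lambda>w. 0)" by (rule ext) (simp add: combF_def)
  ultimately show ?thesis using c(2) by (simp add: E.quot(6))
qed

section \<open>Identification of the enveloping algebra with the graded dual\<close>

abbreviation "D \<equiv> graded_dual n coord_hopf Hc"

lemma D_carrier: "carrier D = {f \<in> extensional (carrier A). linear_form A f \<and> finite {\<alpha>\<in>expos n. \<exists>x\<in>Hc \<alpha>. f x \<noteq> 0}}"
  by (simp add: graded_dual_def graded_dual_algebra_def Let_def)

definition support :: "(('x, 'k) mpoly \<Rightarrow> 'k) \<Rightarrow> 'x mon set" where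
  "support f = {m. keys m \<subseteq> X \<and> f (single m 1) \<noteq> 0}"

text \<open>The form is nonzero in finitely many degrees, and each degree has finitely many
  monomials. Elements of the graded dual are therefore finite combinations of coefficient
  functions.\<close>

lemma finite_support:
  assumes "f \<in> carrier D"
  shows "finite (support f)"
proof (rule finite_subset)
  show "support f \<subseteq> (\<Union>\<alpha>\<in>{\<alpha>\<in>expos n. \<exists>x\<in>Hc \<alpha>. f x \<noteq> 0}. {m. keys m \<subseteq> X \<and> wdeg deg m = \<alpha>})"
  proof
    fix m assume "m \<in> support f"
    then have m: "keys m \<subseteq> X" "f (single m 1) \<noteq> 0" by (auto simp: support_def)
    then have "wdeg deg m \<in> {\<alpha>\<in>expos n. \<exists>x\<in>Hc \<alpha>. f x \<noteq> 0}"
      using wdeg_expos hcomp_closed(6)[OF m(1)] by blast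
    with m show "m \<in> (\<Union>\<alpha>\<in>{\<alpha>\<in>expos n. \<exists>x\<in>Hc \<alpha>. f x \<noteq> 0}. {m. keys m \<subseteq> X \<and> wdeg deg m = \<alpha>})" by blast
  qed
  show "finite (\<Union>\<alpha>\<in>{\<alpha>\<in>expos n. \<exists>x\<in>Hc \<alpha>. f x \<noteq> 0}. {m. keys m \<subseteq> X \<and> wdeg deg m = \<alpha>})"
    using assms finite_mons_deg by (intro finite_UN_I) (auto simp: D_carrier)
qed

lemma support_sum:
  assumes f: "f \<in> carrier D" and P: "P \<in> carrier A"
  shows "f P = (\<Sum>m\<in>support f. f (single m 1) * lookup P m)"
proof -
  have "f P = (\<Sum>m\<in>keys P. lookup P m * f (single m 1))"
    using f P by (intro linear_form_poly) (auto simp: D_carrier)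
  also have "\<dots> = (\<Sum>m\<in>keys P \<union> support f. lookup P m * f (single m 1))"
    using finite_support[OF f] by (intro linear_sum_superset) auto
  also have "\<dots> = (\<Sum>m\<in>support f. lookup P m * f (single m 1))"
    using finite_support[OF f] P by (intro sum.mono_neutral_right) (auto simp: support_def poly_carrier)
  finally show ?thesis by (simp add: mult.commute)
qed

lemma coefficient_dual:
  assumes "keys m \<subseteq> X"
  shows "(\<lambda>P\<in>carrier A. c * lookup P m) \<in> carrier D"
proof -
  have "linear_form A (\<lambda>P. c * lookup P m)" by (simp add: linear_form_def lookup_add algebra_simps)
  then have "linear_form A (\<lambda>P\<in>carrier A. c * lookup P m)"
    using linear_form_cong[OF spA, of "\<lambda>P. c * lookup P m" "\<lambda>P\<in>carrier A. c * lookup P m"] by simp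
  moreover have "finite {\<alpha>\<in>expos n. \<exists>x\<in>Hc \<alpha>. (\<lambda>P\<in>carrier A. c * lookup P m) x \<noteq> 0}"
    by (rule finite_subset[of _ "{wdeg deg m}"]) (auto simp: hcomp_def in_keys_iff)
  ultimately show ?thesis by (simp add: D_carrier)
qed

lemma graded_dual_pairing_coord: "graded_dual_pairing coord_hopf n Hc U0 pairU"
proof (intro graded_dual_pairing.intro graded_dual_pairing_axioms.intro separated_hopf_coord)
  show "assoc_algebra U0" by (rule algU)
  show "linear_form U0 (\<lambda>u. pairU u x)" if "x \<in> carrier coord_hopf" for x by (rule E.pairU_lin[OF that])
  show "restrict (pairU u) (carrier coord_hopf) \<in> carrier D" if u: "u \<in> carrier U0" for u
  proof -
    obtain c where c: "keys c \<subseteq> {m. keys m \<subseteq> X}" "u = E.cls (combF c)"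
      "\<And>P. P \<in> carrier A \<Longrightarrow> pairU u P = (\<Sum>m\<in>keys c. lookup c m * \<Psi> (canon m) P)" using U0_combF[OF u] by blast
    have "linear_form A (pairU u)" using E.pairU_lin2[OF u] by simp
    then have "linear_form A (restrict (pairU u) (carrier A))"
      using linear_form_cong[OF spA, of "restrict (pairU u) (carrier A)" "pairU u"] by simp
    moreover have "finite {\<alpha>\<in>expos n. \<exists>x\<in>Hc \<alpha>. restrict (pairU u) (carrier A) x \<noteq> 0}"
    proof (rule finite_subset)
      show "{\<alpha>\<in>expos n. \<exists>x\<in>Hc \<alpha>. restrict (pairU u) (carrier A) x \<noteq> 0} \<subseteq> wdeg deg ` keys c"
      proof safe
        fix \<alpha> P assume \<alpha>: "\<alpha> \<in> expos n" "P \<in> Hc \<alpha>" "restrict (pairU u) (carrier A) P \<noteq> 0"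
        then have "(\<Sum>m\<in>keys c. lookup c m * \<Psi> (canon m) P) \<noteq> 0" by (simp add: c(3) hcomp_carrier)
        then obtain m where m: "m \<in> keys c" "lookup c m * \<Psi> (canon m) P \<noteq> 0" by (rule sum.not_neutral_contains_not_neutral)
        moreover have "set (canon m) \<subseteq> X" using c(1) m by auto
        ultimately have "\<alpha> = wdeg deg m" using Psi_graded[OF _ \<alpha>(2,1), of "canon m"] by auto
        with m show "\<alpha> \<in> wdeg deg ` keys c" by blast
      qed
    qed simp
    ultimately show ?thesis by (simp add: D_carrier)
  qed
  show "\<exists>u\<in>carrier U0. \<forall>x\<in>carrier coord_hopf. pairU u x = f x" if f: "f \<in> carrier D" for f
  proof -
    have W: "submodule (carrier U0) scalars U0"
      by (rule submoduleI'[OF spU]) (auto simp: kspace_closed[OF spU])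
    have "\<exists>v\<in>carrier U0. \<forall>P\<in>carrier A. pairU v P = lookup P m" if "m \<in> support f" for m
      using dual_basis[of m] submoduleD(1)[OF spU submodule_component] that by (auto simp: support_def)
    from dual_combination[OF W finite_support[OF f] this, of "\<lambda>m. f (single m 1)"]
    show ?thesis using support_sum[OF f] by auto
  qed
  show "u = \<zero>\<^bsub>U0\<^esub>" if "u \<in> carrier U0" "\<forall>x\<in>carrier coord_hopf. pairU u x = 0" for u
    using that by (intro pairU_nondegenerate) auto
  show "pairU (u \<otimes>\<^bsub>U0\<^esub> v) x = comult coord_hopf x (\<lambda>a b. pairU u a * pairU v b)"
    if "u \<in> carrier U0" "v \<in> carrier U0" "x \<in> carrier coord_hopf" for u v x by (rule E.pairU_mult[OF that])
  show "pairU \<one>\<^bsub>U0\<^esub> x = \<eta> x" if "x \<in> carrier coord_hopf" for x by (rule E.pairU_one[OF that])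
  show "\<exists>L. set L \<subseteq> carrier D \<times> carrier D
        \<and> (\<forall>x\<in>carrier coord_hopf. \<forall>y\<in>carrier coord_hopf. f (x \<otimes>\<^bsub>coord_hopf\<^esub> y) = (\<Sum>(a, b)\<leftarrow>L. a x * b y))"
    if f: "f \<in> carrier D" for f
  proof -
    \<comment> \<open>Only factors of monomials in the support of \<open>f\<close> contribute to
      \<open>f (P * Q)\<close>, and there are finitely many of them. The transposed product of
      \<open>f\<close> is a sum of products of coefficient functions over pairs from
      \<open>K\<close>.\<close>
    define K where "K = {m1. keys m1 \<subseteq> X \<and> (\<exists>m2. m1 + m2 \<in> support f)}"
    have "K \<subseteq> (\<Union>m\<in>support f. {m1. \<exists>m2. m1 + m2 = m})" by (auto simp: K_def)
    then have fin: "finite K" using finite_support[OF f] finite_mon_summands by (blast intro: finite_subset)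
    then obtain ks where ks: "set ks = K \<times> K" "distinct ks" using finite_distinct_list[of "K \<times> K"] by auto
    let ?f = "\<lambda>m. f (single m 1)"
    let ?L = "map (\<lambda>(m1, m2). (\<lambda>P\<in>carrier A. ?f (m1 + m2) * lookup P m1, \<lambda>P\<in>carrier A. 1 * lookup P m2)) ks"
    have lf: "linear_form A f" using f by (simp add: D_carrier)
    have "set ?L \<subseteq> carrier D \<times> carrier D"
      using ks(1) coefficient_dual by (auto simp: K_def simp del: mult_1)
    moreover have "f (P * Q) = (\<Sum>(a, b)\<leftarrow>?L. a P * b Q)" if P: "P \<in> carrier A" and Q: "Q \<in> carrier A" for P Q
    proof -
      have 1: "f (P * R) = (\<Sum>m\<in>keys P. lookup P m * f (single m 1 * R))" if "R \<in> carrier A" for R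
        using linear_form_poly[OF lf_comp[OF lin_map_mult(1)[OF algA that] lf] P] by simp
      have 2: "f (R * Q) = (\<Sum>m\<in>keys Q. lookup Q m * f (R * single m 1))" if "R \<in> carrier A" for R
        using linear_form_poly[OF lf_comp[OF lin_map_mult(2)[OF algA that] lf] Q] by simp
      have "f (P * Q) = (\<Sum>m1\<in>keys P. \<Sum>m2\<in>keys Q. lookup P m1 * lookup Q m2 * ?f (m1 + m2))"
        unfolding 1[OF Q]
      proof (rule sum.cong[OF refl])
        fix m1 assume "m1 \<in> keys P"
        then have "single m1 1 \<in> carrier A" using P by (auto simp: poly_carrier)
        then show "lookup P m1 * f (single m1 1 * Q) = (\<Sum>m2\<in>keys Q. lookup P m1 * lookup Q m2 * ?f (m1 + m2))"
          by (simp add: 2 mult_single sum_distrib_left mult.assoc)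
      qed
      also have "\<dots> = (\<Sum>p\<in>keys P \<times> keys Q. lookup P (fst p) * lookup Q (snd p) * ?f (fst p + snd p))"
        by (simp add: sum.cartesian_product split_def)
      also have "\<dots> = (\<Sum>p\<in>(keys P \<times> keys Q) \<inter> (K \<times> K). lookup P (fst p) * lookup Q (snd p) * ?f (fst p + snd p))"
      proof (rule sum.mono_neutral_right)
        show "\<forall>p\<in>keys P \<times> keys Q - keys P \<times> keys Q \<inter> K \<times> K. lookup P (fst p) * lookup Q (snd p) * ?f (fst p + snd p) = 0"
        proof
          fix p assume p: "p \<in> keys P \<times> keys Q - keys P \<times> keys Q \<inter> K \<times> K"
          obtain m1 m2 where [simp]: "p = (m1, m2)" by (cases p)
          have m: "keys m1 \<subseteq> X" "keys m2 \<subseteq> X" using p P Q by (auto simp: poly_carrier)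
          have "\<not> m1 + m2 \<in> support f"
          proof
            assume s: "m1 + m2 \<in> support f"
            then have "m2 + m1 \<in> support f" by (simp add: add.commute)
            with s m have "m1 \<in> K" "m2 \<in> K" unfolding K_def by blast+
            with p show False by auto
          qed
          moreover have "keys (m1 + m2) \<subseteq> X" using m by (simp add: keys_add_nat)
          ultimately show "lookup P (fst p) * lookup Q (snd p) * ?f (fst p + snd p) = 0" by (simp add: support_def)
        qed
      qed auto
      also have "\<dots> = (\<Sum>p\<in>K \<times> K. lookup P (fst p) * lookup Q (snd p) * ?f (fst p + snd p))"
        using fin by (intro sum.mono_neutral_left) (auto simp: in_keys_iff)
      also have "\<dots> = (\<Sum>p\<leftarrow>ks. lookup P (fst p) * lookup Q (snd p) * ?f (fst p + snd p))"
        using ks by (simp add: sum_list_distinct_conv_sum_set)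
      also have "\<dots> = (\<Sum>(a, b)\<leftarrow>?L. a P * b Q)"
        using P Q by (simp add: split_def o_def mult_ac)
      finally show ?thesis .
    qed
    ultimately show ?thesis by (intro exI[of _ ?L]) simp
  qed
  show "(\<lambda>x\<in>carrier coord_hopf. f (antipode coord_hopf x)) \<in> carrier D" if f: "f \<in> carrier D" for f
  proof -
    have lf: "linear_form A f" using f by (simp add: D_carrier)
    have al: "lin_map A A (antipode coord_hopf)"
      using H.antipode_lin by (simp add: lin_map_def)
    have "linear_form A (\<lambda>x\<in>carrier A. f (antipode coord_hopf x))"
      using linear_form_cong[OF spA, of "\<lambda>x\<in>carrier A. f (antipode coord_hopf x)" "\<lambda>x. f (antipode coord_hopf x)"]
        lf_comp[OF al lf] by simp
    moreover have "antipode coord_hopf x \<in> Hc \<alpha>" if "\<alpha> \<in> expos n" "x \<in> Hc \<alpha>" for \<alpha> x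
      using graded_hopf_coord that unfolding graded_hopf_algebra_def by blast
    then have "{\<alpha>\<in>expos n. \<exists>x\<in>Hc \<alpha>. (\<lambda>x\<in>carrier A. f (antipode coord_hopf x)) x \<noteq> 0} \<subseteq> {\<alpha>\<in>expos n. \<exists>x\<in>Hc \<alpha>. f x \<noteq> 0}"
      by (auto dest: hcomp_carrier)
    then have "finite {\<alpha>\<in>expos n. \<exists>x\<in>Hc \<alpha>. (\<lambda>x\<in>carrier A. f (antipode coord_hopf x)) x \<noteq> 0}"
      by (rule finite_subset) (use f in \<open>simp add: D_carrier\<close>)
    ultimately show ?thesis by (simp add: D_carrier)
  qed
qed

theorem enveloping_coord:
  "\<exists>U \<phi>. enveloping_hopf_algebra L U \<and> \<phi> \<in> hopf_iso D U
    \<and> (\<forall>\<alpha>\<in>expos n. \<phi> ` graded_dual_component n coord_hopf Hc \<alpha> = enveloping_component n L Lc \<alpha>)"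
proof -
  interpret G: graded_dual_pairing coord_hopf n Hc U0 pairU by (rule graded_dual_pairing_coord)
  have env: "enveloping_hopf_algebra L G.dual_hopf"
    unfolding enveloping_hopf_algebra_def
  proof (intro conjI ballI)
    fix l assume l: "l \<in> carrier L"
    have e: "E.ew [l] \<in> carrier U0" using l by (intro E.ew_closed) auto
    have pt: "pure_tensor G.dual_hopf G.dual_hopf = pure_tensor U0 U0"
      by (simp add: pure_tensor_def fun_eq_iff)
    have p1: "pairU (E.ew [l]) P = eps l P" if "P \<in> carrier A" for P
      using E.pairU_ew[of "[l]" P] E.\<Phi>_single[of P l] l that by simp
    have one: "\<one>\<^bsub>U0\<^esub> \<in> carrier U0" by (rule algebra_closed[OF algU])
    have pc: "pure_tensor U0 U0 (E.ew [l]) \<one>\<^bsub>U0\<^esub> \<in> tensors U0 U0"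
      "pure_tensor U0 U0 \<one>\<^bsub>U0\<^esub> (E.ew [l]) \<in> tensors U0 U0"
      by (simp_all add: pure_tensor_closed e one)
    show "comult G.dual_hopf (E.ew [l]) = pure_tensor G.dual_hopf G.dual_hopf (E.ew [l]) \<one>\<^bsub>G.dual_hopf\<^esub>
        \<oplus>\<^bsub>tensor_product G.dual_hopf G.dual_hopf\<^esub> pure_tensor G.dual_hopf G.dual_hopf \<one>\<^bsub>G.dual_hopf\<^esub> (E.ew [l])"
      unfolding pt G.dual_simps
    proof (rule G.UU_eqI[OF G.comult_dual(1)[OF e] kspace_closed(2)[OF kspace_tensor_product[OF spU spU] pc]])
      fix P Q assume PQ: "P \<in> carrier coord_hopf" "Q \<in> carrier coord_hopf"
      have bil: "bilinear_form U0 U0 (\<lambda>a b. pairU a P * pairU b Q)" by (rule G.bilinear_pair[OF PQ])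
      have "comult G.dual_hopf (E.ew [l]) (\<lambda>a b. pairU a P * pairU b Q) = eps l (P * Q)"
        using G.comult_dual(2)[OF e PQ] p1[of "P * Q"] PQ by (simp add: poly_closed)
      \<comment> \<open>Elements of \<open>L\<close> are primitive because \<open>eps l\<close> is a
        derivation at the origin.\<close>
      also have "\<dots> = eps l P * \<eta> Q + \<eta> P * eps l Q" using PQ by (intro eps_mult) auto
      also have "\<dots> = (pure_tensor U0 U0 (E.ew [l]) \<one>\<^bsub>U0\<^esub> \<oplus>\<^bsub>tensor_product U0 U0\<^esub> pure_tensor U0 U0 \<one>\<^bsub>U0\<^esub> (E.ew [l]))
          (\<lambda>a b. pairU a P * pairU b Q)"
        using PQ p1 by (simp add: pure_tensor_eval[OF bil] E.pairU_one)
      finally show "comult G.dual_hopf (E.ew [l]) (\<lambda>a b. pairU a P * pairU b Q)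
          = (pure_tensor U0 U0 (E.ew [l]) \<one>\<^bsub>U0\<^esub> \<oplus>\<^bsub>tensor_product U0 U0\<^esub> pure_tensor U0 U0 \<one>\<^bsub>U0\<^esub> (E.ew [l]))
          (\<lambda>a b. pairU a P * pairU b Q)" .
    qed
  qed (simp_all add: G.hopf_dual)
  \<comment> \<open>A form concentrated in degree \<gamma> is a combination of dual basis elements
    of weight \<gamma>. Conversely, words of degree \<gamma> pair to zero with all other components
    by \<open>Phi_graded\<close>.\<close>
  have comp: "G.pre ` graded_dual_component n coord_hopf Hc \<gamma> = enveloping_component n L Lc \<gamma>" if \<gamma>: "\<gamma> \<in> expos n" for \<gamma>
  proof
    show "G.pre ` graded_dual_component n coord_hopf Hc \<gamma> \<subseteq> enveloping_component n L Lc \<gamma>"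
    proof (rule image_subsetI)
      fix f assume "f \<in> graded_dual_component n coord_hopf Hc \<gamma>"
      then have f: "f \<in> carrier D" and z: "\<And>\<beta> x. \<beta> \<in> expos n \<Longrightarrow> \<beta> \<noteq> \<gamma> \<Longrightarrow> x \<in> Hc \<beta> \<Longrightarrow> f x = 0"
        by (auto simp: graded_dual_component_def)
      have "\<exists>v\<in>enveloping_component n L Lc \<gamma>. \<forall>P\<in>carrier A. pairU v P = lookup P m" if m: "m \<in> support f" for m
      proof -
        have "wdeg deg m = \<gamma>"
          using m z[OF wdeg_expos _ hcomp_closed(6), of m 1] by (auto simp: support_def)
        with dual_basis[of m] m show ?thesis by (auto simp: support_def)
      qed
      from dual_combination[OF submodule_component finite_support[OF f] this, of "\<lambda>m. f (single m 1)"]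
      obtain u where u: "u \<in> enveloping_component n L Lc \<gamma>" "\<forall>P\<in>carrier A. pairU u P = f P"
        using support_sum[OF f] by auto
      have "G.pre f = u"
        using u submoduleD(1)[OF spU submodule_component] by (intro G.pre_eqI[OF f]) auto
      with u show "G.pre f \<in> enveloping_component n L Lc \<gamma>" by simp
    qed
    show "enveloping_component n L Lc \<gamma> \<subseteq> G.pre ` graded_dual_component n coord_hopf Hc \<gamma>"
    proof
      fix u assume u: "u \<in> enveloping_component n L Lc \<gamma>"
      let ?W = "{u \<in> carrier U0. \<forall>\<beta>\<in>expos n - {\<gamma>}. \<forall>x\<in>Hc \<beta>. pairU u x = 0}"
      have lin: "linear_form U0 (\<lambda>u. pairU u x)" if "x \<in> Hc \<beta>" for x \<beta>
        using E.pairU_lin[of x] that by (auto dest: hcomp_carrier)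
      have W: "submodule ?W scalars U0"
        by (rule submoduleI'[OF spU])
          (auto simp: kspace_closed[OF spU] linear_form_zero[OF spU lin] linear_form_add[OF lin] linear_form_smult[OF lin])
      have "E.ew ` EC \<gamma> \<subseteq> ?W"
      proof (rule image_subsetI)
        fix w assume w: "w \<in> EC \<gamma>"
        then obtain \<alpha>s where \<alpha>s: "list_all2 (\<lambda>x \<alpha>. x \<in> Lc \<alpha>) w \<alpha>s" "sum_list \<alpha>s = \<gamma>" by (auto simp: EC_def)
        have "pairU (E.ew w) x = 0" if "\<beta> \<in> expos n - {\<gamma>}" "x \<in> Hc \<beta>" for \<beta> x
          using Phi_graded[OF \<alpha>s(1) that(2)] that \<alpha>s(2) E.pairU_ew[OF EC_letters[OF w], of x] by (auto dest: hcomp_carrier)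
        then show "E.ew w \<in> ?W" using E.ew_closed[OF EC_letters[OF w]] by blast
      qed
      then have "lin_span U0 (E.ew ` EC \<gamma>) \<subseteq> ?W" by (rule lin_span_minimal[OF W])
      with u have uW: "u \<in> ?W" by (auto simp: component_eq)
      then have "restrict (pairU u) (carrier coord_hopf) \<in> graded_dual_component n coord_hopf Hc \<gamma>"
        using G.pair_dual[of u] by (auto simp: graded_dual_component_def dest: hcomp_carrier)
      moreover have "u = G.pre (restrict (pairU u) (carrier coord_hopf))" using uW by (simp add: G.pre_restrict del: coord_simps)
      ultimately show "u \<in> G.pre ` graded_dual_component n coord_hopf Hc \<gamma>" by blast
    qed
  qed
  show ?thesis using env G.pre_hopf_iso comp by blast
qed

end

section \<open>Formal power series in finitely many variables out of countably many\<close>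

text \<open>Series in countably many variables form one commutative ring, given as a type of class
  \<open>comm_ring_1\<close>; series in \<open>n\<close> variables are the subring described by
  \<open>in_vars n\<close>.\<close>

typedef 'a mser = "UNIV :: (expo \<Rightarrow> 'a) set"
  morphisms coef MSer ..

lemma coef_MSer [simp]: "coef (MSer f) = f"
  by (simp add: MSer_inverse)

lemma MSer_coef [simp]: "MSer (coef P) = P"
  by (rule coef_inverse)

lemma mser_eqI: "(\<And>\<gamma>. coef P \<gamma> = coef Q \<gamma>) \<Longrightarrow> P = Q"
  by (metis coef_inverse ext)

abbreviation dec :: "expo \<Rightarrow> (expo \<times> expo) set" where
  "dec \<gamma> \<equiv> {(\<alpha>, \<beta>). \<alpha> + \<beta> = \<gamma>}"

lemma finite_dec: "finite (dec \<gamma>)"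
  by (rule finite_mon_sum)

text \<open>Both sides run over the triples of exponents with sum \<gamma>. Associativity of the
  product and the composition of substitutions rest on this.\<close>

lemma sum_dec_assoc:
  "(\<Sum>(a, b)\<in>dec \<gamma>. \<Sum>(c, d)\<in>dec a. f c d b) = (\<Sum>(c, e)\<in>dec \<gamma>. \<Sum>(d, b)\<in>dec e. f c d b)"
proof -
  have "(\<Sum>(a, b)\<in>dec \<gamma>. \<Sum>(c, d)\<in>dec a. f c d b)
    = (\<Sum>q\<in>dec \<gamma>. \<Sum>r\<in>dec (fst q). f (fst r) (snd r) (snd q))"
    by (simp only: split_def)
  also have "\<dots> = (\<Sum>p\<in>(SIGMA q:dec \<gamma>. dec (fst q)). f (fst (snd p)) (snd (snd p)) (snd (fst p)))"
    using sum.Sigma[of "dec \<gamma>" "\<lambda>q. dec (fst q)" "\<lambda>q r. f (fst r) (snd r) (snd q)"]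
    by (simp add: finite_dec finite_dec[unfolded split_def] split_def)
  also have "\<dots> = (\<Sum>p\<in>(SIGMA q:dec \<gamma>. dec (snd q)). f (fst (fst p)) (fst (snd p)) (snd (snd p)))"
    by (rule sum.reindex_bij_witness[where
          i = "\<lambda>p. ((fst (fst p) + fst (snd p), snd (snd p)), (fst (fst p), fst (snd p)))"
          and j = "\<lambda>p. ((fst (snd p), snd (snd p) + snd (fst p)), (snd (snd p), snd (fst p)))"])
      (auto simp: ac_simps)
  also have "\<dots> = (\<Sum>q\<in>dec \<gamma>. \<Sum>r\<in>dec (snd q). f (fst q) (fst r) (snd r))"
    using sum.Sigma[of "dec \<gamma>" "\<lambda>q. dec (snd q)" "\<lambda>q r. f (fst q) (fst r) (snd r)"]
    by (simp add: finite_dec finite_dec[unfolded split_def] split_def)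
  also have "\<dots> = (\<Sum>(c, e)\<in>dec \<gamma>. \<Sum>(d, b)\<in>dec e. f c d b)"
    by (simp only: split_def)
  finally show ?thesis .
qed

lemma sum_dec_swap: "(\<Sum>(a, b)\<in>dec \<gamma>. f a b) = (\<Sum>(a, b)\<in>dec \<gamma>. f b a)"
  by (rule sum.reindex_bij_witness[where i = prod.swap and j = prod.swap]) (auto simp: add.commute)

lemma sum_dec_left:
  "(\<Sum>(a, b)\<in>dec \<gamma>. of_bool (a = \<alpha>) * f b) = (if \<exists>\<delta>. \<alpha> + \<delta> = \<gamma> then f (\<gamma> - \<alpha>) else (0 :: 'a::comm_ring_1))"
proof (cases "\<exists>\<delta>. \<alpha> + \<delta> = \<gamma>")
  case True
  then obtain \<delta> where \<delta>: "\<gamma> = \<alpha> + \<delta>" by blast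
  have "(\<Sum>(a, b)\<in>dec \<gamma>. of_bool (a = \<alpha>) * f b) = (\<Sum>p\<in>dec \<gamma>. if p = (\<alpha>, \<delta>) then f \<delta> else 0)"
  proof (rule sum.cong[OF refl], clarify)
    fix a b assume "\<gamma> = a + b"
    then show "of_bool (a = \<alpha>) * f b = (if (a, b) = (\<alpha>, \<delta>) then f \<delta> else 0)"
      by (cases "a = \<alpha>") (simp_all add: \<delta>)
  qed
  also have "\<dots> = f \<delta>" using finite_dec[of \<gamma>] by (simp add: \<delta>)
  finally show ?thesis using True by (simp add: \<delta>)
next
  case False
  then show ?thesis by (auto intro!: sum.neutral)
qed

instantiation mser :: (comm_ring_1) comm_ring_1
begin

definition "0 = MSer (\<lambda>\<alpha>. 0)"
definition "1 = MSer (\<lambda>\<alpha>. of_bool (\<alpha> = 0))"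
definition "P + Q = MSer (\<lambda>\<alpha>. coef P \<alpha> + coef Q \<alpha>)"
definition "P - Q = MSer (\<lambda>\<alpha>. coef P \<alpha> - coef Q \<alpha>)"
definition "- P = MSer (\<lambda>\<alpha>. - coef P \<alpha>)"
definition "P * Q = MSer (\<lambda>\<gamma>. \<Sum>(\<alpha>, \<beta>)\<in>dec \<gamma>. coef P \<alpha> * coef Q \<beta>)"

instance
proof
  fix P Q R :: "'a mser"
  note d = zero_mser_def one_mser_def plus_mser_def minus_mser_def uminus_mser_def times_mser_def
  show "P * Q * R = P * (Q * R)"
  proof (rule mser_eqI)
    fix \<gamma> :: expo
    have "coef (P * Q * R) \<gamma> = (\<Sum>(a, b)\<in>dec \<gamma>. \<Sum>(c, d)\<in>dec a. coef P c * coef Q d * coef R b)"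
      by (simp add: d sum_distrib_right split_def)
    also have "\<dots> = (\<Sum>(c, e)\<in>dec \<gamma>. \<Sum>(d, b)\<in>dec e. coef P c * coef Q d * coef R b)"
      by (rule sum_dec_assoc)
    also have "\<dots> = coef (P * (Q * R)) \<gamma>"
      by (simp add: d sum_distrib_left split_def mult.assoc)
    finally show "coef (P * Q * R) \<gamma> = coef (P * (Q * R)) \<gamma>" .
  qed
  show "P * Q = Q * P"
    unfolding d by (rule arg_cong[where f = MSer], rule ext, subst sum_dec_swap) (simp add: mult.commute)
  show "1 * P = P"
  proof (rule mser_eqI)
    fix \<gamma> :: expo
    have "coef (1 * P) \<gamma> = (\<Sum>(a, b)\<in>dec \<gamma>. of_bool (a = 0) * coef P b)" by (simp add: d)
    also have "\<dots> = coef P \<gamma>" by (subst sum_dec_left) simp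
    finally show "coef (1 * P) \<gamma> = coef P \<gamma>" .
  qed
  show "(P + Q) * R = P * R + Q * R"
    by (rule mser_eqI) (simp add: d distrib_right sum.distrib split_def)
  show "0 \<noteq> (1 :: 'a mser)"
  proof
    assume "0 = (1 :: 'a mser)"
    then have "coef 0 0 = coef (1 :: 'a mser) 0" by simp
    then show False by (simp add: d)
  qed
  show "P + Q + R = P + (Q + R)" by (simp add: d add.assoc)
  show "P + Q = Q + P" by (simp add: d add.commute)
  show "0 + P = P" by (simp add: d)
  show "- P + P = 0" by (simp add: d)
  show "P - Q = P + - Q" by (simp add: d)
qed

end

lemma coef_simps [simp]:
  "coef 0 \<alpha> = 0" "coef (P + Q) \<alpha> = coef P \<alpha> + coef Q \<alpha>" "coef (P - Q) \<alpha> = coef P \<alpha> - coef Q \<alpha>"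
  "coef (- P) \<alpha> = - coef P \<alpha>" "coef 1 \<alpha> = of_bool (\<alpha> = 0)"
  by (simp_all add: zero_mser_def one_mser_def plus_mser_def minus_mser_def uminus_mser_def)

lemma coef_mult: "coef (P * Q) \<gamma> = (\<Sum>(\<alpha>, \<beta>)\<in>dec \<gamma>. coef P \<alpha> * coef Q \<beta>)"
  by (simp add: times_mser_def)

lemma coef_sum: "coef (sum f S) \<alpha> = (\<Sum>i\<in>S. coef (f i) \<alpha>)"
  by (induction S rule: infinite_finite_induct) auto

lemma dec_0: "dec 0 = {(0, 0)}"
proof -
  have *: "a = 0 \<and> b = 0" if "a + b = 0" for a b :: expo
  proof -
    have "mon_size a + mon_size b = 0" using that by (simp only: mon_size_add[symmetric] mon_size_0)
    then show ?thesis by simp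
  qed
  show ?thesis
  proof (rule Set.set_eqI)
    fix p :: "expo \<times> expo"
    show "p \<in> dec 0 \<longleftrightarrow> p \<in> {(0, 0)}" using *[of "fst p" "snd p"] by (cases p) auto
  qed
qed

lemma coef_mult_0 [simp]: "coef (P * Q) 0 = coef P 0 * coef Q 0"
  by (simp add: coef_mult dec_0)

definition zmon :: "expo \<Rightarrow> 'a::comm_ring_1 mser" where
  "zmon \<alpha> = MSer (\<lambda>\<gamma>. of_bool (\<gamma> = \<alpha>))"

lemma coef_zmon [simp]: "coef (zmon \<alpha>) \<gamma> = of_bool (\<gamma> = \<alpha>)"
  by (simp add: zmon_def)

lemma coef_zmon_mult: "coef (zmon \<alpha> * P) \<gamma> = (if \<exists>\<delta>. \<alpha> + \<delta> = \<gamma> then coef P (\<gamma> - \<alpha>) else 0)"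
  by (simp add: coef_mult sum_dec_left)

lemma coef_zmon_mult_add [simp]: "coef (zmon \<alpha> * P) (\<alpha> + \<delta>) = coef P \<delta>"
  by (subst coef_zmon_mult) auto

lemma zmon_0: "zmon 0 = 1"
  by (rule mser_eqI) simp

lemma zmon_add: "zmon (\<alpha> + \<beta>) = zmon \<alpha> * zmon \<beta>"
proof (rule mser_eqI)
  fix \<gamma> :: expo
  show "coef (zmon (\<alpha> + \<beta>)) \<gamma> = coef (zmon \<alpha> * zmon \<beta>) \<gamma>"
  proof (cases "\<exists>\<delta>. \<alpha> + \<delta> = \<gamma>")
    case True
    then obtain \<delta> where \<delta>: "\<gamma> = \<alpha> + \<delta>" by blast
    show ?thesis by (simp add: \<delta>)
  next
    case False
    then have "\<gamma> \<noteq> \<alpha> + \<beta>" by blast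
    then show ?thesis using False by (simp add: coef_zmon_mult)
  qed
qed

lemma zmon_power: "zmon \<alpha> ^ k = zmon (of_nat k * \<alpha>)"
  by (induction k) (auto simp: zmon_0 zmon_add distrib_right)

lemma mon_size_less: "\<alpha> \<noteq> 0 \<Longrightarrow> mon_size \<beta> < mon_size (\<alpha> + \<beta>)"
  by (cases "mon_size \<alpha>") (simp_all add: mon_size_add)

text \<open>Each factor without constant term contributes at least one to the size of an
  exponent.\<close>

lemma coef_power_small:
  assumes "coef h 0 = 0" "mon_size \<gamma> < k"
  shows "coef (h ^ k) \<gamma> = 0"
  using assms(2)
proof (induction k arbitrary: \<gamma>)
  case (Suc k)
  have "coef h \<alpha> * coef (h ^ k) \<beta> = 0" if "\<alpha> + \<beta> = \<gamma>" for \<alpha> \<beta>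
  proof (cases "\<alpha> = 0")
    case False
    then have "mon_size \<beta> < k" using Suc(2) mon_size_less[of \<alpha> \<beta>] that by simp
    then show ?thesis using Suc(1) by simp
  qed (simp add: assms)
  then show ?case by (auto simp: coef_mult intro!: sum.neutral)
qed simp

section \<open>Powers with exponents in the field\<close>

text \<open>
  The rules for powers are clear for natural exponents; they extend to all exponents because
  coefficients depend polynomially on the exponent.
\<close>

definition polyf :: "('a::field_char_0 \<Rightarrow> 'a) \<Rightarrow> bool" where
  "polyf f \<longleftrightarrow> (\<exists>P :: (unit, 'a) mpoly. \<forall>c. f c = peval (\<lambda>_. c) P)"

lemma polyf_const: "polyf (\<lambda>c. k)"
  unfolding polyf_def by (rule exI[of _ "single 0 k"]) simp

lemma polyf_id: "polyf (\<lambda>c. c)"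
  unfolding polyf_def by (rule exI[of _ "var ()"]) simp

lemma polyf_add: "polyf f \<Longrightarrow> polyf g \<Longrightarrow> polyf (\<lambda>c. f c + g c)"
  unfolding polyf_def by (metis peval_add)

lemma polyf_mult: "polyf f \<Longrightarrow> polyf g \<Longrightarrow> polyf (\<lambda>c. f c * g c)"
  unfolding polyf_def by (metis peval_mult)

lemma polyf_diff:
  assumes "polyf f" "polyf g"
  shows "polyf (\<lambda>c. f c - g c)"
  using polyf_add[OF assms(1) polyf_mult[OF polyf_const[of "- 1"] assms(2)]] by simp

lemma polyf_sum: "(\<And>i. i \<in> S \<Longrightarrow> polyf (f i)) \<Longrightarrow> polyf (\<lambda>c. \<Sum>i\<in>S. f i c)"
  by (induction S rule: infinite_finite_induct) (auto intro: polyf_const polyf_add)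

lemma polyf_prod: "(\<And>i. i \<in> S \<Longrightarrow> polyf (f i)) \<Longrightarrow> polyf (\<lambda>c. \<Prod>i\<in>S. f i c)"
  by (induction S rule: infinite_finite_induct) (auto intro: polyf_const polyf_mult)

lemma polyf_gbinomial: "polyf f \<Longrightarrow> polyf (\<lambda>c. f c gchoose k)"
  unfolding gbinomial_prod_rev divide_inverse
  by (intro polyf_mult polyf_prod polyf_diff polyf_const)

text \<open>The difference is given by a polynomial in one variable vanishing at all natural
  numbers, so \<open>peval_eq_0_imp\<close> applies.\<close>

lemma polyf_eqI:
  assumes "polyf f" "polyf g" "\<And>n::nat. f (of_nat n) = g (of_nat n)"
  shows "f c = g c"
proof -
  obtain P :: "(unit, 'a) mpoly" where P: "\<And>c. f c - g c = peval (\<lambda>_. c) P"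
    using polyf_diff[OF assms(1,2)] unfolding polyf_def by blast
  have "P = 0"
  proof (rule peval_eq_0_imp)
    fix h :: "unit \<Rightarrow> 'a" assume "\<And>x. \<exists>k. h x = of_nat k"
    then obtain k where "h () = of_nat k" by blast
    then have "h = (\<lambda>_. of_nat k)" by (simp add: fun_eq_iff)
    then show "peval h P = 0" using P[of "of_nat k"] assms(3) by simp
  qed
  then show ?thesis using P[of c] by simp
qed

text \<open>The binomial series of \<open>1 + h\<close>; the argument is \<open>h\<close>, meant to
  have no constant term. The truncation belongs to the definition, which makes each coefficient
  visibly a polynomial in \<open>c\<close>.\<close>

definition mpow :: "'a::field_char_0 mser \<Rightarrow> 'a \<Rightarrow> 'a mser" where
  "mpow h c = MSer (\<lambda>\<gamma>. \<Sum>k\<le>mon_size \<gamma>. (c gchoose k) * coef (h ^ k) \<gamma>)"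

lemma coef_mpow:
  assumes "coef h 0 = 0" "mon_size \<gamma> \<le> N"
  shows "coef (mpow h c) \<gamma> = (\<Sum>k\<le>N. (c gchoose k) * coef (h ^ k) \<gamma>)"
proof -
  have "coef (mpow h c) \<gamma> = (\<Sum>k\<le>mon_size \<gamma>. (c gchoose k) * coef (h ^ k) \<gamma>)" by (simp add: mpow_def)
  also have "\<dots> = (\<Sum>k\<le>N. (c gchoose k) * coef (h ^ k) \<gamma>)"
    using assms by (intro sum.mono_neutral_left) (auto simp: coef_power_small)
  finally show ?thesis .
qed

lemma coef_mpow_0 [simp]: "coef (mpow h c) 0 = 1"
  by (simp add: mpow_def)

lemma polyf_mpow: "polyf (\<lambda>c. coef (mpow h (a * c + b)) \<gamma>)"
  unfolding mpow_def coef_MSer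
  by (intro polyf_sum polyf_mult polyf_gbinomial polyf_add polyf_const polyf_id)

lemma polyf_mpow1: "polyf (\<lambda>c. coef (mpow h c) \<gamma>)"
  using polyf_mpow[of h 1 0 \<gamma>] by simp

lemma polyf_coef_mult:
  assumes "\<And>\<alpha>. polyf (\<lambda>c. coef (P c) \<alpha>)" "\<And>\<alpha>. polyf (\<lambda>c. coef (Q c) \<alpha>)"
  shows "polyf (\<lambda>c. coef (P c * Q c) \<gamma>)"
  unfolding coef_mult split_def by (intro polyf_sum polyf_mult assms)

lemma coef_of_nat_mult: "coef (of_nat k * P) \<gamma> = of_nat k * coef (P :: 'a::comm_ring_1 mser) \<gamma>"
  by (induction k) (auto simp: algebra_simps)

lemma mpow_of_nat:
  assumes "coef h 0 = 0"
  shows "mpow h (of_nat m) = (1 + h) ^ m"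
proof (rule mser_eqI)
  fix \<gamma> :: expo
  let ?N = "max m (mon_size \<gamma>)"
  have "coef ((1 + h) ^ m) \<gamma> = (\<Sum>k\<le>m. of_nat (m choose k) * coef (h ^ k) \<gamma>)"
    by (simp add: add.commute[of 1 h] binomial_ring coef_sum coef_of_nat_mult)
  also have "\<dots> = (\<Sum>k\<le>?N. of_nat (m choose k) * coef (h ^ k) \<gamma>)"
    by (intro sum.mono_neutral_left) (auto simp: binomial_eq_0)
  also have "\<dots> = coef (mpow h (of_nat m)) \<gamma>"
    by (simp add: coef_mpow[OF assms, of \<gamma> ?N] binomial_gbinomial)
  finally show "coef (mpow h (of_nat m)) \<gamma> = coef ((1 + h) ^ m) \<gamma>" by simp
qed

lemma mpow_0 [simp]: "coef h 0 = 0 \<Longrightarrow> mpow h 0 = 1"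
  using mpow_of_nat[of h 0] by simp

lemma mpow_1 [simp]: "coef h 0 = 0 \<Longrightarrow> mpow h 1 = 1 + h"
  using mpow_of_nat[of h 1] by simp

lemma mpow_zero [simp]: "mpow 0 c = 1"
proof (rule mser_eqI)
  fix \<gamma> :: expo
  have "coef (mpow 0 c) \<gamma> = (\<Sum>k\<le>mon_size \<gamma>. if k = 0 then coef (1::'a mser) \<gamma> else 0)"
    unfolding mpow_def coef_MSer by (intro sum.cong) (auto simp: power_0_left)
  then show "coef (mpow 0 c) \<gamma> = coef (1::'a mser) \<gamma>" by simp
qed

text \<open>Two interpolations: for natural \<open>d\<close> both sides are polynomial in
  \<open>c\<close> and agree at natural \<open>c\<close>; then for fixed \<open>c\<close> both are
  polynomial in \<open>d\<close> and agree at natural \<open>d\<close>.\<close>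

lemma mpow_add:
  assumes h: "coef h 0 = 0"
  shows "mpow h (c + d) = mpow h c * mpow h d"
proof -
  have 1: "mpow h (c + of_nat m) = mpow h c * mpow h (of_nat m)" for c m
  proof (rule mser_eqI)
    fix \<gamma> :: expo
    show "coef (mpow h (c + of_nat m)) \<gamma> = coef (mpow h c * mpow h (of_nat m)) \<gamma>"
    proof (rule polyf_eqI[where f = "\<lambda>c. coef (mpow h (c + of_nat m)) \<gamma>" and g = "\<lambda>c. coef (mpow h c * mpow h (of_nat m)) \<gamma>"])
      show "polyf (\<lambda>c. coef (mpow h (c + of_nat m)) \<gamma>)" using polyf_mpow[of h 1 "of_nat m" \<gamma>] by simp
      show "polyf (\<lambda>c. coef (mpow h c * mpow h (of_nat m)) \<gamma>)"
        by (intro polyf_coef_mult polyf_mpow1 polyf_const)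
      show "coef (mpow h (of_nat l + of_nat m)) \<gamma> = coef (mpow h (of_nat l) * mpow h (of_nat m)) \<gamma>" for l
        by (simp only: of_nat_add[symmetric] mpow_of_nat[OF h] power_add)
    qed
  qed
  show ?thesis
  proof (rule mser_eqI)
    fix \<gamma> :: expo
    show "coef (mpow h (c + d)) \<gamma> = coef (mpow h c * mpow h d) \<gamma>"
    proof (rule polyf_eqI[where f = "\<lambda>d. coef (mpow h (c + d)) \<gamma>" and g = "\<lambda>d. coef (mpow h c * mpow h d) \<gamma>"])
      show "polyf (\<lambda>d. coef (mpow h (c + d)) \<gamma>)" using polyf_mpow[of h 1 c \<gamma>] by (simp add: add.commute)
      show "polyf (\<lambda>d. coef (mpow h c * mpow h d) \<gamma>)"
        by (intro polyf_coef_mult polyf_mpow1 polyf_const)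
    qed (simp add: 1)
  qed
qed

lemma mpow_sum:
  assumes h: "coef h 0 = 0"
  shows "mpow h (\<Sum>i\<in>S. c i) = (\<Prod>i\<in>S. mpow h (c i))"
  by (induction S rule: infinite_finite_induct) (auto simp: h mpow_add)

lemma mpow_power:
  assumes h: "coef h 0 = 0"
  shows "mpow h c ^ k = mpow h (of_nat k * c)"
  by (induction k) (auto simp: h mpow_add distrib_right)

text \<open>Interpolation in \<open>c\<close>; for natural exponents this is the power of a
  product.\<close>

lemma mpow_mult:
  assumes h: "coef h 0 = 0" "coef g 0 = 0" "1 + f = (1 + h) * (1 + g)"
  shows "mpow f c = mpow h c * mpow g c"
proof (rule mser_eqI)
  fix \<gamma> :: expo
  have "coef (1 + f) 0 = coef ((1 + h) * (1 + g)) 0" by (simp only: h(3))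
  then have f: "coef f 0 = 0" unfolding coef_mult_0 coef_simps h(1,2) by simp
  show "coef (mpow f c) \<gamma> = coef (mpow h c * mpow g c) \<gamma>"
    by (rule polyf_eqI[where f = "\<lambda>c. coef (mpow f c) \<gamma>" and g = "\<lambda>c. coef (mpow h c * mpow g c) \<gamma>"])
      (auto intro!: polyf_coef_mult polyf_mpow1 simp: mpow_of_nat f h power_mult_distrib)
qed

section \<open>Monomial substitutions\<close>

text \<open>
  For a multiplicative family \<open>u\<close> this is the continuous algebra endomorphism mapping the
  monomial of exponent \<open>\<alpha>\<close> to its product with \<open>u \<alpha>\<close>.
\<close>

definition twist :: "(expo \<Rightarrow> 'a::comm_ring_1 mser) \<Rightarrow> 'a mser \<Rightarrow> 'a mser" where
  "twist u P = MSer (\<lambda>\<gamma>. \<Sum>(\<alpha>, \<beta>)\<in>dec \<gamma>. coef P \<alpha> * coef (u \<alpha>) \<beta>)"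

lemma coef_twist: "coef (twist u P) \<gamma> = (\<Sum>(\<alpha>, \<beta>)\<in>dec \<gamma>. coef P \<alpha> * coef (u \<alpha>) \<beta>)"
  by (simp add: twist_def)

text \<open>Lets a factor \<open>R\<close> enter the substitution. With it,
  \<open>twist_mult\<close> and \<open>twist_comp\<close> reduce to
  \<open>sum_dec_assoc\<close>.\<close>

lemma coef_mult_twist: "coef (R * twist u P) \<gamma> = (\<Sum>(\<alpha>, \<beta>)\<in>dec \<gamma>. coef P \<alpha> * coef (R * u \<alpha>) \<beta>)"
proof -
  have "coef (R * twist u P) \<gamma> = (\<Sum>(x, y)\<in>dec \<gamma>. \<Sum>(d, t)\<in>dec y. coef R x * (coef P d * coef (u d) t))"
    by (simp add: coef_mult coef_twist sum_distrib_left split_def)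
  also have "\<dots> = (\<Sum>(y, x)\<in>dec \<gamma>. \<Sum>(d, t)\<in>dec y. coef R x * (coef P d * coef (u d) t))"
    by (rule sum_dec_swap)
  also have "\<dots> = (\<Sum>(d, b)\<in>dec \<gamma>. \<Sum>(t, x)\<in>dec b. coef R x * (coef P d * coef (u d) t))"
    by (rule sum_dec_assoc)
  also have "\<dots> = (\<Sum>(d, b)\<in>dec \<gamma>. coef P d * coef (u d * R) b)"
    unfolding coef_mult sum_distrib_left split_def by (intro sum.cong refl) (simp add: mult_ac)
  finally show ?thesis by (simp add: mult.commute)
qed

lemma twist_add: "twist u (P + Q) = twist u P + twist u Q"
  by (rule mser_eqI) (simp add: coef_twist distrib_right sum.distrib split_def)

lemma twist_zmon: "twist u (zmon \<alpha>) = zmon \<alpha> * u \<alpha>"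
proof (rule mser_eqI)
  fix \<gamma> :: expo
  have "coef (twist u (zmon \<alpha>)) \<gamma> = (\<Sum>(a, b)\<in>dec \<gamma>. of_bool (a = \<alpha>) * coef (u \<alpha>) b)"
    unfolding coef_twist by (intro sum.cong) auto
  then show "coef (twist u (zmon \<alpha>)) \<gamma> = coef (zmon \<alpha> * u \<alpha>) \<gamma>" by (simp add: coef_mult)
qed

lemma twist_1: "u 0 = 1 \<Longrightarrow> twist u 1 = 1"
  using twist_zmon[of u 0] by (simp add: zmon_0)

lemma twist_mult:
  assumes u: "\<And>\<alpha> \<beta>. u (\<alpha> + \<beta>) = u \<alpha> * u \<beta>"
  shows "twist u (P * Q) = twist u P * twist u Q"
proof (rule mser_eqI)
  fix \<gamma> :: expo
  have "coef (twist u (P * Q)) \<gamma> = (\<Sum>(a, b)\<in>dec \<gamma>. \<Sum>(c, d)\<in>dec a. coef P c * (coef Q d * coef (u c * u d) b))"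
    unfolding coef_twist coef_mult[of P Q] by (auto simp: sum_distrib_right split_def u mult.assoc intro!: sum.cong)
  also have "\<dots> = (\<Sum>(c, e)\<in>dec \<gamma>. \<Sum>(d, b)\<in>dec e. coef P c * (coef Q d * coef (u c * u d) b))"
    by (rule sum_dec_assoc)
  also have "\<dots> = (\<Sum>(c, e)\<in>dec \<gamma>. coef P c * coef (twist u Q * u c) e)"
    by (simp add: mult.commute[of "twist u Q"] coef_mult_twist sum_distrib_left split_def)
  also have "\<dots> = coef (twist u Q * twist u P) \<gamma>" by (simp add: coef_mult_twist)
  finally show "coef (twist u (P * Q)) \<gamma> = coef (twist u P * twist u Q) \<gamma>" by (simp add: mult.commute)
qed

text \<open>The inner substitution turns the monomial of exponent \<alpha> into its product with
  \<open>v \<alpha>\<close>; the outer one, being multiplicative, acts on the two factors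
  separately.\<close>

lemma twist_comp:
  assumes u: "\<And>\<alpha> \<beta>. u (\<alpha> + \<beta>) = u \<alpha> * u \<beta>"
  shows "twist u (twist v P) = twist (\<lambda>\<alpha>. u \<alpha> * twist u (v \<alpha>)) P"
proof (rule mser_eqI)
  fix \<gamma> :: expo
  have "coef (twist u (twist v P)) \<gamma> = (\<Sum>(a, b)\<in>dec \<gamma>. \<Sum>(c, d)\<in>dec a. coef P c * (coef (v c) d * coef (u c * u d) b))"
    unfolding coef_twist[of u] coef_twist[of v] by (auto simp: sum_distrib_right split_def u mult.assoc intro!: sum.cong)
  also have "\<dots> = (\<Sum>(c, e)\<in>dec \<gamma>. \<Sum>(d, b)\<in>dec e. coef P c * (coef (v c) d * coef (u c * u d) b))"
    by (rule sum_dec_assoc)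
  also have "\<dots> = coef (twist (\<lambda>\<alpha>. u \<alpha> * twist u (v \<alpha>)) P) \<gamma>"
    by (simp add: coef_twist[of "\<lambda>\<alpha>. u \<alpha> * twist u (v \<alpha>)"] coef_mult_twist sum_distrib_left split_def)
  finally show "coef (twist u (twist v P)) \<gamma> = coef (twist (\<lambda>\<alpha>. u \<alpha> * twist u (v \<alpha>)) P) \<gamma>" .
qed

lemma coef_twist_0: "coef (u 0) 0 = 1 \<Longrightarrow> coef (twist u P) 0 = coef P 0"
  by (simp add: coef_twist dec_0)

lemma twist_power:
  assumes "\<And>\<alpha> \<beta>. u (\<alpha> + \<beta>) = u \<alpha> * u \<beta>" "u 0 = 1"
  shows "twist u (P ^ k) = twist u P ^ k"
  by (induction k) (auto simp: twist_1 twist_mult assms)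

lemma twist_prod:
  assumes "\<And>\<alpha> \<beta>. u (\<alpha> + \<beta>) = u \<alpha> * u \<beta>" "u 0 = 1"
  shows "twist u (prod f S) = (\<Prod>i\<in>S. twist u (f i))"
  by (induction S rule: infinite_finite_induct) (auto simp: twist_1 twist_mult assms)

text \<open>Continuity of the substitution: for a fixed exponent \<gamma> all binomial series
  involved can be cut at the common bound \<open>mon_size \<gamma>\<close>, and the substitution
  respects powers.\<close>

lemma twist_mpow:
  assumes u: "\<And>\<alpha> \<beta>. u (\<alpha> + \<beta>) = u \<alpha> * u \<beta>" "u 0 = 1" and h: "coef h 0 = 0"
  shows "twist u (mpow h c) = mpow (twist u h) c"
proof (rule mser_eqI)
  fix \<gamma> :: expo
  let ?N = "mon_size \<gamma>"
  have h': "coef (twist u h) 0 = 0" using h by (simp add: coef_twist_0 u)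
  have "coef (twist u (mpow h c)) \<gamma> = (\<Sum>(\<alpha>, \<beta>)\<in>dec \<gamma>. \<Sum>k\<le>?N. (c gchoose k) * (coef (h ^ k) \<alpha> * coef (u \<alpha>) \<beta>))"
    unfolding coef_twist
  proof (rule sum.cong[OF refl], clarify)
    fix \<alpha> \<beta> assume "\<gamma> = \<alpha> + \<beta>"
    then have "coef (mpow h c) \<alpha> = (\<Sum>k\<le>mon_size (\<alpha> + \<beta>). (c gchoose k) * coef (h ^ k) \<alpha>)"
      by (intro coef_mpow[OF h]) (simp add: mon_size_add)
    then show "coef (mpow h c) \<alpha> * coef (u \<alpha>) \<beta>
      = (\<Sum>k\<le>mon_size (\<alpha> + \<beta>). (c gchoose k) * (coef (h ^ k) \<alpha> * coef (u \<alpha>) \<beta>))"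
      by (simp add: sum_distrib_right mult.assoc)
  qed
  also have "\<dots> = (\<Sum>k\<le>?N. (c gchoose k) * (\<Sum>(\<alpha>, \<beta>)\<in>dec \<gamma>. coef (h ^ k) \<alpha> * coef (u \<alpha>) \<beta>))"
    unfolding split_def by (subst sum.swap) (simp add: sum_distrib_left)
  also have "\<dots> = (\<Sum>k\<le>?N. (c gchoose k) * coef (twist u h ^ k) \<gamma>)"
    by (simp add: coef_twist[symmetric] twist_power u)
  also have "\<dots> = coef (mpow (twist u h) c) \<gamma>" by (rule coef_mpow[OF h' order_refl, symmetric])
  finally show "coef (twist u (mpow h c)) \<gamma> = coef (mpow (twist u h) c) \<gamma>" .
qed

text \<open>The equations for the coefficients of \<open>P\<close> are triangular with ones on the
  diagonal: at \<gamma> they contain the coefficient of \<open>P\<close> at \<gamma> and otherwise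
  coefficients at exponents of smaller size. Well-founded recursion on the size solves them.\<close>

lemma twist_surj:
  fixes u :: "expo \<Rightarrow> 'a::comm_ring_1 mser"
  assumes u: "\<And>\<alpha>. coef (u \<alpha>) 0 = 1"
  shows "\<exists>P. twist u P = Q"
proof -
  define step where "step f \<gamma> = coef Q \<gamma> - (\<Sum>(\<alpha>, \<beta>)\<in>dec \<gamma> - {(\<gamma>, 0)}. f \<alpha> * coef (u \<alpha>) \<beta>)" for f :: "expo \<Rightarrow> 'a" and \<gamma>
  define f where "f = wfrec (measure mon_size) step"
  have small: "mon_size \<alpha> < mon_size \<gamma>" if "(\<alpha>, \<beta>) \<in> dec \<gamma> - {(\<gamma>, 0)}" for \<alpha> \<beta> \<gamma>
  proof -
    have "\<beta> \<noteq> 0" using that by auto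
    then show ?thesis using that mon_size_less[of \<beta> \<alpha>] by (auto simp: add.commute)
  qed
  have f: "f \<gamma> = step f \<gamma>" for \<gamma>
  proof -
    have "f \<gamma> = step (cut f (measure mon_size) \<gamma>) \<gamma>"
      unfolding f_def by (rule wfrec) simp
    also have "\<dots> = step f \<gamma>"
      unfolding step_def
    proof (intro arg_cong2[of _ _ _ _ "(-)"] refl sum.cong)
      fix p assume "p \<in> dec \<gamma> - {(\<gamma>, 0)}"
      then show "(case p of (\<alpha>, \<beta>) \<Rightarrow> cut f (measure mon_size) \<gamma> \<alpha> * coef (u \<alpha>) \<beta>)
        = (case p of (\<alpha>, \<beta>) \<Rightarrow> f \<alpha> * coef (u \<alpha>) \<beta>)"
        using small[of "fst p" "snd p" \<gamma>] by (cases p) (simp add: cut_def)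
    qed
    finally show ?thesis .
  qed
  have "twist u (MSer f) = Q"
  proof (rule mser_eqI)
    fix \<gamma> :: expo
    have "coef (twist u (MSer f)) \<gamma> = f \<gamma> + (\<Sum>(\<alpha>, \<beta>)\<in>dec \<gamma> - {(\<gamma>, 0)}. f \<alpha> * coef (u \<alpha>) \<beta>)"
      using finite_dec[of \<gamma>] by (simp add: coef_twist sum.remove[of "dec \<gamma>" "(\<gamma>, 0)"] u)
    then show "coef (twist u (MSer f)) \<gamma> = coef Q \<gamma>" using f[of \<gamma>] by (simp add: step_def)
  qed
  then show ?thesis by blast
qed

section \<open>Series in the first \<open>n\<close> variables\<close>

definition in_vars :: "nat \<Rightarrow> 'a::comm_ring_1 mser \<Rightarrow> bool" where
  "in_vars n P \<longleftrightarrow> (\<forall>\<alpha>. \<alpha> \<notin> expos n \<longrightarrow> coef P \<alpha> = 0)"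

lemma in_vars_coef: "in_vars n P \<Longrightarrow> \<alpha> \<notin> expos n \<Longrightarrow> coef P \<alpha> = 0"
  by (simp add: in_vars_def)

lemma in_vars_closed:
  "in_vars n 0" "in_vars n 1" "in_vars n P \<Longrightarrow> in_vars n Q \<Longrightarrow> in_vars n (P + Q)"
  "in_vars n P \<Longrightarrow> in_vars n Q \<Longrightarrow> in_vars n (P - Q)" "in_vars n P \<Longrightarrow> in_vars n (- P)"
  "\<alpha> \<in> expos n \<Longrightarrow> in_vars n (zmon \<alpha>)"
  by (auto simp: in_vars_def expos_closed(1))

lemma in_vars_twist:
  assumes "\<And>\<alpha>. in_vars n (u \<alpha>)" "in_vars n P"
  shows "in_vars n (twist u P)"
  unfolding in_vars_def
proof (intro allI impI)
  fix \<gamma> assume \<gamma>: "\<gamma> \<notin> expos n"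
  have "coef P \<alpha> * coef (u \<alpha>) \<beta> = 0" if "\<alpha> + \<beta> = \<gamma>" for \<alpha> \<beta>
  proof -
    have "\<alpha> \<notin> expos n \<or> \<beta> \<notin> expos n" using \<gamma> that expos_closed(2) by blast
    then show ?thesis using in_vars_coef[OF assms(1)] in_vars_coef[OF assms(2)] by auto
  qed
  then show "coef (twist u P) \<gamma> = 0" by (auto simp: coef_twist intro!: sum.neutral)
qed

lemma in_vars_mult: "in_vars n P \<Longrightarrow> in_vars n Q \<Longrightarrow> in_vars n (P * Q)"
  using in_vars_twist[of n "\<lambda>_. Q" P] by (simp add: in_vars_def coef_twist coef_mult)

lemma in_vars_power: "in_vars n P \<Longrightarrow> in_vars n (P ^ k)"
  by (induction k) (auto simp: in_vars_closed in_vars_mult)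

lemma in_vars_prod: "(\<And>i. i \<in> S \<Longrightarrow> in_vars n (f i)) \<Longrightarrow> in_vars n (prod f S)"
  by (induction S rule: infinite_finite_induct) (auto simp: in_vars_closed in_vars_mult)

lemma in_vars_mpow: "in_vars n h \<Longrightarrow> in_vars n (mpow h c)"
  unfolding in_vars_def mpow_def coef_MSer using in_vars_power[of n h] by (auto simp: in_vars_def)

text \<open>In the triangular system of \<open>twist_surj\<close> the equations at exponents outside
  \<open>expos n\<close> are homogeneous and involve only unknowns of the same kind, so these vanish
  by induction on the size.\<close>

lemma in_vars_twist_inv:
  assumes u: "\<And>\<alpha>. coef (u \<alpha>) 0 = 1" "\<And>\<alpha>. in_vars n (u \<alpha>)" and "in_vars n (twist u P)"
  shows "in_vars n P"
  unfolding in_vars_def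
proof (intro allI impI)
  fix \<gamma> assume "\<gamma> \<notin> expos n"
  then show "coef P \<gamma> = 0"
  proof (induction "mon_size \<gamma>" arbitrary: \<gamma> rule: less_induct)
    case less
    have z: "coef P \<alpha> * coef (u \<alpha>) \<beta> = 0" if p: "(\<alpha>, \<beta>) \<in> dec \<gamma> - {(\<gamma>, 0)}" for \<alpha> \<beta>
    proof (cases "\<beta> \<in> expos n")
      case True
      then have "\<alpha> \<notin> expos n" using p less(2) expos_closed(2) by blast
      moreover have "\<beta> \<noteq> 0" using p by auto
      then have "mon_size \<alpha> < mon_size \<gamma>" using p mon_size_less[of \<beta> \<alpha>] by (auto simp: add.commute)
      ultimately show ?thesis using less(1) by simp
    qed (simp add: in_vars_coef[OF u(2)])
    have "0 = coef (twist u P) \<gamma>" using assms(3) less(2) by (simp add: in_vars_coef)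
    also have "\<dots> = coef P \<gamma> + (\<Sum>(\<alpha>, \<beta>)\<in>dec \<gamma> - {(\<gamma>, 0)}. coef P \<alpha> * coef (u \<alpha>) \<beta>)"
      using finite_dec[of \<gamma>] by (simp add: coef_twist sum.remove[of "dec \<gamma>" "(\<gamma>, 0)"] u)
    also have "(\<Sum>(\<alpha>, \<beta>)\<in>dec \<gamma> - {(\<gamma>, 0)}. coef P \<alpha> * coef (u \<alpha>) \<beta>) = 0"
      by (rule sum.neutral) (use z in auto)
    finally show ?case by simp
  qed
qed

section \<open>The ring of series\<close>

lemma carrier_series_ring: "F \<in> carrier (series_ring n) \<longleftrightarrow> in_vars n (MSer F)"
  by (simp add: series_ring_def in_vars_def)

lemma MSer_mult: "MSer (F \<otimes>\<^bsub>series_ring n\<^esub> G) = MSer F * MSer G"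
  by (simp add: series_ring_def times_mser_def)

lemma MSer_add: "MSer (F \<oplus>\<^bsub>series_ring n\<^esub> G) = MSer F + MSer G"
  by (simp add: series_ring_def plus_mser_def)

lemma MSer_one: "MSer \<one>\<^bsub>series_ring n\<^esub> = 1"
  by (simp add: series_ring_def one_mser_def)

lemma MSer_zero: "MSer \<zero>\<^bsub>series_ring n\<^esub> = 0"
  by (simp add: series_ring_def zero_mser_def)

lemma MSer_eqI: "MSer F = MSer G \<Longrightarrow> F = G"
  by (metis coef_MSer)

lemma series_cring: "cring (series_ring n :: 'k::field mps ring)"
proof (rule cringI)
  show "abelian_group (series_ring n :: 'k mps ring)"
  proof (rule abelian_groupI)
    fix x :: "'k mps" assume x: "x \<in> carrier (series_ring n)"
    show "\<exists>y\<in>carrier (series_ring n). y \<oplus>\<^bsub>series_ring n\<^esub> x = \<zero>\<^bsub>series_ring n\<^esub>"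
      by (rule bexI[of _ "\<lambda>\<alpha>. - x \<alpha>"]) (use x in \<open>simp_all add: series_ring_def\<close>)
  qed (simp_all add: carrier_series_ring MSer_add MSer_zero in_vars_closed MSer_eqI add_ac)
  show "Group.comm_monoid (series_ring n :: 'k mps ring)"
    by (rule comm_monoidI)
      (simp_all add: carrier_series_ring MSer_mult MSer_one in_vars_closed in_vars_mult MSer_eqI mult_ac)
qed (simp add: MSer_eqI MSer_mult MSer_add distrib_right)

lemma MSer_minus:
  assumes "F \<in> carrier (series_ring n)" "G \<in> carrier (series_ring n)"
  shows "MSer (F \<ominus>\<^bsub>series_ring n\<^esub> G) = MSer F - (MSer G :: 'k::field mser)"
proof -
  interpret cring "series_ring n :: 'k mps ring" by (rule series_cring)
  have "(F \<ominus>\<^bsub>series_ring n\<^esub> G) \<oplus>\<^bsub>series_ring n\<^esub> G = F"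
    using assms by (simp add: a_minus_def a_assoc l_neg)
  then have "MSer (F \<ominus>\<^bsub>series_ring n\<^esub> G) + MSer G = MSer F" using MSer_add by metis
  then show ?thesis by (simp add: eq_diff_eq)
qed

lemma MSer_pow: "MSer (F [^]\<^bsub>series_ring n\<^esub> k) = MSer (F :: 'k::field mps) ^ (k :: nat)"
proof -
  interpret cring "series_ring n :: 'k mps ring" by (rule series_cring)
  show ?thesis by (induction k) (simp_all add: MSer_one MSer_mult mult.commute)
qed

lemma MSer_finprod:
  assumes "finite S" "\<And>i. i \<in> S \<Longrightarrow> f i \<in> carrier (series_ring n)"
  shows "MSer (\<Otimes>\<^bsub>series_ring n\<^esub>i\<in>S. f i) = (\<Prod>i\<in>S. MSer (f i :: 'k::field mps))"
proof -
  interpret cring "series_ring n :: 'k mps ring" by (rule series_cring)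
  show ?thesis using assms
  proof (induction S)
    case (insert x S)
    then show ?case by (subst finprod_insert) (auto simp: MSer_mult)
  qed (simp add: MSer_one)
qed

lemma MSer_var: "MSer (series_var i) = zmon (single i 1)"
  by (simp add: series_var_def zmon_def)

lemma single_in_expos: "i \<in> {1..n} \<Longrightarrow> single i k \<in> expos n"
  by (simp add: expos_def)

lemma MSer_powr:
  assumes "u \<in> carrier (series_ring n)"
  shows "MSer (series_powr n u c) = mpow (MSer u - 1) c"
proof -
  interpret cring "series_ring n :: 'a mps ring" by (rule series_cring)
  have "series_powr n u c \<gamma> = coef (mpow (MSer u - 1) c) \<gamma>" for \<gamma>
  proof -
    have "((u \<ominus>\<^bsub>series_ring n\<^esub> \<one>\<^bsub>series_ring n\<^esub>) [^]\<^bsub>series_ring n\<^esub> k) = coef ((MSer u - 1) ^ k)" for k :: nat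
      by (rule MSer_eqI) (simp add: MSer_pow MSer_minus assms MSer_one)
    then show ?thesis by (simp add: series_powr_def mpow_def total_degree_eq)
  qed
  then show ?thesis by (intro mser_eqI) simp
qed

lemma carrier_V0: "P \<in> carrier (V0 n) \<longleftrightarrow> in_vars n (MSer P) \<and> P 0 = 0"
  by (simp add: V0_def carrier_series_ring)

lemma V0_mult: "P \<otimes>\<^bsub>V0 n\<^esub> Q = (\<lambda>\<alpha>. P \<alpha> + Q \<alpha>)"
  by (simp add: V0_def series_ring_def)

lemma V0_one: "\<one>\<^bsub>V0 n\<^esub> = (\<lambda>\<alpha>. 0)"
  by (simp add: V0_def series_ring_def)

lemma group_V0: "group (V0 n :: 'k::field mps monoid)"
proof (rule groupI)
  fix x :: "'k mps" assume x: "x \<in> carrier (V0 n)"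
  show "\<exists>y\<in>carrier (V0 n). y \<otimes>\<^bsub>V0 n\<^esub> x = \<one>\<^bsub>V0 n\<^esub>"
    by (rule bexI[of _ "\<lambda>\<alpha>. - x \<alpha>"]) (use x in \<open>simp_all add: carrier_V0 V0_mult V0_one in_vars_def\<close>)
qed (simp_all add: carrier_V0 V0_mult V0_one in_vars_def add_ac)

lemma div_var_zmon: "div_var i (coef (zmon (single i 1) * P)) = coef P"
  unfolding div_var_def by (rule ext, subst add.commute) (rule coef_zmon_mult_add)

lemma G_set_iff: "F \<in> G_set n i \<longleftrightarrow>
  (\<exists>h. in_vars n h \<and> coef h 0 = 0 \<and> F = coef (zmon (single i 1) * (1 + h)))"
proof -
  have eq: "series_var i \<otimes>\<^bsub>series_ring n\<^esub> (\<one>\<^bsub>series_ring n\<^esub> \<oplus>\<^bsub>series_ring n\<^esub> H)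
    = coef (zmon (single i 1) * (1 + MSer H))" for H :: "'a mps"
    by (rule MSer_eqI) (simp add: MSer_mult MSer_add MSer_one MSer_var)
  show ?thesis
  proof
    assume "F \<in> G_set n i"
    then show "\<exists>h. in_vars n h \<and> coef h 0 = 0 \<and> F = coef (zmon (single i 1) * (1 + h))"
      unfolding G_set_def eq carrier_V0 by auto
  next
    assume "\<exists>h. in_vars n h \<and> coef h 0 = 0 \<and> F = coef (zmon (single i 1) * (1 + h))"
    then obtain h where "in_vars n h" "coef h 0 = 0" "F = coef (zmon (single i 1) * (1 + h))" by blast
    then show "F \<in> G_set n i"
      unfolding G_set_def eq carrier_V0 by (auto intro!: exI[of _ "coef h"])
  qed
qed

lemma finite_expos_bounded: "finite {\<alpha> \<in> expos n. mon_size \<alpha> \<le> N}"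
proof (rule finite_subset[OF _ finite_bounded_mons[of "{1..n}" N]])
  have le: "lookup \<alpha> k \<le> mon_size \<alpha>" for \<alpha> :: expo and k
  proof (cases "k \<in> keys \<alpha>")
    case True
    then show ?thesis unfolding mon_size_def by (intro member_le_sum) auto
  qed (simp add: not_in_keys_iff_lookup_eq_zero)
  show "{\<alpha> \<in> expos n. mon_size \<alpha> \<le> N} \<subseteq> {\<alpha>. keys \<alpha> \<subseteq> {1..n} \<and> (\<forall>k. lookup \<alpha> k \<le> N)}"
    by (auto simp: expos_def intro: order_trans[OF le])
qed simp

lemma zmon_single_power: "zmon (single l 1) ^ k = zmon (single l k)"
proof (induction k)
  case (Suc k)
  have "single l (Suc k) = single l 1 + (single l k :: expo)"
    by (simp add: single_add[symmetric])
  then show ?case by (simp only: power_Suc Suc zmon_add)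
qed (simp add: zmon_0)

lemma zmon_sum: "zmon (sum f S) = (\<Prod>i\<in>S. zmon (f i))"
  by (induction S rule: infinite_finite_induct) (auto simp: zmon_0 zmon_add)

lemma zmon_expos:
  assumes "\<alpha> \<in> expos n"
  shows "(\<Prod>l\<in>{1..n}. zmon (single l 1) ^ lookup \<alpha> l) = zmon \<alpha>"
proof -
  have "\<alpha> = (\<Sum>l\<in>keys \<alpha>. single l (lookup \<alpha> l))" by (rule poly_mapping_sum_singles)
  also have "\<dots> = (\<Sum>l\<in>{1..n}. single l (lookup \<alpha> l))"
    using assms by (intro sum.mono_neutral_left) (auto simp: expos_def in_keys_iff)
  finally have "(\<Sum>l\<in>{1..n}. single l (lookup \<alpha> l)) = \<alpha>" ..
  then show ?thesis by (simp only: zmon_single_power zmon_sum[symmetric])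
qed

text \<open>The truncated sum of the definition runs over exponents in \<open>expos n\<close> of
  size at most that of \<gamma>, the sum in \<open>twist\<close> over summands of \<gamma>. An
  exponent in only one of the two sets contributes 0: either its monomial does not divide the one of
  \<gamma>, or \<open>P\<close> has no such coefficient.\<close>

lemma series_subst_eq_twist:
  assumes P: "in_vars n (MSer P)"
    and G: "\<And>l. l \<in> {1..n} \<Longrightarrow> G l \<in> carrier (series_ring n)"
    and v: "\<And>l. l \<in> {1..n} \<Longrightarrow> MSer (G l) = zmon (single l 1) * v l"
    and u: "\<And>\<alpha>. u \<alpha> = (\<Prod>l\<in>{1..n}. v l ^ lookup \<alpha> l)"
  shows "series_subst n G P = coef (twist u (MSer P))"
proof
  fix \<gamma> :: expo
  interpret cring "series_ring n :: 'a mps ring" by (rule series_cring)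
  have m: "(\<Otimes>\<^bsub>series_ring n\<^esub>i\<in>{1..n}. G i [^]\<^bsub>series_ring n\<^esub> lookup \<alpha> i) = coef (zmon \<alpha> * u \<alpha>)"
    if "\<alpha> \<in> expos n" for \<alpha>
  proof (rule MSer_eqI)
    have "MSer (\<Otimes>\<^bsub>series_ring n\<^esub>i\<in>{1..n}. G i [^]\<^bsub>series_ring n\<^esub> lookup \<alpha> i)
      = (\<Prod>l\<in>{1..n}. (zmon (single l 1) * v l) ^ lookup \<alpha> l)"
      by (subst MSer_finprod) (auto simp: G MSer_pow v intro!: prod.cong nat_pow_closed)
    also have "\<dots> = zmon \<alpha> * u \<alpha>"
      by (simp only: power_mult_distrib prod.distrib zmon_expos[OF that] u)
    finally show "MSer (\<Otimes>\<^bsub>series_ring n\<^esub>i\<in>{1..n}. G i [^]\<^bsub>series_ring n\<^esub> lookup \<alpha> i) = MSer (coef (zmon \<alpha> * u \<alpha>))"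
      by simp
  qed
  have "coef (twist u (MSer P)) \<gamma> = (\<Sum>q\<in>dec \<gamma>. P (fst q) * coef (zmon (fst q) * u (fst q)) \<gamma>)"
    unfolding coef_twist by (rule sum.cong) auto
  also have "\<dots> = (\<Sum>\<alpha>\<in>fst ` dec \<gamma>. P \<alpha> * coef (zmon \<alpha> * u \<alpha>) \<gamma>)"
    by (subst sum.reindex) (auto simp: inj_on_def)
  also have "\<dots> = (\<Sum>\<alpha>\<in>{\<alpha> \<in> expos n. mon_size \<alpha> \<le> mon_size \<gamma>}. P \<alpha> *
    (\<Otimes>\<^bsub>series_ring n\<^esub>i\<in>{1..n}. G i [^]\<^bsub>series_ring n\<^esub> lookup \<alpha> i) \<gamma>)"
  proof (rule sum.mono_neutral_cong)
    fix \<alpha> assume \<alpha>: "\<alpha> \<in> {\<alpha> \<in> expos n. mon_size \<alpha> \<le> mon_size \<gamma>} - fst ` dec \<gamma>"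
    then have "\<nexists>\<delta>. \<alpha> + \<delta> = \<gamma>" by force
    then show "P \<alpha> * (\<Otimes>\<^bsub>series_ring n\<^esub>i\<in>{1..n}. G i [^]\<^bsub>series_ring n\<^esub> lookup \<alpha> i) \<gamma> = 0"
      using \<alpha> m[of \<alpha>] by (simp add: coef_zmon_mult del: One_nat_def)
  next
    fix \<alpha> assume \<alpha>: "\<alpha> \<in> fst ` dec \<gamma> - {\<alpha> \<in> expos n. mon_size \<alpha> \<le> mon_size \<gamma>}"
    then have "\<alpha> \<notin> expos n" by (auto simp: mon_size_add)
    then show "P \<alpha> * coef (zmon \<alpha> * u \<alpha>) \<gamma> = 0" using in_vars_coef[OF P] by simp
  next
    fix \<alpha> assume "\<alpha> \<in> fst ` dec \<gamma> \<inter> {\<alpha> \<in> expos n. mon_size \<alpha> \<le> mon_size \<gamma>}"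
    then show "P \<alpha> * coef (zmon \<alpha> * u \<alpha>) \<gamma>
      = P \<alpha> * (\<Otimes>\<^bsub>series_ring n\<^esub>i\<in>{1..n}. G i [^]\<^bsub>series_ring n\<^esub> lookup \<alpha> i) \<gamma>"
      using m[of \<alpha>] by simp
  qed (simp_all only: finite_expos_bounded finite_dec finite_imageI)
  finally show "series_subst n G P \<gamma> = coef (twist u (MSer P)) \<gamma>"
    by (simp add: series_subst_def total_degree_eq)
qed

section \<open>The groups in terms of power series\<close>

locale coefficient_matrix =
  fixes p q :: nat and B :: "nat \<Rightarrow> nat \<Rightarrow> 'k::field_char_0"
begin

abbreviation "n \<equiv> p + q"

text \<open>The scalar \<open>A\<^sub>j \<cdot> \<alpha>\<close> for \<open>j \<le> p\<close>, and 0
  for the indices of the additive components.\<close>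

definition wt :: "nat \<Rightarrow> expo \<Rightarrow> 'k" where
  "wt j \<alpha> = (\<Sum>l=1..n. coeff_A p B j j l * of_nat (lookup \<alpha> l))"

definition umul :: "(nat \<Rightarrow> 'k mser) \<Rightarrow> expo \<Rightarrow> 'k mser" where
  "umul g \<alpha> = (\<Prod>j\<in>{1..p}. mpow (g j) (wt j \<alpha>))"

definition gact :: "(nat \<Rightarrow> 'k mser) \<Rightarrow> 'k mser \<Rightarrow> 'k mser" where
  "gact g = twist (umul g)"

text \<open>The group law in the coordinates \<open>g j = F\<^sub>j / x\<^sub>j - 1\<close>, solved
  from \<open>1 + gmul g h j = (1 + g j) * (1 + gact g (h j))\<close>.\<close>

definition gmul :: "(nat \<Rightarrow> 'k mser) \<Rightarrow> (nat \<Rightarrow> 'k mser) \<Rightarrow> nat \<Rightarrow> 'k mser" where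
  "gmul g h j = g j + (1 + g j) * gact g (h j)"

definition gok :: "(nat \<Rightarrow> 'k mser) \<Rightarrow> bool" where
  "gok g \<longleftrightarrow> (\<forall>j\<in>{1..p}. in_vars n (g j) \<and> coef (g j) 0 = 0)"

definition gof :: "(nat \<Rightarrow> 'k mps) \<Rightarrow> nat \<Rightarrow> 'k mser" where
  "gof F i = MSer (div_var i (F i)) - 1"

definition fof :: "(nat \<Rightarrow> 'k mser) \<Rightarrow> nat \<Rightarrow> 'k mps" where
  "fof g = (\<lambda>i\<in>{1..p}. coef (zmon (single i 1) * (1 + g i)))"

abbreviation "\<G> \<equiv> G_group p q B"

lemma gokD: "gok g \<Longrightarrow> j \<in> {1..p} \<Longrightarrow> in_vars n (g j)" "gok g \<Longrightarrow> j \<in> {1..p} \<Longrightarrow> coef (g j) 0 = 0"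
  by (auto simp: gok_def)

lemma wt_add: "wt j (\<alpha> + \<beta>) = wt j \<alpha> + wt j \<beta>"
  by (simp add: wt_def lookup_add distrib_left sum.distrib)

lemma wt_0 [simp]: "wt j 0 = 0"
  by (simp add: wt_def)

lemma wt_single:
  assumes "l \<in> {1..n}"
  shows "wt j (single l 1) = coeff_A p B j j l"
proof -
  have "wt j (single l 1) = (\<Sum>k\<in>{1..n}. if k = l then coeff_A p B j j l else 0)"
    unfolding wt_def by (intro sum.cong refl) (auto simp: lookup_single when_def)
  then show ?thesis using assms by simp
qed

lemma umul_add: "gok g \<Longrightarrow> umul g (\<alpha> + \<beta>) = umul g \<alpha> * umul g \<beta>"
  unfolding umul_def prod.distrib[symmetric] by (intro prod.cong refl) (simp add: wt_add mpow_add gokD)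

lemma umul_0: "gok g \<Longrightarrow> umul g 0 = 1"
  unfolding umul_def by (rule prod.neutral) (simp add: gokD)

lemma umul_in_vars: "gok g \<Longrightarrow> in_vars n (umul g \<alpha>)"
  unfolding umul_def by (intro in_vars_prod in_vars_mpow gokD)

lemma coef_prod_0: "coef (prod f S) 0 = (\<Prod>i\<in>S. coef (f i) 0)"
  by (induction S rule: infinite_finite_induct) auto

lemma coef_umul_0 [simp]: "coef (umul g \<alpha>) 0 = 1"
  by (simp add: umul_def coef_prod_0)

lemma umul_cong: "(\<And>j. j \<in> {1..p} \<Longrightarrow> g j = h j) \<Longrightarrow> umul g = umul h"
  unfolding umul_def by (intro ext prod.cong) auto

text \<open>The identity block on top of the matrix gives \<open>x\<^sub>j\<close> the multiplier
  \<open>F\<^sub>j / x\<^sub>j\<close>, so that it is sent to \<open>F\<^sub>j\<close>.\<close>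

lemma umul_var:
  assumes "gok g" "j \<in> {1..p}"
  shows "umul g (single j 1) = 1 + g j"
proof -
  have "umul g (single j 1) = (\<Prod>i\<in>{1..p}. if i = j then 1 + g j else 1)"
    unfolding umul_def
  proof (rule prod.cong[OF refl])
    fix i assume i: "i \<in> {1..p}"
    have "wt i (single j 1) = of_bool (j = i)"
      using assms(2) i by (subst wt_single) (auto simp: coeff_A_def)
    then show "mpow (g i) (wt i (single j 1)) = (if i = j then 1 + g j else 1)"
      using gokD(2)[OF assms(1) i] by (cases "i = j") simp_all
  qed
  then show ?thesis using assms(2) by simp
qed

lemma gact_simps:
  assumes "gok g"
  shows "gact g (P + Q) = gact g P + gact g Q" "gact g (P * Q) = gact g P * gact g Q"
    "gact g 1 = 1" "coef (gact g P) 0 = coef P 0"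
    "gact g (zmon \<alpha>) = zmon \<alpha> * umul g \<alpha>"
  unfolding gact_def
  by (simp_all add: twist_add twist_mult umul_add[OF assms] twist_1 umul_0[OF assms] coef_twist_0 twist_zmon)

lemma gact_mpow: "gok g \<Longrightarrow> coef h 0 = 0 \<Longrightarrow> gact g (mpow h c) = mpow (gact g h) c"
  unfolding gact_def by (rule twist_mpow) (simp_all add: umul_add umul_0)

lemma gact_prod: "gok g \<Longrightarrow> gact g (prod f S) = (\<Prod>i\<in>S. gact g (f i))"
  unfolding gact_def by (rule twist_prod) (simp_all add: umul_add umul_0)

lemma gact_in_vars: "gok g \<Longrightarrow> in_vars n P \<Longrightarrow> in_vars n (gact g P)"
  unfolding gact_def by (intro in_vars_twist umul_in_vars)

lemma gact_cong: "(\<And>j. j \<in> {1..p} \<Longrightarrow> g j = h j) \<Longrightarrow> gact g = gact h"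
  unfolding gact_def using umul_cong[of g h] by simp

lemma gact_zero: "(\<And>j. j \<in> {1..p} \<Longrightarrow> g j = 0) \<Longrightarrow> gact g P = P"
proof -
  assume "\<And>j. j \<in> {1..p} \<Longrightarrow> g j = 0"
  then have "umul g \<alpha> = 1" for \<alpha> unfolding umul_def by (intro prod.neutral) simp
  then have "gact g P = twist (\<lambda>\<alpha>. 1) P" by (simp add: gact_def fun_eq_iff[symmetric] ext[of "umul g" "\<lambda>\<alpha>. 1"])
  also have "\<dots> = P * 1" by (rule mser_eqI) (simp only: coef_twist coef_mult)
  finally show ?thesis by simp
qed

lemma gact_surj:
  assumes "gok g" "in_vars n Q"
  obtains P where "in_vars n P" "gact g P = Q" "coef P 0 = coef Q 0"
proof -
  obtain P where P: "gact g P = Q" using twist_surj[of "umul g" Q] by (auto simp: gact_def)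
  have "in_vars n P"
    by (rule in_vars_twist_inv[of "umul g"]) (use assms P in \<open>simp_all add: umul_in_vars gact_def\<close>)
  then show ?thesis using P gact_simps(4)[OF assms(1), of P] that by simp
qed

lemma one_plus_gmul: "1 + gmul g h j = (1 + g j) * (1 + gact g (h j))"
  by (simp add: gmul_def algebra_simps)

lemma gok_gmul: "gok g \<Longrightarrow> gok h \<Longrightarrow> gok (gmul g h)"
  unfolding gok_def[of "gmul g h"] gmul_def
  by (auto simp: gokD gact_simps(4) in_vars_closed in_vars_mult gact_in_vars)

text \<open>The cocycle identity of the multipliers: powers are multiplicative in the base and
  commute with the substitution. It makes the group law correspond to composition of
  substitutions.\<close>

lemma umul_gmul:
  assumes "gok g" "gok h"
  shows "umul (gmul g h) \<alpha> = umul g \<alpha> * gact g (umul h \<alpha>)"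
proof -
  have "gact g (umul h \<alpha>) = (\<Prod>j\<in>{1..p}. mpow (gact g (h j)) (wt j \<alpha>))"
    unfolding umul_def[of h] gact_prod[OF assms(1)]
    by (intro prod.cong refl) (simp add: gact_mpow assms gokD)
  moreover have "mpow (gmul g h j) c = mpow (g j) c * mpow (gact g (h j)) c" if "j \<in> {1..p}" for j c
    by (rule mpow_mult) (use that in \<open>simp_all add: one_plus_gmul gokD[OF assms(1)] gokD[OF assms(2)] gact_simps(4)[OF assms(1)]\<close>)
  ultimately show ?thesis
    unfolding umul_def[of g] umul_def[of "gmul g h"] by (simp add: prod.distrib)
qed

lemma gact_gmul:
  assumes "gok g" "gok h"
  shows "gact (gmul g h) P = gact g (gact h P)"
proof -
  have "umul (gmul g h) = (\<lambda>\<alpha>. umul g \<alpha> * twist (umul g) (umul h \<alpha>))"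
    using umul_gmul[OF assms] by (auto simp: gact_def)
  then show ?thesis
    using twist_comp[where u = "umul g" and v = "umul h" and P = P] umul_add[OF assms(1)]
    by (simp only: gact_def)
qed

text \<open>\<open>mpow h (-1)\<close> is the inverse of \<open>1 + h\<close>; the identity is
  written in the shape of the coordinate of a product.\<close>

lemma mpow_inverse:
  assumes "coef h 0 = 0"
  shows "h + (1 + h) * (mpow h (-1) - 1) = 0"
  using mpow_add[OF assms, of 1 "-1"] assms by (simp add: algebra_simps)

lemma gof_fof: "i \<in> {1..p} \<Longrightarrow> gof (fof g) i = g i"
  by (simp add: gof_def fof_def div_var_zmon del: One_nat_def)

lemma fof_in_G: "gok g \<Longrightarrow> fof g \<in> carrier (\<G>)"
proof -
  assume g: "gok g"
  have "coef (zmon (single i 1) * (1 + g i)) \<in> G_set n i" if "i \<in> {1..p}" for i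
    unfolding G_set_iff using gokD[OF g that] by blast
  then show ?thesis unfolding G_group_def fof_def by (simp del: One_nat_def)
qed

lemma G_cases:
  assumes "F \<in> carrier (\<G>)"
  shows "gok (gof F)" "fof (gof F) = F"
proof -
  have F: "F \<in> (\<Pi>\<^sub>E i\<in>{1..p}. G_set n i)" using assms by (simp add: G_group_def)
  have *: "in_vars n (gof F i) \<and> coef (gof F i) 0 = 0 \<and> fof (gof F) i = F i" if i: "i \<in> {1..p}" for i
  proof -
    have "F i \<in> G_set n i" using F i by (rule PiE_mem)
    then obtain h where h: "in_vars n h" "coef h 0 = 0" "F i = coef (zmon (single i 1) * (1 + h))"
      unfolding G_set_iff by blast
    then have "gof F i = h" by (simp add: gof_def div_var_zmon del: One_nat_def)
    then show ?thesis using h i by (simp add: fof_def del: One_nat_def)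
  qed
  show "gok (gof F)" using * by (simp add: gok_def)
  show "fof (gof F) = F"
  proof (rule ext)
    fix i show "fof (gof F) i = F i"
      by (cases "i \<in> {1..p}") (use * F in \<open>auto simp: fof_def PiE_def extensional_def\<close>)
  qed
qed

lemma fof_cong: "(\<And>j. j \<in> {1..p} \<Longrightarrow> g j = h j) \<Longrightarrow> fof g = fof h"
  unfolding fof_def by (intro restrict_ext) simp

text \<open>Each variable \<open>l\<close> is sent to its product with \<open>v l\<close>, a product
  of powers of the \<open>F\<^sub>i / x\<^sub>i\<close> whose exponents form row \<open>l\<close> of
  the stacked matrix. Collecting the exponents over a monomial yields its multiplier
  \<open>umul\<close>.\<close>

lemma G_subst_eq:
  assumes F: "F \<in> carrier (\<G>)" and P: "in_vars n (MSer P)"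
  shows "G_subst p q B F P = coef (gact (gof F) (MSer P))"
proof -
  let ?g = "gof F"
  have g: "gok ?g" using G_cases(1)[OF F] .
  have Fi: "MSer (F i) = zmon (single i 1) * (1 + ?g i)" if "i \<in> {1..p}" for i
    using that by (subst G_cases(2)[OF F, symmetric]) (simp add: fof_def del: One_nat_def)
  have d: "div_var i (F i) \<in> carrier (series_ring n)" "MSer (div_var i (F i)) = 1 + ?g i" if "i \<in> {1..p}" for i
  proof -
    show "MSer (div_var i (F i)) = 1 + ?g i" by (simp add: gof_def)
    then show "div_var i (F i) \<in> carrier (series_ring n)"
      using gokD(1)[OF g that] by (simp add: carrier_series_ring in_vars_closed)
  qed
  define v where "v l = (\<Prod>i\<in>{1..p}. mpow (?g i) (coeff_A p B i i l))" for l
  have v_small: "v l = 1 + ?g l" if "l \<in> {1..p}" for l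
  proof -
    have "l \<in> {1..n}" using that by simp
    then show ?thesis
      using umul_var[OF g that] unfolding umul_def v_def by (simp only: wt_single)
  qed
  let ?G = "\<lambda>l. if l \<le> p then F l else series_var l \<otimes>\<^bsub>series_ring n\<^esub>
            (\<Otimes>\<^bsub>series_ring n\<^esub>i\<in>{1..p}. series_powr n (div_var i (F i)) (B (l - p) i))"
  have powr: "MSer (series_powr n (div_var i (F i)) c) = mpow (?g i) c" if "i \<in> {1..p}" for i c
    using MSer_powr[OF d(1)[OF that], of c] d(2)[OF that] by simp
  have powr_closed: "series_powr n (div_var i (F i)) c \<in> carrier (series_ring n)" if "i \<in> {1..p}" for i c
    using gokD(1)[OF g that] by (simp add: carrier_series_ring powr[OF that] in_vars_mpow)
  have G: "MSer (?G l) = zmon (single l 1) * v l" if l: "l \<in> {1..n}" for l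
  proof (cases "l \<le> p")
    case True
    then show ?thesis using l Fi[of l] v_small[of l] by simp
  next
    case False
    have "MSer (?G l) = zmon (single l 1) * (\<Prod>i\<in>{1..p}. mpow (?g i) (B (l - p) i))"
      using False MSer_finprod[of "{1..p}" "\<lambda>i. series_powr n (div_var i (F i)) (B (l - p) i)" n, OF _ powr_closed]
      by (simp add: MSer_mult MSer_var powr del: One_nat_def)
    also have "(\<Prod>i\<in>{1..p}. mpow (?g i) (B (l - p) i)) = v l"
      unfolding v_def using False by (intro prod.cong refl) (simp add: coeff_A_def)
    finally show ?thesis .
  qed
  have v_closed: "in_vars n (v l)" for l
    unfolding v_def by (intro in_vars_prod in_vars_mpow gokD(1)[OF g])
  have "G_subst p q B F P = coef (twist (umul ?g) (MSer P))"
    unfolding G_subst_def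
  proof (rule series_subst_eq_twist[where v = v])
    fix l assume l: "l \<in> {1..n}"
    show "MSer (?G l) = zmon (single l 1) * v l" by (rule G[OF l])
    show "?G l \<in> carrier (series_ring n)"
      unfolding carrier_series_ring G[OF l] by (intro in_vars_mult in_vars_closed single_in_expos l v_closed)
  next
    fix \<alpha> :: expo
    have "(\<Prod>l\<in>{1..n}. v l ^ lookup \<alpha> l)
      = (\<Prod>l\<in>{1..n}. \<Prod>i\<in>{1..p}. mpow (?g i) (coeff_A p B i i l * of_nat (lookup \<alpha> l)))"
      unfolding v_def prod_power_distrib
      by (intro prod.cong refl) (simp add: mpow_power gokD[OF g] mult.commute)
    also have "\<dots> = umul ?g \<alpha>"
      unfolding umul_def wt_def
      by (subst prod.swap, intro prod.cong refl) (simp add: mpow_sum gokD[OF g])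
    finally show "umul ?g \<alpha> = (\<Prod>l\<in>{1..n}. v l ^ lookup \<alpha> l)" by simp
  qed (rule P)
  then show ?thesis by (simp add: gact_def)
qed

lemma G_mult:
  assumes F: "F \<in> carrier (\<G>)" and H: "H \<in> carrier (\<G>)"
  shows "F \<otimes>\<^bsub>\<G>\<^esub> H = fof (gmul (gof F) (gof H))"
proof -
  note g = G_cases(1)[OF F] and h = G_cases(1)[OF H]
  have "G_subst p q B F (H j) = coef (zmon (single j 1) * (1 + gmul (gof F) (gof H) j))"
    if j: "j \<in> {1..p}" for j
  proof -
    have Hj: "MSer (H j) = zmon (single j 1) * (1 + gof H j)"
      using j by (subst G_cases(2)[OF H, symmetric]) (simp add: fof_def del: One_nat_def)
    have "in_vars n (MSer (H j))"
      unfolding Hj using j by (intro in_vars_mult in_vars_closed single_in_expos gokD(1)[OF h j]) simp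
    then show ?thesis
      by (simp only: G_subst_eq[OF F] Hj gact_simps[OF g] umul_var[OF g j] one_plus_gmul mult.assoc)
  qed
  then show ?thesis by (simp add: G_group_def fof_def cong: restrict_cong)
qed

lemma G_one: "\<one>\<^bsub>\<G>\<^esub> = fof (\<lambda>_. 0)"
proof -
  have "series_var i = coef (zmon (single i 1) :: 'k mser)" for i
    by (rule MSer_eqI) (simp add: MSer_var)
  then show ?thesis by (simp add: G_group_def fof_def)
qed

lemma gok_zero: "gok (\<lambda>_. 0)"
  by (simp add: gok_def in_vars_closed)

lemma gof_mult:
  assumes "F \<in> carrier (\<G>)" "H \<in> carrier (\<G>)" "j \<in> {1..p}"
  shows "gof (F \<otimes>\<^bsub>\<G>\<^esub> H) j = gmul (gof F) (gof H) j"
  using assms by (simp add: G_mult gof_fof)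

lemma G_eqI:
  assumes "F \<in> carrier (\<G>)" "H \<in> carrier (\<G>)"
    "\<And>j. j \<in> {1..p} \<Longrightarrow> gof F j = gof H j"
  shows "F = H"
  using fof_cong[of "gof F" "gof H"] assms by (simp add: G_cases(2))

lemma G_closed:
  "F \<in> carrier (\<G>) \<Longrightarrow> H \<in> carrier (\<G>) \<Longrightarrow> F \<otimes>\<^bsub>\<G>\<^esub> H \<in> carrier (\<G>)"
  "\<one>\<^bsub>\<G>\<^esub> \<in> carrier (\<G>)"
  by (simp_all add: G_mult G_one fof_in_G gok_gmul gok_zero G_cases(1))

lemma gof_one: "j \<in> {1..p} \<Longrightarrow> gof \<one>\<^bsub>\<G>\<^esub> j = 0"
  by (simp add: G_one gof_fof)

lemma gact_one: "gact (gof \<one>\<^bsub>\<G>\<^esub>) P = P"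
  by (rule gact_zero[OF gof_one])

lemma act_V0:
  assumes F: "F \<in> carrier (\<G>)"
  shows "P \<in> carrier (V0 n) \<Longrightarrow> G_subst p q B F P = coef (gact (gof F) (MSer P))"
    "P \<in> carrier (V0 n) \<Longrightarrow> G_subst p q B F P \<in> carrier (V0 n)"
    "P \<in> carrier (V0 n) \<Longrightarrow> Q \<in> carrier (V0 n) \<Longrightarrow>
      G_subst p q B F (P \<otimes>\<^bsub>V0 n\<^esub> Q) = G_subst p q B F P \<otimes>\<^bsub>V0 n\<^esub> G_subst p q B F Q"
proof -
  note g = G_cases(1)[OF F]
  show 1: "G_subst p q B F P = coef (gact (gof F) (MSer P))" if "P \<in> carrier (V0 n)" for P
    using that by (intro G_subst_eq[OF F]) (simp add: carrier_V0)
  show "P \<in> carrier (V0 n) \<Longrightarrow> G_subst p q B F P \<in> carrier (V0 n)" for P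
    by (simp add: 1) (simp add: carrier_V0 gact_in_vars[OF g] gact_simps(4)[OF g])
  assume P: "P \<in> carrier (V0 n)" and Q: "Q \<in> carrier (V0 n)"
  have "P \<otimes>\<^bsub>V0 n\<^esub> Q \<in> carrier (V0 n)"
    using P Q group.subgroup_self[OF group_V0] by (rule_tac subgroup.m_closed)
  moreover have "MSer (P \<otimes>\<^bsub>V0 n\<^esub> Q) = MSer P + MSer Q" by (simp add: V0_mult plus_mser_def)
  ultimately have "MSer (G_subst p q B F (P \<otimes>\<^bsub>V0 n\<^esub> Q)) = MSer (G_subst p q B F P \<otimes>\<^bsub>V0 n\<^esub> G_subst p q B F Q)"
    by (simp add: 1 P Q gact_simps[OF g]) (simp add: V0_mult plus_mser_def)
  then show "G_subst p q B F (P \<otimes>\<^bsub>V0 n\<^esub> Q) = G_subst p q B F P \<otimes>\<^bsub>V0 n\<^esub> G_subst p q B F Q"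
    by (rule MSer_eqI)
qed

lemma act_mult:
  assumes F: "F \<in> carrier (\<G>)" and H: "H \<in> carrier (\<G>)" and P: "P \<in> carrier (V0 n)"
  shows "G_subst p q B (F \<otimes>\<^bsub>\<G>\<^esub> H) P = G_subst p q B F (G_subst p q B H P)"
proof -
  have "gact (gof (F \<otimes>\<^bsub>\<G>\<^esub> H)) = gact (gmul (gof F) (gof H))"
    by (rule gact_cong) (rule gof_mult[OF F H])
  then show ?thesis
    using P act_V0(2)[OF H P] by (simp add: act_V0(1) F H G_closed gact_gmul G_cases(1))
qed

lemma act_one: "P \<in> carrier (V0 n) \<Longrightarrow> G_subst p q B \<one>\<^bsub>\<G>\<^esub> P = P"
  by (simp add: act_V0(1) G_closed gact_one)

end

section \<open>Coordinates on the semidirect product\<close>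

text \<open>Right inverses are what surjectivity of \<open>gact\<close> provides: the left factor
  fixes the substitution, and the right factor is solved for.\<close>

lemma group_right_inverseI:
  fixes G (structure)
  assumes "\<And>x y. x \<in> carrier G \<Longrightarrow> y \<in> carrier G \<Longrightarrow> x \<otimes> y \<in> carrier G" "\<one> \<in> carrier G"
    and assoc: "\<And>x y z. x \<in> carrier G \<Longrightarrow> y \<in> carrier G \<Longrightarrow> z \<in> carrier G \<Longrightarrow> x \<otimes> y \<otimes> z = x \<otimes> (y \<otimes> z)"
    and one: "\<And>x. x \<in> carrier G \<Longrightarrow> \<one> \<otimes> x = x" "\<And>x. x \<in> carrier G \<Longrightarrow> x \<otimes> \<one> = x"
    and right_inv: "\<And>x. x \<in> carrier G \<Longrightarrow> \<exists>y\<in>carrier G. x \<otimes> y = \<one>"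
  shows "group G"
proof (rule groupI)
  fix x assume x: "x \<in> carrier G"
  obtain y where y: "y \<in> carrier G" "x \<otimes> y = \<one>" using right_inv[OF x] by blast
  obtain z where z: "z \<in> carrier G" "y \<otimes> z = \<one>" using right_inv[OF y(1)] by blast
  have "x = z" using assoc[OF x y(1) z(1)] by (simp add: y z one x)
  then show "\<exists>y\<in>carrier G. y \<otimes> x = \<one>" using y z by blast
qed (use assms in auto)

locale semidirect = coefficient_matrix p q B for p q and B :: "nat \<Rightarrow> nat \<Rightarrow> 'k::field_char_0" +
  fixes r :: nat
begin

abbreviation "\<Gamma> \<equiv> semidirect_group p q r B"
abbreviation mult_\<Gamma> (infixl "\<bullet>" 70) where "z \<bullet> w \<equiv> z \<otimes>\<^bsub>\<Gamma>\<^esub> w"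
abbreviation "X \<equiv> {1..p + r} \<times> (expos n - {0})"

text \<open>Treats all \<open>p + r\<close> components alike: index \<open>i \<le> p\<close> stands
  for \<open>F\<^sub>i / x\<^sub>i - 1\<close>, index \<open>p + j\<close> for the additive
  component \<open>j\<close>.\<close>

definition ser :: "(nat \<Rightarrow> 'k mps) \<times> (nat \<Rightarrow> 'k mps) \<Rightarrow> nat \<Rightarrow> 'k mser" where
  "ser z i = (if i \<le> p then gof (snd z) i else MSer (fst z (i - p)))"

definition \<kappa> :: "(nat \<Rightarrow> 'k mps) \<times> (nat \<Rightarrow> 'k mps) \<Rightarrow> nat \<times> expo \<Rightarrow> 'k" where
  "\<kappa> z x = coef (ser z (fst x)) (snd x)"

text \<open>The factor that distinguishes multiplicative from additive components; with it
  \<open>ser_mult\<close> is one formula for both.\<close>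

definition wgt :: "(nat \<Rightarrow> 'k mser) \<Rightarrow> nat \<Rightarrow> 'k mser" where
  "wgt g i = (if i \<le> p then 1 + g i else 1)"

lemma carrier_Gam: "z \<in> carrier \<Gamma> \<longleftrightarrow> fst z \<in> (\<Pi>\<^sub>E j\<in>{1..r}. carrier (V0 n)) \<and> snd z \<in> carrier (\<G>)"
  by (cases z) (simp add: semidirect_group_def Let_def)

lemma mult_Gam: "z \<bullet> w = (\<lambda>j\<in>{1..r}. fst z j \<otimes>\<^bsub>V0 n\<^esub> G_subst p q B (snd z) (fst w j), snd z \<otimes>\<^bsub>\<G>\<^esub> snd w)"
  by (cases z, cases w) (auto simp: semidirect_group_def Let_def)

lemma one_Gam: "\<one>\<^bsub>\<Gamma>\<^esub> = (\<lambda>j\<in>{1..r}. \<one>\<^bsub>V0 n\<^esub>, \<one>\<^bsub>\<G>\<^esub>)"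
  by (simp add: semidirect_group_def Let_def)

lemma V0_closed: "P \<in> carrier (V0 n) \<Longrightarrow> Q \<in> carrier (V0 n) \<Longrightarrow> P \<otimes>\<^bsub>V0 n\<^esub> Q \<in> carrier (V0 n)"
  "\<one>\<^bsub>V0 n\<^esub> \<in> carrier (V0 n :: 'a::field mps monoid)"
  by (auto simp: carrier_V0 V0_mult V0_one in_vars_def)

lemma Gam_closed: "z \<in> carrier \<Gamma> \<Longrightarrow> w \<in> carrier \<Gamma> \<Longrightarrow> z \<bullet> w \<in> carrier \<Gamma>" "\<one>\<^bsub>\<Gamma>\<^esub> \<in> carrier \<Gamma>"
proof -
  show "z \<bullet> w \<in> carrier \<Gamma>" if z: "z \<in> carrier \<Gamma>" and w: "w \<in> carrier \<Gamma>"
  proof -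
    have "fst z j \<otimes>\<^bsub>V0 n\<^esub> G_subst p q B (snd z) (fst w j) \<in> carrier (V0 n)" if "j \<in> {1..r}" for j
    proof (intro V0_closed act_V0(2))
      show "fst z j \<in> carrier (V0 n)" "fst w j \<in> carrier (V0 n)" "snd z \<in> carrier (\<G>)"
        using z w that unfolding carrier_Gam by (blast intro: PiE_mem)+
    qed
    then show ?thesis using z w unfolding carrier_Gam mult_Gam by (simp add: G_closed)
  qed
  show "\<one>\<^bsub>\<Gamma>\<^esub> \<in> carrier \<Gamma>" unfolding carrier_Gam one_Gam by (simp add: G_closed V0_closed)
qed

lemma ser_in:
  assumes z: "z \<in> carrier \<Gamma>" and i: "i \<in> {1..p + r}"
  shows "in_vars n (ser z i)" "coef (ser z i) 0 = 0"
proof -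
  have "in_vars n (ser z i) \<and> coef (ser z i) 0 = 0"
  proof (cases "i \<le> p")
    case True
    have "gok (gof (snd z))" using z by (auto simp: carrier_Gam G_cases(1))
    then show ?thesis using True i by (auto simp: ser_def gok_def)
  next
    case False
    then have "i - p \<in> {1..r}" using i by auto
    then have "fst z (i - p) \<in> carrier (V0 n)" using z unfolding carrier_Gam by (blast intro: PiE_mem)
    then show ?thesis using False by (simp add: ser_def carrier_V0)
  qed
  then show "in_vars n (ser z i)" "coef (ser z i) 0 = 0" by auto
qed

lemma gok_ser: "z \<in> carrier \<Gamma> \<Longrightarrow> gok (ser z)"
  by (auto simp: gok_def ser_in)

lemma gact_ser: "gact (gof (snd z)) = gact (ser z)"
  by (rule gact_cong) (simp add: ser_def)

lemma ser_mult:
  assumes z: "z \<in> carrier \<Gamma>" and w: "w \<in> carrier \<Gamma>" and i: "i \<in> {1..p + r}"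
  shows "ser (z \<bullet> w) i = ser z i + wgt (ser z) i * gact (ser z) (ser w i)"
proof (cases "i \<le> p")
  case True
  then have "gof (snd z \<otimes>\<^bsub>\<G>\<^esub> snd w) i = gmul (gof (snd z)) (gof (snd w)) i"
    using z w i by (intro gof_mult) (auto simp: carrier_Gam)
  then show ?thesis using True by (simp add: ser_def[of _ i] mult_Gam gmul_def gact_ser wgt_def)
next
  case False
  then have j: "i - p \<in> {1..r}" using i by auto
  have "fst w (i - p) \<in> carrier (V0 n)" using w j unfolding carrier_Gam by (blast intro: PiE_mem)
  then have "G_subst p q B (snd z) (fst w (i - p)) = coef (gact (ser z) (MSer (fst w (i - p))))"
    using act_V0(1)[of "snd z" "fst w (i - p)"] z by (simp add: carrier_Gam gact_ser)
  then show ?thesis using False j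
    by (simp add: ser_def[of _ i] mult_Gam wgt_def V0_mult plus_mser_def del: One_nat_def)
qed

lemma ser_one: "i \<in> {1..p + r} \<Longrightarrow> ser \<one>\<^bsub>\<Gamma>\<^esub> i = 0"
  by (auto simp: ser_def one_Gam gof_one V0_one zero_mser_def simp del: One_nat_def)

lemma ser_surj:
  assumes "\<And>i. i \<in> {1..p + r} \<Longrightarrow> in_vars n (c i) \<and> coef (c i) 0 = 0"
  obtains z where "z \<in> carrier \<Gamma>" "\<And>i. i \<in> {1..p + r} \<Longrightarrow> ser z i = c i"
proof
  let ?z = "(\<lambda>j\<in>{1..r}. coef (c (j + p)), fof c)"
  have "gok c" using assms by (auto simp: gok_def)
  moreover have "coef (c (j + p)) \<in> carrier (V0 n)" if "j \<in> {1..r}" for j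
    using assms[of "j + p"] that by (simp add: carrier_V0)
  ultimately show "?z \<in> carrier \<Gamma>" by (simp add: carrier_Gam fof_in_G)
  fix i assume "i \<in> {1..p + r}"
  then show "ser ?z i = c i" by (auto simp: ser_def gof_fof simp del: One_nat_def)
qed

lemma ser_inj:
  assumes z: "z \<in> carrier \<Gamma>" and w: "w \<in> carrier \<Gamma>" and eq: "\<And>i. i \<in> {1..p + r} \<Longrightarrow> ser z i = ser w i"
  shows "z = w"
proof (rule prod_eqI)
  show "snd z = snd w"
  proof (rule G_eqI)
    fix j assume "j \<in> {1..p}"
    then show "gof (snd z) j = gof (snd w) j" using eq[of j] by (simp add: ser_def)
  qed (use z w in \<open>auto simp: carrier_Gam\<close>)
  show "fst z = fst w"
  proof (rule PiE_ext)
    show "fst z \<in> (\<Pi>\<^sub>E j\<in>{1..r}. carrier (V0 n))" "fst w \<in> (\<Pi>\<^sub>E j\<in>{1..r}. carrier (V0 n))"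
      using z w by (auto simp only: carrier_Gam)
    fix j assume "j \<in> {1..r}"
    then have "MSer (fst z j) = MSer (fst w j)" using eq[of "j + p"] by (simp add: ser_def)
    then show "fst z j = fst w j" by (rule MSer_eqI)
  qed
qed

lemma gact_0: "gok g \<Longrightarrow> gact g 0 = 0"
  using gact_simps(1)[of g 0 0] by simp

lemma group_Gam: "group \<Gamma>"
proof (rule group_right_inverseI)
  fix x y z assume c: "x \<in> carrier \<Gamma>" "y \<in> carrier \<Gamma>" "z \<in> carrier \<Gamma>"
  note xy = Gam_closed(1)[OF c(1,2)] and yz = Gam_closed(1)[OF c(2,3)]
  have g: "gact (ser (x \<bullet> y)) P = gact (ser x) (gact (ser y) P)" for P
  proof -
    have "gact (ser (x \<bullet> y)) = gact (gmul (ser x) (ser y))"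
      by (rule gact_cong) (simp add: ser_mult[OF c(1,2)] gmul_def wgt_def)
    then show ?thesis by (simp add: gact_gmul gok_ser c)
  qed
  \<comment> \<open>The factors \<open>wgt\<close> satisfy the same cocycle identity as the
    multipliers, which is what associativity comes down to.\<close>
  have w: "wgt (ser (x \<bullet> y)) i = wgt (ser x) i * gact (ser x) (wgt (ser y) i)" if "i \<in> {1..p + r}" for i
    using that by (simp add: wgt_def ser_mult[OF c(1,2)] gact_simps[OF gok_ser[OF c(1)]] algebra_simps del: One_nat_def)
  show "x \<bullet> y \<bullet> z = x \<bullet> (y \<bullet> z)"
  proof (rule ser_inj)
    fix i assume i: "i \<in> {1..p + r}"
    show "ser (x \<bullet> y \<bullet> z) i = ser (x \<bullet> (y \<bullet> z)) i"
      by (simp only: ser_mult[OF xy c(3) i] ser_mult[OF c(1) yz i] ser_mult[OF c(1,2) i] ser_mult[OF c(2,3) i]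
          g w[OF i] gact_simps[OF gok_ser[OF c(1)]] distrib_left mult.assoc add.assoc)
  qed (simp_all add: Gam_closed c)
next
  fix x assume c: "x \<in> carrier \<Gamma>"
  show "\<one>\<^bsub>\<Gamma>\<^esub> \<bullet> x = x"
  proof (rule ser_inj)
    fix i assume i: "i \<in> {1..p + r}"
    have "gact (ser \<one>\<^bsub>\<Gamma>\<^esub>) P = P" for P by (rule gact_zero) (simp add: ser_one)
    then show "ser (\<one>\<^bsub>\<Gamma>\<^esub> \<bullet> x) i = ser x i"
      by (simp only: ser_mult[OF Gam_closed(2) c i] wgt_def ser_one[OF i]) simp
  qed (simp_all add: Gam_closed c)
  show "x \<bullet> \<one>\<^bsub>\<Gamma>\<^esub> = x"
  proof (rule ser_inj)
    fix i assume i: "i \<in> {1..p + r}"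
    show "ser (x \<bullet> \<one>\<^bsub>\<Gamma>\<^esub>) i = ser x i"
      by (simp only: ser_mult[OF c Gam_closed(2) i] ser_one[OF i] gact_0[OF gok_ser[OF c]]) simp
  qed (simp_all add: Gam_closed c)
  note g = gok_ser[OF c]
  \<comment> \<open>By \<open>ser_mult\<close>, a right inverse must be sent by
    \<open>gact (ser x)\<close> to the inverse of \<open>1 + ser x i\<close> minus 1 in the
    multiplicative components, and to \<open>- ser x i\<close> in the additive ones.\<close>
  let ?c = "\<lambda>i. if i \<le> p then mpow (ser x i) (-1) - 1 else - ser x i"
  have "\<exists>P. in_vars n P \<and> coef P 0 = 0 \<and> gact (ser x) P = ?c i" if i: "i \<in> {1..p + r}" for i
  proof -
    have "in_vars n (?c i)" by (simp add: in_vars_closed in_vars_mpow ser_in[OF c i])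
    then obtain P where "in_vars n P" "gact (ser x) P = ?c i" "coef P 0 = coef (?c i) 0"
      by (rule gact_surj[OF g])
    then show ?thesis using ser_in(2)[OF c i] by (intro exI[of _ P]) simp
  qed
  then have "\<exists>k. \<forall>i\<in>{1..p + r}. in_vars n (k i) \<and> coef (k i) 0 = 0 \<and> gact (ser x) (k i) = ?c i"
    by (intro bchoice ballI)
  then obtain k where k: "\<And>i. i \<in> {1..p + r} \<Longrightarrow> in_vars n (k i) \<and> coef (k i) 0 = 0"
    "\<And>i. i \<in> {1..p + r} \<Longrightarrow> gact (ser x) (k i) = ?c i"
    by blast
  obtain y where y: "y \<in> carrier \<Gamma>" "\<And>i. i \<in> {1..p + r} \<Longrightarrow> ser y i = k i"
    using ser_surj[of k] k(1) by blast
  have "x \<bullet> y = \<one>\<^bsub>\<Gamma>\<^esub>"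
  proof (rule ser_inj)
    fix i assume i: "i \<in> {1..p + r}"
    show "ser (x \<bullet> y) i = ser \<one>\<^bsub>\<Gamma>\<^esub> i"
      unfolding ser_mult[OF c y(1) i] ser_one[OF i] y(2)[OF i] k(2)[OF i]
      using mpow_inverse[OF ser_in(2)[OF c i]] by (simp add: wgt_def)
  qed (simp_all add: Gam_closed c y)
  then show "\<exists>y\<in>carrier \<Gamma>. x \<bullet> y = \<one>\<^bsub>\<Gamma>\<^esub>" using y(1) by blast
qed (simp_all add: Gam_closed)

end

section \<open>The group of substitutions and its action by automorphisms\<close>

context coefficient_matrix
begin

text \<open>The case \<open>r = 0\<close> of \<open>group_Gam\<close>: the first component is then
  the only element of the empty product, the function that is \<open>undefined\<close>
  everywhere.\<close>

lemma group_G: "group \<G>"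
proof -
  interpret S: semidirect p q B 0 .
  interpret S: group S.\<Gamma> by (rule S.group_Gam)
  define e where "e F = (\<lambda>_ :: nat. undefined :: 'k mps, F)" for F :: "nat \<Rightarrow> 'k mps"
  have c: "z \<in> carrier S.\<Gamma> \<longleftrightarrow> z = e (snd z) \<and> snd z \<in> carrier \<G>" for z
    by (cases z) (auto simp: S.carrier_Gam e_def)
  have e: "e F \<in> carrier S.\<Gamma> \<longleftrightarrow> F \<in> carrier \<G>" for F
    by (simp add: c) (simp add: e_def)
  have m: "e F \<otimes>\<^bsub>S.\<Gamma>\<^esub> e H = e (F \<otimes>\<^bsub>\<G>\<^esub> H)" "\<one>\<^bsub>S.\<Gamma>\<^esub> = e \<one>\<^bsub>\<G>\<^esub>" for F H
    by (auto simp: S.mult_Gam S.one_Gam e_def)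
  have inj: "e F = e H \<longleftrightarrow> F = H" for F H by (simp add: e_def)
  show ?thesis
  proof (rule groupI)
    fix x y z assume x: "x \<in> carrier \<G>" and "y \<in> carrier \<G>" "z \<in> carrier \<G>"
    then show "x \<otimes>\<^bsub>\<G>\<^esub> y \<otimes>\<^bsub>\<G>\<^esub> z = x \<otimes>\<^bsub>\<G>\<^esub> (y \<otimes>\<^bsub>\<G>\<^esub> z)"
      using S.m_assoc[of "e x" "e y" "e z"] by (simp add: e m inj)
  next
    fix x assume x: "x \<in> carrier \<G>"
    then show "\<one>\<^bsub>\<G>\<^esub> \<otimes>\<^bsub>\<G>\<^esub> x = x" using S.l_one[of "e x"] by (simp add: e m inj)
    obtain y where "y \<in> carrier S.\<Gamma>" "y \<otimes>\<^bsub>S.\<Gamma>\<^esub> e x = \<one>\<^bsub>S.\<Gamma>\<^esub>" using S.l_inv_ex[of "e x"] e[of x] x by blast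
    then have "e (snd y) \<otimes>\<^bsub>S.\<Gamma>\<^esub> e x = \<one>\<^bsub>S.\<Gamma>\<^esub>" "snd y \<in> carrier \<G>" unfolding c by simp_all
    then show "\<exists>y\<in>carrier \<G>. y \<otimes>\<^bsub>\<G>\<^esub> x = \<one>\<^bsub>\<G>\<^esub>" by (auto simp: m inj)
  qed (simp_all add: G_closed)
qed

text \<open>Bijectivity comes from the action of the inverse element, and \<open>act_mult\<close>
  matches the product of the group with composition in \<open>AutoGroup\<close>.\<close>

lemma action_hom:
  "(\<lambda>F\<in>carrier (\<G>). \<lambda>P\<in>carrier (V0 n). G_subst p q B F P)
    \<in> hom (\<G>) (AutoGroup (V0 n))"
proof -
  interpret G: group "\<G>" by (rule group_G)
  let ?V = "carrier (V0 n :: 'k mps monoid)"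
  let ?a = "\<lambda>F. \<lambda>P\<in>?V. G_subst p q B F P"
  have bij: "?a F \<in> Bij ?V" if F: "F \<in> carrier (\<G>)" for F
  proof -
    have "bij_betw (G_subst p q B F) ?V ?V"
    proof (rule bij_betw_byWitness[where f' = "G_subst p q B (inv\<^bsub>\<G>\<^esub> F)"])
      show "\<forall>P\<in>?V. G_subst p q B (inv\<^bsub>\<G>\<^esub> F) (G_subst p q B F P) = P"
        using F by (simp add: act_mult[symmetric] act_one)
      show "\<forall>P\<in>?V. G_subst p q B F (G_subst p q B (inv\<^bsub>\<G>\<^esub> F) P) = P"
        using F by (simp add: act_mult[symmetric] act_one)
    qed (use F in \<open>auto intro: act_V0(2)\<close>)
    then show ?thesis by (simp add: Bij_def)
  qed
  have aut: "?a F \<in> auto (V0 n)" if F: "F \<in> carrier (\<G>)" for F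
  proof -
    have "?a F \<in> hom (V0 n) (V0 n)"
    proof (rule homI)
      fix P Q assume c: "P \<in> ?V" "Q \<in> ?V"
      then have "P \<otimes>\<^bsub>V0 n\<^esub> Q \<in> ?V"
        using group.subgroup_self[OF group_V0] by (rule_tac subgroup.m_closed)
      then show "?a F (P \<otimes>\<^bsub>V0 n\<^esub> Q) = ?a F P \<otimes>\<^bsub>V0 n\<^esub> ?a F Q" using c by (simp add: act_V0(3) F)
    qed (simp add: act_V0(2) F)
    then show ?thesis using bij[OF F] by (simp add: auto_def)
  qed
  show ?thesis
  proof (rule homI)
    fix F H assume F: "F \<in> carrier (\<G>)" and H: "H \<in> carrier (\<G>)"
    show "(\<lambda>F\<in>carrier (\<G>). ?a F) (F \<otimes>\<^bsub>\<G>\<^esub> H)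
      = (\<lambda>F\<in>carrier (\<G>). ?a F) F \<otimes>\<^bsub>AutoGroup (V0 n)\<^esub> (\<lambda>F\<in>carrier (\<G>). ?a F) H"
      using bij F H by (auto simp: AutoGroup_def BijGroup_def compose_def act_mult act_V0(2) intro!: restrict_ext)
  qed (simp add: AutoGroup_def aut)
qed

end

section \<open>Polynomial group law in the coordinates\<close>

context semidirect
begin

abbreviation Hk :: "expo \<Rightarrow> (nat \<times> expo, 'k) mpoly set" where "Hk \<equiv> hcomp X snd"

text \<open>The degree required of a coefficient is its own exponent. As exponents add in products
  of series, the operations entering the group law preserve this property; this is the origin of the
  grading.\<close>

definition polys :: "((nat \<Rightarrow> 'k mps) \<times> (nat \<Rightarrow> 'k mps) \<Rightarrow> 'k mser) \<Rightarrow> bool" where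
  "polys f \<longleftrightarrow> (\<forall>\<beta>. \<exists>Q\<in>Hk \<beta>. \<forall>z\<in>carrier \<Gamma>. coef (f z) \<beta> = peval (\<kappa> z) Q)"

lemma hcomp_sum: "(\<And>i. i \<in> S \<Longrightarrow> f i \<in> hcomp Y d \<alpha>) \<Longrightarrow> sum f S \<in> hcomp Y d \<alpha>"
  by (induction S rule: infinite_finite_induct) (auto intro: hcomp_closed)

lemma peval_sum: "peval g (sum f S) = (\<Sum>i\<in>S. peval g (f i))"
  by (induction S rule: infinite_finite_induct) (auto simp: peval_add)

lemma polys_1: "polys (\<lambda>z. 1)"
  unfolding polys_def
proof
  fix \<beta> show "\<exists>Q\<in>Hk \<beta>. \<forall>z\<in>carrier \<Gamma>. coef 1 \<beta> = peval (\<kappa> z) Q"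
    by (cases "\<beta> = 0") (auto intro: bexI[of _ 1] bexI[of _ 0] hcomp_closed)
qed

lemma polys_add: "polys f \<Longrightarrow> polys g \<Longrightarrow> polys (\<lambda>z. f z + g z)"
  unfolding polys_def
proof
  fix \<beta>
  assume "\<forall>\<beta>. \<exists>Q\<in>Hk \<beta>. \<forall>z\<in>carrier \<Gamma>. coef (f z) \<beta> = peval (\<kappa> z) Q" "\<forall>\<beta>. \<exists>Q\<in>Hk \<beta>. \<forall>z\<in>carrier \<Gamma>. coef (g z) \<beta> = peval (\<kappa> z) Q"
  then obtain P Q where "P \<in> Hk \<beta>" "Q \<in> Hk \<beta>" "\<forall>z\<in>carrier \<Gamma>. coef (f z) \<beta> = peval (\<kappa> z) P" "\<forall>z\<in>carrier \<Gamma>. coef (g z) \<beta> = peval (\<kappa> z) Q"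
    by blast
  then show "\<exists>Q\<in>Hk \<beta>. \<forall>z\<in>carrier \<Gamma>. coef (f z + g z) \<beta> = peval (\<kappa> z) Q"
    by (intro bexI[of _ "P + Q"]) (auto simp: peval_add hcomp_closed)
qed

lemma polys_obtain:
  assumes "polys f"
  obtains Q where "\<And>\<beta>. Q \<beta> \<in> Hk \<beta>" "\<And>z \<beta>. z \<in> carrier \<Gamma> \<Longrightarrow> coef (f z) \<beta> = peval (\<kappa> z) (Q \<beta>)"
  using bchoice[of UNIV "\<lambda>\<beta> Q. Q \<in> Hk \<beta> \<and> (\<forall>z\<in>carrier \<Gamma>. coef (f z) \<beta> = peval (\<kappa> z) Q)"] assms
  unfolding polys_def by blast

lemma polys_mult:
  assumes "polys f" "polys g"
  shows "polys (\<lambda>z. f z * g z)"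
proof -
  obtain P where P: "\<And>\<beta>. P \<beta> \<in> Hk \<beta>" "\<And>z \<beta>. z \<in> carrier \<Gamma> \<Longrightarrow> coef (f z) \<beta> = peval (\<kappa> z) (P \<beta>)"
    using polys_obtain[OF assms(1)] by blast
  obtain Q where Q: "\<And>\<beta>. Q \<beta> \<in> Hk \<beta>" "\<And>z \<beta>. z \<in> carrier \<Gamma> \<Longrightarrow> coef (g z) \<beta> = peval (\<kappa> z) (Q \<beta>)"
    using polys_obtain[OF assms(2)] by blast
  show ?thesis
    unfolding polys_def
  proof
    fix \<gamma>
    have "(\<Sum>c\<in>dec \<gamma>. P (fst c) * Q (snd c)) \<in> Hk \<gamma>"
      by (rule hcomp_sum) (use hcomp_closed(2)[OF P(1) Q(1)] in auto)
    moreover have "coef (f z * g z) \<gamma> = peval (\<kappa> z) (\<Sum>c\<in>dec \<gamma>. P (fst c) * Q (snd c))" if "z \<in> carrier \<Gamma>" for z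
      unfolding coef_mult peval_sum peval_mult by (simp add: P(2) Q(2) that split_def)
    ultimately show "\<exists>Q\<in>Hk \<gamma>. \<forall>z\<in>carrier \<Gamma>. coef (f z * g z) \<gamma> = peval (\<kappa> z) Q" by blast
  qed
qed

lemma polys_power: "polys f \<Longrightarrow> polys (\<lambda>z. f z ^ k)"
  by (induction k) (auto intro: polys_1 polys_mult)

lemma polys_prod: "(\<And>i. i \<in> S \<Longrightarrow> polys (f i)) \<Longrightarrow> polys (\<lambda>z. \<Prod>i\<in>S. f i z)"
  by (induction S rule: infinite_finite_induct) (auto intro: polys_1 polys_mult)

lemma polys_mpow:
  assumes "polys f"
  shows "polys (\<lambda>z. mpow (f z) c)"
  unfolding polys_def
proof
  fix \<gamma> :: expo
  have "\<exists>Q\<in>Hk \<gamma>. \<forall>z\<in>carrier \<Gamma>. coef (f z ^ k) \<gamma> = peval (\<kappa> z) Q" for k :: nat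
    using polys_power[OF assms, of k] unfolding polys_def by blast
  then obtain Q where Q: "\<And>k. Q k \<in> Hk \<gamma>" "\<And>z k. z \<in> carrier \<Gamma> \<Longrightarrow> coef (f z ^ k) \<gamma> = peval (\<kappa> z) (Q k)"
    by metis
  let ?P = "\<Sum>k\<le>mon_size \<gamma>. scale (c gchoose k) (Q k)"
  have "?P \<in> Hk \<gamma>" by (intro hcomp_sum hcomp_closed(3) Q)
  moreover have "coef (mpow (f z) c) \<gamma> = peval (\<kappa> z) ?P" if "z \<in> carrier \<Gamma>" for z
    unfolding peval_sum mpow_def by (simp add: Q(2) that)
  ultimately show "\<exists>Q\<in>Hk \<gamma>. \<forall>z\<in>carrier \<Gamma>. coef (mpow (f z) c) \<gamma> = peval (\<kappa> z) Q" by blast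
qed

lemma polys_ser:
  assumes i: "i \<in> {1..p + r}"
  shows "polys (\<lambda>z. ser z i)"
  unfolding polys_def
proof
  fix \<gamma>
  show "\<exists>Q\<in>Hk \<gamma>. \<forall>z\<in>carrier \<Gamma>. coef (ser z i) \<gamma> = peval (\<kappa> z) Q"
  proof (cases "\<gamma> \<in> expos n - {0}")
    case True
    then have "var (i, \<gamma>) \<in> Hk (snd (i, \<gamma>))" using i by (intro hcomp_closed(7)) auto
    then show ?thesis by (intro bexI[of _ "var (i, \<gamma>)"]) (auto simp: \<kappa>_def)
  next
    case False
    then have "coef (ser z i) \<gamma> = 0" if "z \<in> carrier \<Gamma>" for z
      using ser_in[OF that i] in_vars_coef by (cases "\<gamma> = 0") auto
    then show ?thesis by (intro bexI[of _ 0]) (auto simp: hcomp_closed)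
  qed
qed

lemma polys_coefficient: "i \<in> {1..p + r} \<Longrightarrow> polys (\<lambda>z. wgt (ser z) i * umul (ser z) \<alpha>)"
  unfolding umul_def wgt_def
  by (cases "i \<le> p"; simp; intro polys_mult polys_prod polys_mpow polys_add polys_1 polys_ser; simp)

text \<open>The polynomial in the left factor that multiplies the coefficient at \<alpha> of the
  right factor, in the coefficient at \<open>\<alpha> + \<beta>\<close> of their product.\<close>

definition wpoly :: "nat \<Rightarrow> expo \<Rightarrow> expo \<Rightarrow> (nat \<times> expo, 'k) mpoly" where
  "wpoly i \<alpha> \<beta> = (SOME Q. Q \<in> Hk \<beta> \<and> (\<forall>z\<in>carrier \<Gamma>. coef (wgt (ser z) i * umul (ser z) \<alpha>) \<beta> = peval (\<kappa> z) Q))"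

lemma wpoly:
  assumes i: "i \<in> {1..p + r}"
  shows "wpoly i \<alpha> \<beta> \<in> Hk \<beta>"
    "z \<in> carrier \<Gamma> \<Longrightarrow> peval (\<kappa> z) (wpoly i \<alpha> \<beta>) = coef (wgt (ser z) i * umul (ser z) \<alpha>) \<beta>"
proof -
  have "\<exists>Q. Q \<in> Hk \<beta> \<and> (\<forall>z\<in>carrier \<Gamma>. coef (wgt (ser z) i * umul (ser z) \<alpha>) \<beta> = peval (\<kappa> z) Q)"
    using polys_coefficient[OF i] unfolding polys_def by blast
  note Q = someI_ex[OF this, folded wpoly_def]
  show "wpoly i \<alpha> \<beta> \<in> Hk \<beta>" using Q by blast
  show "z \<in> carrier \<Gamma> \<Longrightarrow> peval (\<kappa> z) (wpoly i \<alpha> \<beta>) = coef (wgt (ser z) i * umul (ser z) \<alpha>) \<beta>" using Q by simp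
qed

lemma coef_ser_mult:
  assumes z: "z \<in> carrier \<Gamma>" and w: "w \<in> carrier \<Gamma>" and i: "i \<in> {1..p + r}"
  shows "coef (ser (z \<bullet> w) i) \<gamma>
    = coef (ser z i) \<gamma> + (\<Sum>(\<alpha>, \<beta>)\<in>dec \<gamma>. coef (ser w i) \<alpha> * peval (\<kappa> z) (wpoly i \<alpha> \<beta>))"
  unfolding ser_mult[OF assms] coef_simps gact_def coef_mult_twist wpoly(2)[OF i z] ..

text \<open>The pair \<open>(0, \<gamma>)\<close> is left out: it would contribute the constant term
  of the right factor, which is zero, and \<open>(i, 0)\<close> is not a coordinate.\<close>

definition dlist :: "expo \<Rightarrow> (expo \<times> expo) list" where
  "dlist \<gamma> = (SOME xs. set xs = dec \<gamma> - {(0, \<gamma>)} \<and> distinct xs)"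

lemma dlist: "set (dlist \<gamma>) = dec \<gamma> - {(0, \<gamma>)}" "distinct (dlist \<gamma>)"
  using someI_ex[OF finite_distinct_list, of "dec \<gamma> - {(0, \<gamma>)}", folded dlist_def] finite_dec[of \<gamma>] by auto

lemma sum_dlist: "(\<Sum>c\<leftarrow>dlist \<gamma>. f c) = (\<Sum>c\<in>dec \<gamma> - {(0, \<gamma>)}. f c)"
  using sum.distinct_set_conv_list[OF dlist(2), of f \<gamma>] by (simp add: dlist)

text \<open>The coproduct of the coordinate \<open>(i, \<gamma>)\<close> as a list of pairs. The
  right legs are 1 or variables because the action on the right factor is linear.\<close>

definition clist :: "nat \<Rightarrow> expo \<Rightarrow> ((nat \<times> expo, 'k) mpoly \<times> (nat \<times> expo, 'k) mpoly) list" where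
  "clist i \<gamma> = (var (i, \<gamma>), 1) # map (\<lambda>c. (wpoly i (fst c) (snd c), var (i, fst c))) (dlist \<gamma>)"

lemma clist_mult:
  assumes z: "z \<in> carrier \<Gamma>" and w: "w \<in> carrier \<Gamma>" and i: "i \<in> {1..p + r}"
  shows "\<kappa> (z \<bullet> w) (i, \<gamma>) = (\<Sum>(a, b)\<leftarrow>clist i \<gamma>. peval (\<kappa> z) a * peval (\<kappa> w) b)"
proof -
  have "(\<Sum>(a, b)\<leftarrow>clist i \<gamma>. peval (\<kappa> z) a * peval (\<kappa> w) b)
    = coef (ser z i) \<gamma> + (\<Sum>c\<in>dec \<gamma> - {(0, \<gamma>)}. coef (ser w i) (fst c) * peval (\<kappa> z) (wpoly i (fst c) (snd c)))"
    by (simp add: clist_def comp_def sum_dlist \<kappa>_def[of _ "(i, _)"] mult.commute)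
  also have "(\<Sum>c\<in>dec \<gamma> - {(0, \<gamma>)}. coef (ser w i) (fst c) * peval (\<kappa> z) (wpoly i (fst c) (snd c)))
    = (\<Sum>c\<in>dec \<gamma>. coef (ser w i) (fst c) * peval (\<kappa> z) (wpoly i (fst c) (snd c)))"
    using finite_dec[of \<gamma>] ser_in(2)[OF w i] by (intro sum.mono_neutral_left) auto
  finally show ?thesis by (simp add: \<kappa>_def[of _ "(i, _)"] coef_ser_mult[OF assms] split_def)
qed

lemma clist_in:
  assumes "(i, \<gamma>) \<in> X" "(a, b) \<in> set (clist i \<gamma>)"
  shows "\<exists>\<alpha> \<beta>. \<alpha> + \<beta> = \<gamma> \<and> a \<in> Hk \<alpha> \<and> b \<in> Hk \<beta>"
proof -
  have i: "i \<in> {1..p + r}" and \<gamma>: "\<gamma> \<in> expos n" using assms(1) by auto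
  consider "a = var (i, \<gamma>)" "b = 1" | \<alpha> \<beta> where "(\<alpha>, \<beta>) \<in> dec \<gamma> - {(0, \<gamma>)}" "a = wpoly i \<alpha> \<beta>" "b = var (i, \<alpha>)"
  proof -
    have "(a, b) = (var (i, \<gamma>), 1) \<or> (\<exists>c\<in>dec \<gamma> - {(0, \<gamma>)}. (a, b) = (wpoly i (fst c) (snd c), var (i, fst c)))"
      using assms(2) unfolding clist_def dlist(1)[symmetric] by auto
    then show thesis
    proof
      assume "(a, b) = (var (i, \<gamma>), 1)"
      then show thesis using that(1) by simp
    next
      assume "\<exists>c\<in>dec \<gamma> - {(0, \<gamma>)}. (a, b) = (wpoly i (fst c) (snd c), var (i, fst c))"
      then obtain c where "c \<in> dec \<gamma> - {(0, \<gamma>)}" "(a, b) = (wpoly i (fst c) (snd c), var (i, fst c))" by blast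
      then show thesis using that(2)[of "fst c" "snd c"] by (simp add: split_def)
    qed
  qed
  then show ?thesis
  proof cases
    case 1
    then show ?thesis using hcomp_closed(7)[OF assms(1), of snd]
      by (intro exI[of _ \<gamma>] exI[of _ 0]) (simp add: hcomp_closed)
  next
    case 2
    then have \<alpha>: "(i, \<alpha>) \<in> X" using i \<gamma> expos_closed(4)[of \<alpha> \<beta> n] by auto
    show ?thesis using hcomp_closed(7)[OF \<alpha>, of snd] wpoly(1)[OF i, of \<alpha> \<beta>] 2
      by (intro exI[of _ \<beta>] exI[of _ \<alpha>]) (auto simp: add.commute)
  qed
qed

text \<open>In the equation for the coefficient at \<gamma> of the product of \<open>z\<close> and
  its inverse, the pair \<open>(\<gamma>, 0)\<close> carries the wanted coefficient of the inverse
  with factor 1, and the other pairs involve only exponents of smaller size. Homogeneity passes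
  through this recursion.\<close>

lemma polys_inv:
  assumes i: "i \<in> {1..p + r}"
  shows "\<exists>Q\<in>Hk \<gamma>. \<forall>z\<in>carrier \<Gamma>. coef (ser (inv\<^bsub>\<Gamma>\<^esub> z) i) \<gamma> = peval (\<kappa> z) Q"
proof (induction "mon_size \<gamma>" arbitrary: \<gamma> rule: less_induct)
  case less
  interpret G: group \<Gamma> by (rule group_Gam)
  obtain R where R: "R \<in> Hk \<gamma>" "\<And>z. z \<in> carrier \<Gamma> \<Longrightarrow> coef (ser z i) \<gamma> = peval (\<kappa> z) R"
    using polys_ser[OF i] unfolding polys_def by blast
  have "\<exists>Q\<in>Hk \<alpha>. \<forall>z\<in>carrier \<Gamma>. coef (ser (inv\<^bsub>\<Gamma>\<^esub> z) i) \<alpha> = peval (\<kappa> z) Q"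
    if "(\<alpha>, \<beta>) \<in> dec \<gamma> - {(\<gamma>, 0)}" for \<alpha> \<beta>
  proof (rule less)
    have "\<beta> \<noteq> 0" using that by auto
    then show "mon_size \<alpha> < mon_size \<gamma>" using mon_size_less[of \<beta> \<alpha>] that by (auto simp: add.commute)
  qed
  then have "\<forall>c\<in>dec \<gamma> - {(\<gamma>, 0)}. \<exists>Q. Q \<in> Hk (fst c) \<and> (\<forall>z\<in>carrier \<Gamma>. coef (ser (inv\<^bsub>\<Gamma>\<^esub> z) i) (fst c) = peval (\<kappa> z) Q)"
    by fastforce
  from bchoice[OF this] obtain Q where Q: "\<And>c. c \<in> dec \<gamma> - {(\<gamma>, 0)} \<Longrightarrow> Q c \<in> Hk (fst c)"
    "\<And>c z. c \<in> dec \<gamma> - {(\<gamma>, 0)} \<Longrightarrow> z \<in> carrier \<Gamma> \<Longrightarrow> coef (ser (inv\<^bsub>\<Gamma>\<^esub> z) i) (fst c) = peval (\<kappa> z) (Q c)"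
    by blast
  let ?S = "\<Sum>c\<in>dec \<gamma> - {(\<gamma>, 0)}. Q c * wpoly i (fst c) (snd c)"
  let ?P = "scale (- 1) (R + ?S)"
  have "?S \<in> Hk \<gamma>"
  proof (rule hcomp_sum)
    fix c assume c: "c \<in> dec \<gamma> - {(\<gamma>, 0)}"
    then show "Q c * wpoly i (fst c) (snd c) \<in> Hk \<gamma>"
      using hcomp_closed(2)[OF Q(1)[OF c] wpoly(1)[OF i, of "fst c" "snd c"]] by auto
  qed
  then have "?P \<in> Hk \<gamma>" by (intro hcomp_closed R)
  moreover have "coef (ser (inv\<^bsub>\<Gamma>\<^esub> z) i) \<gamma> = peval (\<kappa> z) ?P" if z: "z \<in> carrier \<Gamma>" for z
  proof -
    let ?w = "inv\<^bsub>\<Gamma>\<^esub> z"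
    let ?f = "\<lambda>c. coef (ser ?w i) (fst c) * peval (\<kappa> z) (wpoly i (fst c) (snd c))"
    have "0 = coef (ser (z \<bullet> ?w) i) \<gamma>" using z i by (simp add: G.r_inv ser_one)
    also have "\<dots> = coef (ser z i) \<gamma> + (\<Sum>c\<in>dec \<gamma>. ?f c)"
      using coef_ser_mult[OF z G.inv_closed[OF z] i, of \<gamma>] by (simp only: split_def)
    also have "(\<Sum>c\<in>dec \<gamma>. ?f c) = ?f (\<gamma>, 0) + (\<Sum>c\<in>dec \<gamma> - {(\<gamma>, 0)}. ?f c)"
      using finite_dec[of \<gamma>] by (intro sum.remove) auto
    also have "?f (\<gamma>, 0) = coef (ser ?w i) \<gamma>"
      using ser_in(2)[OF z i] by (simp add: wpoly(2)[OF i z] wgt_def)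
    also have "(\<Sum>c\<in>dec \<gamma> - {(\<gamma>, 0)}. ?f c) = peval (\<kappa> z) ?S"
      unfolding peval_sum peval_mult by (intro sum.cong refl) (simp add: Q(2) z)
    finally show ?thesis using R(2)[OF z] by (simp add: peval_add) (simp add: eq_neg_iff_add_eq_0 algebra_simps)
  qed
  ultimately show ?case by blast
qed

sublocale C: graded_coord_group "p + q" X snd \<Gamma> \<kappa>
proof (rule graded_coord_group.intro)
  interpret G: group \<Gamma> by (rule group_Gam)
  show "Group.group \<Gamma>" by (rule group_Gam)
  show "finite {x \<in> X. snd x = \<alpha>}" for \<alpha> :: expo
    by (rule finite_subset[of _ "{1..p + r} \<times> {\<alpha>}"]) auto
  show "\<exists>g\<in>carrier \<Gamma>. \<forall>x\<in>X. \<kappa> g x = \<phi> x" for \<phi>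
  proof -
    obtain z where z: "z \<in> carrier \<Gamma>"
      "\<And>i. i \<in> {1..p + r} \<Longrightarrow> ser z i = MSer (\<lambda>\<alpha>. if \<alpha> \<in> expos n - {0} then \<phi> (i, \<alpha>) else 0)"
      by (rule ser_surj[of "\<lambda>i. MSer (\<lambda>\<alpha>. if \<alpha> \<in> expos n - {0} then \<phi> (i, \<alpha>) else 0)"]) (auto simp: in_vars_def)
    then show ?thesis by (intro bexI[of _ z]) (auto simp: \<kappa>_def)
  qed
  show "g = h" if g: "g \<in> carrier \<Gamma>" and h: "h \<in> carrier \<Gamma>" and eq: "\<And>x. x \<in> X \<Longrightarrow> \<kappa> g x = \<kappa> h x" for g h
  proof (rule ser_inj[OF g h], rule mser_eqI)
    fix i \<gamma> assume i: "i \<in> {1..p + r}"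
    show "coef (ser g i) \<gamma> = coef (ser h i) \<gamma>"
    proof (cases "\<gamma> \<in> expos n - {0}")
      case True
      then show ?thesis using eq[of "(i, \<gamma>)"] i by (simp add: \<kappa>_def)
    next
      case False
      then show ?thesis
        using ser_in(2)[OF g i] ser_in(2)[OF h i] in_vars_coef[OF ser_in(1)[OF g i]] in_vars_coef[OF ser_in(1)[OF h i]]
        by (cases "\<gamma> = 0") auto
    qed
  qed
  show "\<kappa> \<one>\<^bsub>\<Gamma>\<^esub> x = 0" if "x \<in> X" for x
    using that by (auto simp: \<kappa>_def ser_one simp del: One_nat_def)
  show "\<exists>L. (\<forall>(a, b)\<in>set L. \<exists>\<alpha> \<beta>. \<alpha> + \<beta> = snd x \<and> a \<in> Hk \<alpha> \<and> b \<in> Hk \<beta>)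
      \<and> (\<forall>g\<in>carrier \<Gamma>. \<forall>h\<in>carrier \<Gamma>. \<kappa> (g \<bullet> h) x = (\<Sum>(a, b)\<leftarrow>L. peval (\<kappa> g) a * peval (\<kappa> h) b))"
    if x: "x \<in> X" for x
  proof (intro exI[of _ "clist (fst x) (snd x)"] conjI ballI)
    fix g h assume "g \<in> carrier \<Gamma>" "h \<in> carrier \<Gamma>"
    then show "\<kappa> (g \<bullet> h) x = (\<Sum>(a, b)\<leftarrow>clist (fst x) (snd x). peval (\<kappa> g) a * peval (\<kappa> h) b)"
      using clist_mult[of g h "fst x" "snd x"] x by auto
  next
    fix c assume "c \<in> set (clist (fst x) (snd x))"
    then show "case c of (a, b) \<Rightarrow> \<exists>\<alpha> \<beta>. \<alpha> + \<beta> = snd x \<and> a \<in> Hk \<alpha> \<and> b \<in> Hk \<beta>"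
      using clist_in[of "fst x" "snd x" "fst c" "snd c"] x by (simp add: split_def)
  qed
  show "\<exists>P\<in>Hk (snd x). \<forall>g\<in>carrier \<Gamma>. \<kappa> (inv\<^bsub>\<Gamma>\<^esub> g) x = peval (\<kappa> g) P" if "x \<in> X" for x
    using polys_inv[of "fst x" "snd x"] that by (auto simp: \<kappa>_def[of _ x])
qed auto

end

section \<open>The Lie algebra of the semidirect product\<close>

lemma mon_size_of_nat_mult: "mon_size (of_nat k * \<alpha> :: expo) = k * mon_size \<alpha>"
  by (induction k) (simp_all add: distrib_right mon_size_add)

lemma of_nat_mult_eq_self: "\<alpha> \<noteq> 0 \<Longrightarrow> of_nat k * \<alpha> = (\<alpha> :: expo) \<longleftrightarrow> k = 1"
proof
  assume "\<alpha> \<noteq> 0" "of_nat k * \<alpha> = \<alpha>"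
  then have "k * mon_size \<alpha> = mon_size \<alpha>" "mon_size \<alpha> \<noteq> 0"
    using mon_size_of_nat_mult[of k \<alpha>] by simp_all
  then show "k = 1" by simp
qed simp

text \<open>At the point whose only nonzero coordinate is \<open>x\<close>, with value 1, a monomial
  with another variable vanishes and a power of \<open>x\<close> has value 1. Homogeneity of nonzero
  degree \<open>d x\<close> leaves only the first power.\<close>

lemma lookup_eq_peval:
  assumes Q: "Q \<in> hcomp Y d (d x)" and x: "d x \<noteq> 0"
  shows "peval (\<lambda>y. of_bool (y = x)) Q = lookup Q (single x 1)"
proof -
  have "meval (\<lambda>y. of_bool (y = x)) m = (of_bool (m = single x 1) :: 'b)" if m: "m \<in> keys Q" for m
  proof (cases "keys m \<subseteq> {x}")
    case True
    have k: "m = single x (lookup m x)"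
    proof (rule poly_mapping_eqI)
      fix y show "lookup m y = lookup (single x (lookup m x)) y"
        using True by (cases "y = x") (auto simp: lookup_single in_keys_iff when_def)
    qed
    have "wdeg d m = d x" using m Q by (auto simp: hcomp_def)
    then have "of_nat (lookup m x) * d x = d x" by (subst (asm) k) simp
    then have "lookup m x = 1" using of_nat_mult_eq_self[OF x] by blast
    then have "m = single x 1" using k by simp
    then show ?thesis by (simp del: One_nat_def)
  next
    case False
    then obtain y where y: "y \<in> keys m" "y \<noteq> x" by blast
    then have "lookup m y \<noteq> 0" by (simp add: in_keys_iff)
    then have "meval (\<lambda>y. of_bool (y = x)) m = (0 :: 'b)"
      unfolding meval_def using y by (intro prod_zero bexI[of _ y]) auto
    moreover have "m \<noteq> single x 1" using y by auto
    ultimately show ?thesis by simp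
  qed
  then have "peval (\<lambda>y. of_bool (y = x)) Q
    = (\<Sum>m\<in>keys Q. if m = single x 1 then lookup Q (single x 1) else 0)"
    unfolding peval_def by (intro sum.cong) auto
  then show ?thesis by (simp add: not_in_keys_iff_lookup_eq_zero del: One_nat_def)
qed

text \<open>Only the linear term of the binomial series has exponent \<delta>.\<close>

lemma coef_mpow_zmon:
  assumes "\<delta> \<noteq> 0"
  shows "coef (mpow (zmon \<delta>) c) \<delta> = c"
proof -
  have "coef (mpow (zmon \<delta>) c) \<delta> = (\<Sum>k\<le>mon_size \<delta>. if k = 1 then c else 0)"
    unfolding mpow_def coef_MSer zmon_power coef_zmon
  proof (rule sum.cong[OF refl])
    fix k
    show "(c gchoose k) * of_bool (\<delta> = of_nat k * \<delta>) = (if k = 1 then c else 0)"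
      using of_nat_mult_eq_self[OF assms, of k] by (auto simp: eq_commute[of \<delta>])
  qed
  moreover have "1 \<le> mon_size \<delta>" using assms by (cases "mon_size \<delta>") auto
  ultimately show ?thesis by simp
qed

context semidirect
begin

text \<open>The linear coefficient is the value at the group element \<open>z\<close> whose only
  nonzero coordinate is \<open>(j, \<delta>)\<close>, equal to 1. For \<open>j \<le> p\<close> the
  multiplier of \<alpha> is there a power of \<open>1 + zmon \<delta>\<close> with exponent
  \<open>wt j \<alpha>\<close>, and \<open>wgt\<close> adds 1 if \<open>i = j\<close>. For
  \<open>j > p\<close> both factors are 1 and the value is 0.\<close>

lemma wpoly_linear:
  assumes i: "i \<in> {1..p + r}" and x: "(j, \<delta>) \<in> X"
  shows "lookup (wpoly i \<alpha> \<beta>) (single (j, \<delta>) 1)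
    = of_bool (\<beta> = \<delta>) * (wt j \<alpha> + of_bool (i = j \<and> j \<le> p))"
proof (cases "\<beta> = \<delta>")
  case False
  have "single (j, \<delta>) 1 \<notin> keys (wpoly i \<alpha> \<beta>)"
  proof
    assume "single (j, \<delta>) 1 \<in> keys (wpoly i \<alpha> \<beta>)"
    then have "wdeg snd (single (j, \<delta>) (1::nat)) = \<beta>" using wpoly(1)[OF i, of \<alpha> \<beta>] by (auto simp: hcomp_def)
    then show False using False by simp
  qed
  then show ?thesis using False by (simp add: not_in_keys_iff_lookup_eq_zero)
next
  case True
  have j: "j \<in> {1..p + r}" and \<delta>: "\<delta> \<in> expos n" "\<delta> \<noteq> 0" using x by auto
  obtain z where z: "z \<in> carrier \<Gamma>" "\<And>l. l \<in> {1..p + r} \<Longrightarrow> ser z l = (if l = j then zmon \<delta> else 0)"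
  proof (rule ser_surj[of "\<lambda>l. if l = j then zmon \<delta> else 0"])
    show "in_vars n (if l = j then zmon \<delta> else 0) \<and> coef (if l = j then zmon \<delta> else 0) 0 = (0 :: 'k)" for l
      using \<delta> by (simp add: in_vars_closed)
  qed (use that in blast)
  have \<kappa>z: "\<kappa> z y = of_bool (y = (j, \<delta>))" if "y \<in> X" for y
    using that by (cases y) (auto simp: \<kappa>_def z(2) simp del: One_nat_def)
  have W: "wpoly i \<alpha> \<beta> \<in> Hk (snd (j, \<delta>))" using wpoly(1)[OF i, of \<alpha> \<beta>] True by simp
  have "lookup (wpoly i \<alpha> \<beta>) (single (j, \<delta>) 1) = peval (\<lambda>y. of_bool (y = (j, \<delta>))) (wpoly i \<alpha> \<beta>)"
    by (rule lookup_eq_peval[symmetric, OF W]) (simp add: \<delta>)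
  also have "\<dots> = peval (\<kappa> z) (wpoly i \<alpha> \<beta>)"
  proof (rule peval_cong)
    fix m y assume "m \<in> keys (wpoly i \<alpha> \<beta>)" "y \<in> keys m"
    then have "y \<in> X" using W by (auto simp: hcomp_def poly_carrier)
    then show "of_bool (y = (j, \<delta>)) = \<kappa> z y" by (rule \<kappa>z[symmetric])
  qed
  also have "\<dots> = coef (wgt (ser z) i * umul (ser z) \<alpha>) \<delta>" by (simp add: wpoly(2)[OF i z(1)] True)
  also have "umul (ser z) \<alpha> = (if j \<le> p then mpow (zmon \<delta>) (wt j \<alpha>) else 1)"
  proof -
    have "umul (ser z) \<alpha> = (\<Prod>l\<in>{1..p}. if l = j then mpow (zmon \<delta>) (wt j \<alpha>) else 1)"
      unfolding umul_def by (intro prod.cong refl) (simp add: z(2) del: One_nat_def)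
    then show ?thesis using j by simp
  qed
  also have "wgt (ser z) i = 1 + (if i = j \<and> j \<le> p then zmon \<delta> else 0)"
    using i by (auto simp: wgt_def z(2) simp del: One_nat_def)
  also have "coef ((1 + (if i = j \<and> j \<le> p then zmon \<delta> else 0)) * (if j \<le> p then mpow (zmon \<delta>) (wt j \<alpha>) else 1)) \<delta>
    = wt j \<alpha> + of_bool (i = j \<and> j \<le> p)"
  proof -
    have "wt j \<alpha> = 0" if "\<not> j \<le> p" using that by (simp add: wt_def coeff_A_def)
    moreover have "coef (zmon \<delta> * mpow (zmon \<delta>) (wt j \<alpha>)) \<delta> = 1"
      using coef_zmon_mult_add[of \<delta> "mpow (zmon \<delta>) (wt j \<alpha>)" 0] by simp
    ultimately show ?thesis using \<delta> by (auto simp: distrib_right coef_mpow_zmon)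
  qed
  finally show ?thesis using True by simp
qed

lemma comult_var:
  assumes x: "(i, \<gamma>) \<in> X"
  shows "comult C.coord_hopf (var (i, \<gamma>)) = tensor_sum C.A C.A (clist i \<gamma>)"
proof (rule C.AA_eqI)
  have c: "set (clist i \<gamma>) \<subseteq> carrier C.A \<times> carrier C.A"
    using clist_in[OF x] by (auto simp: hcomp_def)
  then show "tensor_sum C.A C.A (clist i \<gamma>) \<in> tensors C.A C.A"
    by (auto simp: tensor_carrier)
  have v: "var (i, \<gamma>) \<in> carrier C.A" using x by (rule poly_closed(7))
  then show "comult C.coord_hopf (var (i, \<gamma>)) \<in> tensors C.A C.A" by (rule C.comult_coord)
  fix g h assume g: "g \<in> carrier \<Gamma>" and h: "h \<in> carrier \<Gamma>"
  show "comult C.coord_hopf (var (i, \<gamma>)) (\<lambda>a b. C.ev g a * C.ev h b)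
    = tensor_sum C.A C.A (clist i \<gamma>) (\<lambda>a b. C.ev g a * C.ev h b)"
    using x by (simp only: C.comult_coord(2)[OF v g h] tensor_sum_eval C.bil_ev if_True peval_var) (rule clist_mult[OF g h], auto)
qed

text \<open>The last summand, symmetric in \<open>x\<close> and \<open>y\<close>, disappears from the bracket.\<close>

lemma comult_var_linear:
  assumes x: "x \<in> X" and y: "y \<in> X" and c: "(i, \<gamma>) \<in> X"
  shows "comult C.coord_hopf (var (i, \<gamma>))
      (\<lambda>P Q. lookup P (single x 1) * lookup Q (single y 1))
    = of_bool (fst y = i \<and> snd y + snd x = \<gamma>) * (wt (fst x) (snd y) + of_bool (i = fst x \<and> fst x \<le> p))"
proof -
  have i: "i \<in> {1..p + r}" using c by simp
  have lin: "linear_form C.A (\<lambda>P. lookup P m)" for m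
    by (simp add: linear_form_def lookup_add)
  have one: "lookup 1 (single y (1 :: nat)) = (0 :: 'k)"
  proof -
    have "single y (1 :: nat) \<noteq> 0" using mon_size_single[of y 1] by (metis mon_size_0 zero_neq_one)
    then show ?thesis by (simp add: lookup_one when_def del: One_nat_def)
  qed
  have v: "lookup (var w) (single y 1) = (of_bool (w = y) :: 'k)" for w
    using single_1_eq_iff[of w y] by (simp add: var_def lookup_single when_def)
  have "comult C.coord_hopf (var (i, \<gamma>))
      (\<lambda>P Q. lookup P (single x 1) * lookup Q (single y 1))
    = (\<Sum>(a, b)\<leftarrow>clist i \<gamma>. lookup a (single x 1) * lookup b (single y 1))"
    by (simp only: comult_var[OF c] tensor_sum_eval bilinear_mult[OF lin lin] if_True)
  \<comment> \<open>The head of \<open>clist\<close> has right leg 1, which has no linear part, and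
    drops out.\<close>
  also have "\<dots> = (\<Sum>c\<in>dec \<gamma> - {(0, \<gamma>)}.
      lookup (wpoly i (fst c) (snd c)) (single x 1) * of_bool ((i, fst c) = y))"
    by (simp only: clist_def list.map sum_list.Cons one v split_def fst_conv snd_conv map_map comp_def sum_dlist mult_zero_right add_0)
  also have "\<dots> = (\<Sum>c\<in>dec \<gamma> - {(0, \<gamma>)}. if c = (snd y, snd x)
      then of_bool (fst y = i) * (wt (fst x) (snd y) + of_bool (i = fst x \<and> fst x \<le> p)) else 0)"
  proof (rule sum.cong[OF refl])
    fix c
    have "lookup (wpoly i (fst c) (snd c)) (single x 1)
      = of_bool (snd c = snd x) * (wt (fst x) (fst c) + of_bool (i = fst x \<and> fst x \<le> p))"
      using wpoly_linear[OF i, of "fst x" "snd x"] x by simp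
    then show "lookup (wpoly i (fst c) (snd c)) (single x 1) * of_bool ((i, fst c) = y)
      = (if c = (snd y, snd x) then of_bool (fst y = i) * (wt (fst x) (snd y) + of_bool (i = fst x \<and> fst x \<le> p)) else 0)"
      by (cases c; cases y; cases x) auto
  qed
  also have "\<dots> = of_bool (fst y = i \<and> snd y + snd x = \<gamma>) * (wt (fst x) (snd y) + of_bool (i = fst x \<and> fst x \<le> p))"
    using finite_dec[of \<gamma>] y by auto
  finally show ?thesis .
qed

section \<open>The deg1 pre-Lie algebra and its Lie algebra\<close>

abbreviation "cA \<equiv> coeff_A p B"
abbreviation "L \<equiv> deg1_algebra n (p + r) cA (\<lambda>i j. 0)"

abbreviation mult_L (infixl "\<star>" 70) where "x \<star> y \<equiv> x \<otimes>\<^bsub>L\<^esub> y"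

text \<open>The pre-Lie product of the basis vectors with indices \<open>a\<close> and
  \<open>b\<close>: \<open>a\<close> determines the column, \<open>b\<close> the exponent it is
  paired with.\<close>

definition mu :: "nat \<times> expo \<Rightarrow> nat \<times> expo \<Rightarrow> 'k deg1" where
  "mu a b = single (fst b, snd b + snd a) (wt (fst a) (snd b))"

lemma L_simps:
  "carrier L = {l. keys l \<subseteq> X}" "zero L = 0" "add L = (+)" "smult L = scale"
  by (simp_all add: deg1_algebra_def)

lemma lookup_L_mult: "lookup (x \<star> y) c
  = (\<Sum>a\<in>keys x. lookup x a * (\<Sum>b\<in>keys y. lookup y b * lookup (mu a b) c))"
proof -
  have w: "(\<Sum>l=1..n. cA i j l * of_nat (lookup \<alpha> l)) + 0 = wt j \<alpha>" for i j \<alpha>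
    by (simp add: wt_def coeff_A_def)
  show ?thesis
    unfolding deg1_algebra_def module.simps partial_object.simps monoid.simps w split_def lookup_sum sum_distrib_left
    by (intro sum.cong refl) (simp add: mu_def lookup_single when_def mult_ac)
qed

lemma L_bilinear:
  "(x + y) \<star> z = x \<star> z + y \<star> z" "z \<star> (x + y) = z \<star> x + z \<star> y"
  "scale c x \<star> y = scale c (x \<star> y)"
  "y \<star> scale c x = scale c (y \<star> x)"
proof (rule_tac [1-4] poly_mapping_eqI)
  fix k
  show "lookup ((x + y) \<star> z) k = lookup (x \<star> z + y \<star> z) k"
    by (simp only: lookup_add[of "x \<star> z"] lookup_L_mult linear_sum_add)
  show "lookup (z \<star> (x + y)) k = lookup (z \<star> x + z \<star> y) k"
    by (simp only: lookup_add[of "z \<star> x"] lookup_L_mult linear_sum_add distrib_left sum.distrib)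
  show "lookup (scale c x \<star> y) k = lookup (scale c (x \<star> y)) k"
    by (simp only: lookup_map_mult[of c "x \<star> y"] lookup_L_mult linear_sum_map)
  show "lookup (y \<star> scale c x) k = lookup (scale c (y \<star> x)) k"
    by (simp only: lookup_map_mult[of c "y \<star> x"] lookup_L_mult linear_sum_map) (simp add: sum_distrib_left mult_ac)
qed

lemma L_mult_sgl: "sgl a \<star> sgl b = mu a b"
  by (rule poly_mapping_eqI) (simp add: lookup_L_mult sgl_def)

lemma L_closed:
  assumes "keys x \<subseteq> X" "keys y \<subseteq> X"
  shows "keys (x \<star> y) \<subseteq> X"
proof
  fix c assume c: "c \<in> keys (x \<star> y)"
  show "c \<in> X"
  proof (rule ccontr)
    assume "c \<notin> X"
    moreover have "fst b \<in> {1..p + r} \<and> snd b + snd a \<in> expos n - {0}" if "a \<in> X" "b \<in> X" for a b :: "nat \<times> expo"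
      using that expos_closed(2)[of "snd b" n "snd a"] mon_size_less[of "snd b" "snd a"]
      by (auto simp: mem_Times_iff add.commute)
    ultimately have "lookup (mu a b) c = 0" if "a \<in> X" "b \<in> X" for a b
      using that unfolding mu_def lookup_single when_def by (metis SigmaI)
    then have "lookup (x \<star> y) c = 0"
      unfolding lookup_L_mult using subsetD[OF assms(1)] subsetD[OF assms(2)] by (simp del: One_nat_def)
    then show False using c by (simp add: in_keys_iff)
  qed
qed

lemma keys_closed: "keys x \<subseteq> Y \<Longrightarrow> keys y \<subseteq> Y \<Longrightarrow> keys (x + y) \<subseteq> Y"
  "keys x \<subseteq> Y \<Longrightarrow> keys (scale c (x :: 'a \<Rightarrow>\<^sub>0 'b::field)) \<subseteq> Y"
  using Poly_Mapping.keys_add[of x y] keys_map_mult[of c x] by blast+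

lemma kspace_L: "kspace L"
  by (rule kspaceI) (simp_all only: L_simps mem_Collect_eq keys_closed map_mult_add add_ac keys_zero empty_subsetI
      add.right_inverse add.left_inverse add_0_left add_0_right)

lemma L_minus: "x \<in> carrier L \<Longrightarrow> y \<in> carrier L \<Longrightarrow> x \<ominus>\<^bsub>L\<^esub> y = x - y"
  using kspace_minus_one[OF kspace_L, of y] by (simp add: a_minus_def L_simps map_mult_add)

lemma L_zero: "0 \<star> x = 0" "x \<star> 0 = 0"
  by (rule poly_mapping_eqI, simp add: lookup_L_mult)+

lemma single_sgl: "single a c = scale c (sgl a)"
  by (rule poly_mapping_eqI) (simp add: sgl_def lookup_single when_def)

lemma scale_diff: "scale c u - scale c v = scale c (u - v :: 'k deg1)"
  by (rule poly_mapping_eqI) (simp add: lookup_minus algebra_simps)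

text \<open>As \<open>wt\<close> is additive in the exponent, the term in which \<open>a\<close>
  acts on the exponent of \<open>b\<close> occurs in both products and cancels. What remains is
  symmetric in \<open>a\<close> and \<open>b\<close>, which is the pre-Lie identity.\<close>

lemma L_pre_lie_sgl:
  "(sgl a \<star> sgl b) \<star> sgl c - sgl a \<star> (sgl b \<star> sgl c)
    = single (fst c, snd c + snd b + snd a) (- wt (fst a) (snd c) * wt (fst b) (snd c))"
  unfolding L_mult_sgl mu_def single_sgl[of _ "wt _ _"] L_bilinear
  by (rule poly_mapping_eqI)
    (auto simp: L_mult_sgl mu_def lookup_minus lookup_single when_def sgl_def wt_add algebra_simps)

text \<open>Trilinear extension from basis vectors, where the associator is symmetric in its first
  two arguments by \<open>L_pre_lie_sgl\<close>.\<close>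

lemma L_pre_lie:
  "(x \<star> y) \<star> z - x \<star> (y \<star> z) = (y \<star> x) \<star> z - y \<star> (x \<star> z)"
proof -
  define D where "D x y z = (x \<star> y) \<star> z - x \<star> (y \<star> z) - ((y \<star> x) \<star> z - y \<star> (x \<star> z))" for x y z
  have add: "D (x + x') y z = D x y z + D x' y z" "D x (y + y') z = D x y z + D x y' z" "D x y (z + z') = D x y z + D x y z'" for x x' y y' z z'
    by (simp_all add: D_def L_bilinear algebra_simps)
  have sc: "D (scale c x) y z = scale c (D x y z)"
    "D x (scale c y) z = scale c (D x y z)"
    "D x y (scale c z) = scale c (D x y z)" for c x y z
    by (simp_all add: D_def L_bilinear scale_diff)
  have zero: "D 0 y z = 0" "D x 0 z = 0" "D x y 0 = 0" for x y z by (simp_all add: D_def L_zero)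
  have 1: "D (sgl a) (sgl b) (sgl c) = 0" for a b c
    unfolding D_def L_pre_lie_sgl by (simp add: ac_simps)
  have 2: "D x (sgl b) (sgl c) = 0" for x b c
    using subset_UNIV[of "keys x"] by (induction x rule: poly_mapping_induct) (simp_all add: add zero sc single_sgl 1)
  have 3: "D x y (sgl c) = 0" for x y c
    using subset_UNIV[of "keys y"] by (induction y rule: poly_mapping_induct) (simp_all add: add zero sc single_sgl 2)
  have "D x y z = 0"
    using subset_UNIV[of "keys z"] by (induction z rule: poly_mapping_induct) (simp_all add: add zero sc single_sgl 3)
  then show ?thesis by (simp add: D_def)
qed

lemma pre_lie_L: "pre_lie_algebra L"
  unfolding pre_lie_algebra_def
proof (intro conjI ballI kspace_L)
  fix x y z assume c: "x \<in> carrier L" "y \<in> carrier L" "z \<in> carrier L"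
  have cl: "u \<star> v \<in> carrier L" if "u \<in> carrier L" "v \<in> carrier L" for u v
    using that L_closed by (auto simp: L_simps)
  show "((x \<star> y) \<star> z) \<ominus>\<^bsub>L\<^esub> (x \<star> (y \<star> z)) = ((y \<star> x) \<star> z) \<ominus>\<^bsub>L\<^esub> (y \<star> (x \<star> z))"
    using c by (simp add: L_minus cl L_pre_lie)
next
  fix x assume "x \<in> carrier L"
  then show "lin_map L L (\<lambda>y. x \<star> y)" "lin_map L L (\<lambda>y. y \<star> x)"
    using L_closed by (auto simp: lin_map_def L_simps L_bilinear)
qed

lemma finsum_L: "finite S \<Longrightarrow> (\<And>a. a \<in> S \<Longrightarrow> keys (f a) \<subseteq> X) \<Longrightarrow> (\<Oplus>\<^bsub>L\<^esub>a\<in>S. f a) = sum f S"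
proof (induction S rule: finite_induct)
  interpret M: Module.module scalars L by (rule kspace_L)
  case empty
  show ?case by (simp add: M.finsum_empty) (simp add: L_simps)
next
  interpret M: Module.module scalars L by (rule kspace_L)
  case (insert a S)
  then show ?case by (subst M.finsum_insert) (auto simp: L_simps)
qed

lemma basis_L: "is_basis L X (\<lambda>(i, \<alpha>). deg1_basis i \<alpha>)"
proof -
  have b: "(\<lambda>(i, \<alpha>). deg1_basis i \<alpha>) = (sgl :: _ \<Rightarrow> 'k deg1)"
    by (auto simp: deg1_basis_def sgl_def)
  have s: "(\<Oplus>\<^bsub>L\<^esub>j\<in>keys c. lookup c j \<odot>\<^bsub>L\<^esub> sgl j) = c" if "keys c \<subseteq> X" for c
  proof -
    have "(\<Oplus>\<^bsub>L\<^esub>j\<in>keys c. lookup c j \<odot>\<^bsub>L\<^esub> sgl j) = (\<Sum>j\<in>keys c. lookup c j \<odot>\<^bsub>L\<^esub> sgl j)"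
      using that by (intro finsum_L) (auto simp: L_simps single_sgl[symmetric] split: if_splits)
    also have "\<dots> = c" using poly_mapping_sum_singles[of c] by (simp add: L_simps single_sgl[symmetric])
    finally show ?thesis .
  qed
  show ?thesis
    unfolding is_basis_def b
  proof (intro conjI ballI)
    show "sgl \<in> X \<rightarrow> carrier L" by (auto simp: L_simps sgl_def)
    fix x assume "x \<in> carrier L"
    then have x: "keys x \<subseteq> X" by (simp add: L_simps)
    show "\<exists>!c. keys c \<subseteq> X \<and> x = (\<Oplus>\<^bsub>L\<^esub>j\<in>keys c. lookup c j \<odot>\<^bsub>L\<^esub> sgl j)"
      using x s by (intro ex1I[of _ x]) auto
  qed
qed

lemma deg1_L: "deg1_pre_lie_algebra n (p + r) cA (\<lambda>i j. 0) L deg1_basis"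
  unfolding deg1_pre_lie_algebra_def
proof (intro conjI ballI pre_lie_L basis_L)
  fix i j \<alpha> \<beta>
  have "deg1_basis j \<beta> \<star> deg1_basis i \<alpha> = mu (j, \<beta>) (i, \<alpha>)"
    unfolding deg1_basis_def by (rule L_mult_sgl[unfolded sgl_def])
  also have "\<dots> = wt j \<alpha> \<odot>\<^bsub>L\<^esub> deg1_basis i (\<alpha> + \<beta>)"
    by (rule poly_mapping_eqI) (simp add: mu_def L_simps deg1_basis_def lookup_single when_def)
  also have "wt j \<alpha> = (\<Sum>l=1..n. cA i j l * of_nat (lookup \<alpha> l)) + 0"
    by (simp add: wt_def coeff_A_def)
  finally show "deg1_basis j \<beta> \<star> deg1_basis i \<alpha>
    = ((\<Sum>l=1..n. cA i j l * of_nat (lookup \<alpha> l)) + 0) \<odot>\<^bsub>L\<^esub> deg1_basis i (\<alpha> + \<beta>)" .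
qed

lemma fundamental_L: "fundamental_coefficients n (p + r) cA (\<lambda>i j. 0)"
  unfolding fundamental_coefficients_def
proof (intro exI conjI)
  \<comment> \<open>The indices of additive components form \<open>I 0\<close>, possibly empty; each
    \<open>j \<le> p\<close> is a class of its own with vector \<open>A\<^sub>j\<close>, and all
    scalars are 0.\<close>
  let ?I = "\<lambda>m. if m = 0 then {p + 1..p + r} else {m}"
  show "{1..p + r} = (\<Union>m\<in>{0..p}. ?I m)" by (auto split: if_splits)
  show "disjoint_family_on ?I {0..p}" by (auto simp: disjoint_family_on_def)
  show "\<forall>i\<in>{1..p + r}. (\<forall>j\<in>?I 0. (\<forall>l\<in>{1..n}. cA i j l = 0) \<and> (0 :: 'k) = 0)
    \<and> (\<forall>m\<in>{1..p}. \<forall>j\<in>?I m. \<forall>l\<in>{1..n}. cA i j l = cA m m l)"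
    by (auto simp: coeff_A_def)
  show "\<forall>l\<in>{1..p}. \<forall>m\<in>{1..p}. \<forall>i\<in>?I l. \<forall>j\<in>?I m. (0 :: 'k) = (if l = m then 0 else 0)" by simp
qed auto

abbreviation "g \<equiv> lie_of_pre_lie L"

lemma lie_simps: "carrier g = {l. keys l \<subseteq> X}" "zero g = 0" "add g = (+)" "smult g = scale"
  by (simp_all add: lie_of_pre_lie_def L_simps)

lemma lie_mult: "keys x \<subseteq> X \<Longrightarrow> keys y \<subseteq> X \<Longrightarrow> x \<otimes>\<^bsub>g\<^esub> y = x \<star> y - y \<star> x"
  using L_closed[of x y] L_closed[of y x] by (simp add: lie_of_pre_lie_def L_minus L_simps)

text \<open>
  For \<open>\<alpha>\<close> outside \<open>expos n\<close>, \<open>deg1_component\<close> is the hull of a set contained in no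
  submodule of \<open>L\<close>, hence \<open>UNIV\<close>.
\<close>

definition comp :: "expo \<Rightarrow> 'k deg1 set" where
  "comp \<alpha> = (if \<alpha> \<in> expos n then deg1_component (p + r) L \<alpha> else {0})"

lemma comp_keys: "l \<in> comp \<alpha> \<Longrightarrow> keys l \<subseteq> {x \<in> X. snd x = \<alpha>}"
proof -
  assume l: "l \<in> comp \<alpha>"
  show ?thesis
  proof (cases "\<alpha> \<in> expos n - {0}")
    case False
    then show ?thesis using l by (auto simp: comp_def deg1_component_def L_simps split: if_splits)
  next
    case True
    let ?W = "{l :: 'k deg1. keys l \<subseteq> {x \<in> X. snd x = \<alpha>}}"
    have "submodule ?W scalars L"
    proof (rule submoduleI'[OF kspace_L])
      show "x \<oplus>\<^bsub>L\<^esub> y \<in> ?W" if "x \<in> ?W" "y \<in> ?W" for x y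
        using that by (simp only: L_simps mem_Collect_eq keys_closed)
      show "c \<odot>\<^bsub>L\<^esub> x \<in> ?W" if "x \<in> ?W" for c x
        using that by (simp only: L_simps mem_Collect_eq keys_closed)
    qed (auto simp: L_simps)
    moreover have "{deg1_basis i \<alpha> | i. i \<in> {1..p + r}} \<subseteq> ?W" using True by (auto simp: deg1_basis_def)
    ultimately have "lin_span L {deg1_basis i \<alpha> | i. i \<in> {1..p + r}} \<subseteq> ?W" by (rule lin_span_minimal)
    then show ?thesis using l True by (auto simp: comp_def deg1_component_def)
  qed
qed

lemma comp_sgl: "x \<in> X \<Longrightarrow> sgl x \<in> comp (snd x)"
  using lin_span_superset[of "{deg1_basis i (snd x) | i. i \<in> {1..p + r}}" L]
  by (cases x) (auto simp: comp_def deg1_component_def deg1_basis_def sgl_def)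

text \<open>The words in the definition only use degrees in \<open>expos n\<close>, where
  \<open>comp\<close> and \<open>deg1_component\<close> agree.\<close>

lemma enveloping_component_comp: "enveloping_component n g (deg1_component (p + r) L) = enveloping_component n g comp"
proof -
  have "list_all2 (\<lambda>x \<alpha>. x \<in> deg1_component (p + r) L \<alpha>) w \<alpha>s \<longleftrightarrow> list_all2 (\<lambda>x \<alpha>. x \<in> comp \<alpha>) w \<alpha>s"
    if "set \<alpha>s \<subseteq> expos n" for w \<alpha>s
    using that by (intro list.rel_cong refl) (auto simp: comp_def)
  then show ?thesis unfolding enveloping_component_def by (intro ext arg_cong[where f = "lin_span _"]) blast
qed

sublocale E: coord_lie "p + q" X snd \<Gamma> \<kappa> g comp
proof (rule coord_lie.intro, rule C.graded_coord_group_axioms, rule coord_lie_axioms.intro)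
  fix x y z :: "'k deg1" and c
  show "keys (x \<otimes>\<^bsub>g\<^esub> y) \<subseteq> X" if "keys x \<subseteq> X" "keys y \<subseteq> X"
    using that L_closed[of x y] L_closed[of y x] keys_diff[of "x \<star> y" "y \<star> x"] by (auto simp: lie_mult)
  show "(x + y) \<otimes>\<^bsub>g\<^esub> z = x \<otimes>\<^bsub>g\<^esub> z + y \<otimes>\<^bsub>g\<^esub> z" "z \<otimes>\<^bsub>g\<^esub> (x + y) = z \<otimes>\<^bsub>g\<^esub> x + z \<otimes>\<^bsub>g\<^esub> y"
    if "x \<in> carrier g" "y \<in> carrier g" "z \<in> carrier g"
  proof -
    have "keys (x + y) \<subseteq> X" using that Poly_Mapping.keys_add[of x y] by (auto simp: lie_simps)
    then show "(x + y) \<otimes>\<^bsub>g\<^esub> z = x \<otimes>\<^bsub>g\<^esub> z + y \<otimes>\<^bsub>g\<^esub> z" "z \<otimes>\<^bsub>g\<^esub> (x + y) = z \<otimes>\<^bsub>g\<^esub> x + z \<otimes>\<^bsub>g\<^esub> y"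
      using that by (simp_all add: lie_simps lie_mult L_bilinear)
  qed
  show "scale c x \<otimes>\<^bsub>g\<^esub> y = scale c (x \<otimes>\<^bsub>g\<^esub> y)"
    "y \<otimes>\<^bsub>g\<^esub> scale c x = scale c (y \<otimes>\<^bsub>g\<^esub> x)"
    if "x \<in> carrier g" "y \<in> carrier g"
  proof -
    have "keys (scale c x) \<subseteq> X" using that keys_map_mult[of c x] by (auto simp: lie_simps)
    then show "scale c x \<otimes>\<^bsub>g\<^esub> y = scale c (x \<otimes>\<^bsub>g\<^esub> y)"
      "y \<otimes>\<^bsub>g\<^esub> scale c x = scale c (y \<otimes>\<^bsub>g\<^esub> x)"
      using that by (simp_all add: lie_simps lie_mult L_bilinear scale_diff)
  qed
next
  fix a b c assume a: "a \<in> X" and b: "b \<in> X" and c: "c \<in> X"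
  obtain i \<gamma> where c': "c = (i, \<gamma>)" by (cases c)
  have "lookup (sgl a \<otimes>\<^bsub>g\<^esub> sgl b) c = lookup (mu a b) c - lookup (mu b a) c"
    using a b by (simp add: lie_mult sgl_def[of a] sgl_def[of b] lookup_minus L_mult_sgl[unfolded sgl_def])
  also have "\<dots> = comult C.coord_hopf (var c) (\<lambda>p q. lookup p (single a 1) * lookup q (single b 1))
      - comult C.coord_hopf (var c) (\<lambda>p q. lookup p (single b 1) * lookup q (single a 1))"
    unfolding c' comult_var_linear[OF a b c[unfolded c']] comult_var_linear[OF b a c[unfolded c']]
    by (auto simp: mu_def lookup_single when_def add.commute)
  finally show "lookup (sgl a \<otimes>\<^bsub>g\<^esub> sgl b) c = comult C.coord_hopf (var c) (\<lambda>p q. lookup p (single a 1) * lookup q (single b 1))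
      - comult C.coord_hopf (var c) (\<lambda>p q. lookup p (single b 1) * lookup q (single a 1))" .
qed (simp_all only: lie_simps comp_keys comp_sgl)

theorem fundamental_hopf_algebra: "\<exists>(H :: ('k, (nat \<times> expo, 'k) mpoly) hopf) Hc.
  graded_hopf_algebra n H Hc \<and> cring H \<and> \<Gamma> \<cong> character_group H
  \<and> (\<exists>U \<phi>. enveloping_hopf_algebra g U \<and> \<phi> \<in> hopf_iso (graded_dual n H Hc) U
      \<and> (\<forall>\<alpha>\<in>expos n. \<phi> ` graded_dual_component n H Hc \<alpha>
          = enveloping_component n g (deg1_component (p + r) L) \<alpha>))"
  unfolding enveloping_component_comp
  using C.graded_hopf_coord C.cring_coord C.iso_characters E.enveloping_coord
  by (intro exI[of _ C.coord_hopf] exI[of _ Hk] conjI)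

end

theorem proposition30:
  fixes p q :: nat and B :: "nat \<Rightarrow> nat \<Rightarrow> 'k::field_char_0"
  assumes "p \<ge> 1"
  shows "group (G_group p q B)
    \<and> (\<lambda>F\<in>carrier (G_group p q B). \<lambda>P\<in>carrier (V0 (p + q)). G_subst p q B F P)
        \<in> hom (G_group p q B) (AutoGroup (V0 (p + q)))
    \<and> (\<forall>r. let n = p + q; A = coeff_A p B; b = (\<lambda>i j. 0);
               L = deg1_algebra n (p + r) A b; g = lie_of_pre_lie L
        in group (semidirect_group p q r B)
         \<and> fundamental_coefficients n (p + r) A b
         \<and> deg1_pre_lie_algebra n (p + r) A b L deg1_basis
         \<and> (\<exists>(H :: ('k, ((nat \<times> expo) \<Rightarrow>\<^sub>0 nat) \<Rightarrow>\<^sub>0 'k) hopf) Hc.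
               graded_hopf_algebra n H Hc \<and> cring H
             \<and> semidirect_group p q r B \<cong> character_group H
             \<and> (\<exists>U \<phi>. enveloping_hopf_algebra g U
                  \<and> \<phi> \<in> hopf_iso (graded_dual n H Hc) U
                  \<and> (\<forall>\<alpha>\<in>expos n. \<phi> ` graded_dual_component n H Hc \<alpha>
                         = enveloping_component n g (deg1_component (p + r) L) \<alpha>))))"
  unfolding Let_def
  by (intro conjI allI coefficient_matrix.group_G coefficient_matrix.action_hom semidirect.group_Gam
      semidirect.fundamental_L semidirect.deg1_L semidirect.fundamental_hopf_algebra)

end
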